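(* Let $\mathcal C$ and $\mathcal M$ be pivotal tensor categories which are both semisimple, let $\Phi^{\mathcal Z}:\mathcal C\to\mathcal Z(\mathcal M)$ be a pivotal functor, let $\Phi=F\circ\Phi^{\mathcal Z}:\mathcal C\to\mathcal M$ where $F:\mathcal Z(\mathcal M)\to\mathcal M$ is the forgetful functor, and let $\mathrm{Tr}_{\mathcal C}:\mathcal M\to\mathcal C$ be the right adjoint of $\Phi$. Let $A,B\in\mathcal M$ be algebra objects such that the category of $A$-$B$-bimodules in $\mathcal M$ is semisimple. Then the algebra object $\mathrm{Tr}_{\mathcal C}(A\otimes B)$ in $\mathcal C$ is semisimple. In particular, if $A$ and $B$ are separable algebras, then $\mathrm{Tr}_{\mathcal C}(A\otimes B)$ is semisimple.
   Context: Categories and functors are linear over a field $k$, with finite-dimensional morphism spaces. Tensor functors are strong monoidal; associators, unitors and the isomorphisms $\Phi(c)\otimes\Phi(d)\cong\Phi(c\otimes d)$, $1\cong\Phi(1)$ are suppressed. Rigid: every object $a$ has a dual $a^*$ with $\mathrm{ev}_a:a^*\otimes a\to1$, $\mathrm{coev}_a:1\to a\otimes a^*$ satisfying the zig-zag equations, and every object is isomorphic to the dual of some object. Pivotal: rigid with a monoidal natural isomorphism $\varphi_a:a\to a^{**}$. A tensor functor $G$ between pivotal categories has canonical isomorphisms $\delta_x:G(x^* )\to G(x)^*$; it is pivotal if $G(\varphi_x)=\delta_{x^*}^{-1}\circ\delta_x^*\circ\varphi_{G(x)}$. The Drinfel'd center $\mathcal Z(\mathcal M)$ has as objects pairs $(a,e_a)$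 with $e_{a,b}:a\otimes b\to b\otimes a$ isomorphisms natural in $b$ satisfying $e_{a,b\otimes c}=(\mathrm{id}_b\otimes e_{a,c})\circ(e_{a,b}\otimes\mathrm{id}_c)$; morphisms are morphisms of $\mathcal M$ commuting with the half-braidings; $e_{a\otimes b,c}=(e_{a,c}\otimes\mathrm{id}_b)\circ(\mathrm{id}_a\otimes e_{b,c})$; it is pivotal with the same $\varphi_a$. For $c\in\mathcal C$, $y\in\mathcal M$ one has $e_{\Phi(c),y}:\Phi(c)\otimes y\to y\otimes\Phi(c)$. Let $\varepsilon_x:\Phi(\mathrm{Tr}_{\mathcal C}(x))\to x$ and $\eta_c:c\to\mathrm{Tr}_{\mathcal C}(\Phi(c))$ be the counit and unit of $\Phi\dashv\mathrm{Tr}_{\mathcal C}$; set $i=\eta_{1}:1\to\mathrm{Tr}_{\mathcal C}(1)$. The mate of $g:c\to\mathrm{Tr}_{\mathcal C}(x)$ is $\varepsilon_x\circ\Phi(g):\Phi(c)\to x$. The multiplication map $\mu_{x,y}:\mathrm{Tr}_{\mathcal C}(x)\otimes\mathrm{Tr}_{\mathcal C}(y)\to\mathrm{Tr}_{\mathcal C}(x\otimes y)$ is the morphism whose mate is $\varepsilon_x\otimes\varepsilon_y$. Let $\widetilde{\mathrm{ev}}_y=\mathrm{ev}_{y^*}\circ(\varphi_y\otimes\mathrm{id}_{y^*}):y\otimes y^*\to1$. The traciator $\tau_{x,y}:\mathrm{Tr}_{\mathcal C}(x\otimes y)\to\mathrm{Tr}_{\mathcal C}(y\otimes x)$ is the morphism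 whose mate is, with $c=\mathrm{Tr}_{\mathcal C}(x\otimes y)$, $$(\mathrm{id}_{y\otimes x}\otimes\widetilde{\mathrm{ev}}_y)\circ(\mathrm{id}_y\otimes\varepsilon_{x\otimes y}\otimes\mathrm{id}_{y^*})\circ(e_{\Phi(c),y}\otimes\mathrm{id}_{y^*})\circ(\mathrm{id}_{\Phi(c)}\otimes\mathrm{coev}_y).$$ It is invertible; put $\tau^+_{x,y}=\tau_{x,y}$, $\tau^-_{x,y}=\tau_{y,x}^{-1}$. For algebra objects $A=(A,m_A,i_A)$, $B=(B,m_B,i_B)$ in $\mathcal M$, $\mathrm{Tr}_{\mathcal C}(A\otimes B)$ is an algebra object with multiplication $\mathrm{Tr}_{\mathcal C}(m_A\otimes m_B)\circ\tau^-_{B,A\otimes A\otimes B}\circ\mu_{B\otimes A,A\otimes B}\circ(\tau^+_{A,B}\otimes\mathrm{id}_{\mathrm{Tr}_{\mathcal C}(A\otimes B)})$ and unit $\mathrm{Tr}_{\mathcal C}(i_A\otimes i_B)\circ i$. An algebra object in a semisimple tensor category is semisimple if its category of (left) modules is semisimple, and separable if its multiplication $A\otimes A\to A$ splits as a morphism of $A$-$A$-bimodules. *)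

theory Defs
  imports "HOL-Library.FuncSet"
begin

section \<open>Categories\<close>

text \<open>
  A category is given by a set of objects and, for any two objects, a set of morphisms. Hom-sets
  need not be disjoint: morphisms do not carry their source and target, so that categories of
  structured objects (modules, bimodules, the center) can use the morphisms of the underlying
  category as they are. Every operation whose value depends on the source or the target of a
  morphism takes these as arguments.
\<close>

record ('o, 'm) Cat =
  obj :: "'o set"
  hom :: "'o \<Rightarrow> 'o \<Rightarrow> 'm set"
  idm :: "'o \<Rightarrow> 'm"
  comp :: "'m \<Rightarrow> 'm \<Rightarrow> 'm" (infixr "\<cdot>\<index>" 55)

locale category =
  fixes C :: "('o, 'm, 'x) Cat_scheme" (structure)
  assumes id_in_hom: "a \<in> obj C \<Longrightarrow> idm C a \<in> hom C a a"
    and comp_in_hom: "\<lbrakk>a \<in> obj C; b \<in> obj C; c \<in> obj C; f \<in> hom C a b; g \<in> hom C b c\<rbrakk>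
      \<Longrightarrow> g \<cdot> f \<in> hom C a c"
    and comp_id: "\<lbrakk>a \<in> obj C; b \<in> obj C; f \<in> hom C a b\<rbrakk> \<Longrightarrow> f \<cdot> idm C a = f"
    and id_comp: "\<lbrakk>a \<in> obj C; b \<in> obj C; f \<in> hom C a b\<rbrakk> \<Longrightarrow> idm C b \<cdot> f = f"
    and comp_assoc: "\<lbrakk>a \<in> obj C; b \<in> obj C; c \<in> obj C; d \<in> obj C;
        f \<in> hom C a b; g \<in> hom C b c; h \<in> hom C c d\<rbrakk>
      \<Longrightarrow> (h \<cdot> g) \<cdot> f = h \<cdot> (g \<cdot> f)"

context
  fixes C :: "('o, 'm, 'x) Cat_scheme" (structure)
begin

definition is_inverse :: "'o \<Rightarrow> 'o \<Rightarrow> 'm \<Rightarrow> 'm \<Rightarrow> bool" where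
  "is_inverse a b f g \<longleftrightarrow>
     f \<in> hom C a b \<and> g \<in> hom C b a \<and> g \<cdot> f = idm C a \<and> f \<cdot> g = idm C b"

definition iso_mor :: "'o \<Rightarrow> 'o \<Rightarrow> 'm \<Rightarrow> bool" where
  "iso_mor a b f \<longleftrightarrow> (\<exists>g. is_inverse a b f g)"

definition inv_mor :: "'o \<Rightarrow> 'o \<Rightarrow> 'm \<Rightarrow> 'm" where
  "inv_mor a b f = (THE g. is_inverse a b f g)"

definition mono_mor :: "'o \<Rightarrow> 'o \<Rightarrow> 'm \<Rightarrow> bool" where
  "mono_mor a b f \<longleftrightarrow> f \<in> hom C a b \<and>
     (\<forall>z\<in>obj C. \<forall>g\<in>hom C z a. \<forall>h\<in>hom C z a. f \<cdot> g = f \<cdot> h \<longrightarrow> g = h)"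

definition epi_mor :: "'o \<Rightarrow> 'o \<Rightarrow> 'm \<Rightarrow> bool" where
  "epi_mor a b f \<longleftrightarrow> f \<in> hom C a b \<and>
     (\<forall>z\<in>obj C. \<forall>g\<in>hom C b z. \<forall>h\<in>hom C b z. g \<cdot> f = h \<cdot> f \<longrightarrow> g = h)"

end


section \<open>Linear, abelian and semisimple categories\<close>

record ('k, 'o, 'm) LinCat = "('o, 'm) Cat" +
  zerom :: "'o \<Rightarrow> 'o \<Rightarrow> 'm"
  addm :: "'m \<Rightarrow> 'm \<Rightarrow> 'm" (infixl "\<oplus>\<index>" 65)
  scale :: "'k \<Rightarrow> 'm \<Rightarrow> 'm" (infixr "\<odot>\<index>" 70)

definition lsum :: "('k, 'o, 'm, 'x) LinCat_scheme \<Rightarrow> 'o \<Rightarrow> 'o \<Rightarrow> 'm list \<Rightarrow> 'm" where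
  "lsum C a b fs = foldr (addm C) fs (zerom C a b)"

locale linear_category = category C
  for C :: "('k::field, 'o, 'm, 'x) LinCat_scheme" (structure) +
  assumes zero_in_hom: "\<lbrakk>a \<in> obj C; b \<in> obj C\<rbrakk> \<Longrightarrow> zerom C a b \<in> hom C a b"
    and add_in_hom: "\<lbrakk>a \<in> obj C; b \<in> obj C; f \<in> hom C a b; g \<in> hom C a b\<rbrakk>
      \<Longrightarrow> f \<oplus> g \<in> hom C a b"
    and scale_in_hom: "\<lbrakk>a \<in> obj C; b \<in> obj C; f \<in> hom C a b\<rbrakk> \<Longrightarrow> r \<odot> f \<in> hom C a b"
    and add_assoc: "\<lbrakk>a \<in> obj C; b \<in> obj C; f \<in> hom C a b; g \<in> hom C a b; h \<in> hom C a b\<rbrakk>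
      \<Longrightarrow> (f \<oplus> g) \<oplus> h = f \<oplus> (g \<oplus> h)"
    and add_commute: "\<lbrakk>a \<in> obj C; b \<in> obj C; f \<in> hom C a b; g \<in> hom C a b\<rbrakk>
      \<Longrightarrow> f \<oplus> g = g \<oplus> f"
    and add_zero: "\<lbrakk>a \<in> obj C; b \<in> obj C; f \<in> hom C a b\<rbrakk> \<Longrightarrow> f \<oplus> zerom C a b = f"
    and add_inverse: "\<lbrakk>a \<in> obj C; b \<in> obj C; f \<in> hom C a b\<rbrakk>
      \<Longrightarrow> \<exists>g\<in>hom C a b. f \<oplus> g = zerom C a b"
    and scale_one: "\<lbrakk>a \<in> obj C; b \<in> obj C; f \<in> hom C a b\<rbrakk> \<Longrightarrow> 1 \<odot> f = f"
    and scale_scale: "\<lbrakk>a \<in> obj C; b \<in> obj C; f \<in> hom C a b\<rbrakk>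
      \<Longrightarrow> r \<odot> (s \<odot> f) = (r * s) \<odot> f"
    and scale_add_left: "\<lbrakk>a \<in> obj C; b \<in> obj C; f \<in> hom C a b\<rbrakk>
      \<Longrightarrow> (r + s) \<odot> f = r \<odot> f \<oplus> s \<odot> f"
    and scale_add_right: "\<lbrakk>a \<in> obj C; b \<in> obj C; f \<in> hom C a b; g \<in> hom C a b\<rbrakk>
      \<Longrightarrow> r \<odot> (f \<oplus> g) = r \<odot> f \<oplus> r \<odot> g"
    and comp_add_left: "\<lbrakk>a \<in> obj C; b \<in> obj C; c \<in> obj C;
        f \<in> hom C a b; g \<in> hom C b c; h \<in> hom C b c\<rbrakk>
      \<Longrightarrow> (g \<oplus> h) \<cdot> f = (g \<cdot> f) \<oplus> (h \<cdot> f)"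
    and comp_add_right: "\<lbrakk>a \<in> obj C; b \<in> obj C; c \<in> obj C;
        f \<in> hom C a b; g \<in> hom C a b; h \<in> hom C b c\<rbrakk>
      \<Longrightarrow> h \<cdot> (f \<oplus> g) = (h \<cdot> f) \<oplus> (h \<cdot> g)"
    and comp_scale_left: "\<lbrakk>a \<in> obj C; b \<in> obj C; c \<in> obj C; f \<in> hom C a b; g \<in> hom C b c\<rbrakk>
      \<Longrightarrow> (r \<odot> g) \<cdot> f = r \<odot> (g \<cdot> f)"
    and comp_scale_right: "\<lbrakk>a \<in> obj C; b \<in> obj C; c \<in> obj C; f \<in> hom C a b; g \<in> hom C b c\<rbrakk>
      \<Longrightarrow> g \<cdot> (r \<odot> f) = r \<odot> (g \<cdot> f)"
    and finite_dimensional_hom: "\<lbrakk>a \<in> obj C; b \<in> obj C\<rbrakk>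
      \<Longrightarrow> \<exists>fs. set fs \<subseteq> hom C a b \<and>
            (\<forall>f\<in>hom C a b. \<exists>rs. length rs = length fs \<and> f = lsum C a b (map2 (scale C) rs fs))"

context
  fixes C :: "('k, 'o, 'm, 'x) LinCat_scheme" (structure)
begin

definition is_kernel :: "'o \<Rightarrow> 'o \<Rightarrow> 'm \<Rightarrow> 'o \<Rightarrow> 'm \<Rightarrow> bool" where
  "is_kernel a b f n k \<longleftrightarrow> k \<in> hom C n a \<and> f \<cdot> k = zerom C n b \<and>
     (\<forall>z\<in>obj C. \<forall>g\<in>hom C z a. f \<cdot> g = zerom C z b \<longrightarrow> (\<exists>!h. h \<in> hom C z n \<and> k \<cdot> h = g))"

definition is_cokernel :: "'o \<Rightarrow> 'o \<Rightarrow> 'm \<Rightarrow> 'o \<Rightarrow> 'm \<Rightarrow> bool" where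
  "is_cokernel a b f q p \<longleftrightarrow> p \<in> hom C b q \<and> p \<cdot> f = zerom C a q \<and>
     (\<forall>z\<in>obj C. \<forall>g\<in>hom C b z. g \<cdot> f = zerom C a z \<longrightarrow> (\<exists>!h. h \<in> hom C q z \<and> h \<cdot> p = g))"

text \<open>The empty list of summands is allowed; its direct sum is a zero object.\<close>

definition is_direct_sum :: "'o \<Rightarrow> 'o list \<Rightarrow> bool" where
  "is_direct_sum x ss \<longleftrightarrow> (\<exists>i p.
     (\<forall>j<length ss. i j \<in> hom C (ss ! j) x \<and> p j \<in> hom C x (ss ! j)) \<and>
     (\<forall>j<length ss. \<forall>l<length ss.
        p j \<cdot> i l = (if j = l then idm C (ss ! j) else zerom C (ss ! l) (ss ! j))) \<and>
     lsum C x x (map (\<lambda>j. i j \<cdot> p j) [0..<length ss]) = idm C x)"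

definition simple_object :: "'o \<Rightarrow> bool" where
  "simple_object s \<longleftrightarrow> s \<in> obj C \<and> idm C s \<noteq> zerom C s s \<and>
     (\<forall>a\<in>obj C. \<forall>f. mono_mor C a s f \<longrightarrow> f = zerom C a s \<or> iso_mor C a s f)"

end

locale abelian_category = linear_category C
  for C :: "('k::field, 'o, 'm, 'x) LinCat_scheme" (structure) +
  assumes direct_sums: "set ss \<subseteq> obj C \<Longrightarrow> \<exists>x\<in>obj C. is_direct_sum C x ss"
    and kernels: "\<lbrakk>a \<in> obj C; b \<in> obj C; f \<in> hom C a b\<rbrakk> \<Longrightarrow> \<exists>n\<in>obj C. \<exists>k. is_kernel C a b f n k"
    and cokernels: "\<lbrakk>a \<in> obj C; b \<in> obj C; f \<in> hom C a b\<rbrakk>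
      \<Longrightarrow> \<exists>q\<in>obj C. \<exists>p. is_cokernel C a b f q p"
    and monos_normal: "\<lbrakk>a \<in> obj C; b \<in> obj C; mono_mor C a b f\<rbrakk>
      \<Longrightarrow> \<exists>c\<in>obj C. \<exists>g\<in>hom C b c. is_kernel C b c g a f"
    and epis_normal: "\<lbrakk>a \<in> obj C; b \<in> obj C; epi_mor C a b f\<rbrakk>
      \<Longrightarrow> \<exists>c\<in>obj C. \<exists>g\<in>hom C c a. is_cokernel C c a g b f"

text \<open>An infinite direct sum of non-zero objects would have an infinite-dimensional endomorphism
  space, so only finite direct sums of simple objects have to be considered.\<close>

locale semisimple_category = abelian_category C
  for C :: "('k::field, 'o, 'm, 'x) LinCat_scheme" (structure) +
  assumes sum_of_simples:
    "x \<in> obj C \<Longrightarrow> \<exists>ss. (\<forall>s\<in>set ss. simple_object C s) \<and> is_direct_sum C x ss"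


section \<open>Tensor categories\<close>

text \<open>\<open>\<otimes>\<close> is the tensor product of objects, \<open>\<star>\<close> that of morphisms. Nothing is assumed to be
  strict: \<open>assoc\<close> is the associator \<open>(a \<otimes> b) \<otimes> c \<rightarrow> a \<otimes> (b \<otimes> c)\<close>, and \<open>lunit\<close>, \<open>runit\<close> are the
  unitors \<open>\<one> \<otimes> a \<rightarrow> a\<close>, \<open>a \<otimes> \<one> \<rightarrow> a\<close>.\<close>

record ('k, 'o, 'm) TensorCat = "('k, 'o, 'm) LinCat" +
  tobj :: "'o \<Rightarrow> 'o \<Rightarrow> 'o" (infixr "\<otimes>\<index>" 75)
  tmor :: "'m \<Rightarrow> 'm \<Rightarrow> 'm" (infixr "\<star>\<index>" 70)
  tunit :: 'o ("\<one>\<index>")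
  assoc :: "'o \<Rightarrow> 'o \<Rightarrow> 'o \<Rightarrow> 'm"
  lunit :: "'o \<Rightarrow> 'm"
  runit :: "'o \<Rightarrow> 'm"

locale tensor_category = linear_category C
  for C :: "('k::field, 'o, 'm, 'x) TensorCat_scheme" (structure) +
  assumes tunit_obj: "\<one> \<in> obj C"
    and tobj_obj: "\<lbrakk>a \<in> obj C; b \<in> obj C\<rbrakk> \<Longrightarrow> a \<otimes> b \<in> obj C"
    and tmor_in_hom: "\<lbrakk>a \<in> obj C; b \<in> obj C; c \<in> obj C; d \<in> obj C; f \<in> hom C a b; g \<in> hom C c d\<rbrakk>
      \<Longrightarrow> f \<star> g \<in> hom C (a \<otimes> c) (b \<otimes> d)"
    and tmor_id: "\<lbrakk>a \<in> obj C; b \<in> obj C\<rbrakk> \<Longrightarrow> idm C a \<star> idm C b = idm C (a \<otimes> b)"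
    and tmor_comp: "\<lbrakk>a \<in> obj C; b \<in> obj C; c \<in> obj C; a' \<in> obj C; b' \<in> obj C; c' \<in> obj C;
        f \<in> hom C a b; g \<in> hom C b c; f' \<in> hom C a' b'; g' \<in> hom C b' c'\<rbrakk>
      \<Longrightarrow> (g \<cdot> f) \<star> (g' \<cdot> f') = (g \<star> g') \<cdot> (f \<star> f')"
    and tmor_add_left: "\<lbrakk>a \<in> obj C; b \<in> obj C; c \<in> obj C; d \<in> obj C;
        f \<in> hom C a b; g \<in> hom C a b; h \<in> hom C c d\<rbrakk>
      \<Longrightarrow> (f \<oplus> g) \<star> h = (f \<star> h) \<oplus> (g \<star> h)"
    and tmor_add_right: "\<lbrakk>a \<in> obj C; b \<in> obj C; c \<in> obj C; d \<in> obj C;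
        f \<in> hom C a b; g \<in> hom C c d; h \<in> hom C c d\<rbrakk>
      \<Longrightarrow> f \<star> (g \<oplus> h) = (f \<star> g) \<oplus> (f \<star> h)"
    and tmor_scale_left: "\<lbrakk>a \<in> obj C; b \<in> obj C; c \<in> obj C; d \<in> obj C; f \<in> hom C a b; g \<in> hom C c d\<rbrakk>
      \<Longrightarrow> (r \<odot> f) \<star> g = r \<odot> (f \<star> g)"
    and tmor_scale_right: "\<lbrakk>a \<in> obj C; b \<in> obj C; c \<in> obj C; d \<in> obj C; f \<in> hom C a b; g \<in> hom C c d\<rbrakk>
      \<Longrightarrow> f \<star> (r \<odot> g) = r \<odot> (f \<star> g)"
    and assoc_iso: "\<lbrakk>a \<in> obj C; b \<in> obj C; c \<in> obj C\<rbrakk>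
      \<Longrightarrow> iso_mor C ((a \<otimes> b) \<otimes> c) (a \<otimes> (b \<otimes> c)) (assoc C a b c)"
    and lunit_iso: "a \<in> obj C \<Longrightarrow> iso_mor C (\<one> \<otimes> a) a (lunit C a)"
    and runit_iso: "a \<in> obj C \<Longrightarrow> iso_mor C (a \<otimes> \<one>) a (runit C a)"
    and assoc_natural: "\<lbrakk>a \<in> obj C; b \<in> obj C; c \<in> obj C; a' \<in> obj C; b' \<in> obj C; c' \<in> obj C;
        f \<in> hom C a a'; g \<in> hom C b b'; h \<in> hom C c c'\<rbrakk>
      \<Longrightarrow> assoc C a' b' c' \<cdot> ((f \<star> g) \<star> h) = (f \<star> (g \<star> h)) \<cdot> assoc C a b c"
    and lunit_natural: "\<lbrakk>a \<in> obj C; b \<in> obj C; f \<in> hom C a b\<rbrakk>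
      \<Longrightarrow> lunit C b \<cdot> (idm C \<one> \<star> f) = f \<cdot> lunit C a"
    and runit_natural: "\<lbrakk>a \<in> obj C; b \<in> obj C; f \<in> hom C a b\<rbrakk>
      \<Longrightarrow> runit C b \<cdot> (f \<star> idm C \<one>) = f \<cdot> runit C a"
    and pentagon: "\<lbrakk>a \<in> obj C; b \<in> obj C; c \<in> obj C; d \<in> obj C\<rbrakk>
      \<Longrightarrow> (idm C a \<star> assoc C b c d) \<cdot> assoc C a (b \<otimes> c) d \<cdot> (assoc C a b c \<star> idm C d)
          = assoc C a b (c \<otimes> d) \<cdot> assoc C (a \<otimes> b) c d"
    and triangle: "\<lbrakk>a \<in> obj C; b \<in> obj C\<rbrakk>
      \<Longrightarrow> (idm C a \<star> lunit C b) \<cdot> assoc C a \<one> b = runit C a \<star> idm C b"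

record ('o, 'm) Alg =
  alg_obj :: 'o
  alg_mult :: 'm
  alg_unit :: 'm

context
  fixes C :: "('k, 'o, 'm, 'x) TensorCat_scheme" (structure)
begin

definition assoc_inv :: "'o \<Rightarrow> 'o \<Rightarrow> 'o \<Rightarrow> 'm" where
  "assoc_inv a b c = inv_mor C ((a \<otimes> b) \<otimes> c) (a \<otimes> (b \<otimes> c)) (assoc C a b c)"

definition lunit_inv :: "'o \<Rightarrow> 'm" where
  "lunit_inv a = inv_mor C (\<one> \<otimes> a) a (lunit C a)"

definition runit_inv :: "'o \<Rightarrow> 'm" where
  "runit_inv a = inv_mor C (a \<otimes> \<one>) a (runit C a)"

definition is_algebra :: "('o, 'm) Alg \<Rightarrow> bool" where
  "is_algebra A \<longleftrightarrow> (let a = alg_obj A; m = alg_mult A; i = alg_unit A in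
     a \<in> obj C \<and> m \<in> hom C (a \<otimes> a) a \<and> i \<in> hom C \<one> a \<and>
     m \<cdot> (m \<star> idm C a) = m \<cdot> (idm C a \<star> m) \<cdot> assoc C a a a \<and>
     m \<cdot> (i \<star> idm C a) = lunit C a \<and>
     m \<cdot> (idm C a \<star> i) = runit C a)"

definition is_left_action :: "('o, 'm) Alg \<Rightarrow> 'o \<Rightarrow> 'm \<Rightarrow> bool" where
  "is_left_action A x l \<longleftrightarrow> (let a = alg_obj A in
     l \<in> hom C (a \<otimes> x) x \<and>
     l \<cdot> (alg_mult A \<star> idm C x) = l \<cdot> (idm C a \<star> l) \<cdot> assoc C a a x \<and>
     l \<cdot> (alg_unit A \<star> idm C x) = lunit C x)"

definition is_right_action :: "('o, 'm) Alg \<Rightarrow> 'o \<Rightarrow> 'm \<Rightarrow> bool" where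
  "is_right_action B x r \<longleftrightarrow> (let b = alg_obj B in
     r \<in> hom C (x \<otimes> b) x \<and>
     r \<cdot> (r \<star> idm C b) = r \<cdot> (idm C x \<star> alg_mult B) \<cdot> assoc C x b b \<and>
     r \<cdot> (idm C x \<star> alg_unit B) = runit C x)"

definition left_modules :: "('o, 'm) Alg \<Rightarrow> ('k, 'o \<times> 'm, 'm) LinCat" where
  "left_modules A =
     \<lparr>obj = {(x, l). x \<in> obj C \<and> is_left_action A x l},
      hom = (\<lambda>(x, l) (y, l'). {f \<in> hom C x y. f \<cdot> l = l' \<cdot> (idm C (alg_obj A) \<star> f)}),
      idm = (\<lambda>(x, l). idm C x),
      comp = comp C,
      zerom = (\<lambda>(x, l) (y, l'). zerom C x y),
      addm = addm C,
      scale = scale C\<rparr>"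

definition bimodules :: "('o, 'm) Alg \<Rightarrow> ('o, 'm) Alg \<Rightarrow> ('k, 'o \<times> 'm \<times> 'm, 'm) LinCat" where
  "bimodules A B =
     \<lparr>obj = {(x, l, r). x \<in> obj C \<and> is_left_action A x l \<and> is_right_action B x r \<and>
               r \<cdot> (l \<star> idm C (alg_obj B))
               = l \<cdot> (idm C (alg_obj A) \<star> r) \<cdot> assoc C (alg_obj A) x (alg_obj B)},
      hom = (\<lambda>(x, l, r) (y, l', r'). {f \<in> hom C x y.
               f \<cdot> l = l' \<cdot> (idm C (alg_obj A) \<star> f) \<and> f \<cdot> r = r' \<cdot> (f \<star> idm C (alg_obj B))}),
      idm = (\<lambda>(x, l, r). idm C x),
      comp = comp C,
      zerom = (\<lambda>(x, l, r) (y, l', r'). zerom C x y),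
      addm = addm C,
      scale = scale C\<rparr>"

definition separable_algebra :: "('o, 'm) Alg \<Rightarrow> bool" where
  "separable_algebra A \<longleftrightarrow> is_algebra A \<and> (let a = alg_obj A; m = alg_mult A in
     \<exists>s \<in> hom (bimodules A A)
            (a, m, m)
            (a \<otimes> a, (m \<star> idm C a) \<cdot> assoc_inv a a a, (idm C a \<star> m) \<cdot> assoc C a a a).
       m \<cdot> s = idm C a)"

end

definition semisimple_algebra ::
    "('k::field, 'o, 'm, 'x) TensorCat_scheme \<Rightarrow> ('o, 'm) Alg \<Rightarrow> bool" where
  "semisimple_algebra C A \<longleftrightarrow> is_algebra C A \<and> semisimple_category (left_modules C A)"


section \<open>Pivotal categories\<close>

text \<open>\<open>ev a : a\<^sup>* \<otimes> a \<rightarrow> \<one>\<close>, \<open>coev a : \<one> \<rightarrow> a \<otimes> a\<^sup>*\<close>, and \<open>piv a : a \<rightarrow> a\<^sup>*\<^sup>*\<close>.\<close>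

record ('k, 'o, 'm) PivCat = "('k, 'o, 'm) TensorCat" +
  dual :: "'o \<Rightarrow> 'o"
  ev :: "'o \<Rightarrow> 'm"
  coev :: "'o \<Rightarrow> 'm"
  piv :: "'o \<Rightarrow> 'm"

context
  fixes C :: "('k, 'o, 'm, 'x) PivCat_scheme" (structure)
begin

text \<open>For \<open>h : u \<otimes> a \<rightarrow> \<one>\<close>, the morphism \<open>adjunct u a h : u \<rightarrow> a\<^sup>*\<close> is
  \<open>(h \<otimes> id) \<circ> (id \<otimes> coev a)\<close>, i.e. the unique \<open>g\<close> with \<open>ev a \<circ> (g \<otimes> id) = h\<close>.\<close>

definition adjunct :: "'o \<Rightarrow> 'o \<Rightarrow> 'm \<Rightarrow> 'm" where
  "adjunct u a h =
     lunit C (dual C a) \<cdot> (h \<star> idm C (dual C a)) \<cdot> assoc_inv C u a (dual C a)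
     \<cdot> (idm C u \<star> coev C a) \<cdot> runit_inv C u"

text \<open>The dual \<open>b\<^sup>* \<rightarrow> a\<^sup>*\<close> of \<open>f : a \<rightarrow> b\<close>.\<close>

definition dual_mor :: "'o \<Rightarrow> 'o \<Rightarrow> 'm \<Rightarrow> 'm" where
  "dual_mor a b f = adjunct (dual C b) a (ev C b \<cdot> (idm C (dual C b) \<star> f))"

text \<open>The canonical isomorphisms \<open>b\<^sup>* \<otimes> a\<^sup>* \<rightarrow> (a \<otimes> b)\<^sup>*\<close> and \<open>\<one> \<rightarrow> \<one>\<^sup>*\<close>.\<close>

definition dual_tensor :: "'o \<Rightarrow> 'o \<Rightarrow> 'm" where
  "dual_tensor a b = adjunct (dual C b \<otimes> dual C a) (a \<otimes> b)
     (ev C b \<cdot> (idm C (dual C b) \<star>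
        (lunit C b \<cdot> (ev C a \<star> idm C b) \<cdot> assoc_inv C (dual C a) a b))
      \<cdot> assoc C (dual C b) (dual C a) (a \<otimes> b))"

definition dual_unit :: 'm where
  "dual_unit = adjunct \<one> \<one> (lunit C \<one>)"

definition ev_tilde :: "'o \<Rightarrow> 'm" where
  "ev_tilde a = ev C (dual C a) \<cdot> (piv C a \<star> idm C (dual C a))"

end

locale pivotal_category = tensor_category C
  for C :: "('k::field, 'o, 'm, 'x) PivCat_scheme" (structure) +
  assumes dual_obj: "a \<in> obj C \<Longrightarrow> dual C a \<in> obj C"
    and ev_in_hom: "a \<in> obj C \<Longrightarrow> ev C a \<in> hom C (dual C a \<otimes> a) \<one>"
    and coev_in_hom: "a \<in> obj C \<Longrightarrow> coev C a \<in> hom C \<one> (a \<otimes> dual C a)"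
    and zigzag: "a \<in> obj C \<Longrightarrow>
        runit C a \<cdot> (idm C a \<star> ev C a) \<cdot> assoc C a (dual C a) a
        \<cdot> (coev C a \<star> idm C a) \<cdot> lunit_inv C a = idm C a"
    and zigzag_dual: "a \<in> obj C \<Longrightarrow>
        lunit C (dual C a) \<cdot> (ev C a \<star> idm C (dual C a)) \<cdot> assoc_inv C (dual C a) a (dual C a)
        \<cdot> (idm C (dual C a) \<star> coev C a) \<cdot> runit_inv C (dual C a) = idm C (dual C a)"
    and iso_to_dual: "a \<in> obj C \<Longrightarrow> \<exists>b\<in>obj C. \<exists>f. iso_mor C a (dual C b) f"
    and piv_iso: "a \<in> obj C \<Longrightarrow> iso_mor C a (dual C (dual C a)) (piv C a)"
    and piv_natural: "\<lbrakk>a \<in> obj C; b \<in> obj C; f \<in> hom C a b\<rbrakk>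
      \<Longrightarrow> dual_mor C (dual C b) (dual C a) (dual_mor C a b f) \<cdot> piv C a = piv C b \<cdot> f"
    \<comment> \<open>The monoidal structure \<open>a\<^sup>*\<^sup>* \<otimes> b\<^sup>*\<^sup>* \<rightarrow> (a \<otimes> b)\<^sup>*\<^sup>*\<close> of the double dual is
        \<open>dual_tensor b\<^sup>* a\<^sup>*\<close> followed by the inverse of the dual of \<open>dual_tensor a b\<close>.\<close>
    and piv_tensor: "\<lbrakk>a \<in> obj C; b \<in> obj C\<rbrakk>
      \<Longrightarrow> dual_mor C (dual C b \<otimes> dual C a) (dual C (a \<otimes> b)) (dual_tensor C a b) \<cdot> piv C (a \<otimes> b)
          = dual_tensor C (dual C b) (dual C a) \<cdot> (piv C a \<star> piv C b)"
    and piv_unit: "dual_mor C \<one> (dual C \<one>) (dual_unit C) \<cdot> piv C \<one> = dual_unit C"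


section \<open>Functors\<close>

record ('o, 'm, 'p, 'n) Functor =
  fobj :: "'o \<Rightarrow> 'p"
  fmor :: "'m \<Rightarrow> 'n"

text \<open>\<open>fmult a b : F a \<otimes> F b \<rightarrow> F (a \<otimes> b)\<close> and \<open>funit : \<one> \<rightarrow> F \<one>\<close>.\<close>

record ('o, 'm, 'p, 'n) TFunctor = "('o, 'm, 'p, 'n) Functor" +
  fmult :: "'o \<Rightarrow> 'o \<Rightarrow> 'n"
  funit :: 'n

locale linear_functor =
  fixes C :: "('k::field, 'o, 'm, 'x) LinCat_scheme" (structure)
    and D :: "('k, 'p, 'n, 'y) LinCat_scheme" (structure)
    and F :: "('o, 'm, 'p, 'n, 'z) Functor_scheme"
  assumes fobj_obj: "a \<in> obj C \<Longrightarrow> fobj F a \<in> obj D"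
    and fmor_in_hom: "\<lbrakk>a \<in> obj C; b \<in> obj C; f \<in> hom C a b\<rbrakk>
      \<Longrightarrow> fmor F f \<in> hom D (fobj F a) (fobj F b)"
    and fmor_id: "a \<in> obj C \<Longrightarrow> fmor F (idm C a) = idm D (fobj F a)"
    and fmor_comp: "\<lbrakk>a \<in> obj C; b \<in> obj C; c \<in> obj C; f \<in> hom C a b; g \<in> hom C b c\<rbrakk>
      \<Longrightarrow> fmor F (g \<cdot>\<^bsub>C\<^esub> f) = fmor F g \<cdot>\<^bsub>D\<^esub> fmor F f"
    and fmor_add: "\<lbrakk>a \<in> obj C; b \<in> obj C; f \<in> hom C a b; g \<in> hom C a b\<rbrakk>
      \<Longrightarrow> fmor F (f \<oplus>\<^bsub>C\<^esub> g) = fmor F f \<oplus>\<^bsub>D\<^esub> fmor F g"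
    and fmor_scale: "\<lbrakk>a \<in> obj C; b \<in> obj C; f \<in> hom C a b\<rbrakk>
      \<Longrightarrow> fmor F (r \<odot>\<^bsub>C\<^esub> f) = r \<odot>\<^bsub>D\<^esub> fmor F f"

locale tensor_functor = linear_functor C D F
  for C :: "('k::field, 'o, 'm, 'x) TensorCat_scheme" (structure)
    and D :: "('k, 'p, 'n, 'y) TensorCat_scheme" (structure)
    and F :: "('o, 'm, 'p, 'n, 'z) TFunctor_scheme" +
  assumes fmult_iso: "\<lbrakk>a \<in> obj C; b \<in> obj C\<rbrakk>
      \<Longrightarrow> iso_mor D (fobj F a \<otimes>\<^bsub>D\<^esub> fobj F b) (fobj F (a \<otimes>\<^bsub>C\<^esub> b)) (fmult F a b)"
    and funit_iso: "iso_mor D \<one>\<^bsub>D\<^esub> (fobj F \<one>\<^bsub>C\<^esub>) (funit F)"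
    and fmult_natural: "\<lbrakk>a \<in> obj C; b \<in> obj C; a' \<in> obj C; b' \<in> obj C;
        f \<in> hom C a a'; g \<in> hom C b b'\<rbrakk>
      \<Longrightarrow> fmult F a' b' \<cdot>\<^bsub>D\<^esub> (fmor F f \<star>\<^bsub>D\<^esub> fmor F g) = fmor F (f \<star>\<^bsub>C\<^esub> g) \<cdot>\<^bsub>D\<^esub> fmult F a b"
    and fmult_assoc: "\<lbrakk>a \<in> obj C; b \<in> obj C; c \<in> obj C\<rbrakk>
      \<Longrightarrow> fmor F (assoc C a b c) \<cdot>\<^bsub>D\<^esub> fmult F (a \<otimes>\<^bsub>C\<^esub> b) c \<cdot>\<^bsub>D\<^esub> (fmult F a b \<star>\<^bsub>D\<^esub> idm D (fobj F c))
          = fmult F a (b \<otimes>\<^bsub>C\<^esub> c) \<cdot>\<^bsub>D\<^esub> (idm D (fobj F a) \<star>\<^bsub>D\<^esub> fmult F b c)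
            \<cdot>\<^bsub>D\<^esub> assoc D (fobj F a) (fobj F b) (fobj F c)"
    and fmult_lunit: "a \<in> obj C
      \<Longrightarrow> fmor F (lunit C a) \<cdot>\<^bsub>D\<^esub> fmult F \<one>\<^bsub>C\<^esub> a \<cdot>\<^bsub>D\<^esub> (funit F \<star>\<^bsub>D\<^esub> idm D (fobj F a))
          = lunit D (fobj F a)"
    and fmult_runit: "a \<in> obj C
      \<Longrightarrow> fmor F (runit C a) \<cdot>\<^bsub>D\<^esub> fmult F a \<one>\<^bsub>C\<^esub> \<cdot>\<^bsub>D\<^esub> (idm D (fobj F a) \<star>\<^bsub>D\<^esub> funit F)
          = runit D (fobj F a)"

text \<open>The canonical isomorphism \<open>\<delta>\<^sub>x : F (x\<^sup>*) \<rightarrow> (F x)\<^sup>*\<close>.\<close>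

definition fdual ::
    "('k, 'o, 'm, 'x) PivCat_scheme \<Rightarrow> ('k, 'p, 'n, 'y) PivCat_scheme
     \<Rightarrow> ('o, 'm, 'p, 'n, 'z) TFunctor_scheme \<Rightarrow> 'o \<Rightarrow> 'n" where
  "fdual C D F x = adjunct D (fobj F (dual C x)) (fobj F x)
     (inv_mor D \<one>\<^bsub>D\<^esub> (fobj F \<one>\<^bsub>C\<^esub>) (funit F) \<cdot>\<^bsub>D\<^esub> fmor F (ev C x) \<cdot>\<^bsub>D\<^esub> fmult F (dual C x) x)"

locale pivotal_functor = tensor_functor C D F
  for C :: "('k::field, 'o, 'm, 'x) PivCat_scheme" (structure)
    and D :: "('k, 'p, 'n, 'y) PivCat_scheme" (structure)
    and F :: "('o, 'm, 'p, 'n, 'z) TFunctor_scheme" +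
  assumes fmor_piv: "x \<in> obj C
      \<Longrightarrow> fmor F (piv C x)
          = inv_mor D (fobj F (dual C (dual C x))) (dual D (fobj F (dual C x))) (fdual C D F (dual C x))
            \<cdot>\<^bsub>D\<^esub> dual_mor D (fobj F (dual C x)) (dual D (fobj F x)) (fdual C D F x)
            \<cdot>\<^bsub>D\<^esub> piv D (fobj F x)"

text \<open>The composite \<open>G \<circ> F\<close>, where \<open>G\<close> takes values in \<open>E\<close>.\<close>

definition tfunctor_comp ::
    "('k, 'q, 'l, 'x) TensorCat_scheme \<Rightarrow> ('p, 'n, 'q, 'l) TFunctor \<Rightarrow> ('o, 'm, 'p, 'n) TFunctor
     \<Rightarrow> ('o, 'm, 'q, 'l) TFunctor" where
  "tfunctor_comp E G F =
     \<lparr>fobj = (\<lambda>a. fobj G (fobj F a)),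
      fmor = (\<lambda>f. fmor G (fmor F f)),
      fmult = (\<lambda>a b. fmor G (fmult F a b) \<cdot>\<^bsub>E\<^esub> fmult G (fobj F a) (fobj F b)),
      funit = fmor G (funit F) \<cdot>\<^bsub>E\<^esub> funit G\<rparr>"

text \<open>\<open>F\<close> is left adjoint to \<open>R\<close>, with unit \<open>\<eta>\<close> and counit \<open>\<epsilon>\<close>.\<close>

locale adjunction =
  fixes C :: "('k::field, 'o, 'm, 'x) LinCat_scheme" (structure)
    and D :: "('k, 'p, 'n, 'y) LinCat_scheme" (structure)
    and F :: "('o, 'm, 'p, 'n, 'z) Functor_scheme"
    and R :: "('p, 'n, 'o, 'm, 'w) Functor_scheme"
    and \<eta> :: "'o \<Rightarrow> 'm"
    and \<epsilon> :: "'p \<Rightarrow> 'n"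
  assumes left_functor: "linear_functor C D F"
    and right_functor: "linear_functor D C R"
    and unit_in_hom: "c \<in> obj C \<Longrightarrow> \<eta> c \<in> hom C c (fobj R (fobj F c))"
    and counit_in_hom: "x \<in> obj D \<Longrightarrow> \<epsilon> x \<in> hom D (fobj F (fobj R x)) x"
    and unit_natural: "\<lbrakk>c \<in> obj C; d \<in> obj C; f \<in> hom C c d\<rbrakk>
      \<Longrightarrow> fmor R (fmor F f) \<cdot>\<^bsub>C\<^esub> \<eta> c = \<eta> d \<cdot>\<^bsub>C\<^esub> f"
    and counit_natural: "\<lbrakk>x \<in> obj D; y \<in> obj D; g \<in> hom D x y\<rbrakk>
      \<Longrightarrow> g \<cdot>\<^bsub>D\<^esub> \<epsilon> x = \<epsilon> y \<cdot>\<^bsub>D\<^esub> fmor F (fmor R g)"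
    and triangle_left: "c \<in> obj C \<Longrightarrow> \<epsilon> (fobj F c) \<cdot>\<^bsub>D\<^esub> fmor F (\<eta> c) = idm D (fobj F c)"
    and triangle_right: "x \<in> obj D \<Longrightarrow> fmor R (\<epsilon> x) \<cdot>\<^bsub>C\<^esub> \<eta> (fobj R x) = idm C (fobj R x)"


section \<open>The Drinfel'd center\<close>

context
  fixes M :: "('k, 'o, 'm, 'x) PivCat_scheme" (structure)
begin

text \<open>Half-braidings \<open>e\<^sub>b : a \<otimes> b \<rightarrow> b \<otimes> a\<close> are extensional functions, so that they are determined
  by their values on the objects of \<open>M\<close>.\<close>

definition is_half_braiding :: "'o \<Rightarrow> ('o \<Rightarrow> 'm) \<Rightarrow> bool" where
  "is_half_braiding a e \<longleftrightarrow> e \<in> extensional (obj M) \<and>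
     (\<forall>b\<in>obj M. iso_mor M (a \<otimes> b) (b \<otimes> a) (e b)) \<and>
     (\<forall>b\<in>obj M. \<forall>c\<in>obj M. \<forall>f\<in>hom M b c. e c \<cdot> (idm M a \<star> f) = (f \<star> idm M a) \<cdot> e b) \<and>
     (\<forall>b\<in>obj M. \<forall>c\<in>obj M.
        e (b \<otimes> c) = assoc_inv M b c a \<cdot> (idm M b \<star> e c) \<cdot> assoc M b a c
                    \<cdot> (e b \<star> idm M c) \<cdot> assoc_inv M a b c)"

definition braid_tensor :: "'o \<times> ('o \<Rightarrow> 'm) \<Rightarrow> 'o \<times> ('o \<Rightarrow> 'm) \<Rightarrow> 'o \<Rightarrow> 'm" where
  "braid_tensor = (\<lambda>(a, e) (b, e'). \<lambda>c\<in>obj M.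
     assoc M c a b \<cdot> (e c \<star> idm M b) \<cdot> assoc_inv M a c b \<cdot> (idm M a \<star> e' c) \<cdot> assoc M a b c)"

definition braid_unit :: "'o \<Rightarrow> 'm" where
  "braid_unit = (\<lambda>b\<in>obj M. runit_inv M b \<cdot> lunit M b)"

text \<open>The half-braiding on \<open>a\<^sup>*\<close> for which \<open>ev a\<close> and \<open>coev a\<close> are morphisms of the center, i.e.
  \<open>(ev a \<otimes> id \<otimes> id) \<circ> (id \<otimes> e\<^sub>b\<^sup>-\<^sup>1 \<otimes> id) \<circ> (id \<otimes> id \<otimes> coev a) : a\<^sup>* \<otimes> b \<rightarrow> b \<otimes> a\<^sup>*\<close>.\<close>

definition braid_dual :: "'o \<times> ('o \<Rightarrow> 'm) \<Rightarrow> 'o \<Rightarrow> 'm" where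
  "braid_dual = (\<lambda>(a, e). \<lambda>b\<in>obj M. let a' = dual M a in
     (lunit M b \<star> idm M a')
     \<cdot> ((ev M a \<star> idm M b) \<star> idm M a')
     \<cdot> (assoc_inv M a' a b \<star> idm M a')
     \<cdot> ((idm M a' \<star> inv_mor M (a \<otimes> b) (b \<otimes> a) (e b)) \<star> idm M a')
     \<cdot> (assoc M a' b a \<star> idm M a')
     \<cdot> assoc_inv M (a' \<otimes> b) a a'
     \<cdot> (idm M (a' \<otimes> b) \<star> coev M a)
     \<cdot> runit_inv M (a' \<otimes> b))"

definition center :: "('k, 'o \<times> ('o \<Rightarrow> 'm), 'm) PivCat" where
  "center =
     \<lparr>obj = {(a, e). a \<in> obj M \<and> is_half_braiding a e},
      hom = (\<lambda>(a, e) (b, e'). {f \<in> hom M a b. \<forall>c\<in>obj M.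
               (idm M c \<star> f) \<cdot> e c = e' c \<cdot> (f \<star> idm M c)}),
      idm = (\<lambda>x. idm M (fst x)),
      comp = comp M,
      zerom = (\<lambda>x y. zerom M (fst x) (fst y)),
      addm = addm M,
      scale = scale M,
      tobj = (\<lambda>x y. (fst x \<otimes> fst y, braid_tensor x y)),
      tmor = tmor M,
      tunit = (\<one>, braid_unit),
      assoc = (\<lambda>x y z. assoc M (fst x) (fst y) (fst z)),
      lunit = (\<lambda>x. lunit M (fst x)),
      runit = (\<lambda>x. runit M (fst x)),
      dual = (\<lambda>x. (dual M (fst x), braid_dual x)),
      ev = (\<lambda>x. ev M (fst x)),
      coev = (\<lambda>x. coev M (fst x)),
      piv = (\<lambda>x. piv M (fst x))\<rparr>"

definition forgetful :: "('o \<times> ('o \<Rightarrow> 'm), 'm, 'o, 'm) TFunctor" where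
  "forgetful =
     \<lparr>fobj = fst,
      fmor = (\<lambda>f. f),
      fmult = (\<lambda>x y. idm M (fst x \<otimes> fst y)),
      funit = idm M \<one>\<rparr>"

end


section \<open>The categorified trace\<close>

context
  fixes C :: "('k, 'o, 'm, 'x) PivCat_scheme" (structure)
    and M :: "('k, 'p, 'n, 'y) PivCat_scheme" (structure)
    and \<Phi>Z :: "('o, 'm, 'p \<times> ('p \<Rightarrow> 'n), 'n) TFunctor"
    and Tr :: "('p, 'n, 'o, 'm) Functor"
    and \<eta> :: "'o \<Rightarrow> 'm"
    and \<epsilon> :: "'p \<Rightarrow> 'n"
begin

text \<open>The functor \<open>\<Phi> = F \<circ> \<Phi>\<^sup>Z\<close>.\<close>

definition phi :: "('o, 'm, 'p, 'n) TFunctor" where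
  "phi = tfunctor_comp M (forgetful M) \<Phi>Z"

text \<open>The half-braiding \<open>e\<^bsub>\<Phi>(c),y\<^esub> : \<Phi>(c) \<otimes> y \<rightarrow> y \<otimes> \<Phi>(c)\<close>.\<close>

definition half_braid :: "'o \<Rightarrow> 'p \<Rightarrow> 'n" where
  "half_braid c y = snd (fobj \<Phi>Z c) y"

text \<open>The morphism \<open>c \<rightarrow> Tr x\<close> whose mate is \<open>f : \<Phi>(c) \<rightarrow> x\<close>.\<close>

definition unmate :: "'o \<Rightarrow> 'p \<Rightarrow> 'n \<Rightarrow> 'm" where
  "unmate c x f = (THE g. g \<in> hom C c (fobj Tr x) \<and> \<epsilon> x \<cdot>\<^bsub>M\<^esub> fmor phi g = f)"

definition tr_mult :: "'p \<Rightarrow> 'p \<Rightarrow> 'm" where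
  "tr_mult x y = unmate (fobj Tr x \<otimes>\<^bsub>C\<^esub> fobj Tr y) (x \<otimes>\<^bsub>M\<^esub> y)
     ((\<epsilon> x \<star>\<^bsub>M\<^esub> \<epsilon> y)
      \<cdot>\<^bsub>M\<^esub> inv_mor M (fobj phi (fobj Tr x) \<otimes>\<^bsub>M\<^esub> fobj phi (fobj Tr y))
           (fobj phi (fobj Tr x \<otimes>\<^bsub>C\<^esub> fobj Tr y)) (fmult phi (fobj Tr x) (fobj Tr y)))"

text \<open>\<open>\<eta>\<^sub>\<one>\<close> followed by the identification \<open>Tr (\<Phi> \<one>) \<cong> Tr \<one>\<close>.\<close>

definition tr_unit :: 'm where
  "tr_unit = fmor Tr (inv_mor M \<one>\<^bsub>M\<^esub> (fobj phi \<one>\<^bsub>C\<^esub>) (funit phi)) \<cdot>\<^bsub>C\<^esub> \<eta> \<one>\<^bsub>C\<^esub>"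

definition traciator :: "'p \<Rightarrow> 'p \<Rightarrow> 'm" where
  "traciator x y = (let c = fobj Tr (x \<otimes>\<^bsub>M\<^esub> y); p = fobj phi c; y' = dual M y in
     unmate c (y \<otimes>\<^bsub>M\<^esub> x)
       (runit M (y \<otimes>\<^bsub>M\<^esub> x)
        \<cdot>\<^bsub>M\<^esub> (idm M (y \<otimes>\<^bsub>M\<^esub> x) \<star>\<^bsub>M\<^esub> ev_tilde M y)
        \<cdot>\<^bsub>M\<^esub> assoc M (y \<otimes>\<^bsub>M\<^esub> x) y y'
        \<cdot>\<^bsub>M\<^esub> (assoc_inv M y x y \<star>\<^bsub>M\<^esub> idm M y')
        \<cdot>\<^bsub>M\<^esub> ((idm M y \<star>\<^bsub>M\<^esub> \<epsilon> (x \<otimes>\<^bsub>M\<^esub> y)) \<star>\<^bsub>M\<^esub> idm M y')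
        \<cdot>\<^bsub>M\<^esub> (half_braid c y \<star>\<^bsub>M\<^esub> idm M y')
        \<cdot>\<^bsub>M\<^esub> assoc_inv M p y y'
        \<cdot>\<^bsub>M\<^esub> (idm M p \<star>\<^bsub>M\<^esub> coev M y)
        \<cdot>\<^bsub>M\<^esub> runit_inv M p))"

text \<open>\<open>\<tau>\<^sup>-\<^bsub>x,y\<^esub> : Tr (x \<otimes> y) \<rightarrow> Tr (y \<otimes> x)\<close> is the inverse of \<open>\<tau>\<^bsub>y,x\<^esub>\<close>.\<close>

definition traciator_minus :: "'p \<Rightarrow> 'p \<Rightarrow> 'm" where
  "traciator_minus x y =
     inv_mor C (fobj Tr (y \<otimes>\<^bsub>M\<^esub> x)) (fobj Tr (x \<otimes>\<^bsub>M\<^esub> y)) (traciator y x)"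

text \<open>The multiplication contains the reassociations \<open>(b \<otimes> a) \<otimes> (a \<otimes> b) \<rightarrow> b \<otimes> ((a \<otimes> a) \<otimes> b)\<close> and
  \<open>((a \<otimes> a) \<otimes> b) \<otimes> b \<rightarrow> (a \<otimes> a) \<otimes> (b \<otimes> b)\<close>.\<close>

definition tr_algebra :: "('p, 'n) Alg \<Rightarrow> ('p, 'n) Alg \<Rightarrow> ('o, 'm) Alg" where
  "tr_algebra A B = (let a = alg_obj A; b = alg_obj B; t = fobj Tr (a \<otimes>\<^bsub>M\<^esub> b) in
     \<lparr>alg_obj = t,
      alg_mult =
        fmor Tr (alg_mult A \<star>\<^bsub>M\<^esub> alg_mult B)
        \<cdot>\<^bsub>C\<^esub> fmor Tr (assoc M (a \<otimes>\<^bsub>M\<^esub> a) b b)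
        \<cdot>\<^bsub>C\<^esub> traciator_minus b ((a \<otimes>\<^bsub>M\<^esub> a) \<otimes>\<^bsub>M\<^esub> b)
        \<cdot>\<^bsub>C\<^esub> fmor Tr ((idm M b \<star>\<^bsub>M\<^esub> assoc_inv M a a b) \<cdot>\<^bsub>M\<^esub> assoc M b a (a \<otimes>\<^bsub>M\<^esub> b))
        \<cdot>\<^bsub>C\<^esub> tr_mult (b \<otimes>\<^bsub>M\<^esub> a) (a \<otimes>\<^bsub>M\<^esub> b)
        \<cdot>\<^bsub>C\<^esub> (traciator a b \<star>\<^bsub>C\<^esub> idm C t),
      alg_unit =
        fmor Tr ((alg_unit A \<star>\<^bsub>M\<^esub> alg_unit B) \<cdot>\<^bsub>M\<^esub> lunit_inv M \<one>\<^bsub>M\<^esub>) \<cdot>\<^bsub>C\<^esub> tr_unit\<rparr>)"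

end

end

theory Submission
  imports Defs
begin

text \<open>
  A linear category with finite sums, split idempotents and finite-dimensional morphism spaces is
  semisimple if and only if every morphism \<open>f\<close> is regular, i.e. \<open>f = f \<circ> g \<circ> f\<close> for some \<open>g\<close>.
  Put \<open>T = Tr(A \<otimes> B)\<close>. Mating, and bending \<open>\<Phi>(c)\<close> around \<open>B\<close> by means of the half-braiding, turns the
  morphisms \<open>d \<rightarrow> T \<otimes> c\<close> into the morphisms \<open>\<Phi>(d) \<rightarrow> A \<otimes> \<Phi>(c) \<otimes> B\<close>, so it identifies morphisms between the
  free \<open>T\<close>-modules on \<open>d\<close> and \<open>c\<close> with morphisms between the free \<open>A\<close>-\<open>B\<close>-bimodules on \<open>\<Phi>(d)\<close> and
  \<open>\<Phi>(c)\<close>, compatibly with composition. These are regular if the category of bimodules is semisimple; if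
  \<open>A\<close> and \<open>B\<close> are separable, averaging a quasi-inverse in \<open>M\<close> over the two sections gives one of
  bimodules. Finally, regularity of the maps between free modules makes every \<open>T\<close>-module a retract of a
  free one, and regularity is inherited by retracts.
\<close>

section \<open>Typed arrows\<close>

text \<open>Nothing in the definitions is strict, so a diagram such as the traciator carries
  associators and unitors everywhere, and morphisms do not know their sources and targets. Hence
  morphisms are packed together with their source and target, and diagrams are computed in a strict
  monoidal category whose objects are words; \<open>M\<close>, and through \<Phi> also
  \<open>C\<close>, are mapped into it by strong functors. There the mate of the traciator is a
  strand pulled around \<Phi>(c), and the product of the trace algebra reads: nest the second counit
  between the two letters of the first, then multiply in A and in B. The algebra axioms and the
  comparison with bimodules are read off from this formula. Regularity is the form of semisimplicity
  that travels well: it is a single equation for a morphism and a quasi-inverse, so it passes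
  through a bijection of morphism sets without an equivalence of module categories being
  constructed. It also lets both assumptions on A and B end in the same statement about bilinear
  maps between free bimodules.\<close>

locale arrow_category =
  fixes Ob :: "'a set"
    and Ar :: "'s \<Rightarrow> bool"
    and Dom Cod :: "'s \<Rightarrow> 'a"
    and Cmp :: "'s \<Rightarrow> 's \<Rightarrow> 's" (infixr "\<bullet>" 55)
    and Id :: "'a \<Rightarrow> 's"
  assumes cmp_assoc: "(h \<bullet> g) \<bullet> f = h \<bullet> g \<bullet> f"
    and Ar_cmp [simp]: "Ar (g \<bullet> f) \<longleftrightarrow> Ar g \<and> Ar f \<and> Dom g = Cod f"
    and Dom_cmp [simp]: "Dom (g \<bullet> f) = Dom f"
    and Cod_cmp [simp]: "Cod (g \<bullet> f) = Cod g"
    and Ar_Id [simp]: "Ar (Id a) \<longleftrightarrow> a \<in> Ob"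
    and Dom_Id [simp]: "Dom (Id a) = a"
    and Cod_Id [simp]: "Cod (Id a) = a"
    and Id_cmp [simp]: "\<lbrakk>Ar f; Cod f = a\<rbrakk> \<Longrightarrow> Id a \<bullet> f = f"
    and cmp_Id [simp]: "\<lbrakk>Ar f; Dom f = a\<rbrakk> \<Longrightarrow> f \<bullet> Id a = f"
    and Dom_Ob [simp]: "Ar f \<Longrightarrow> Dom f \<in> Ob"
    and Cod_Ob [simp]: "Ar f \<Longrightarrow> Cod f \<in> Ob"
begin

text \<open>Composites are kept nested to the right; this form lets an equation between two
  neighbours be applied in the middle of a longer composite.\<close>

lemma cmp_cancel: "g \<bullet> f = h \<Longrightarrow> g \<bullet> f \<bullet> k = h \<bullet> k"
  by (metis cmp_assoc)

lemma iso_mono: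
  assumes "u' \<bullet> u = Id a" "u \<bullet> f = u \<bullet> g" "Ar f" "Ar g" "Cod f = a" "Cod g = a"
  shows "f = g"
  by (metis assms Id_cmp cmp_assoc)

lemma iso_epi:
  assumes "u \<bullet> u' = Id a" "f \<bullet> u = g \<bullet> u" "Ar f" "Ar g" "Dom f = a" "Dom g = a"
  shows "f = g"
  by (metis assms cmp_Id cmp_assoc)

end

text \<open>Objects are words in the letters \<open>ob\<close> and their tensor product is
  concatenation, so associativity and unit laws for objects are equalities of lists, and checking
  types is list computation. Associativity of the tensor product of arrows is required for ill-typed
  arrows as well, which keeps it usable without side conditions.\<close>

locale strict_monoidal = arrow_category "lists ob" Ar Dom Cod Cmp Id
  for ob :: "'a set"
    and Ar :: "'s \<Rightarrow> bool"
    and Dom Cod :: "'s \<Rightarrow> 'a list"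
    and Cmp :: "'s \<Rightarrow> 's \<Rightarrow> 's" (infixr "\<bullet>" 55)
    and Id :: "'a list \<Rightarrow> 's" +
  fixes Tns :: "'s \<Rightarrow> 's \<Rightarrow> 's" (infixr "\<boxtimes>" 60)
  assumes tns_assoc: "(f \<boxtimes> g) \<boxtimes> h = f \<boxtimes> g \<boxtimes> h"
    and Ar_tns [simp]: "Ar (f \<boxtimes> g) \<longleftrightarrow> Ar f \<and> Ar g"
    and Dom_tns [simp]: "Dom (f \<boxtimes> g) = Dom f @ Dom g"
    and Cod_tns [simp]: "Cod (f \<boxtimes> g) = Cod f @ Cod g"
    and Id_tns_Id: "Id xs \<boxtimes> Id ys = Id (xs @ ys)"
    and interchange: "\<lbrakk>Ar (g \<bullet> f); Ar (g' \<bullet> f')\<rbrakk>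
      \<Longrightarrow> (g \<bullet> f) \<boxtimes> (g' \<bullet> f') = (g \<boxtimes> g') \<bullet> (f \<boxtimes> f')"
    and Id_Nil_tns: "Ar f \<Longrightarrow> Id [] \<boxtimes> f = f"
    and tns_Id_Nil: "Ar f \<Longrightarrow> f \<boxtimes> Id [] = f"
begin

text \<open>Whiskering: one generator \<open>f\<close> with identity strands \<open>xs\<close> on
  its left and \<open>ys\<close> on its right. Every diagram below is a composite of such
  slices.\<close>

definition L :: "'a list \<Rightarrow> 's \<Rightarrow> 'a list \<Rightarrow> 's" where
  "L xs f ys = Id xs \<boxtimes> f \<boxtimes> Id ys"

lemma Ar_L [simp]: "Ar (L xs f ys) \<longleftrightarrow> set xs \<subseteq> ob \<and> Ar f \<and> set ys \<subseteq> ob"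
  by (auto simp: L_def lists_eq_set)

lemma Dom_subset [simp]: "Ar f \<Longrightarrow> set (Dom f) \<subseteq> ob" "Ar f \<Longrightarrow> set (Cod f) \<subseteq> ob"
  using Dom_Ob[of f] Cod_Ob[of f] by (auto simp: lists_eq_set)

lemma lists_iff [simp]: "xs \<in> lists A \<longleftrightarrow> set xs \<subseteq> A"
  by (auto simp: lists_eq_set)

declare in_lists_conv_set [simp del] Cons_in_lists_iff [simp del]

lemma Dom_L [simp]: "Dom (L xs f ys) = xs @ Dom f @ ys"
  by (simp add: L_def)

lemma Cod_L [simp]: "Cod (L xs f ys) = xs @ Cod f @ ys"
  by (simp add: L_def)

lemma L_Nil: "Ar f \<Longrightarrow> L [] f [] = f"
  by (simp add: L_def Id_Nil_tns tns_Id_Nil)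

lemma L_L [simp]: "L xs (L xs' f ys') ys = L (xs @ xs') f (ys' @ ys)"
  unfolding L_def by (metis tns_assoc Id_tns_Id)

lemma L_Id [simp]: "L xs (Id us) ys = Id (xs @ us @ ys)"
  by (simp add: L_def Id_tns_Id)

lemma L_cmp: "\<lbrakk>Ar (g \<bullet> f); set xs \<subseteq> ob; set ys \<subseteq> ob\<rbrakk>
    \<Longrightarrow> L xs (g \<bullet> f) ys = L xs g ys \<bullet> L xs f ys"
  unfolding L_def
  using interchange[of "Id xs" "Id xs" "g \<boxtimes> Id ys" "f \<boxtimes> Id ys"]
    interchange[of g f "Id ys" "Id ys"] by simp

text \<open>A tensor product is resolved into two slices; \<open>tns_L'\<close> does it in the other
  order, and equating the two gives the interchange law for slices.\<close>

lemma tns_L: "\<lbrakk>Ar f; Ar g\<rbrakk> \<Longrightarrow> f \<boxtimes> g = L [] f (Cod g) \<bullet> L (Dom f) g []"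
  using interchange[of f "Id (Dom f)" "Id (Cod g)" g]
  by (simp add: L_def Id_Nil_tns tns_Id_Nil)

lemma tns_L': "\<lbrakk>Ar f; Ar g\<rbrakk> \<Longrightarrow> f \<boxtimes> g = L (Cod f) g [] \<bullet> L [] f (Dom g)"
  using interchange[of "Id (Cod f)" f g "Id (Dom g)"]
  by (simp add: L_def Id_Nil_tns tns_Id_Nil)

lemma Id_tns: "Ar f \<Longrightarrow> Id xs \<boxtimes> f = L xs f []"
  by (simp add: L_def tns_Id_Nil)

lemma tns_Id: "\<lbrakk>Ar f; set xs \<subseteq> ob\<rbrakk> \<Longrightarrow> f \<boxtimes> Id xs = L [] f xs"
  by (simp add: L_def Id_Nil_tns)

text \<open>Two generators on disjoint strands, separated by the strands \<open>zs\<close>, commute.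
  The idle strands beside each generator record whether the other one has already been
  applied.\<close>

lemma exchange0:
  assumes "Ar f" "Ar g" "set xs \<subseteq> ob" "set ys \<subseteq> ob" "set zs \<subseteq> ob"
  shows "L xs f (zs @ Cod g @ ys) \<bullet> L (xs @ Dom f @ zs) g ys
    = L (xs @ Cod f @ zs) g ys \<bullet> L xs f (zs @ Dom g @ ys)"
proof -
  have "L [] f (zs @ Cod g) \<bullet> L (Dom f @ zs) g [] = L (Cod f @ zs) g [] \<bullet> L [] f (zs @ Dom g)"
    using tns_L[of f "L zs g []"] tns_L'[of f "L zs g []"] assms by simp
  then have "L xs (L [] f (zs @ Cod g) \<bullet> L (Dom f @ zs) g []) ys
      = L xs (L (Cod f @ zs) g [] \<bullet> L [] f (zs @ Dom g)) ys"
    by simp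
  then show ?thesis
    using assms by (simp add: L_cmp)
qed

text \<open>Used as a rewrite rule, \<open>exch\<close> moves the leftmost generators of a diagram to its source.\<close>

lemma exch0:
  assumes "Ar f" "Ar g" "take (length xs + length (Dom f)) xs' = xs @ Dom f"
    "ys = drop (length xs + length (Dom f)) xs' @ Cod g @ ys'"
    "set xs' \<subseteq> ob" "set ys' \<subseteq> ob"
  shows "L xs f ys \<bullet> L xs' g ys' = L (xs @ Cod f @ drop (length xs + length (Dom f)) xs') g ys'
    \<bullet> L xs f (drop (length xs + length (Dom f)) xs' @ Dom g @ ys')"
proof -
  define zs where "zs = drop (length xs + length (Dom f)) xs'"
  have xs': "xs' = xs @ Dom f @ zs"
    using assms(3) unfolding zs_def by (metis append_take_drop_id append.assoc)
  show ?thesis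
    using assms xs' exchange0[of f g xs ys' zs] unfolding zs_def[symmetric] by simp
qed

lemma exch1:
  assumes "Ar f" "Ar g" "take (length xs + length (Dom f)) xs' = xs @ Dom f"
    "ys = drop (length xs + length (Dom f)) xs' @ Cod g @ ys'"
    "set xs' \<subseteq> ob" "set ys' \<subseteq> ob"
  shows "L xs f ys \<bullet> L xs' g ys' \<bullet> k = L (xs @ Cod f @ drop (length xs + length (Dom f)) xs') g ys'
    \<bullet> L xs f (drop (length xs + length (Dom f)) xs' @ Dom g @ ys') \<bullet> k"
  using exch0[OF assms] by (metis cmp_assoc)

lemmas exch = exch0 exch1

end

text \<open>An ill-typed composite is an arrow with middle component \<^const>\<open>None\<close>; hence the domain and the codomain of a
  composite, and associativity, need no side conditions.\<close>

type_synonym ('o, 'm) tarr = "'o \<times> 'm option \<times> 'o"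

definition tdom :: "('o, 'm) tarr \<Rightarrow> 'o" where "tdom F = fst F"
definition tcod :: "('o, 'm) tarr \<Rightarrow> 'o" where "tcod F = snd (snd F)"
definition mor :: "('o, 'm) tarr \<Rightarrow> 'm" where "mor F = the (fst (snd F))"

lemma tarr_sel [simp]: "tdom (a, m, b) = a" "tcod (a, m, b) = b" "mor (a, Some f, b) = f"
  by (simp_all add: tdom_def tcod_def mor_def)

context
  fixes C :: "('o, 'm, 'x) Cat_scheme" (structure)
begin

definition tAr :: "('o, 'm) tarr \<Rightarrow> bool" where
  "tAr F \<longleftrightarrow> (\<exists>a\<in>obj C. \<exists>b\<in>obj C. \<exists>f\<in>hom C a b. F = (a, Some f, b))"

text \<open>Typing is checked when the arrow is built, so that later only the predicate
  \<open>tAr\<close> has to be consulted.\<close>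

definition mk :: "'o \<Rightarrow> 'm \<Rightarrow> 'o \<Rightarrow> ('o, 'm) tarr" where
  "mk a f b = (a, if a \<in> obj C \<and> b \<in> obj C \<and> f \<in> hom C a b then Some f else None, b)"

definition tcmp :: "('o, 'm) tarr \<Rightarrow> ('o, 'm) tarr \<Rightarrow> ('o, 'm) tarr" where
  "tcmp G F = (tdom F, if tAr G \<and> tAr F \<and> tdom G = tcod F then Some (mor G \<cdot> mor F) else None, tcod G)"

definition tid :: "'o \<Rightarrow> ('o, 'm) tarr" where
  "tid a = mk a (idm C a) a"

lemma tAr_mk [simp]: "tAr (mk a f b) \<longleftrightarrow> a \<in> obj C \<and> b \<in> obj C \<and> f \<in> hom C a b"
  by (auto simp: tAr_def mk_def)

lemma tAr_None [simp]: "\<not> tAr (a, None, b)"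
  by (simp add: tAr_def)

lemma tAr_Some [simp]: "tAr (a, Some f, b) \<longleftrightarrow> a \<in> obj C \<and> b \<in> obj C \<and> f \<in> hom C a b"
  by (auto simp: tAr_def)

lemma mk_sel [simp]: "tdom (mk a f b) = a" "tcod (mk a f b) = b"
  "\<lbrakk>a \<in> obj C; b \<in> obj C; f \<in> hom C a b\<rbrakk> \<Longrightarrow> mor (mk a f b) = f"
  by (simp_all add: mk_def)

lemma tcmp_sel [simp]: "tdom (tcmp G F) = tdom F" "tcod (tcmp G F) = tcod G"
  by (simp_all add: tcmp_def)

lemma tid_sel [simp]: "tdom (tid a) = a" "tcod (tid a) = a"
  by (simp_all add: tid_def)

lemma tAr_sel [simp]:
  assumes "tAr F"
  shows "tdom F \<in> obj C" "tcod F \<in> obj C" "mor F \<in> hom C (tdom F) (tcod F)"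
  using assms by (auto simp: tAr_def)

lemma tarr_eqI: "\<lbrakk>tAr F; tAr G; tdom F = tdom G; tcod F = tcod G; mor F = mor G\<rbrakk> \<Longrightarrow> F = G"
  by (auto simp: tAr_def)

lemma mk_mor [simp]: "\<lbrakk>tAr F; tdom F = a; tcod F = b\<rbrakk> \<Longrightarrow> mk a (mor F) b = F"
  by (auto simp: tAr_def mk_def)

lemma mk_eq_iff:
  "\<lbrakk>a \<in> obj C; b \<in> obj C; f \<in> hom C a b; g \<in> hom C a b\<rbrakk> \<Longrightarrow> mk a f b = mk a g b \<longleftrightarrow> f = g"
  by (simp add: mk_def)

lemma tcmp_mk:
  "\<lbrakk>a \<in> obj C; b \<in> obj C; c \<in> obj C; f \<in> hom C a b; g \<in> hom C b c\<rbrakk>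
    \<Longrightarrow> tcmp (mk b g c) (mk a f b) = (a, Some (g \<cdot> f), c)"
  by (simp add: tcmp_def)

end

notation tcmp (infixr "\<bullet>\<^sub>t\<index>" 55)

context category
begin

lemma mor_cmp [simp]: "\<lbrakk>tAr C G; tAr C F; tdom G = tcod F\<rbrakk> \<Longrightarrow> mor (G \<bullet>\<^sub>t F) = mor G \<cdot> mor F"
  by (simp add: tcmp_def)

sublocale arrow_category "obj C" "tAr C" tdom tcod "tcmp C" "tid C"
proof unfold_locales
  have ar: "tAr C (tcmp C g f) \<longleftrightarrow> tAr C g \<and> tAr C f \<and> tdom g = tcod f" for f g
  proof -
    have "mor g \<cdot> mor f \<in> hom C (tdom f) (tcod g)" if "tAr C g" "tAr C f" "tdom g = tcod f"
      using that tAr_sel comp_in_hom by metis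
    then show ?thesis
      by (auto simp: tcmp_def)
  qed
  fix f g h a
  show "tAr C (tcmp C g f) \<longleftrightarrow> tAr C g \<and> tAr C f \<and> tdom g = tcod f"
    by (rule ar)
  show "tcmp C (tcmp C h g) f = tcmp C h (tcmp C g f)"
  proof (cases "tAr C h \<and> tAr C g \<and> tAr C f \<and> tdom h = tcod g \<and> tdom g = tcod f")
    case True
    then have h: "mor f \<in> hom C (tdom f) (tcod f)" "mor g \<in> hom C (tcod f) (tcod g)"
      "mor h \<in> hom C (tcod g) (tcod h)"
      and o: "tdom f \<in> obj C" "tcod f \<in> obj C" "tcod g \<in> obj C" "tcod h \<in> obj C"
      using tAr_sel by metis+
    show ?thesis
      using True h o comp_assoc[OF o h] comp_in_hom[OF o(1-3) h(1,2)] comp_in_hom[OF o(2-4) h(2,3)]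
      by (simp add: tcmp_def)
  next
    case False
    \<comment> \<open>If one of the three arrows is ill-typed or a source and a target do not match,
      both bracketings reduce to the same triple with middle component \<open>None\<close>.\<close>
    then have *: "\<not> (tAr C (tcmp C h g) \<and> tAr C f \<and> tdom (tcmp C h g) = tcod f)"
      "\<not> (tAr C h \<and> tAr C (tcmp C g f) \<and> tdom h = tcod (tcmp C g f))"
      using ar[of h g] ar[of g f] by auto
    show ?thesis
      unfolding tcmp_def[of C "tcmp C h g"] tcmp_def[of C h "tcmp C g f"] if_not_P[OF *(1)] if_not_P[OF *(2)]
      by simp
  qed
  show "tAr C (tid C a) \<longleftrightarrow> a \<in> obj C"
    by (auto simp: tid_def id_in_hom)
  show "tcmp C (tid C a) f = f" if "tAr C f" "tcod f = a"
  proof -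
    from that obtain b m where "f = (b, Some m, a)" "b \<in> obj C" "a \<in> obj C" "m \<in> hom C b a"
      by (auto simp: tAr_def)
    then show ?thesis
      by (simp add: tcmp_def tid_def mk_def id_in_hom id_comp)
  qed
  show "tcmp C f (tid C a) = f" if "tAr C f" "tdom f = a"
  proof -
    from that obtain b m where "f = (a, Some m, b)" "b \<in> obj C" "a \<in> obj C" "m \<in> hom C a b"
      by (auto simp: tAr_def)
    then show ?thesis
      by (simp add: tcmp_def tid_def mk_def id_in_hom comp_id)
  qed
qed auto

lemma mor_id [simp]: "a \<in> obj C \<Longrightarrow> mor (tid C a) = idm C a"
  by (simp add: tid_def id_in_hom)

lemma is_inverse_unique:
  assumes "is_inverse C a b f g" "is_inverse C a b f h" "a \<in> obj C" "b \<in> obj C"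
  shows "g = h"
proof -
  have "g = g \<cdot> (f \<cdot> h)"
    using assms by (simp add: is_inverse_def comp_id[of b a])
  also have "\<dots> = (g \<cdot> f) \<cdot> h"
    using assms comp_assoc[of b a b a h f g] by (simp add: is_inverse_def)
  also have "\<dots> = h"
    using assms by (simp add: is_inverse_def id_comp[of b a])
  finally show ?thesis .
qed

lemma inv_mor_eq:
  assumes "is_inverse C a b f g" "a \<in> obj C" "b \<in> obj C"
  shows "inv_mor C a b f = g"
  unfolding inv_mor_def by (rule the_equality) (use assms is_inverse_unique in blast)+

lemma is_inverse_inv_mor:
  assumes "iso_mor C a b f" "a \<in> obj C" "b \<in> obj C"
  shows "is_inverse C a b f (inv_mor C a b f)"
proof -
  from assms obtain g where "is_inverse C a b f g"
    by (auto simp: iso_mor_def)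
  then show ?thesis
    using inv_mor_eq assms(2,3) by metis
qed

lemma is_inverse_iff:
  assumes "a \<in> obj C" "b \<in> obj C" "f \<in> hom C a b" "g \<in> hom C b a"
  shows "is_inverse C a b f g \<longleftrightarrow>
    mk C b g a \<bullet>\<^sub>t mk C a f b = tid C a \<and> mk C a f b \<bullet>\<^sub>t mk C b g a = tid C b"
  using assms by (simp add: is_inverse_def tcmp_mk tid_def) (simp add: mk_def id_in_hom)

lemma inverse_arrows:
  assumes "iso_mor C a b f" "a \<in> obj C" "b \<in> obj C"
  shows "f \<in> hom C a b" "inv_mor C a b f \<in> hom C b a"
    "mk C b (inv_mor C a b f) a \<bullet>\<^sub>t mk C a f b = tid C a"
    "mk C a f b \<bullet>\<^sub>t mk C b (inv_mor C a b f) a = tid C b"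
  using is_inverse_inv_mor[OF assms] assms(2,3) is_inverse_iff[of a b f]
  by (auto simp: is_inverse_def)

end

section \<open>Typed arrows of a tensor category and the coherence of units\<close>

definition ttns :: "('k, 'o, 'm, 'x) TensorCat_scheme \<Rightarrow> ('o, 'm) tarr \<Rightarrow> ('o, 'm) tarr \<Rightarrow> ('o, 'm) tarr"
    (infixr "\<boxtimes>\<^sub>t\<index>" 60) where
  "ttns C F G = (tdom F \<otimes>\<^bsub>C\<^esub> tdom G, if tAr C F \<and> tAr C G then Some (mor F \<star>\<^bsub>C\<^esub> mor G) else None,
     tcod F \<otimes>\<^bsub>C\<^esub> tcod G)"

context tensor_category
begin

declare tunit_obj [simp] tobj_obj [simp]

lemma Ar_ttns [simp]: "tAr C (F \<boxtimes>\<^sub>t G) \<longleftrightarrow> tAr C F \<and> tAr C G"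
  by (auto simp: ttns_def tmor_in_hom)

lemma ttns_sel [simp]:
  shows "tdom (F \<boxtimes>\<^sub>t G) = tdom F \<otimes> tdom G" "tcod (F \<boxtimes>\<^sub>t G) = tcod F \<otimes> tcod G"
    "\<lbrakk>tAr C F; tAr C G\<rbrakk> \<Longrightarrow> mor (F \<boxtimes>\<^sub>t G) = mor F \<star> mor G"
  by (simp_all add: ttns_def)

lemma tid_ttns [simp]: "\<lbrakk>a \<in> obj C; b \<in> obj C\<rbrakk> \<Longrightarrow> tid C a \<boxtimes>\<^sub>t tid C b = tid C (a \<otimes> b)"
  by (rule tarr_eqI[of C]) (simp_all add: tmor_id)

lemma ttns_cmp:
  "\<lbrakk>tAr C G; tAr C F; tdom G = tcod F; tAr C G'; tAr C F'; tdom G' = tcod F'\<rbrakk>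
    \<Longrightarrow> (G \<bullet>\<^sub>t F) \<boxtimes>\<^sub>t (G' \<bullet>\<^sub>t F') = (G \<boxtimes>\<^sub>t G') \<bullet>\<^sub>t (F \<boxtimes>\<^sub>t F')"
  using tmor_comp[of "tdom F" "tcod F" "tcod G" "tdom F'" "tcod F'" "tcod G'" "mor F" "mor G" "mor F'" "mor G'"]
    tAr_sel[of C F] tAr_sel[of C G] tAr_sel[of C F'] tAr_sel[of C G']
  by (intro tarr_eqI[of C]) simp_all

definition As where "As a b c = mk C ((a \<otimes> b) \<otimes> c) (assoc C a b c) (a \<otimes> (b \<otimes> c))"
definition Ai where "Ai a b c = mk C (a \<otimes> (b \<otimes> c)) (assoc_inv C a b c) ((a \<otimes> b) \<otimes> c)"
definition Lu where "Lu a = mk C (\<one> \<otimes> a) (lunit C a) a"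
definition Li where "Li a = mk C a (lunit_inv C a) (\<one> \<otimes> a)"
definition Ru where "Ru a = mk C (a \<otimes> \<one>) (runit C a) a"
definition Ri where "Ri a = mk C a (runit_inv C a) (a \<otimes> \<one>)"

lemma coherence_sel [simp]:
  "tdom (As a b c) = (a \<otimes> b) \<otimes> c" "tcod (As a b c) = a \<otimes> (b \<otimes> c)"
  "tdom (Ai a b c) = a \<otimes> (b \<otimes> c)" "tcod (Ai a b c) = (a \<otimes> b) \<otimes> c"
  "tdom (Lu a) = \<one> \<otimes> a" "tcod (Lu a) = a" "tdom (Li a) = a" "tcod (Li a) = \<one> \<otimes> a"
  "tdom (Ru a) = a \<otimes> \<one>" "tcod (Ru a) = a" "tdom (Ri a) = a" "tcod (Ri a) = a \<otimes> \<one>"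
  by (simp_all add: As_def Ai_def Lu_def Li_def Ru_def Ri_def)

lemma As_arrow [simp]:
  assumes "a \<in> obj C" "b \<in> obj C" "c \<in> obj C"
  shows "tAr C (As a b c)" "tAr C (Ai a b c)"
    "As a b c \<bullet>\<^sub>t Ai a b c = tid C (a \<otimes> (b \<otimes> c))" "Ai a b c \<bullet>\<^sub>t As a b c = tid C ((a \<otimes> b) \<otimes> c)"
  using inverse_arrows[OF assoc_iso[OF assms]] assms by (simp_all add: As_def Ai_def assoc_inv_def)

lemma Lu_arrow [simp]:
  assumes "a \<in> obj C"
  shows "tAr C (Lu a)" "tAr C (Li a)"
    "Lu a \<bullet>\<^sub>t Li a = tid C a" "Li a \<bullet>\<^sub>t Lu a = tid C (\<one> \<otimes> a)"
  using inverse_arrows[OF lunit_iso[OF assms]] assms by (simp_all add: Lu_def Li_def lunit_inv_def)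

lemma Ru_arrow [simp]:
  assumes "a \<in> obj C"
  shows "tAr C (Ru a)" "tAr C (Ri a)"
    "Ru a \<bullet>\<^sub>t Ri a = tid C a" "Ri a \<bullet>\<^sub>t Ru a = tid C (a \<otimes> \<one>)"
  using inverse_arrows[OF runit_iso[OF assms]] assms by (simp_all add: Ru_def Ri_def runit_inv_def)

lemma mor_As [simp]:
  "\<lbrakk>a \<in> obj C; b \<in> obj C; c \<in> obj C\<rbrakk> \<Longrightarrow> mor (As a b c) = assoc C a b c"
  "\<lbrakk>a \<in> obj C; b \<in> obj C; c \<in> obj C\<rbrakk> \<Longrightarrow> mor (Ai a b c) = assoc_inv C a b c"
  using As_arrow[of a b c] by (simp_all add: As_def Ai_def)

lemma mor_unitors [simp]:
  assumes "a \<in> obj C"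
  shows "mor (Lu a) = lunit C a" "mor (Li a) = lunit_inv C a"
    "mor (Ru a) = runit C a" "mor (Ri a) = runit_inv C a"
  using assms Lu_arrow[of a] Ru_arrow[of a] by (simp_all add: Lu_def Li_def Ru_def Ri_def)

lemma As_natural:
  "\<lbrakk>tAr C F; tAr C G; tAr C H\<rbrakk>
    \<Longrightarrow> As (tcod F) (tcod G) (tcod H) \<bullet>\<^sub>t ((F \<boxtimes>\<^sub>t G) \<boxtimes>\<^sub>t H)
      = (F \<boxtimes>\<^sub>t (G \<boxtimes>\<^sub>t H)) \<bullet>\<^sub>t As (tdom F) (tdom G) (tdom H)"
  by (rule tarr_eqI[of C]) (simp_all add: assoc_natural)

lemma Lu_natural: "tAr C F \<Longrightarrow> Lu (tcod F) \<bullet>\<^sub>t (tid C \<one> \<boxtimes>\<^sub>t F) = F \<bullet>\<^sub>t Lu (tdom F)"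
  by (rule tarr_eqI[of C]) (simp_all add: lunit_natural)

lemma Ru_natural: "tAr C F \<Longrightarrow> Ru (tcod F) \<bullet>\<^sub>t (F \<boxtimes>\<^sub>t tid C \<one>) = F \<bullet>\<^sub>t Ru (tdom F)"
  by (rule tarr_eqI[of C]) (simp_all add: runit_natural)

lemma t_pentagon:
  "\<lbrakk>a \<in> obj C; b \<in> obj C; c \<in> obj C; d \<in> obj C\<rbrakk>
    \<Longrightarrow> (tid C a \<boxtimes>\<^sub>t As b c d) \<bullet>\<^sub>t As a (b \<otimes> c) d \<bullet>\<^sub>t (As a b c \<boxtimes>\<^sub>t tid C d)
      = As a b (c \<otimes> d) \<bullet>\<^sub>t As (a \<otimes> b) c d"
  by (rule tarr_eqI[of C]) (simp_all add: pentagon)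

lemma t_triangle:
  "\<lbrakk>a \<in> obj C; b \<in> obj C\<rbrakk> \<Longrightarrow> (tid C a \<boxtimes>\<^sub>t Lu b) \<bullet>\<^sub>t As a \<one> b = Ru a \<boxtimes>\<^sub>t tid C b"
  by (rule tarr_eqI[of C]) (simp_all add: triangle)

text \<open>The interchange law oriented against \<open>ttns_cmp\<close>, with a second form for use
  inside a composite nested to the right; it collects neighbouring tensor products into one.\<close>

lemma tns_merge:
  "\<lbrakk>tAr C G; tAr C F; tdom G = tcod F; tAr C G'; tAr C F'; tdom G' = tcod F'\<rbrakk>
    \<Longrightarrow> (G \<boxtimes>\<^sub>t G') \<bullet>\<^sub>t (F \<boxtimes>\<^sub>t F') = (G \<bullet>\<^sub>t F) \<boxtimes>\<^sub>t (G' \<bullet>\<^sub>t F')"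
  "\<lbrakk>tAr C G; tAr C F; tdom G = tcod F; tAr C G'; tAr C F'; tdom G' = tcod F'\<rbrakk>
    \<Longrightarrow> (G \<boxtimes>\<^sub>t G') \<bullet>\<^sub>t (F \<boxtimes>\<^sub>t F') \<bullet>\<^sub>t K = ((G \<bullet>\<^sub>t F) \<boxtimes>\<^sub>t (G' \<bullet>\<^sub>t F')) \<bullet>\<^sub>t K"
  by (simp_all add: ttns_cmp flip: cmp_assoc)

text \<open>Naturality of the unitor turns \<open>F\<close> into
  \<open>tid C \<one> \<boxtimes>\<^sub>t F\<close> up to invertible factors. Equations may
  therefore be proved after adding a unit strand, where the triangle and the pentagon apply.\<close>

lemma unit_tns_inj:
  assumes "tid C \<one> \<boxtimes>\<^sub>t F = tid C \<one> \<boxtimes>\<^sub>t G" "tAr C F" "tAr C G" "tdom F = tdom G" "tcod F = tcod G"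
  shows "F = G"
proof (rule iso_epi)
  show "Lu (tdom F) \<bullet>\<^sub>t Li (tdom F) = tid C (tdom F)"
    using assms(2) by simp
  show "F \<bullet>\<^sub>t Lu (tdom F) = G \<bullet>\<^sub>t Lu (tdom F)"
    using Lu_natural[OF assms(2)] Lu_natural[OF assms(3)] assms(1,4,5) by metis
qed (use assms in auto)

lemma tns_unit_inj:
  assumes "F \<boxtimes>\<^sub>t tid C \<one> = G \<boxtimes>\<^sub>t tid C \<one>" "tAr C F" "tAr C G" "tdom F = tdom G" "tcod F = tcod G"
  shows "F = G"
proof (rule iso_epi)
  show "Ru (tdom F) \<bullet>\<^sub>t Ri (tdom F) = tid C (tdom F)"
    using assms(2) by simp
  show "F \<bullet>\<^sub>t Ru (tdom F) = G \<bullet>\<^sub>t Ru (tdom F)"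
    using Ru_natural[OF assms(2)] Ru_natural[OF assms(3)] assms(1,4,5) by metis
qed (use assms in auto)

lemma As_mono:
  assumes "As a b c \<bullet>\<^sub>t F = As a b c \<bullet>\<^sub>t G" "a \<in> obj C" "b \<in> obj C" "c \<in> obj C"
    "tAr C F" "tAr C G" "tcod F = (a \<otimes> b) \<otimes> c" "tcod G = (a \<otimes> b) \<otimes> c"
  shows "F = G"
  by (rule iso_mono[OF As_arrow(4) assms(1)]) (use assms in auto)

lemma As_epi:
  assumes "F \<bullet>\<^sub>t As a b c = G \<bullet>\<^sub>t As a b c" "a \<in> obj C" "b \<in> obj C" "c \<in> obj C"
    "tAr C F" "tAr C G" "tdom F = a \<otimes> b \<otimes> c" "tdom G = a \<otimes> b \<otimes> c"
  shows "F = G"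
  by (rule iso_epi[OF As_arrow(3) assms(1)]) (use assms in auto)

lemma As_Id_epi:
  assumes "F \<bullet>\<^sub>t (As a b c \<boxtimes>\<^sub>t tid C d) = G \<bullet>\<^sub>t (As a b c \<boxtimes>\<^sub>t tid C d)"
    "a \<in> obj C" "b \<in> obj C" "c \<in> obj C" "d \<in> obj C"
    "tAr C F" "tAr C G" "tdom F = (a \<otimes> b \<otimes> c) \<otimes> d" "tdom G = (a \<otimes> b \<otimes> c) \<otimes> d"
  shows "F = G"
proof (rule iso_epi[OF _ assms(1)])
  show "(As a b c \<boxtimes>\<^sub>t tid C d) \<bullet>\<^sub>t (Ai a b c \<boxtimes>\<^sub>t tid C d) = tid C ((a \<otimes> b \<otimes> c) \<otimes> d)"
    using assms by (simp add: tns_merge)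
qed (use assms in auto)

text \<open>Kelly's argument: after tensoring with the unit on the left and composing with
  associators, both sides appear in the pentagon for \<open>\<one>\<close>, \<open>\<one>\<close>,
  \<open>a\<close>, \<open>b\<close>, and the triangle rewrites the edges that contain
  unitors.\<close>

lemma Lu_tns:
  assumes [simp]: "a \<in> obj C" "b \<in> obj C"
  shows "Lu (a \<otimes> b) \<bullet>\<^sub>t As \<one> a b = Lu a \<boxtimes>\<^sub>t tid C b"
proof (rule unit_tns_inj, rule As_epi, rule As_Id_epi)
  let ?I = "tid C \<one>"
  have "((?I \<boxtimes>\<^sub>t (Lu (a \<otimes> b) \<bullet>\<^sub>t As \<one> a b)) \<bullet>\<^sub>t As \<one> (\<one> \<otimes> a) b) \<bullet>\<^sub>t (As \<one> \<one> a \<boxtimes>\<^sub>t tid C b)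
      = (?I \<boxtimes>\<^sub>t Lu (a \<otimes> b)) \<bullet>\<^sub>t (?I \<boxtimes>\<^sub>t As \<one> a b) \<bullet>\<^sub>t As \<one> (\<one> \<otimes> a) b \<bullet>\<^sub>t (As \<one> \<one> a \<boxtimes>\<^sub>t tid C b)"
    by (simp add: tns_merge cmp_assoc)
  also have "\<dots> = (Ru \<one> \<boxtimes>\<^sub>t tid C (a \<otimes> b)) \<bullet>\<^sub>t As (\<one> \<otimes> \<one>) a b"
    by (simp add: t_pentagon cmp_cancel[OF t_triangle])
  also have "\<dots> = As \<one> a b \<bullet>\<^sub>t ((Ru \<one> \<boxtimes>\<^sub>t tid C a) \<boxtimes>\<^sub>t tid C b)"
    using As_natural[of "Ru \<one>" "tid C a" "tid C b"] by simp
  also have "\<dots> = As \<one> a b \<bullet>\<^sub>t ((?I \<boxtimes>\<^sub>t Lu a) \<boxtimes>\<^sub>t tid C b) \<bullet>\<^sub>t (As \<one> \<one> a \<boxtimes>\<^sub>t tid C b)"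
    by (simp add: tns_merge t_triangle)
  also have "\<dots> = ((?I \<boxtimes>\<^sub>t (Lu a \<boxtimes>\<^sub>t tid C b)) \<bullet>\<^sub>t As \<one> (\<one> \<otimes> a) b) \<bullet>\<^sub>t (As \<one> \<one> a \<boxtimes>\<^sub>t tid C b)"
    by (simp add: cmp_cancel[OF As_natural[of ?I "Lu a" "tid C b", simplified]] cmp_assoc)
  finally show "((?I \<boxtimes>\<^sub>t (Lu (a \<otimes> b) \<bullet>\<^sub>t As \<one> a b)) \<bullet>\<^sub>t As \<one> (\<one> \<otimes> a) b) \<bullet>\<^sub>t (As \<one> \<one> a \<boxtimes>\<^sub>t tid C b)
    = ((?I \<boxtimes>\<^sub>t (Lu a \<boxtimes>\<^sub>t tid C b)) \<bullet>\<^sub>t As \<one> (\<one> \<otimes> a) b) \<bullet>\<^sub>t (As \<one> \<one> a \<boxtimes>\<^sub>t tid C b)" .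
qed simp_all

text \<open>The mirror image, from the pentagon for \<open>a\<close>, \<open>b\<close>,
  \<open>\<one>\<close>, \<open>\<one>\<close>.\<close>

lemma Ru_tns:
  assumes [simp]: "a \<in> obj C" "b \<in> obj C"
  shows "(tid C a \<boxtimes>\<^sub>t Ru b) \<bullet>\<^sub>t As a b \<one> = Ru (a \<otimes> b)"
proof (rule tns_unit_inj, rule As_mono[of a b \<one>])
  let ?I = "tid C \<one>"
  have "As a b \<one> \<bullet>\<^sub>t (Ru (a \<otimes> b) \<boxtimes>\<^sub>t ?I)
      = As a b \<one> \<bullet>\<^sub>t (tid C (a \<otimes> b) \<boxtimes>\<^sub>t Lu \<one>) \<bullet>\<^sub>t As (a \<otimes> b) \<one> \<one>"
    by (simp add: t_triangle)
  also have "\<dots> = (tid C a \<boxtimes>\<^sub>t (tid C b \<boxtimes>\<^sub>t Lu \<one>)) \<bullet>\<^sub>t As a b (\<one> \<otimes> \<one>) \<bullet>\<^sub>t As (a \<otimes> b) \<one> \<one>"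
    by (simp add: cmp_cancel[OF As_natural[of "tid C a" "tid C b" "Lu \<one>", simplified]] cmp_assoc)
  also have "\<dots> = (tid C a \<boxtimes>\<^sub>t (tid C b \<boxtimes>\<^sub>t Lu \<one>)) \<bullet>\<^sub>t (tid C a \<boxtimes>\<^sub>t As b \<one> \<one>)
      \<bullet>\<^sub>t As a (b \<otimes> \<one>) \<one> \<bullet>\<^sub>t (As a b \<one> \<boxtimes>\<^sub>t ?I)"
    by (simp add: t_pentagon)
  also have "\<dots> = (tid C a \<boxtimes>\<^sub>t (Ru b \<boxtimes>\<^sub>t ?I)) \<bullet>\<^sub>t As a (b \<otimes> \<one>) \<one> \<bullet>\<^sub>t (As a b \<one> \<boxtimes>\<^sub>t ?I)"
    by (simp add: tns_merge t_triangle)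
  also have "\<dots> = As a b \<one> \<bullet>\<^sub>t ((tid C a \<boxtimes>\<^sub>t Ru b) \<boxtimes>\<^sub>t ?I) \<bullet>\<^sub>t (As a b \<one> \<boxtimes>\<^sub>t ?I)"
    by (simp add: cmp_cancel[OF As_natural[of "tid C a" "Ru b" ?I, simplified]] cmp_assoc)
  finally show "As a b \<one> \<bullet>\<^sub>t (((tid C a \<boxtimes>\<^sub>t Ru b) \<bullet>\<^sub>t As a b \<one>) \<boxtimes>\<^sub>t ?I)
    = As a b \<one> \<bullet>\<^sub>t (Ru (a \<otimes> b) \<boxtimes>\<^sub>t ?I)"
    by (simp add: tns_merge)
qed simp_all

text \<open>Naturality of the left unitor with respect to itself identifies
  \<open>tid C \<one> \<boxtimes>\<^sub>t Lu \<one>\<close> with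
  \<open>Lu (\<one> \<otimes> \<one>)\<close>; then \<open>Lu_tns\<close> and the triangle express
  the same arrow through the left and through the right unitor.\<close>

lemma Lu_unit_eq_Ru_unit: "Lu \<one> = Ru \<one>"
proof (rule tns_unit_inj)
  have "tid C \<one> \<boxtimes>\<^sub>t Lu \<one> = Lu (\<one> \<otimes> \<one>)"
    using Lu_natural[of "Lu \<one>"] iso_mono[of "Li \<one>" "Lu \<one>" _ "tid C \<one> \<boxtimes>\<^sub>t Lu \<one>" "Lu (\<one> \<otimes> \<one>)"]
    by simp
  then show "Lu \<one> \<boxtimes>\<^sub>t tid C \<one> = Ru \<one> \<boxtimes>\<^sub>t tid C \<one>"
    using Lu_tns[of \<one> \<one>] t_triangle[of \<one> \<one>] by simp
qed simp_all

end

section \<open>Strictification\<close>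

context
  fixes C :: "('k, 'o, 'm, 'x) TensorCat_scheme" (structure)
begin

text \<open>The bracketing is to the right and always ends in the unit. Thus the one-letter word
  \<open>[x]\<close> stands for \<open>x \<otimes> \<one>\<close> and not for \<open>x\<close>, in
  exchange for a recursion without special cases.\<close>

primrec big :: "'o list \<Rightarrow> 'o" where
  "big [] = \<one>"
| "big (x # xs) = x \<otimes> big xs"

text \<open>Words form a category by taking over the morphisms between the bracketed products; it is
  this category that receives a strict tensor product.\<close>

definition lcat :: "('o list, 'm) Cat" where
  "lcat = \<lparr>obj = lists (obj C), hom = (\<lambda>xs ys. hom C (big xs) (big ys)),
     idm = (\<lambda>xs. idm C (big xs)), comp = comp C\<rparr>"

text \<open>\<open>und\<close> reads an arrow of words as an arrow between products, and
  \<open>lift\<close> goes back. An ill-typed arrow stays ill-typed under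
  \<open>und\<close>.\<close>

definition und :: "('o list, 'm) tarr \<Rightarrow> ('o, 'm) tarr" where
  "und F = (big (tdom F), if tAr lcat F then Some (mor F) else None, big (tcod F))"

definition lift :: "'o list \<Rightarrow> ('o, 'm) tarr \<Rightarrow> 'o list \<Rightarrow> ('o list, 'm) tarr" where
  "lift xs F ys = mk lcat xs (mor F) ys"

end

context tensor_category
begin

lemma big_obj [simp]: "set xs \<subseteq> obj C \<Longrightarrow> big C xs \<in> obj C"
  by (induction xs) auto

lemma lcat_sel [simp]: "obj (lcat C) = lists (obj C)" "hom (lcat C) xs ys = hom C (big C xs) (big C ys)"
  "idm (lcat C) xs = idm C (big C xs)" "comp (lcat C) = comp C"
  by (simp_all add: lcat_def)

sublocale LC: category "lcat C"
  by unfold_locales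
    (auto simp: lists_eq_set id_in_hom comp_id id_comp comp_assoc intro: comp_in_hom comp_assoc
      intro: comp_in_hom[OF big_obj big_obj big_obj] comp_id[OF big_obj big_obj] id_comp[OF big_obj big_obj]
       comp_assoc[OF big_obj big_obj big_obj big_obj])

lemma und_sel [simp]: "tdom (und C F) = big C (tdom F)" "tcod (und C F) = big C (tcod F)"
  by (simp_all add: und_def)

lemma lAr_sets [simp]:
  assumes "tAr (lcat C) F"
  shows "set (tdom F) \<subseteq> obj C" "set (tcod F) \<subseteq> obj C"
  using tAr_sel[OF assms] by (auto simp: lists_eq_set)

lemma und_arrow [simp]:
  assumes "tAr (lcat C) F"
  shows "tAr C (und C F)" "mor (und C F) = mor F"
  using tAr_sel[OF assms] assms by (simp_all add: und_def)

lemma und_inj: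
  "\<lbrakk>und C F = und C G; tAr (lcat C) F; tAr (lcat C) G; tdom F = tdom G; tcod F = tcod G\<rbrakk> \<Longrightarrow> F = G"
  by (rule tarr_eqI[of "lcat C"]) (auto simp flip: und_arrow(2))

lemma lift_sel [simp]: "tdom (lift C xs F ys) = xs" "tcod (lift C xs F ys) = ys"
  by (simp_all add: lift_def)

lemma lift_arrow [simp]:
  assumes "tAr C F" "tdom F = big C xs" "tcod F = big C ys" "set xs \<subseteq> obj C" "set ys \<subseteq> obj C"
  shows "tAr (lcat C) (lift C xs F ys)" "und C (lift C xs F ys) = F"
  using assms tAr_sel[of C F] by (auto simp: lift_def und_def lists_eq_set intro!: tarr_eqI[of C])

lemma und_cmp [simp]:
  assumes "tAr (lcat C) F" "tAr (lcat C) G" "tdom G = tcod F"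
  shows "und C (tcmp (lcat C) G F) = und C G \<bullet>\<^sub>t und C F"
  by (rule tarr_eqI[of C]) (use assms in simp_all)

lemma und_id [simp]: "set xs \<subseteq> obj C \<Longrightarrow> und C (tid (lcat C) xs) = tid C (big C xs)"
  by (rule tarr_eqI[of C]) (simp_all add: lists_eq_set)

text \<open>The canonical rebracketing of the product of two bracketed words into the bracketed
  product of the joined word; \<open>cci\<close> is its inverse, given by its own recursion.\<close>

primrec cc :: "'o list \<Rightarrow> 'o list \<Rightarrow> ('o, 'm) tarr" where
  "cc [] ys = Lu (big C ys)"
| "cc (x # xs) ys = (tid C x \<boxtimes>\<^sub>t cc xs ys) \<bullet>\<^sub>t As x (big C xs) (big C ys)"

primrec cci :: "'o list \<Rightarrow> 'o list \<Rightarrow> ('o, 'm) tarr" where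
  "cci [] ys = Li (big C ys)"
| "cci (x # xs) ys = Ai x (big C xs) (big C ys) \<bullet>\<^sub>t (tid C x \<boxtimes>\<^sub>t cci xs ys)"

lemma cc_arrow [simp]:
  assumes "set xs \<subseteq> obj C" "set ys \<subseteq> obj C"
  shows "tAr C (cc xs ys)" "tdom (cc xs ys) = big C xs \<otimes> big C ys" "tcod (cc xs ys) = big C (xs @ ys)"
    "tAr C (cci xs ys)" "tdom (cci xs ys) = big C (xs @ ys)" "tcod (cci xs ys) = big C xs \<otimes> big C ys"
  using assms by (induction xs) simp_all

lemma cc_inverse [simp]:
  assumes "set xs \<subseteq> obj C" "set ys \<subseteq> obj C"
  shows "cc xs ys \<bullet>\<^sub>t cci xs ys = tid C (big C (xs @ ys))"
    "cci xs ys \<bullet>\<^sub>t cc xs ys = tid C (big C xs \<otimes> big C ys)"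
  using assms
  by (induction xs)
    (simp_all add: cmp_assoc cmp_cancel[OF As_arrow(3)] cmp_cancel[OF As_arrow(4)] tns_merge)

text \<open>This is what makes the transported tensor product strictly associative. For the empty
  word it is the unit law \<open>Lu_tns\<close>, and adding a letter costs one pentagon surrounded
  by naturality of associators.\<close>

lemma cc_assoc:
  assumes "set xs \<subseteq> obj C" "set ys \<subseteq> obj C" "set zs \<subseteq> obj C"
  shows "cc (xs @ ys) zs \<bullet>\<^sub>t (cc xs ys \<boxtimes>\<^sub>t tid C (big C zs))
    = cc xs (ys @ zs) \<bullet>\<^sub>t (tid C (big C xs) \<boxtimes>\<^sub>t cc ys zs) \<bullet>\<^sub>t As (big C xs) (big C ys) (big C zs)"
  using assms(1)
proof (induction xs)
  case Nil
  have "cc ys zs \<bullet>\<^sub>t (Lu (big C ys) \<boxtimes>\<^sub>t tid C (big C zs))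
      = cc ys zs \<bullet>\<^sub>t Lu (big C ys \<otimes> big C zs) \<bullet>\<^sub>t As \<one> (big C ys) (big C zs)"
    using assms by (simp add: Lu_tns)
  also have "\<dots> = Lu (big C (ys @ zs)) \<bullet>\<^sub>t (tid C \<one> \<boxtimes>\<^sub>t cc ys zs) \<bullet>\<^sub>t As \<one> (big C ys) (big C zs)"
    using assms cmp_cancel[OF Lu_natural[of "cc ys zs"]] by (simp add: cmp_assoc)
  finally show ?case
    by simp
next
  case (Cons x xs)
  let ?x = "big C xs" and ?y = "big C ys" and ?z = "big C zs"
  have [simp]: "x \<in> obj C" "set xs \<subseteq> obj C" "set ys \<subseteq> obj C" "set zs \<subseteq> obj C"
    using Cons.prems assms by auto
  have "cc ((x # xs) @ ys) zs \<bullet>\<^sub>t (cc (x # xs) ys \<boxtimes>\<^sub>t tid C ?z)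
      = (tid C x \<boxtimes>\<^sub>t cc (xs @ ys) zs) \<bullet>\<^sub>t As x (big C (xs @ ys)) ?z
        \<bullet>\<^sub>t ((tid C x \<boxtimes>\<^sub>t cc xs ys) \<boxtimes>\<^sub>t tid C ?z) \<bullet>\<^sub>t (As x ?x ?y \<boxtimes>\<^sub>t tid C ?z)"
    by (simp add: cmp_assoc tns_merge)
  also have "\<dots> = (tid C x \<boxtimes>\<^sub>t cc (xs @ ys) zs) \<bullet>\<^sub>t (tid C x \<boxtimes>\<^sub>t (cc xs ys \<boxtimes>\<^sub>t tid C ?z))
      \<bullet>\<^sub>t As x (?x \<otimes> ?y) ?z \<bullet>\<^sub>t (As x ?x ?y \<boxtimes>\<^sub>t tid C ?z)"
    using cmp_cancel[OF As_natural[of "tid C x" "cc xs ys" "tid C ?z"]] by (simp add: cmp_assoc)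
  also have "\<dots> = (tid C x \<boxtimes>\<^sub>t cc xs (ys @ zs)) \<bullet>\<^sub>t (tid C x \<boxtimes>\<^sub>t (tid C ?x \<boxtimes>\<^sub>t cc ys zs))
      \<bullet>\<^sub>t (tid C x \<boxtimes>\<^sub>t As ?x ?y ?z) \<bullet>\<^sub>t As x (?x \<otimes> ?y) ?z \<bullet>\<^sub>t (As x ?x ?y \<boxtimes>\<^sub>t tid C ?z)"
    using Cons by (simp add: tns_merge)
  also have "\<dots> = (tid C x \<boxtimes>\<^sub>t cc xs (ys @ zs)) \<bullet>\<^sub>t (tid C x \<boxtimes>\<^sub>t (tid C ?x \<boxtimes>\<^sub>t cc ys zs))
      \<bullet>\<^sub>t As x ?x (?y \<otimes> ?z) \<bullet>\<^sub>t As (x \<otimes> ?x) ?y ?z"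
    by (simp add: t_pentagon)
  also have "\<dots> = (tid C x \<boxtimes>\<^sub>t cc xs (ys @ zs)) \<bullet>\<^sub>t As x ?x (big C (ys @ zs))
      \<bullet>\<^sub>t (tid C (x \<otimes> ?x) \<boxtimes>\<^sub>t cc ys zs) \<bullet>\<^sub>t As (x \<otimes> ?x) ?y ?z"
    using cmp_cancel[OF As_natural[of "tid C x" "tid C ?x" "cc ys zs"]] by (simp add: cmp_assoc)
  finally show ?case
    by (simp add: cmp_assoc)
qed

text \<open>Needed for the empty word to be a strict unit on the right; the base case is the
  agreement of the two unitors at the unit object.\<close>

lemma cc_Nil: "set xs \<subseteq> obj C \<Longrightarrow> cc xs [] = Ru (big C xs)"
proof (induction xs)
  case Nil
  then show ?case
    by (simp add: Lu_unit_eq_Ru_unit)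
next
  case (Cons x xs)
  then show ?case
    using Ru_tns[of x "big C xs"] by simp
qed

lemma cc_single: "\<lbrakk>x \<in> obj C; set ys \<subseteq> obj C\<rbrakk> \<Longrightarrow> cc [x] ys = Ru x \<boxtimes>\<^sub>t tid C (big C ys)"
  by (simp add: t_triangle)

text \<open>The tensor product of \<open>C\<close> conjugated by the rebracketing isomorphisms, so
  that it lives between concatenated words.\<close>

definition ltns (infixr "\<boxtimes>\<^sub>l" 60) where
  "F \<boxtimes>\<^sub>l G = (tdom F @ tdom G,
     if tAr (lcat C) F \<and> tAr (lcat C) G
     then Some (mor (cc (tcod F) (tcod G) \<bullet>\<^sub>t (und C F \<boxtimes>\<^sub>t und C G) \<bullet>\<^sub>t cci (tdom F) (tdom G))) else None,
     tcod F @ tcod G)"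

lemma ltns_sel [simp]: "tdom (F \<boxtimes>\<^sub>l G) = tdom F @ tdom G" "tcod (F \<boxtimes>\<^sub>l G) = tcod F @ tcod G"
  by (simp_all add: ltns_def)

lemma ltns_lift:
  "\<lbrakk>tAr (lcat C) F; tAr (lcat C) G\<rbrakk> \<Longrightarrow> F \<boxtimes>\<^sub>l G = lift C (tdom F @ tdom G)
    (cc (tcod F) (tcod G) \<bullet>\<^sub>t (und C F \<boxtimes>\<^sub>t und C G) \<bullet>\<^sub>t cci (tdom F) (tdom G)) (tcod F @ tcod G)"
  using tAr_sel(3)[of C "cc (tcod F) (tcod G) \<bullet>\<^sub>t (und C F \<boxtimes>\<^sub>t und C G) \<bullet>\<^sub>t cci (tdom F) (tdom G)"]
  by (simp add: ltns_def lift_def mk_def lists_eq_set)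

lemma ltns_Ar [simp]: "tAr (lcat C) (F \<boxtimes>\<^sub>l G) \<longleftrightarrow> tAr (lcat C) F \<and> tAr (lcat C) G"
proof
  show "tAr (lcat C) F \<and> tAr (lcat C) G \<Longrightarrow> tAr (lcat C) (F \<boxtimes>\<^sub>l G)"
    by (simp add: ltns_lift)
qed (auto simp: ltns_def split: if_splits)

lemma und_ltns [simp]:
  "\<lbrakk>tAr (lcat C) F; tAr (lcat C) G\<rbrakk>
    \<Longrightarrow> und C (F \<boxtimes>\<^sub>l G) = cc (tcod F) (tcod G) \<bullet>\<^sub>t (und C F \<boxtimes>\<^sub>t und C G) \<bullet>\<^sub>t cci (tdom F) (tdom G)"
  by (simp add: ltns_lift)

text \<open>Precomposed with the rebracketing of the three sources, both sides become the threefold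
  tensor product followed by the rebracketing of the three targets, by \<open>cc_assoc\<close> at
  both ends and naturality of the associator in between. Ill-typed arguments give the middle
  component \<open>None\<close> on both sides.\<close>

lemma ltns_assoc: "(F \<boxtimes>\<^sub>l G) \<boxtimes>\<^sub>l H = F \<boxtimes>\<^sub>l G \<boxtimes>\<^sub>l H"
proof (cases "tAr (lcat C) F \<and> tAr (lcat C) G \<and> tAr (lcat C) H")
  case True
  then have [simp]: "tAr (lcat C) F" "tAr (lcat C) G" "tAr (lcat C) H"
    by auto
  let ?c = "\<lambda>d. cc (d F @ d G) (d H) \<bullet>\<^sub>t (cc (d F) (d G) \<boxtimes>\<^sub>t tid C (big C (d H)))"
  let ?F = "und C F" and ?G = "und C G" and ?H = "und C H"
  show ?thesis
  proof (rule und_inj)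
    have *: "und C ((F \<boxtimes>\<^sub>l G) \<boxtimes>\<^sub>l H) \<bullet>\<^sub>t ?c tdom = ?c tcod \<bullet>\<^sub>t ((?F \<boxtimes>\<^sub>t ?G) \<boxtimes>\<^sub>t ?H)"
      by (simp add: cmp_assoc cmp_cancel[OF cc_inverse(2)] tns_merge)
    have "und C (F \<boxtimes>\<^sub>l G \<boxtimes>\<^sub>l H) \<bullet>\<^sub>t ?c tdom
      = cc (tcod F) (tcod G @ tcod H) \<bullet>\<^sub>t (?F \<boxtimes>\<^sub>t (cc (tcod G) (tcod H) \<bullet>\<^sub>t (?G \<boxtimes>\<^sub>t ?H)))
        \<bullet>\<^sub>t As (big C (tdom F)) (big C (tdom G)) (big C (tdom H))"
      by (simp add: cc_assoc cmp_assoc cmp_cancel[OF cc_inverse(2)] tns_merge)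
    also have "\<dots> = cc (tcod F) (tcod G @ tcod H) \<bullet>\<^sub>t (tid C (big C (tcod F)) \<boxtimes>\<^sub>t cc (tcod G) (tcod H))
        \<bullet>\<^sub>t (?F \<boxtimes>\<^sub>t (?G \<boxtimes>\<^sub>t ?H)) \<bullet>\<^sub>t As (big C (tdom F)) (big C (tdom G)) (big C (tdom H))"
      by (simp add: tns_merge)
    also have "\<dots> = ?c tcod \<bullet>\<^sub>t ((?F \<boxtimes>\<^sub>t ?G) \<boxtimes>\<^sub>t ?H)"
      using As_natural[of ?F ?G ?H] by (simp add: cc_assoc cmp_assoc)
    finally have **: "und C ((F \<boxtimes>\<^sub>l G) \<boxtimes>\<^sub>l H) \<bullet>\<^sub>t ?c tdom = und C (F \<boxtimes>\<^sub>l G \<boxtimes>\<^sub>l H) \<bullet>\<^sub>t ?c tdom"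
      using * by simp
    have "?c tdom \<bullet>\<^sub>t (cci (tdom F) (tdom G) \<boxtimes>\<^sub>t tid C (big C (tdom H))) \<bullet>\<^sub>t cci (tdom F @ tdom G) (tdom H)
        = tid C (big C (tdom F @ tdom G @ tdom H))"
      by (simp add: cmp_assoc tns_merge)
    from this ** show "und C ((F \<boxtimes>\<^sub>l G) \<boxtimes>\<^sub>l H) = und C (F \<boxtimes>\<^sub>l G \<boxtimes>\<^sub>l H)"
      by (rule iso_epi) simp_all
  qed simp_all
next
  case False
  then have *: "\<not> (tAr (lcat C) (F \<boxtimes>\<^sub>l G) \<and> tAr (lcat C) H)" "\<not> (tAr (lcat C) F \<and> tAr (lcat C) (G \<boxtimes>\<^sub>l H))"
    by auto
  show ?thesis
    unfolding ltns_def[of "F \<boxtimes>\<^sub>l G" H] ltns_def[of F "G \<boxtimes>\<^sub>l H"] if_not_P[OF *(1)] if_not_P[OF *(2)]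
    by simp
qed

text \<open>Mac Lane's strictification. For well-typed arrows every axiom is an equation between
  arrows of \<open>C\<close>, in which neighbouring rebracketings cancel.\<close>

sublocale S: strict_monoidal "obj C" "tAr (lcat C)" tdom tcod "tcmp (lcat C)" "tid (lcat C)" ltns
proof
  show "(f \<boxtimes>\<^sub>l g) \<boxtimes>\<^sub>l h = f \<boxtimes>\<^sub>l g \<boxtimes>\<^sub>l h" for f g h
    by (rule ltns_assoc)
  show "tid (lcat C) xs \<boxtimes>\<^sub>l tid (lcat C) ys = tid (lcat C) (xs @ ys)" for xs ys
  proof (cases "set xs \<subseteq> obj C \<and> set ys \<subseteq> obj C")
    case True
    then show ?thesis
      by (intro und_inj) (simp_all add: lists_eq_set)
  next
    case False
    then have *: "\<not> (tAr (lcat C) (tid (lcat C) xs) \<and> tAr (lcat C) (tid (lcat C) ys))"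
      and "\<not> xs @ ys \<in> lists (obj C)"
      by (auto simp: lists_eq_set)
    then show ?thesis
      unfolding ltns_def if_not_P[OF *] by (auto simp: tid_def mk_def)
  qed
  show "(tcmp (lcat C) g f) \<boxtimes>\<^sub>l (tcmp (lcat C) g' f') = tcmp (lcat C) (g \<boxtimes>\<^sub>l g') (f \<boxtimes>\<^sub>l f')"
    if "tAr (lcat C) (tcmp (lcat C) g f)" "tAr (lcat C) (tcmp (lcat C) g' f')" for f g f' g'
    by (intro und_inj) (use that in \<open>simp_all add: cmp_assoc cmp_cancel[OF cc_inverse(2)] tns_merge\<close>)
  show "tid (lcat C) [] \<boxtimes>\<^sub>l f = f" if [simp]: "tAr (lcat C) f" for f
  proof (rule und_inj)
    have "Lu (tcod (und C f)) \<bullet>\<^sub>t (tid C \<one> \<boxtimes>\<^sub>t und C f) \<bullet>\<^sub>t Li (tdom (und C f)) = und C f"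
      using cmp_cancel[OF Lu_natural[of "und C f"]] by (simp add: cmp_assoc)
    then show "und C (tid (lcat C) [] \<boxtimes>\<^sub>l f) = und C f"
      by (simp add: lists_eq_set)
  qed (simp_all add: lists_eq_set)
  show "f \<boxtimes>\<^sub>l tid (lcat C) [] = f" if [simp]: "tAr (lcat C) f" for f
  proof (rule und_inj)
    have "cci (tdom f) [] = Ri (big C (tdom f))"
      by (rule iso_mono[of "cci (tdom f) []" "cc (tdom f) []"]) (simp_all, simp add: cc_Nil)
    moreover have "Ru (tcod (und C f)) \<bullet>\<^sub>t (und C f \<boxtimes>\<^sub>t tid C \<one>) \<bullet>\<^sub>t Ri (tdom (und C f)) = und C f"
      using cmp_cancel[OF Ru_natural[of "und C f"]] by (simp add: cmp_assoc)
    ultimately show "und C (f \<boxtimes>\<^sub>l tid (lcat C) []) = und C f"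
      by (simp add: lists_eq_set cc_Nil)
  qed (simp_all add: lists_eq_set)
qed (simp_all add: LC.cmp_assoc lists_eq_set)

end

section \<open>Strong functors to strict monoidal categories\<close>

text \<open>Every object of \<open>C\<close> becomes a single letter, so a product
  \<open>a \<otimes> b\<close> is one letter while \<open>[fo a, fo b]\<close> is a word of two;
  \<open>mu\<close> merges and \<open>mu'\<close> splits, and \<open>nu\<close>, \<open>nu'\<close>
  create and remove the letter of the unit. The axioms are those of a strong monoidal functor with
  the associators and unitors of the strict target erased.\<close>

locale strong_functor = C: tensor_category C + strict_monoidal ob Ar Dom Cod Cmp Id Tns
  for C :: "('k::field, 'o, 'm, 'x) TensorCat_scheme" (structure)
    and ob :: "'a set"
    and Ar :: "'s \<Rightarrow> bool"
    and Dom Cod :: "'s \<Rightarrow> 'a list"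
    and Cmp :: "'s \<Rightarrow> 's \<Rightarrow> 's" (infixr "\<bullet>" 55)
    and Id :: "'a list \<Rightarrow> 's"
    and Tns :: "'s \<Rightarrow> 's \<Rightarrow> 's" (infixr "\<boxtimes>" 60) +
  fixes fo :: "'o \<Rightarrow> 'a"
    and fm :: "('o, 'm) tarr \<Rightarrow> 's"
    and mu mu' :: "'o \<Rightarrow> 'o \<Rightarrow> 's"
    and nu nu' :: 's
  assumes fo_ob [simp]: "a \<in> obj C \<Longrightarrow> fo a \<in> ob"
    and fm_arrow [simp]: "tAr C F \<Longrightarrow> Ar (fm F)" "tAr C F \<Longrightarrow> Dom (fm F) = [fo (tdom F)]"
      "tAr C F \<Longrightarrow> Cod (fm F) = [fo (tcod F)]"
    and fm_id: "a \<in> obj C \<Longrightarrow> fm (tid C a) = Id [fo a]"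
    and fm_cmp: "\<lbrakk>tAr C G; tAr C F; tdom G = tcod F\<rbrakk> \<Longrightarrow> fm (G \<bullet>\<^sub>t F) = fm G \<bullet> fm F"
    and mu_arrow [simp]: "\<lbrakk>a \<in> obj C; b \<in> obj C\<rbrakk> \<Longrightarrow> Ar (mu a b)"
      "\<lbrakk>a \<in> obj C; b \<in> obj C\<rbrakk> \<Longrightarrow> Dom (mu a b) = [fo a, fo b]"
      "\<lbrakk>a \<in> obj C; b \<in> obj C\<rbrakk> \<Longrightarrow> Cod (mu a b) = [fo (a \<otimes> b)]"
    and mu'_arrow [simp]: "\<lbrakk>a \<in> obj C; b \<in> obj C\<rbrakk> \<Longrightarrow> Ar (mu' a b)"
      "\<lbrakk>a \<in> obj C; b \<in> obj C\<rbrakk> \<Longrightarrow> Dom (mu' a b) = [fo (a \<otimes> b)]"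
      "\<lbrakk>a \<in> obj C; b \<in> obj C\<rbrakk> \<Longrightarrow> Cod (mu' a b) = [fo a, fo b]"
    and mu_mu': "\<lbrakk>a \<in> obj C; b \<in> obj C\<rbrakk> \<Longrightarrow> mu a b \<bullet> mu' a b = Id [fo (a \<otimes> b)]"
    and mu'_mu: "\<lbrakk>a \<in> obj C; b \<in> obj C\<rbrakk> \<Longrightarrow> mu' a b \<bullet> mu a b = Id [fo a, fo b]"
    and nu_arrow [simp]: "Ar nu" "Dom nu = []" "Cod nu = [fo \<one>]"
    and nu'_arrow [simp]: "Ar nu'" "Dom nu' = [fo \<one>]" "Cod nu' = []"
    and nu_nu': "nu \<bullet> nu' = Id [fo \<one>]"
    and nu'_nu: "nu' \<bullet> nu = Id []"
    and fm_tns0: "\<lbrakk>tAr C F; tAr C G\<rbrakk>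
      \<Longrightarrow> fm (F \<boxtimes>\<^sub>t G) \<bullet> mu (tdom F) (tdom G) = mu (tcod F) (tcod G) \<bullet> (fm F \<boxtimes> fm G)"
    and fm_As0: "\<lbrakk>a \<in> obj C; b \<in> obj C; c \<in> obj C\<rbrakk>
      \<Longrightarrow> fm (C.As a b c) \<bullet> mu (a \<otimes> b) c \<bullet> (mu a b \<boxtimes> Id [fo c]) = mu a (b \<otimes> c) \<bullet> (Id [fo a] \<boxtimes> mu b c)"
    and fm_Lu0: "a \<in> obj C \<Longrightarrow> fm (C.Lu a) \<bullet> mu \<one> a \<bullet> (nu \<boxtimes> Id [fo a]) = Id [fo a]"
    and fm_Ru0: "a \<in> obj C \<Longrightarrow> fm (C.Ru a) \<bullet> mu a \<one> \<bullet> (Id [fo a] \<boxtimes> nu) = Id [fo a]"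
begin

text \<open>Every generator is kept inside an \<open>L\<close>, also when it is not whiskered at all, so that the
  rewrite rules for diagrams need only one form.\<close>

lemma L_iso:
  assumes "f \<bullet> g = Id zs" "Ar f" "Ar g" "Dom f = Cod g" "set xs \<subseteq> ob" "set ys \<subseteq> ob"
  shows "L xs f ys \<bullet> L xs g ys = Id (xs @ zs @ ys)"
    "L xs f ys \<bullet> L xs g ys \<bullet> k = Id (xs @ zs @ ys) \<bullet> k"
proof -
  show *: "L xs f ys \<bullet> L xs g ys = Id (xs @ zs @ ys)"
  proof -
    have "L xs f ys \<bullet> L xs g ys = L xs (f \<bullet> g) ys"
      by (rule L_cmp[symmetric]) (simp_all only: Ar_cmp assms(2-6))
    then show ?thesis
      by (simp only: assms(1) L_Id)
  qed
  show "L xs f ys \<bullet> L xs g ys \<bullet> k = Id (xs @ zs @ ys) \<bullet> k"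
    by (rule cmp_cancel[OF *])
qed

lemma mu_cancel [simp]:
  assumes "a \<in> obj C" "b \<in> obj C" "set xs \<subseteq> ob" "set ys \<subseteq> ob"
  shows "L xs (mu a b) ys \<bullet> L xs (mu' a b) ys = Id (xs @ fo (a \<otimes> b) # ys)"
    "L xs (mu a b) ys \<bullet> L xs (mu' a b) ys \<bullet> k = Id (xs @ fo (a \<otimes> b) # ys) \<bullet> k"
    "L xs (mu' a b) ys \<bullet> L xs (mu a b) ys = Id (xs @ fo a # fo b # ys)"
    "L xs (mu' a b) ys \<bullet> L xs (mu a b) ys \<bullet> k = Id (xs @ fo a # fo b # ys) \<bullet> k"
  using assms L_iso[OF mu_mu'] L_iso[OF mu'_mu] by simp_all

lemma nu_cancel [simp]:
  assumes "set xs \<subseteq> ob" "set ys \<subseteq> ob"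
  shows "L xs nu ys \<bullet> L xs nu' ys = Id (xs @ fo \<one> # ys)"
    "L xs nu ys \<bullet> L xs nu' ys \<bullet> k = Id (xs @ fo \<one> # ys) \<bullet> k"
    "L xs nu' ys \<bullet> L xs nu ys = Id (xs @ ys)"
    "L xs nu' ys \<bullet> L xs nu ys \<bullet> k = Id (xs @ ys) \<bullet> k"
  using assms L_iso[OF nu_nu'] L_iso[OF nu'_nu] by simp_all

lemma fm_iso:
  assumes "F \<bullet>\<^sub>t G = tid C a" "tAr C F" "tAr C G" "tdom F = tcod G" "a \<in> obj C"
  shows "fm F \<bullet> fm G = Id [fo a]"
  using assms fm_cmp[of F G] fm_id by simp

lemma L_fm_cmp [simp]:
  "\<lbrakk>tAr C G; tAr C F; tdom G = tcod F; set xs \<subseteq> ob; set ys \<subseteq> ob\<rbrakk>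
    \<Longrightarrow> L xs (fm (G \<bullet>\<^sub>t F)) ys = L xs (fm G) ys \<bullet> L xs (fm F) ys"
  by (simp add: fm_cmp L_cmp)

lemma L_fm_id [simp]: "a \<in> obj C \<Longrightarrow> L xs (fm (tid C a)) ys = Id (xs @ fo a # ys)"
  by (simp add: fm_id)

text \<open>Together with the rules for associators and unitors below, this pushes \<open>fm\<close>
  down to atomic arrows: each bracketed arrow becomes merges, slices and splits, and adjacent merges
  and splits cancel.\<close>

lemma fm_tns:
  assumes "tAr C F" "tAr C G"
  shows "fm (F \<boxtimes>\<^sub>t G) = L [] (mu (tcod F) (tcod G)) [] \<bullet> L [] (fm F) [fo (tcod G)]
    \<bullet> L [fo (tdom F)] (fm G) [] \<bullet> L [] (mu' (tdom F) (tdom G)) []"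
proof -
  have "fm (F \<boxtimes>\<^sub>t G) = (fm (F \<boxtimes>\<^sub>t G) \<bullet> mu (tdom F) (tdom G)) \<bullet> mu' (tdom F) (tdom G)"
    using assms by (simp add: cmp_assoc mu_mu')
  then show ?thesis
    using assms by (simp add: fm_tns0 tns_L cmp_assoc L_Nil)
qed

lemma L_fm_tns:
  assumes "tAr C F" "tAr C G" "set xs \<subseteq> ob" "set ys \<subseteq> ob"
  shows "L xs (fm (F \<boxtimes>\<^sub>t G)) ys = L xs (mu (tcod F) (tcod G)) ys \<bullet> L xs (fm F) (fo (tcod G) # ys)
    \<bullet> L (xs @ [fo (tdom F)]) (fm G) ys \<bullet> L xs (mu' (tdom F) (tdom G)) ys"
  using assms by (simp add: fm_tns L_cmp)

text \<open>In a strict target an associator is nothing but splitting and merging letters in another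
  order.\<close>

lemma fm_As:
  assumes [simp]: "a \<in> obj C" "b \<in> obj C" "c \<in> obj C"
  shows "fm (C.As a b c) = L [] (mu a (b \<otimes> c)) [] \<bullet> L [fo a] (mu b c) []
    \<bullet> L [] (mu' a b) [fo c] \<bullet> L [] (mu' (a \<otimes> b) c) []"
proof -
  have "fm (C.As a b c) = (fm (C.As a b c) \<bullet> mu (a \<otimes> b) c \<bullet> (mu a b \<boxtimes> Id [fo c]))
      \<bullet> L [] (mu' a b) [fo c] \<bullet> L [] (mu' (a \<otimes> b) c) []"
    by (simp add: cmp_assoc tns_Id)
      (simp add: L_Nil mu_mu')
  then show ?thesis
    unfolding fm_As0[OF assms] by (simp add: cmp_assoc Id_tns L_Nil)
qed

lemma fm_Ai:
  assumes [simp]: "a \<in> obj C" "b \<in> obj C" "c \<in> obj C"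
  shows "fm (C.Ai a b c) = L [] (mu (a \<otimes> b) c) [] \<bullet> L [] (mu a b) [fo c]
    \<bullet> L [fo a] (mu' b c) [] \<bullet> L [] (mu' a (b \<otimes> c)) []"
proof (rule iso_mono)
  show "fm (C.Ai a b c) \<bullet> fm (C.As a b c) = Id [fo ((a \<otimes> b) \<otimes> c)]"
    by (rule fm_iso) simp_all
  show "fm (C.As a b c) \<bullet> fm (C.Ai a b c) = fm (C.As a b c) \<bullet> L [] (mu (a \<otimes> b) c) [] \<bullet> L [] (mu a b) [fo c]
    \<bullet> L [fo a] (mu' b c) [] \<bullet> L [] (mu' a (b \<otimes> c)) []"
    using fm_iso[of "C.As a b c" "C.Ai a b c"] by (simp add: fm_As cmp_assoc)
qed simp_all

lemma L_fm_As:
  assumes "a \<in> obj C" "b \<in> obj C" "c \<in> obj C" "set xs \<subseteq> ob" "set ys \<subseteq> ob"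
  shows "L xs (fm (C.As a b c)) ys = L xs (mu a (b \<otimes> c)) ys \<bullet> L (xs @ [fo a]) (mu b c) ys
    \<bullet> L xs (mu' a b) (fo c # ys) \<bullet> L xs (mu' (a \<otimes> b) c) ys"
  "L xs (fm (C.Ai a b c)) ys = L xs (mu (a \<otimes> b) c) ys \<bullet> L xs (mu a b) (fo c # ys)
    \<bullet> L (xs @ [fo a]) (mu' b c) ys \<bullet> L xs (mu' a (b \<otimes> c)) ys"
  using assms by (simp_all add: fm_As fm_Ai L_cmp)

lemma fm_Lu:
  assumes [simp]: "a \<in> obj C"
  shows "fm (C.Lu a) = L [] nu' [fo a] \<bullet> L [] (mu' \<one> a) []"
proof -
  have "fm (C.Lu a) = (fm (C.Lu a) \<bullet> mu \<one> a \<bullet> (nu \<boxtimes> Id [fo a])) \<bullet> L [] nu' [fo a] \<bullet> L [] (mu' \<one> a) []"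
    by (simp add: cmp_assoc tns_Id) (simp add: L_Nil mu_mu')
  then show ?thesis
    by (simp add: fm_Lu0)
qed

lemma fm_Li:
  assumes [simp]: "a \<in> obj C"
  shows "fm (C.Li a) = L [] (mu \<one> a) [] \<bullet> L [] nu [fo a]"
proof (rule iso_mono)
  show "fm (C.Li a) \<bullet> fm (C.Lu a) = Id [fo (\<one> \<otimes> a)]"
    by (rule fm_iso) simp_all
  show "fm (C.Lu a) \<bullet> fm (C.Li a) = fm (C.Lu a) \<bullet> L [] (mu \<one> a) [] \<bullet> L [] nu [fo a]"
    using fm_iso[of "C.Lu a" "C.Li a"] by (simp add: fm_Lu cmp_assoc)
qed simp_all

lemma fm_Ru:
  assumes [simp]: "a \<in> obj C"
  shows "fm (C.Ru a) = L [fo a] nu' [] \<bullet> L [] (mu' a \<one>) []"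
proof -
  have "fm (C.Ru a) = (fm (C.Ru a) \<bullet> mu a \<one> \<bullet> (Id [fo a] \<boxtimes> nu)) \<bullet> L [fo a] nu' [] \<bullet> L [] (mu' a \<one>) []"
    by (simp add: cmp_assoc Id_tns) (simp add: L_Nil mu_mu')
  then show ?thesis
    by (simp add: fm_Ru0)
qed

lemma fm_Ri:
  assumes [simp]: "a \<in> obj C"
  shows "fm (C.Ri a) = L [] (mu a \<one>) [] \<bullet> L [fo a] nu []"
proof (rule iso_mono)
  show "fm (C.Ri a) \<bullet> fm (C.Ru a) = Id [fo (a \<otimes> \<one>)]"
    by (rule fm_iso) simp_all
  show "fm (C.Ru a) \<bullet> fm (C.Ri a) = fm (C.Ru a) \<bullet> L [] (mu a \<one>) [] \<bullet> L [fo a] nu []"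
    using fm_iso[of "C.Ru a" "C.Ri a"] by (simp add: fm_Ru cmp_assoc)
qed simp_all

lemma L_fm_unitors:
  assumes "a \<in> obj C" "set xs \<subseteq> ob" "set ys \<subseteq> ob"
  shows "L xs (fm (C.Lu a)) ys = L xs nu' (fo a # ys) \<bullet> L xs (mu' \<one> a) ys"
    "L xs (fm (C.Li a)) ys = L xs (mu \<one> a) ys \<bullet> L xs nu (fo a # ys)"
    "L xs (fm (C.Ru a)) ys = L (xs @ [fo a]) nu' ys \<bullet> L xs (mu' a \<one>) ys"
    "L xs (fm (C.Ri a)) ys = L xs (mu a \<one>) ys \<bullet> L (xs @ [fo a]) nu ys"
  using assms by (simp_all add: fm_Lu fm_Li fm_Ru fm_Ri L_cmp)

lemmas L_fm = L_fm_tns L_fm_As L_fm_unitors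

end

section \<open>The embedding of a tensor category into its strictification\<close>

context tensor_category
begin

text \<open>An arrow between the products attached to one-letter words has to carry along the unit
  that ends these products.\<close>

definition str :: "('o, 'm) tarr \<Rightarrow> ('o list, 'm) tarr" where
  "str F = lift C [tdom F] (F \<boxtimes>\<^sub>t tid C \<one>) [tcod F]"

lemma str_arrow [simp]:
  assumes "tAr C F"
  shows "tAr (lcat C) (str F)" "tdom (str F) = [tdom F]" "tcod (str F) = [tcod F]"
    "und C (str F) = F \<boxtimes>\<^sub>t tid C \<one>"
  using assms by (simp_all add: str_def)

lemma cci_single: "\<lbrakk>x \<in> obj C; set ys \<subseteq> obj C\<rbrakk> \<Longrightarrow> cci [x] ys = Ri x \<boxtimes>\<^sub>t tid C (big C ys)"
  by (rule iso_mono[of "cci [x] ys" "cc [x] ys" "(x \<otimes> \<one>) \<otimes> big C ys"])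
    (simp_all only: cc_inverse set_simps insert_subset empty_subsetI simp_thms,
      simp_all add: cc_single tns_merge del: cc.simps cci.simps)

lemma Ai_natural:
  assumes [simp]: "tAr C F" "tAr C G" "tAr C H"
  shows "((F \<boxtimes>\<^sub>t G) \<boxtimes>\<^sub>t H) \<bullet>\<^sub>t Ai (tdom F) (tdom G) (tdom H)
      = Ai (tcod F) (tcod G) (tcod H) \<bullet>\<^sub>t (F \<boxtimes>\<^sub>t (G \<boxtimes>\<^sub>t H))"
proof -
  have "((F \<boxtimes>\<^sub>t G) \<boxtimes>\<^sub>t H) \<bullet>\<^sub>t Ai (tdom F) (tdom G) (tdom H)
    = Ai (tcod F) (tcod G) (tcod H) \<bullet>\<^sub>t (As (tcod F) (tcod G) (tcod H)
      \<bullet>\<^sub>t ((F \<boxtimes>\<^sub>t G) \<boxtimes>\<^sub>t H)) \<bullet>\<^sub>t Ai (tdom F) (tdom G) (tdom H)"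
    by (simp add: cmp_assoc cmp_cancel[OF As_arrow(4)])
  then show ?thesis
    unfolding As_natural[OF assms] by (simp add: cmp_assoc)
qed

text \<open>The right unitor hidden in \<open>cc [x] ys\<close> removes the unit added by
  \<open>str\<close>.\<close>

lemma und_str_tns:
  assumes [simp]: "tAr C F" "tAr (lcat C) G"
  shows "und C (str F \<boxtimes>\<^sub>l G) = F \<boxtimes>\<^sub>t und C G"
proof -
  have "Ru (tcod F) \<bullet>\<^sub>t (F \<boxtimes>\<^sub>t tid C \<one>) \<bullet>\<^sub>t Ri (tdom F) = F"
    using cmp_cancel[OF Ru_natural[of F]] by (simp add: cmp_assoc)
  then show ?thesis
    by (simp add: cc_single cci_single tns_merge del: cc.simps cci.simps)
qed

lemma und_Id_tns:
  assumes [simp]: "a \<in> obj C" "tAr (lcat C) G"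
  shows "und C (tid (lcat C) [a] \<boxtimes>\<^sub>l G) = tid C a \<boxtimes>\<^sub>t und C G"
proof -
  have "tid (lcat C) [a] = str (tid C a)"
    by (intro und_inj) simp_all
  then show ?thesis
    using und_str_tns[of "tid C a" G] by simp
qed

text \<open>The candidate for \<open>mu\<close>, whiskered by one more letter, is again an inverse
  associator; this reduces the associativity of \<open>mu\<close> to a pentagon.\<close>

lemma und_Ai_tns:
  assumes [simp]: "a \<in> obj C" "b \<in> obj C" "c \<in> obj C"
  shows "und C (lift C [a, b] (Ai a b \<one>) [a \<otimes> b] \<boxtimes>\<^sub>l tid (lcat C) [c]) = Ai a b (c \<otimes> \<one>)"
proof -
  let ?I = "tid C (c \<otimes> \<one>)"
  have "Ai a b (c \<otimes> \<one>) \<bullet>\<^sub>t cc [a, b] [c]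
      = Ai a b (c \<otimes> \<one>) \<bullet>\<^sub>t (tid C a \<boxtimes>\<^sub>t (Ru b \<boxtimes>\<^sub>t ?I)) \<bullet>\<^sub>t As a (b \<otimes> \<one>) (c \<otimes> \<one>)"
    by (simp add: t_triangle)
  also have "\<dots> = (tid C a \<boxtimes>\<^sub>t Ru b) \<boxtimes>\<^sub>t ?I"
    using As_natural[of "tid C a" "Ru b" ?I, symmetric] by (simp add: cmp_cancel[OF As_arrow(4)])
  also have "\<dots> = (Ru (a \<otimes> b) \<boxtimes>\<^sub>t ?I) \<bullet>\<^sub>t (Ai a b \<one> \<boxtimes>\<^sub>t ?I)"
    by (simp add: tns_merge Ru_tns[symmetric] cmp_assoc)
  finally have "(Ru (a \<otimes> b) \<boxtimes>\<^sub>t ?I) \<bullet>\<^sub>t (Ai a b \<one> \<boxtimes>\<^sub>t ?I) = Ai a b (c \<otimes> \<one>) \<bullet>\<^sub>t cc [a, b] [c]"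
    by simp
  then have "(Ru (a \<otimes> b) \<boxtimes>\<^sub>t ?I) \<bullet>\<^sub>t (Ai a b \<one> \<boxtimes>\<^sub>t ?I) \<bullet>\<^sub>t cci [a, b] [c]
    = Ai a b (c \<otimes> \<one>) \<bullet>\<^sub>t cc [a, b] [c] \<bullet>\<^sub>t cci [a, b] [c]"
    by (simp only: cmp_assoc[symmetric])
  then show ?thesis
    using cc_inverse(1)[of "[a, b]" "[c]"]
    by (simp add: cc_single[of "a \<otimes> b"] del: cc.simps cci.simps)
qed

lemma und_Li_tns:
  assumes [simp]: "a \<in> obj C"
  shows "und C (lift C [] (Li \<one>) [\<one>] \<boxtimes>\<^sub>l tid (lcat C) [a]) = Li (a \<otimes> \<one>)"
proof -
  have "Ru \<one> \<bullet>\<^sub>t Li \<one> = tid C \<one>"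
    by (simp flip: Lu_unit_eq_Ru_unit)
  then show ?thesis
    using cmp_cancel[OF tns_merge(1)[of "Ru \<one>" "Li \<one>" "tid C (a \<otimes> \<one>)" "tid C (a \<otimes> \<one>)"]]
    by (simp add: cc_single[of \<one>] cmp_assoc del: cc.simps)
qed

text \<open>The letter \<open>a \<otimes> b\<close> stands for
  \<open>(a \<otimes> b) \<otimes> \<one>\<close> and the word \<open>[a, b]\<close> for
  \<open>a \<otimes> (b \<otimes> \<one>)\<close>. So merging is an inverse associator, splitting is
  an associator, and the unit letter is created by the inverse left unitor of the unit
  object.\<close>

sublocale Str: strong_functor C "obj C" "tAr (lcat C)" tdom tcod "tcmp (lcat C)" "tid (lcat C)" ltns
  "\<lambda>a. a" str "\<lambda>a b. lift C [a, b] (Ai a b \<one>) [a \<otimes> b]" "\<lambda>a b. lift C [a \<otimes> b] (As a b \<one>) [a, b]"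
  "lift C [] (Li \<one>) [\<one>]" "lift C [\<one>] (Lu \<one>) []"
proof unfold_locales
  fix F G a b c
  show "str (tid C a) = tid (lcat C) [a]" if "a \<in> obj C"
    using that by (intro und_inj) (simp_all add: str_def)
  show "str (G \<bullet>\<^sub>t F) = tcmp (lcat C) (str G) (str F)" if "tAr C G" "tAr C F" "tdom G = tcod F"
    using that by (intro und_inj) (simp_all add: str_def tns_merge)
  {
    assume [simp]: "a \<in> obj C" "b \<in> obj C"
    show "tcmp (lcat C) (lift C [a, b] (Ai a b \<one>) [a \<otimes> b]) (lift C [a \<otimes> b] (As a b \<one>) [a, b])
        = tid (lcat C) [a \<otimes> b]"
      by (intro und_inj) simp_all
    show "tcmp (lcat C) (lift C [a \<otimes> b] (As a b \<one>) [a, b]) (lift C [a, b] (Ai a b \<one>) [a \<otimes> b])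
        = tid (lcat C) [a, b]"
      by (intro und_inj) simp_all
  }
  show "tcmp (lcat C) (lift C [] (Li \<one>) [\<one>]) (lift C [\<one>] (Lu \<one>) []) = tid (lcat C) [\<one>]"
    by (intro und_inj) simp_all
  show "tcmp (lcat C) (lift C [\<one>] (Lu \<one>) []) (lift C [] (Li \<one>) [\<one>]) = tid (lcat C) []"
    by (intro und_inj) simp_all
  show "tcmp (lcat C) (str (F \<boxtimes>\<^sub>t G)) (lift C [tdom F, tdom G] (Ai (tdom F) (tdom G) \<one>) [tdom F \<otimes> tdom G])
      = tcmp (lcat C) (lift C [tcod F, tcod G] (Ai (tcod F) (tcod G) \<one>) [tcod F \<otimes> tcod G]) (str F \<boxtimes>\<^sub>l str G)"
    if [simp]: "tAr C F" "tAr C G"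
    using Ai_natural[of F G "tid C \<one>"] by (intro und_inj) (simp_all add: und_str_tns del: und_ltns)
  show "tcmp (lcat C) (str (As a b c)) (tcmp (lcat C) (lift C [a \<otimes> b, c] (Ai (a \<otimes> b) c \<one>) [(a \<otimes> b) \<otimes> c])
        (lift C [a, b] (Ai a b \<one>) [a \<otimes> b] \<boxtimes>\<^sub>l tid (lcat C) [c]))
      = tcmp (lcat C) (lift C [a, b \<otimes> c] (Ai a (b \<otimes> c) \<one>) [a \<otimes> b \<otimes> c])
        (tid (lcat C) [a] \<boxtimes>\<^sub>l lift C [b, c] (Ai b c \<one>) [b \<otimes> c])"
    if [simp]: "a \<in> obj C" "b \<in> obj C" "c \<in> obj C"
  proof (rule und_inj)
    let ?I = "tid C \<one>"
    \<comment> \<open>This is the pentagon for \<open>a\<close>, \<open>b\<close>, \<open>c\<close>,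
      \<open>\<one>\<close> with some edges inverted; it is checked after composition with the
      inverse of the right hand side.\<close>
    have "(As a b c \<boxtimes>\<^sub>t ?I) \<bullet>\<^sub>t Ai (a \<otimes> b) c \<one> \<bullet>\<^sub>t Ai a b (c \<otimes> \<one>)
        = Ai a (b \<otimes> c) \<one> \<bullet>\<^sub>t (tid C a \<boxtimes>\<^sub>t Ai b c \<one>)"
    proof (rule iso_mono[of "Ai a (b \<otimes> c) \<one> \<bullet>\<^sub>t (tid C a \<boxtimes>\<^sub>t Ai b c \<one>)"
          "(tid C a \<boxtimes>\<^sub>t As b c \<one>) \<bullet>\<^sub>t As a (b \<otimes> c) \<one>" "(a \<otimes> (b \<otimes> c)) \<otimes> \<one>"])
      show "((tid C a \<boxtimes>\<^sub>t As b c \<one>) \<bullet>\<^sub>t As a (b \<otimes> c) \<one>) \<bullet>\<^sub>t (As a b c \<boxtimes>\<^sub>t ?I) \<bullet>\<^sub>t Ai (a \<otimes> b) c \<one> \<bullet>\<^sub>t Ai a b (c \<otimes> \<one>)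
        = ((tid C a \<boxtimes>\<^sub>t As b c \<one>) \<bullet>\<^sub>t As a (b \<otimes> c) \<one>) \<bullet>\<^sub>t Ai a (b \<otimes> c) \<one> \<bullet>\<^sub>t (tid C a \<boxtimes>\<^sub>t Ai b c \<one>)"
        by (simp add: cmp_assoc cmp_cancel[OF t_pentagon[simplified cmp_assoc[symmetric]]]
            cmp_cancel[OF As_arrow(3)] cmp_cancel[OF As_arrow(4)] tns_merge)
          (simp add: cmp_assoc[symmetric] t_pentagon[simplified cmp_assoc[symmetric]],
            simp add: cmp_assoc cmp_cancel[OF As_arrow(3)] cmp_cancel[OF As_arrow(4)])
    qed (simp_all add: cmp_assoc cmp_cancel[OF As_arrow(3)] cmp_cancel[OF As_arrow(4)] tns_merge)
    then show "und C (tcmp (lcat C) (str (As a b c)) (tcmp (lcat C) (lift C [a \<otimes> b, c] (Ai (a \<otimes> b) c \<one>) [(a \<otimes> b) \<otimes> c])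
        (lift C [a, b] (Ai a b \<one>) [a \<otimes> b] \<boxtimes>\<^sub>l tid (lcat C) [c])))
      = und C (tcmp (lcat C) (lift C [a, b \<otimes> c] (Ai a (b \<otimes> c) \<one>) [a \<otimes> b \<otimes> c])
        (tid (lcat C) [a] \<boxtimes>\<^sub>l lift C [b, c] (Ai b c \<one>) [b \<otimes> c]))"
      by (simp add: und_Id_tns und_Ai_tns del: und_ltns)
  qed simp_all
  show "tcmp (lcat C) (str (Lu a)) (tcmp (lcat C) (lift C [\<one>, a] (Ai \<one> a \<one>) [\<one> \<otimes> a])
      (lift C [] (Li \<one>) [\<one>] \<boxtimes>\<^sub>l tid (lcat C) [a])) = tid (lcat C) [a]" if [simp]: "a \<in> obj C"
  proof (rule und_inj)
    have "(Lu a \<boxtimes>\<^sub>t tid C \<one>) \<bullet>\<^sub>t Ai \<one> a \<one> \<bullet>\<^sub>t Li (a \<otimes> \<one>) = tid C (a \<otimes> \<one>)"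
      using Lu_tns[of a \<one>, symmetric] by (simp add: cmp_assoc cmp_cancel[OF As_arrow(3)])
    then show "und C (tcmp (lcat C) (str (Lu a)) (tcmp (lcat C) (lift C [\<one>, a] (Ai \<one> a \<one>) [\<one> \<otimes> a])
      (lift C [] (Li \<one>) [\<one>] \<boxtimes>\<^sub>l tid (lcat C) [a]))) = und C (tid (lcat C) [a])"
      by (simp add: und_Li_tns del: und_ltns)
  qed simp_all
  show "tcmp (lcat C) (str (Ru a)) (tcmp (lcat C) (lift C [a, \<one>] (Ai a \<one> \<one>) [a \<otimes> \<one>])
      (tid (lcat C) [a] \<boxtimes>\<^sub>l lift C [] (Li \<one>) [\<one>])) = tid (lcat C) [a]" if [simp]: "a \<in> obj C"
  proof (rule und_inj)
    have "(Ru a \<boxtimes>\<^sub>t tid C \<one>) \<bullet>\<^sub>t Ai a \<one> \<one> \<bullet>\<^sub>t (tid C a \<boxtimes>\<^sub>t Li \<one>) = tid C (a \<otimes> \<one>)"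
      using t_triangle[of a \<one>, symmetric] by (simp add: cmp_assoc cmp_cancel[OF As_arrow(3)] tns_merge)
    then show "und C (tcmp (lcat C) (str (Ru a)) (tcmp (lcat C) (lift C [a, \<one>] (Ai a \<one> \<one>) [a \<otimes> \<one>])
      (tid (lcat C) [a] \<boxtimes>\<^sub>l lift C [] (Li \<one>) [\<one>]))) = und C (tid (lcat C) [a])"
      by (simp add: und_Id_tns del: und_ltns)
  qed simp_all
qed (simp_all add: str_def)

end

section \<open>Tensor functors on typed arrows, and their composites with strong functors\<close>

locale tensor_functor_between = tensor_functor C D F + C: tensor_category C + D: tensor_category D
  for C :: "('k::field, 'o, 'm, 'x) TensorCat_scheme" (structure)
    and D :: "('k, 'p, 'n, 'y) TensorCat_scheme" (structure)
    and F :: "('o, 'm, 'p, 'n, 'z) TFunctor_scheme"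
begin

abbreviation "cmpD \<equiv> tcmp D"
notation cmpD (infixr "\<bullet>\<^sub>D" 55)
abbreviation "tnsD \<equiv> ttns D"
notation tnsD (infixr "\<boxtimes>\<^sub>D" 60)

definition tF :: "('o, 'm) tarr \<Rightarrow> ('p, 'n) tarr" where
  "tF X = mk D (fobj F (tdom X)) (fmor F (mor X)) (fobj F (tcod X))"

definition tFm where
  "tFm a b = mk D (fobj F a \<otimes>\<^bsub>D\<^esub> fobj F b) (fmult F a b) (fobj F (a \<otimes> b))"

definition tFm' where
  "tFm' a b = mk D (fobj F (a \<otimes> b))
    (inv_mor D (fobj F a \<otimes>\<^bsub>D\<^esub> fobj F b) (fobj F (a \<otimes> b)) (fmult F a b)) (fobj F a \<otimes>\<^bsub>D\<^esub> fobj F b)"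

definition tFn where "tFn = mk D \<one>\<^bsub>D\<^esub> (funit F) (fobj F \<one>)"

definition tFn' where
  "tFn' = mk D (fobj F \<one>) (inv_mor D \<one>\<^bsub>D\<^esub> (fobj F \<one>) (funit F)) \<one>\<^bsub>D\<^esub>"

declare fobj_obj [simp]

lemma tF_arrow [simp]:
  assumes "tAr C X"
  shows "tAr D (tF X)" "tdom (tF X) = fobj F (tdom X)" "tcod (tF X) = fobj F (tcod X)"
    "mor (tF X) = fmor F (mor X)"
  using assms by (simp_all add: tF_def fmor_in_hom[OF tAr_sel(1)[OF assms] tAr_sel(2)[OF assms]])

lemma tFm_arrow [simp]:
  assumes [simp]: "a \<in> obj C" "b \<in> obj C"
  shows "tAr D (tFm a b)" "tdom (tFm a b) = fobj F a \<otimes>\<^bsub>D\<^esub> fobj F b" "tcod (tFm a b) = fobj F (a \<otimes> b)"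
    "mor (tFm a b) = fmult F a b"
    "tAr D (tFm' a b)" "tdom (tFm' a b) = fobj F (a \<otimes> b)" "tcod (tFm' a b) = fobj F a \<otimes>\<^bsub>D\<^esub> fobj F b"
    "tFm a b \<bullet>\<^sub>D tFm' a b = tid D (fobj F (a \<otimes> b))"
    "tFm' a b \<bullet>\<^sub>D tFm a b = tid D (fobj F a \<otimes>\<^bsub>D\<^esub> fobj F b)"
  using D.inverse_arrows[OF fmult_iso[OF assms]] by (simp_all add: tFm_def tFm'_def)

lemma tFn_arrow [simp]:
  "tAr D tFn" "tdom tFn = \<one>\<^bsub>D\<^esub>" "tcod tFn = fobj F \<one>" "mor tFn = funit F"
  "tAr D tFn'" "tdom tFn' = fobj F \<one>" "tcod tFn' = \<one>\<^bsub>D\<^esub>"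
  "tFn \<bullet>\<^sub>D tFn' = tid D (fobj F \<one>)" "tFn' \<bullet>\<^sub>D tFn = tid D \<one>\<^bsub>D\<^esub>"
  using D.inverse_arrows[OF funit_iso] by (simp_all add: tFn_def tFn'_def)

lemma tF_cmp: "\<lbrakk>tAr C Y; tAr C X; tdom Y = tcod X\<rbrakk> \<Longrightarrow> tF (Y \<bullet>\<^sub>t X) = tF Y \<bullet>\<^sub>D tF X"
  using fmor_comp[of "tdom X" "tcod X" "tcod Y" "mor X" "mor Y"] tAr_sel[of C X] tAr_sel[of C Y]
  by (intro tarr_eqI[of D]) simp_all

lemma tF_id: "a \<in> obj C \<Longrightarrow> tF (tid C a) = tid D (fobj F a)"
  by (intro tarr_eqI[of D]) (simp_all add: fmor_id)

lemma tFm_natural: "\<lbrakk>tAr C X; tAr C Y\<rbrakk>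
    \<Longrightarrow> tF (X \<boxtimes>\<^sub>t Y) \<bullet>\<^sub>D tFm (tdom X) (tdom Y) = tFm (tcod X) (tcod Y) \<bullet>\<^sub>D (tF X \<boxtimes>\<^sub>D tF Y)"
  using fmult_natural[of "tdom X" "tdom Y" "tcod X" "tcod Y" "mor X" "mor Y", symmetric]
  by (intro tarr_eqI[of D]) simp_all

lemma tF_As: "\<lbrakk>a \<in> obj C; b \<in> obj C; c \<in> obj C\<rbrakk>
    \<Longrightarrow> tF (C.As a b c) \<bullet>\<^sub>D tFm (a \<otimes> b) c \<bullet>\<^sub>D (tFm a b \<boxtimes>\<^sub>D tid D (fobj F c))
      = tFm a (b \<otimes> c) \<bullet>\<^sub>D (tid D (fobj F a) \<boxtimes>\<^sub>D tFm b c) \<bullet>\<^sub>D D.As (fobj F a) (fobj F b) (fobj F c)"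
  by (intro tarr_eqI[of D]) (simp_all add: fmult_assoc)

lemma tF_Lu: "a \<in> obj C \<Longrightarrow> tF (C.Lu a) \<bullet>\<^sub>D tFm \<one> a \<bullet>\<^sub>D (tFn \<boxtimes>\<^sub>D tid D (fobj F a)) = D.Lu (fobj F a)"
  by (intro tarr_eqI[of D]) (simp_all add: fmult_lunit)

lemma tF_Ru: "a \<in> obj C \<Longrightarrow> tF (C.Ru a) \<bullet>\<^sub>D tFm a \<one> \<bullet>\<^sub>D (tid D (fobj F a) \<boxtimes>\<^sub>D tFn) = D.Ru (fobj F a)"
  by (intro tarr_eqI[of D]) (simp_all add: fmult_runit)

end

text \<open>A tensor functor from \<open>C\<close> to \<open>D\<close> followed by a strong functor
  on \<open>D\<close> is a strong functor on \<open>C\<close> (the interpretation \<open>FS\<close>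
  below). In the application objects of \<open>C\<close> thereby appear as letters beside those of
  \<open>M\<close>, and arrows of both categories can be mixed in one diagram.\<close>

locale strong_functor_after = tensor_functor_between C D F + strong_functor D ob Ar Dom Cod Cmp Id Tns fo fm mu mu' nu nu'
  for C :: "('k::field, 'o, 'm, 'x) TensorCat_scheme" (structure)
    and D :: "('k, 'p, 'n, 'y) TensorCat_scheme" (structure)
    and F :: "('o, 'm, 'p, 'n, 'z) TFunctor_scheme"
    and ob :: "'a set"
    and Ar :: "'s \<Rightarrow> bool"
    and Dom Cod :: "'s \<Rightarrow> 'a list"
    and Cmp :: "'s \<Rightarrow> 's \<Rightarrow> 's" (infixr "\<bullet>" 55)
    and Id :: "'a list \<Rightarrow> 's"
    and Tns :: "'s \<Rightarrow> 's \<Rightarrow> 's" (infixr "\<boxtimes>" 60)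
    and fo :: "'p \<Rightarrow> 'a"
    and fm :: "('p, 'n) tarr \<Rightarrow> 's"
    and mu mu' :: "'p \<Rightarrow> 'p \<Rightarrow> 's"
    and nu nu' :: 's
begin

definition "cmu a b = fm (tFm a b) \<bullet> mu (fobj F a) (fobj F b)"
definition "cmu' a b = mu' (fobj F a) (fobj F b) \<bullet> fm (tFm' a b)"
definition "cnu = fm tFn \<bullet> nu"
definition "cnu' = nu' \<bullet> fm tFn'"

lemma cmu_arrow [simp]:
  assumes "a \<in> obj C" "b \<in> obj C"
  shows "Ar (cmu a b)" "Dom (cmu a b) = [fo (fobj F a), fo (fobj F b)]" "Cod (cmu a b) = [fo (fobj F (a \<otimes> b))]"
    "Ar (cmu' a b)" "Dom (cmu' a b) = [fo (fobj F (a \<otimes> b))]" "Cod (cmu' a b) = [fo (fobj F a), fo (fobj F b)]"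
  using assms by (simp_all add: cmu_def cmu'_def)

lemma cnu_arrow [simp]:
  "Ar cnu" "Dom cnu = []" "Cod cnu = [fo (fobj F \<one>)]" "Ar cnu'" "Dom cnu' = [fo (fobj F \<one>)]" "Cod cnu' = []"
  by (simp_all add: cnu_def cnu'_def)

lemma L_cmu:
  assumes "a \<in> obj C" "b \<in> obj C" "set xs \<subseteq> ob" "set ys \<subseteq> ob"
  shows "L xs (cmu a b) ys = L xs (fm (tFm a b)) ys \<bullet> L xs (mu (fobj F a) (fobj F b)) ys"
    "L xs (cmu' a b) ys = L xs (mu' (fobj F a) (fobj F b)) ys \<bullet> L xs (fm (tFm' a b)) ys"
  using assms by (simp_all add: cmu_def cmu'_def L_cmp)

lemma L_cnu:
  assumes "set xs \<subseteq> ob" "set ys \<subseteq> ob"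
  shows "L xs cnu ys = L xs (fm tFn) ys \<bullet> L xs nu ys"
    "L xs cnu' ys = L xs nu' ys \<bullet> L xs (fm tFn') ys"
  using assms by (simp_all add: cnu_def cnu'_def L_cmp)

lemma fm_cancel:
  assumes "X \<bullet>\<^sub>D Y = tid D a" "tAr D X" "tAr D Y" "tdom X = tcod Y" "a \<in> obj D" "set xs \<subseteq> ob" "set ys \<subseteq> ob"
  shows "L xs (fm X) ys \<bullet> L xs (fm Y) ys = Id (xs @ fo a # ys)"
    "L xs (fm X) ys \<bullet> L xs (fm Y) ys \<bullet> k = Id (xs @ fo a # ys) \<bullet> k"
  using L_iso[OF fm_iso[OF assms(1-5)]] assms by simp_all

text \<open>Each law of the composite is the law of the tensor functor, mapped by \<open>fm\<close>
  and rewritten with \<open>L_fm\<close>, in which the associators and unitors of \<open>D\<close>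
  vanish.\<close>

sublocale FS: strong_functor C ob Ar Dom Cod Cmp Id Tns "\<lambda>a. fo (fobj F a)" "\<lambda>X. fm (tF X)"
  cmu cmu' cnu cnu'
proof unfold_locales
  fix X Y a b c
  show "cmu a b \<bullet> cmu' a b = Id [fo (fobj F (a \<otimes> b))]" "cmu' a b \<bullet> cmu a b = Id [fo (fobj F a), fo (fobj F b)]"
    if [simp]: "a \<in> obj C" "b \<in> obj C"
  proof -
    have "L [] (cmu a b) [] \<bullet> L [] (cmu' a b) [] = Id [fo (fobj F (a \<otimes> b))]"
      "L [] (cmu' a b) [] \<bullet> L [] (cmu a b) [] = Id [fo (fobj F a), fo (fobj F b)]"
      by (simp_all add: L_cmu cmp_assoc fm_cancel[OF tFm_arrow(8)] fm_cancel[OF tFm_arrow(9)])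
    then show "cmu a b \<bullet> cmu' a b = Id [fo (fobj F (a \<otimes> b))]"
      "cmu' a b \<bullet> cmu a b = Id [fo (fobj F a), fo (fobj F b)]"
      by (simp_all add: L_Nil)
  qed
  have "L [] cnu [] \<bullet> L [] cnu' [] = Id [fo (fobj F \<one>)]" "L [] cnu' [] \<bullet> L [] cnu [] = Id []"
    by (simp_all add: L_cnu cmp_assoc fm_cancel[OF tFn_arrow(8)] fm_cancel[OF tFn_arrow(9)])
  then show "cnu \<bullet> cnu' = Id [fo (fobj F \<one>)]" "cnu' \<bullet> cnu = Id []"
    by (simp_all add: L_Nil)
  show "fm (tF (X \<boxtimes>\<^sub>t Y)) \<bullet> cmu (tdom X) (tdom Y) = cmu (tcod X) (tcod Y) \<bullet> (fm (tF X) \<boxtimes> fm (tF Y))"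
    if [simp]: "tAr C X" "tAr C Y"
  proof -
    have "L [] (fm (tF (X \<boxtimes>\<^sub>t Y) \<bullet>\<^sub>D tFm (tdom X) (tdom Y))) [] \<bullet> L [] (mu (fobj F (tdom X)) (fobj F (tdom Y))) []
      = L [] (fm (tFm (tcod X) (tcod Y) \<bullet>\<^sub>D (tF X \<boxtimes>\<^sub>D tF Y))) [] \<bullet> L [] (mu (fobj F (tdom X)) (fobj F (tdom Y))) []"
      by (simp only: tFm_natural that)
    then show ?thesis
      by (simp add: L_fm cmp_assoc tns_L cmu_def) (simp add: L_Nil)
  qed
  show "fm (tF (C.As a b c)) \<bullet> cmu (a \<otimes> b) c \<bullet> (cmu a b \<boxtimes> Id [fo (fobj F c)])
      = cmu a (b \<otimes> c) \<bullet> (Id [fo (fobj F a)] \<boxtimes> cmu b c)"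
    if [simp]: "a \<in> obj C" "b \<in> obj C" "c \<in> obj C"
  proof -
    let ?k = "L [] (mu (fobj F a \<otimes>\<^bsub>D\<^esub> fobj F b) (fobj F c)) [] \<bullet> L [] (mu (fobj F a) (fobj F b)) [fo (fobj F c)]"
    have "L [] (fm (tF (C.As a b c) \<bullet>\<^sub>D tFm (a \<otimes> b) c \<bullet>\<^sub>D (tFm a b \<boxtimes>\<^sub>D tid D (fobj F c)))) [] \<bullet> ?k
      = L [] (fm (tFm a (b \<otimes> c) \<bullet>\<^sub>D (tid D (fobj F a) \<boxtimes>\<^sub>D tFm b c) \<bullet>\<^sub>D D.As (fobj F a) (fobj F b) (fobj F c))) [] \<bullet> ?k"
      by (simp only: tF_As that)
    then show ?thesis
      by (simp add: L_fm cmp_assoc Id_tns tns_Id L_cmu) (simp add: L_Nil cmu_def cmp_assoc)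
  qed
  show "fm (tF (C.Lu a)) \<bullet> cmu \<one> a \<bullet> (cnu \<boxtimes> Id [fo (fobj F a)]) = Id [fo (fobj F a)]"
    if [simp]: "a \<in> obj C"
  proof -
    let ?k = "L [] (mu \<one>\<^bsub>D\<^esub> (fobj F a)) [] \<bullet> L [] nu [fo (fobj F a)]"
    have "L [] (fm (tF (C.Lu a) \<bullet>\<^sub>D tFm \<one> a \<bullet>\<^sub>D (tFn \<boxtimes>\<^sub>D tid D (fobj F a)))) [] \<bullet> ?k = L [] (fm (D.Lu (fobj F a))) [] \<bullet> ?k"
      by (simp only: tF_Lu that)
    then show ?thesis
      by (simp add: L_fm cmp_assoc tns_Id L_cnu) (simp add: L_Nil cmu_def cmp_assoc)
  qed
  show "fm (tF (C.Ru a)) \<bullet> cmu a \<one> \<bullet> (Id [fo (fobj F a)] \<boxtimes> cnu) = Id [fo (fobj F a)]"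
    if [simp]: "a \<in> obj C"
  proof -
    let ?k = "L [] (mu (fobj F a) \<one>\<^bsub>D\<^esub>) [] \<bullet> L [fo (fobj F a)] nu []"
    have "L [] (fm (tF (C.Ru a) \<bullet>\<^sub>D tFm a \<one> \<bullet>\<^sub>D (tid D (fobj F a) \<boxtimes>\<^sub>D tFn))) [] \<bullet> ?k = L [] (fm (D.Ru (fobj F a))) [] \<bullet> ?k"
      by (simp only: tF_Ru that)
    then show ?thesis
      by (simp add: L_fm cmp_assoc Id_tns L_cnu) (simp add: L_Nil cmu_def cmp_assoc)
  qed
qed (simp_all add: tF_cmp tF_id fm_cmp fm_id)

end

section \<open>Duality\<close>

context pivotal_category
begin

declare dual_obj [simp]

definition "Ev a = mk C (dual C a \<otimes> a) (ev C a) \<one>"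
definition "Co a = mk C \<one> (coev C a) (a \<otimes> dual C a)"
definition "Piv a = mk C a (piv C a) (dual C (dual C a))"
definition "Piv' a = mk C (dual C (dual C a)) (inv_mor C a (dual C (dual C a)) (piv C a)) a"
text \<open>The duality of the other hand, obtained from that of \<open>dual C a\<close> through the
  pivotal isomorphism.\<close>

definition "Evt a = Ev (dual C a) \<bullet>\<^sub>t (Piv a \<boxtimes>\<^sub>t tid C (dual C a))"
definition "Cot a = (tid C (dual C a) \<boxtimes>\<^sub>t Piv' a) \<bullet>\<^sub>t Co (dual C a)"

lemma Ev_arrow [simp]:
  assumes "a \<in> obj C"
  shows "tAr C (Ev a)" "tdom (Ev a) = dual C a \<otimes> a" "tcod (Ev a) = \<one>" "mor (Ev a) = ev C a"
    "tAr C (Co a)" "tdom (Co a) = \<one>" "tcod (Co a) = a \<otimes> dual C a" "mor (Co a) = coev C a"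
  using assms by (simp_all add: Ev_def Co_def ev_in_hom coev_in_hom)

lemma Piv_arrow [simp]:
  assumes "a \<in> obj C"
  shows "tAr C (Piv a)" "tdom (Piv a) = a" "tcod (Piv a) = dual C (dual C a)" "mor (Piv a) = piv C a"
    "tAr C (Piv' a)" "tdom (Piv' a) = dual C (dual C a)" "tcod (Piv' a) = a"
    "Piv a \<bullet>\<^sub>t Piv' a = tid C (dual C (dual C a))" "Piv' a \<bullet>\<^sub>t Piv a = tid C a"
  using inverse_arrows[OF piv_iso[OF assms]] assms by (simp_all add: Piv_def Piv'_def)

lemma Evt_arrow [simp]:
  assumes "a \<in> obj C"
  shows "tAr C (Evt a)" "tdom (Evt a) = a \<otimes> dual C a" "tcod (Evt a) = \<one>" "mor (Evt a) = ev_tilde C a"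
    "tAr C (Cot a)" "tdom (Cot a) = \<one>" "tcod (Cot a) = dual C a \<otimes> a"
  using assms by (simp_all add: Evt_def Cot_def ev_tilde_def)

lemma t_zigzag:
  assumes "a \<in> obj C"
  shows "Ru a \<bullet>\<^sub>t (tid C a \<boxtimes>\<^sub>t Ev a) \<bullet>\<^sub>t As a (dual C a) a \<bullet>\<^sub>t (Co a \<boxtimes>\<^sub>t tid C a) \<bullet>\<^sub>t Li a = tid C a"
    "Lu (dual C a) \<bullet>\<^sub>t (Ev a \<boxtimes>\<^sub>t tid C (dual C a)) \<bullet>\<^sub>t Ai (dual C a) a (dual C a)
      \<bullet>\<^sub>t (tid C (dual C a) \<boxtimes>\<^sub>t Co a) \<bullet>\<^sub>t Ri (dual C a) = tid C (dual C a)"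
  using assms zigzag[OF assms] zigzag_dual[OF assms] by (auto intro!: tarr_eqI[of C])

end

locale strong_functor_pivotal = strong_functor C ob Ar Dom Cod Cmp Id Tns fo fm mu mu' nu nu' + C: pivotal_category C
  for C :: "('k::field, 'o, 'm, 'x) PivCat_scheme" (structure)
    and ob :: "'a set"
    and Ar :: "'s \<Rightarrow> bool"
    and Dom Cod :: "'s \<Rightarrow> 'a list"
    and Cmp :: "'s \<Rightarrow> 's \<Rightarrow> 's" (infixr "\<bullet>" 55)
    and Id :: "'a list \<Rightarrow> 's"
    and Tns :: "'s \<Rightarrow> 's \<Rightarrow> 's" (infixr "\<boxtimes>" 60)
    and fo :: "'o \<Rightarrow> 'a"
    and fm :: "('o, 'm) tarr \<Rightarrow> 's"
    and mu mu' :: "'o \<Rightarrow> 'o \<Rightarrow> 's"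
    and nu nu' :: 's
begin

text \<open>Cups and caps of the strict calculus: the letter of the unit object is removed, so they
  begin or end in the empty word.\<close>

definition "sev a = nu' \<bullet> fm (C.Ev a) \<bullet> mu (dual C a) a"
definition "sco a = mu' a (dual C a) \<bullet> fm (C.Co a) \<bullet> nu"
definition "sevt a = nu' \<bullet> fm (C.Evt a) \<bullet> mu a (dual C a)"
definition "scot a = mu' (dual C a) a \<bullet> fm (C.Cot a) \<bullet> nu"

lemma sev_arrow [simp]:
  assumes "a \<in> obj C"
  shows "Ar (sev a)" "Dom (sev a) = [fo (dual C a), fo a]" "Cod (sev a) = []"
    "Ar (sco a)" "Dom (sco a) = []" "Cod (sco a) = [fo a, fo (dual C a)]"
    "Ar (sevt a)" "Dom (sevt a) = [fo a, fo (dual C a)]" "Cod (sevt a) = []"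
    "Ar (scot a)" "Dom (scot a) = []" "Cod (scot a) = [fo (dual C a), fo a]"
  using assms by (simp_all add: sev_def sco_def sevt_def scot_def)

lemma L_sev:
  assumes "a \<in> obj C" "set xs \<subseteq> ob" "set ys \<subseteq> ob"
  shows "L xs (sev a) ys = L xs nu' ys \<bullet> L xs (fm (C.Ev a)) ys \<bullet> L xs (mu (dual C a) a) ys"
    "L xs (sco a) ys = L xs (mu' a (dual C a)) ys \<bullet> L xs (fm (C.Co a)) ys \<bullet> L xs nu ys"
    "L xs (sevt a) ys = L xs nu' ys \<bullet> L xs (fm (C.Evt a)) ys \<bullet> L xs (mu a (dual C a)) ys"
    "L xs (scot a) ys = L xs (mu' (dual C a) a) ys \<bullet> L xs (fm (C.Cot a)) ys \<bullet> L xs nu ys"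
  using assms by (simp_all add: sev_def sco_def sevt_def scot_def L_cmp)

lemma L_fm_ev:
  assumes "a \<in> obj C" "set xs \<subseteq> ob" "set ys \<subseteq> ob"
  shows "L xs (fm (C.Ev a)) ys = L xs nu ys \<bullet> L xs (sev a) ys \<bullet> L xs (mu' (dual C a) a) ys"
    "L xs (fm (C.Co a)) ys = L xs (mu a (dual C a)) ys \<bullet> L xs (sco a) ys \<bullet> L xs nu' ys"
    "L xs (fm (C.Evt a)) ys = L xs nu ys \<bullet> L xs (sevt a) ys \<bullet> L xs (mu' a (dual C a)) ys"
    "L xs (fm (C.Cot a)) ys = L xs (mu (dual C a) a) ys \<bullet> L xs (scot a) ys \<bullet> L xs nu' ys"
  using assms by (simp_all add: L_sev cmp_assoc)

lemma zz0:
  assumes [simp]: "a \<in> obj C"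
  shows "L [fo a] (sev a) [] \<bullet> L [] (sco a) [fo a] = Id [fo a]"
    "L [] (sev a) [fo (dual C a)] \<bullet> L [fo (dual C a)] (sco a) [] = Id [fo (dual C a)]"
proof -
  have "L [] (fm (C.Ru a \<bullet>\<^sub>t (tid C a \<boxtimes>\<^sub>t C.Ev a) \<bullet>\<^sub>t C.As a (dual C a) a \<bullet>\<^sub>t (C.Co a \<boxtimes>\<^sub>t tid C a) \<bullet>\<^sub>t C.Li a)) []
    = L [] (fm (tid C a)) []"
    by (simp only: C.t_zigzag assms)
  then show "L [fo a] (sev a) [] \<bullet> L [] (sco a) [fo a] = Id [fo a]"
    by (simp add: L_fm L_fm_ev cmp_assoc)
  have "L [] (fm (C.Lu (dual C a) \<bullet>\<^sub>t (C.Ev a \<boxtimes>\<^sub>t tid C (dual C a)) \<bullet>\<^sub>t C.Ai (dual C a) a (dual C a)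
      \<bullet>\<^sub>t (tid C (dual C a) \<boxtimes>\<^sub>t C.Co a) \<bullet>\<^sub>t C.Ri (dual C a))) [] = L [] (fm (tid C (dual C a))) []"
    by (simp only: C.t_zigzag assms)
  then show "L [] (sev a) [fo (dual C a)] \<bullet> L [fo (dual C a)] (sco a) [] = Id [fo (dual C a)]"
    by (simp add: L_fm L_fm_ev cmp_assoc)
qed

lemma L_Piv:
  assumes "a \<in> obj C" "set xs \<subseteq> ob" "set ys \<subseteq> ob"
  shows "L xs (fm (C.Piv a)) ys \<bullet> L xs (fm (C.Piv' a)) ys = Id (xs @ fo (dual C (dual C a)) # ys)"
    "L xs (fm (C.Piv a)) ys \<bullet> L xs (fm (C.Piv' a)) ys \<bullet> k = Id (xs @ fo (dual C (dual C a)) # ys) \<bullet> k"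
    "L xs (fm (C.Piv' a)) ys \<bullet> L xs (fm (C.Piv a)) ys = Id (xs @ fo a # ys)"
    "L xs (fm (C.Piv' a)) ys \<bullet> L xs (fm (C.Piv a)) ys \<bullet> k = Id (xs @ fo a # ys) \<bullet> k"
  using assms L_iso[OF fm_iso[OF C.Piv_arrow(8)]] L_iso[OF fm_iso[OF C.Piv_arrow(9)]] by simp_all

lemma L_sevt:
  assumes "a \<in> obj C" "set xs \<subseteq> ob" "set ys \<subseteq> ob"
  shows "L xs (sevt a) ys = L xs (sev (dual C a)) ys \<bullet> L xs (fm (C.Piv a)) (fo (dual C a) # ys)"
    "L xs (scot a) ys = L (xs @ [fo (dual C a)]) (fm (C.Piv' a)) ys \<bullet> L xs (sco (dual C a)) ys"
  using assms by (simp_all add: L_sev L_fm C.Evt_def C.Cot_def cmp_assoc)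

text \<open>Zig-zags are proved on minimal words; this adds idle strands on both sides of such an
  equation and keeps the normal form of whiskered generators.\<close>

lemma whisk:
  assumes "L us f vs \<bullet> L us' g vs' = h" "Ar f" "Ar g" "us @ Dom f @ vs = us' @ Cod g @ vs'"
    "set us \<subseteq> ob" "set vs \<subseteq> ob" "set us' \<subseteq> ob" "set vs' \<subseteq> ob" "set xs \<subseteq> ob" "set ys \<subseteq> ob"
  shows "L (xs @ us) f (vs @ ys) \<bullet> L (xs @ us') g (vs' @ ys) = L xs h ys"
    "L (xs @ us) f (vs @ ys) \<bullet> L (xs @ us') g (vs' @ ys) \<bullet> k = L xs h ys \<bullet> k"
proof -
  show *: "L (xs @ us) f (vs @ ys) \<bullet> L (xs @ us') g (vs' @ ys) = L xs h ys"
    using assms(2-) by (simp flip: assms(1) add: L_cmp)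
  show "L (xs @ us) f (vs @ ys) \<bullet> L (xs @ us') g (vs' @ ys) \<bullet> k = L xs h ys \<bullet> k"
    by (rule cmp_cancel[OF *])
qed

lemma zz:
  assumes [simp]: "a \<in> obj C" "set xs \<subseteq> ob" "set ys \<subseteq> ob"
  shows "\<lbrakk>us = xs @ [fo a]; vs = fo a # ys\<rbrakk> \<Longrightarrow> L us (sev a) ys \<bullet> L xs (sco a) vs = Id (xs @ fo a # ys)"
    "\<lbrakk>us = xs @ [fo a]; vs = fo a # ys\<rbrakk> \<Longrightarrow> L us (sev a) ys \<bullet> L xs (sco a) vs \<bullet> k = Id (xs @ fo a # ys) \<bullet> k"
    "\<lbrakk>us = xs @ [fo (dual C a)]; vs = fo (dual C a) # ys\<rbrakk>
      \<Longrightarrow> L xs (sev a) vs \<bullet> L us (sco a) ys = Id (xs @ fo (dual C a) # ys)"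
    "\<lbrakk>us = xs @ [fo (dual C a)]; vs = fo (dual C a) # ys\<rbrakk>
      \<Longrightarrow> L xs (sev a) vs \<bullet> L us (sco a) ys \<bullet> k = Id (xs @ fo (dual C a) # ys) \<bullet> k"
  using whisk[OF zz0(1)[of a], of xs ys] whisk[OF zz0(2)[of a], of xs ys] by simp_all

text \<open>In the first equation the pivotal isomorphism and its inverse sit on different strands;
  moving them to the two ends of the diagram leaves the zig-zag of \<open>dual C a\<close>,
  conjugated by the pivotal isomorphism. In the second they cancel directly.\<close>

lemma zzt0:
  assumes [simp]: "a \<in> obj C"
  shows "L [] (sevt a) [fo a] \<bullet> L [fo a] (scot a) [] = Id [fo a]"
    "L [fo (dual C a)] (sevt a) [] \<bullet> L [] (scot a) [fo (dual C a)] = Id [fo (dual C a)]"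
proof -
  have "L [] (sevt a) [fo a] \<bullet> L [fo a] (scot a) []
    = L [] (fm (C.Piv' a)) [] \<bullet> L [] (sev (dual C a)) [fo (dual C (dual C a))]
      \<bullet> L [fo (dual C (dual C a))] (sco (dual C a)) [] \<bullet> L [] (fm (C.Piv a)) []"
    by (simp add: L_sevt cmp_assoc exch)
  also have "\<dots> = Id [fo a]"
    by (simp add: zz L_Piv)
  finally show "L [] (sevt a) [fo a] \<bullet> L [fo a] (scot a) [] = Id [fo a]" .
  show "L [fo (dual C a)] (sevt a) [] \<bullet> L [] (scot a) [fo (dual C a)] = Id [fo (dual C a)]"
    by (simp add: L_sevt cmp_assoc L_Piv zz)
qed

lemma zzt:
  assumes [simp]: "a \<in> obj C" "set xs \<subseteq> ob" "set ys \<subseteq> ob"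
  shows "\<lbrakk>us = xs @ [fo a]; vs = fo a # ys\<rbrakk> \<Longrightarrow> L xs (sevt a) vs \<bullet> L us (scot a) ys = Id (xs @ fo a # ys)"
    "\<lbrakk>us = xs @ [fo a]; vs = fo a # ys\<rbrakk> \<Longrightarrow> L xs (sevt a) vs \<bullet> L us (scot a) ys \<bullet> k = Id (xs @ fo a # ys) \<bullet> k"
    "\<lbrakk>us = xs @ [fo (dual C a)]; vs = fo (dual C a) # ys\<rbrakk>
      \<Longrightarrow> L us (sevt a) ys \<bullet> L xs (scot a) vs = Id (xs @ fo (dual C a) # ys)"
    "\<lbrakk>us = xs @ [fo (dual C a)]; vs = fo (dual C a) # ys\<rbrakk>
      \<Longrightarrow> L us (sevt a) ys \<bullet> L xs (scot a) vs \<bullet> k = Id (xs @ fo (dual C a) # ys) \<bullet> k"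
  using whisk[OF zzt0(1)[of a], of xs ys] whisk[OF zzt0(2)[of a], of xs ys] by simp_all

end

sublocale pivotal_category \<subseteq> Str: strong_functor_pivotal C "obj C" "tAr (lcat C)" tdom tcod "tcmp (lcat C)" "tid (lcat C)" ltns
  "\<lambda>a. a" str "\<lambda>a b. lift C [a, b] (Ai a b \<one>) [a \<otimes> b]" "\<lambda>a b. lift C [a \<otimes> b] (As a b \<one>) [a, b]"
  "lift C [] (Li \<one>) [\<one>]" "lift C [\<one>] (Lu \<one>) []"
  by unfold_locales

section \<open>The underlying functor of a functor to the center\<close>

lemma center_sel: "comp (center M) = comp M" "idm (center M) x = idm M (fst x)"
  "tmor (center M) = tmor M" "addm (center M) = addm M" "scale (center M) = scale M"
  "tobj (center M) x y = (fst x \<otimes>\<^bsub>M\<^esub> fst y, braid_tensor M x y)" "tunit (center M) = (\<one>\<^bsub>M\<^esub>, braid_unit M)"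
  "assoc (center M) x y z = assoc M (fst x) (fst y) (fst z)"
  "lunit (center M) x = lunit M (fst x)" "runit (center M) x = runit M (fst x)"
  by (simp_all add: center_def)

lemma center_hom: "f \<in> hom (center M) x y \<longleftrightarrow> f \<in> hom M (fst x) (fst y) \<and>
    (\<forall>c\<in>obj M. (idm M c \<star>\<^bsub>M\<^esub> f) \<cdot>\<^bsub>M\<^esub> snd x c = snd y c \<cdot>\<^bsub>M\<^esub> (f \<star>\<^bsub>M\<^esub> idm M c))"
  by (cases x; cases y) (simp add: center_def)

text \<open>Identities and composition in the center are those of the underlying category, so an
  inverse there is an inverse below.\<close>

lemma center_iso: "iso_mor (center M) x y f \<Longrightarrow> f \<in> hom (center M) x y \<and> iso_mor M (fst x) (fst y) f"
  by (auto simp: iso_mor_def is_inverse_def center_hom center_sel)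

lemma phi_sel: "fobj (phi M \<Phi>Z) c = fst (fobj \<Phi>Z c)" "fmor (phi M \<Phi>Z) f = fmor \<Phi>Z f"
  by (simp_all add: phi_def tfunctor_comp_def forgetful_def)

context
  fixes C :: "('k::field, 'o, 'm, 'x) PivCat_scheme" (structure)
    and M :: "('k, 'p, 'n, 'y) PivCat_scheme"
    and \<Phi>Z :: "('o, 'm, 'p \<times> ('p \<Rightarrow> 'n), 'n) TFunctor"
  assumes M: "tensor_category M" and tf: "tensor_functor C (center M) \<Phi>Z" and C: "tensor_category C"
begin

interpretation C: tensor_category C by (rule C)
interpretation M: tensor_category M by (rule M)
interpretation Z: tensor_functor C "center M" \<Phi>Z by (rule tf)

lemma center_obj: "c \<in> obj C \<Longrightarrow> fst (fobj \<Phi>Z c) \<in> obj M \<and> is_half_braiding M (fst (fobj \<Phi>Z c)) (snd (fobj \<Phi>Z c))"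
  using Z.fobj_obj[of c] by (auto simp: center_def)

text \<open>The structure maps of the forgetful functor are identities. Removing them requires the
  structure map of \<open>\<Phi>Z\<close> to be a morphism of \<open>M\<close>, which its being a
  morphism of the center provides.\<close>

lemma phi_fmult: "\<lbrakk>a \<in> obj C; b \<in> obj C\<rbrakk> \<Longrightarrow> fmult (phi M \<Phi>Z) a b = fmult \<Phi>Z a b"
  using center_iso[OF Z.fmult_iso[of a b]] center_obj[of a] center_obj[of b] center_obj[of "a \<otimes> b"]
    M.comp_id[of "fst (fobj \<Phi>Z a) \<otimes>\<^bsub>M\<^esub> fst (fobj \<Phi>Z b)" "fst (fobj \<Phi>Z (a \<otimes> b))" "fmult \<Phi>Z a b"]
  by (simp add: phi_def tfunctor_comp_def forgetful_def center_hom center_sel)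

lemma phi_funit: "funit (phi M \<Phi>Z) = funit \<Phi>Z"
  using center_iso[OF Z.funit_iso] center_obj[of \<one>] M.comp_id[of "\<one>\<^bsub>M\<^esub>" "fst (fobj \<Phi>Z \<one>)" "funit \<Phi>Z"]
  by (simp add: phi_def tfunctor_comp_def forgetful_def center_hom center_sel)

lemma tensor_functor_phi: "tensor_functor C M (phi M \<Phi>Z)"
proof unfold_locales
  show "iso_mor M (fobj (phi M \<Phi>Z) a \<otimes>\<^bsub>M\<^esub> fobj (phi M \<Phi>Z) b) (fobj (phi M \<Phi>Z) (a \<otimes> b)) (fmult (phi M \<Phi>Z) a b)"
    if "a \<in> obj C" "b \<in> obj C" for a b
    using center_iso[OF Z.fmult_iso[OF that]] by (simp add: phi_fmult that phi_sel center_sel)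
  show "iso_mor M \<one>\<^bsub>M\<^esub> (fobj (phi M \<Phi>Z) \<one>) (funit (phi M \<Phi>Z))"
    using center_iso[OF Z.funit_iso] by (simp add: phi_funit phi_sel center_sel)
qed (use center_obj Z.fmor_in_hom Z.fmor_id Z.fmor_comp Z.fmor_add Z.fmor_scale Z.fmult_natural
    Z.fmult_assoc Z.fmult_lunit Z.fmult_runit in \<open>simp_all add: phi_fmult phi_funit center_hom center_sel phi_sel\<close>)

end

section \<open>Mates and traciators\<close>

text \<open>Besides the categorical data, a strict category receiving \<open>M\<close> is fixed
  abstractly. The functor into it has to be full and faithful on letters: faithfulness turns strict
  identities into identities in \<open>M\<close>, and fullness turns a strict diagram between
  letters into an arrow of \<open>M\<close>, to which naturality of half-braidings or the adjunction
  applies.\<close>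

locale trace_setting = strong_functor_after C M "phi M \<Phi>Z" ob Ar Dom Cod Cmp Id Tns fo fm mu mu' nu nu'
    + C: pivotal_category C + D: pivotal_category M
    + strong_functor_pivotal M ob Ar Dom Cod Cmp Id Tns fo fm mu mu' nu nu'
    + adjunction C M "phi M \<Phi>Z" Tr \<eta> \<epsilon>
  for C :: "('k::field, 'o, 'm, 'x) PivCat_scheme" (structure)
    and M :: "('k, 'p, 'n, 'y) PivCat_scheme"
    and \<Phi>Z :: "('o, 'm, 'p \<times> ('p \<Rightarrow> 'n), 'n) TFunctor"
    and Tr :: "('p, 'n, 'o, 'm) Functor"
    and \<eta> :: "'o \<Rightarrow> 'm"
    and \<epsilon> :: "'p \<Rightarrow> 'n"
    and ob :: "'a set"
    and Ar :: "'s \<Rightarrow> bool"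
    and Dom Cod :: "'s \<Rightarrow> 'a list"
    and Cmp :: "'s \<Rightarrow> 's \<Rightarrow> 's" (infixr "\<bullet>" 55)
    and Id :: "'a list \<Rightarrow> 's"
    and Tns :: "'s \<Rightarrow> 's \<Rightarrow> 's" (infixr "\<boxtimes>" 60)
    and fo :: "'p \<Rightarrow> 'a"
    and fm :: "('p, 'n) tarr \<Rightarrow> 's"
    and mu mu' :: "'p \<Rightarrow> 'p \<Rightarrow> 's"
    and nu nu' :: 's +
  assumes center_functor: "tensor_functor C (center M) \<Phi>Z"
    and fm_faithful: "\<lbrakk>fm F = fm G; tAr M F; tAr M G; tdom F = tdom G; tcod F = tcod G\<rbrakk> \<Longrightarrow> F = G"
    and fm_full: "\<lbrakk>Ar X; Dom X = [fo a]; Cod X = [fo b]; a \<in> obj M; b \<in> obj M\<rbrakk>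
      \<Longrightarrow> \<exists>F. tAr M F \<and> tdom F = a \<and> tcod F = b \<and> fm F = X"
begin

sublocale FS: strong_functor_pivotal C ob Ar Dom Cod Cmp Id Tns "\<lambda>a. fo (fobj (phi M \<Phi>Z) a)" "\<lambda>X. fm (tF X)"
  cmu cmu' cnu cnu'
  by unfold_locales

abbreviation Ph where "Ph c \<equiv> fobj (phi M \<Phi>Z) c"
abbreviation p where "p c \<equiv> fo (Ph c)"
abbreviation tensM (infixr "\<otimes>\<^sub>M" 75) where "x \<otimes>\<^sub>M y \<equiv> x \<otimes>\<^bsub>M\<^esub> y"

section \<open>Half-braidings of the objects in the image of \<Phi>\<close>

definition "Eb c y = mk M (Ph c \<otimes>\<^sub>M y) (half_braid \<Phi>Z c y) (y \<otimes>\<^sub>M Ph c)"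
definition "Eb' c y = mk M (y \<otimes>\<^sub>M Ph c) (inv_mor M (Ph c \<otimes>\<^sub>M y) (y \<otimes>\<^sub>M Ph c) (half_braid \<Phi>Z c y)) (Ph c \<otimes>\<^sub>M y)"

lemma half_braiding: "c \<in> obj C \<Longrightarrow> is_half_braiding M (Ph c) (half_braid \<Phi>Z c)"
  using center_obj[OF D.tensor_category_axioms center_functor C.tensor_category_axioms, of c]
  by (simp add: phi_sel half_braid_def[abs_def])

lemma Eb_arrow [simp]:
  assumes "c \<in> obj C" "y \<in> obj M"
  shows "tAr M (Eb c y)" "tdom (Eb c y) = Ph c \<otimes>\<^sub>M y" "tcod (Eb c y) = y \<otimes>\<^sub>M Ph c"
    "mor (Eb c y) = half_braid \<Phi>Z c y"
    "tAr M (Eb' c y)" "tdom (Eb' c y) = y \<otimes>\<^sub>M Ph c" "tcod (Eb' c y) = Ph c \<otimes>\<^sub>M y"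
    "Eb c y \<bullet>\<^sub>D Eb' c y = tid M (y \<otimes>\<^sub>M Ph c)" "Eb' c y \<bullet>\<^sub>D Eb c y = tid M (Ph c \<otimes>\<^sub>M y)"
  using D.inverse_arrows[of "Ph c \<otimes>\<^sub>M y" "y \<otimes>\<^sub>M Ph c" "half_braid \<Phi>Z c y"] half_braiding[of c] assms
  by (simp_all add: Eb_def Eb'_def is_half_braiding_def)

lemma Eb_natural:
  assumes "c \<in> obj C" "tAr M F"
  shows "Eb c (tcod F) \<bullet>\<^sub>D (tid M (Ph c) \<boxtimes>\<^sub>D F) = (F \<boxtimes>\<^sub>D tid M (Ph c)) \<bullet>\<^sub>D Eb c (tdom F)"
  using half_braiding[OF assms(1)] assms tAr_sel[OF assms(2)]
  by (intro tarr_eqI[of M]) (simp_all add: is_half_braiding_def)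

lemma Eb_tns:
  assumes "c \<in> obj C" "y \<in> obj M" "z \<in> obj M"
  shows "Eb c (y \<otimes>\<^sub>M z) = D.Ai y z (Ph c) \<bullet>\<^sub>D (tid M y \<boxtimes>\<^sub>D Eb c z) \<bullet>\<^sub>D D.As y (Ph c) z
    \<bullet>\<^sub>D (Eb c y \<boxtimes>\<^sub>D tid M z) \<bullet>\<^sub>D D.Ai (Ph c) y z"
  using half_braiding[OF assms(1)] assms
  by (intro tarr_eqI[of M]) (simp_all add: is_half_braiding_def)

lemma center_hom_half_braid:
  assumes "f \<in> hom (center M) x (fobj \<Phi>Z d)" "y \<in> obj M"
  shows "(idm M y \<star>\<^bsub>M\<^esub> f) \<cdot>\<^bsub>M\<^esub> snd x y = half_braid \<Phi>Z d y \<cdot>\<^bsub>M\<^esub> (f \<star>\<^bsub>M\<^esub> idm M y)"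
  using assms by (simp add: center_hom half_braid_def)

text \<open>The functor takes values in the center, so the image of an arrow of \<open>C\<close>
  commutes with half-braidings. In the same way the next two lemmas express that
  \<open>fmult\<close> and \<open>funit\<close> are morphisms of the center.\<close>

lemma Eb_natural_left:
  assumes "tAr C X" "y \<in> obj M"
  shows "(tid M y \<boxtimes>\<^sub>D tF X) \<bullet>\<^sub>D Eb (tdom X) y = Eb (tcod X) y \<bullet>\<^sub>D (tF X \<boxtimes>\<^sub>D tid M y)"
proof -
  interpret Z: tensor_functor C "center M" \<Phi>Z by (rule center_functor)
  show ?thesis
    using center_hom_half_braid[OF Z.fmor_in_hom[OF tAr_sel[OF assms(1)]] assms(2)] assms
    by (intro tarr_eqI[of M]) (simp_all flip: half_braid_def phi_sel[where M = M])
qed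

lemma Eb_tns_left:
  assumes "a \<in> obj C" "b \<in> obj C" "y \<in> obj M"
  shows "(tid M y \<boxtimes>\<^sub>D tFm a b) \<bullet>\<^sub>D D.As y (Ph a) (Ph b) \<bullet>\<^sub>D (Eb a y \<boxtimes>\<^sub>D tid M (Ph b)) \<bullet>\<^sub>D D.Ai (Ph a) y (Ph b)
      \<bullet>\<^sub>D (tid M (Ph a) \<boxtimes>\<^sub>D Eb b y) \<bullet>\<^sub>D D.As (Ph a) (Ph b) y
    = Eb (a \<otimes> b) y \<bullet>\<^sub>D (tFm a b \<boxtimes>\<^sub>D tid M y)"
proof -
  interpret Z: tensor_functor C "center M" \<Phi>Z by (rule center_functor)
  have "fmult \<Phi>Z a b \<in> hom (center M) (fobj \<Phi>Z a \<otimes>\<^bsub>center M\<^esub> fobj \<Phi>Z b) (fobj \<Phi>Z (a \<otimes> b))"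
    using center_iso[OF Z.fmult_iso[OF assms(1,2)]] by simp
  from center_hom_half_braid[OF this assms(3)] show ?thesis
    using assms
    by (intro tarr_eqI[of M])
      (simp_all add: phi_fmult[OF D.tensor_category_axioms center_functor C.tensor_category_axioms] center_sel
        braid_tensor_def case_prod_beta flip: half_braid_def phi_sel[where M = M])
qed

lemma Eb_unit_left:
  assumes "y \<in> obj M"
  shows "(tid M y \<boxtimes>\<^sub>D tFn) \<bullet>\<^sub>D D.Ri y \<bullet>\<^sub>D D.Lu y = Eb \<one> y \<bullet>\<^sub>D (tFn \<boxtimes>\<^sub>D tid M y)"
proof -
  interpret Z: tensor_functor C "center M" \<Phi>Z by (rule center_functor)
  have "funit \<Phi>Z \<in> hom (center M) \<one>\<^bsub>center M\<^esub> (fobj \<Phi>Z \<one>)"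
    using center_iso[OF Z.funit_iso] by simp
  from center_hom_half_braid[OF this assms] show ?thesis
    using assms
    by (intro tarr_eqI[of M])
      (simp_all add: phi_funit[OF D.tensor_category_axioms center_functor C.tensor_category_axioms] center_sel
        braid_unit_def flip: half_braid_def phi_sel[where M = M])
qed

text \<open>The crossing of the letters \<open>p c\<close> and \<open>fo y\<close> as a strict
  diagram; \<open>E'\<close> is the inverse crossing.\<close>

definition "E c y = mu' y (Ph c) \<bullet> fm (Eb c y) \<bullet> mu (Ph c) y"
definition "E' c y = mu' (Ph c) y \<bullet> fm (Eb' c y) \<bullet> mu y (Ph c)"

lemma E_arrow [simp]:
  assumes "c \<in> obj C" "y \<in> obj M"
  shows "Ar (E c y)" "Dom (E c y) = [p c, fo y]" "Cod (E c y) = [fo y, p c]"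
    "Ar (E' c y)" "Dom (E' c y) = [fo y, p c]" "Cod (E' c y) = [p c, fo y]"
  using assms by (simp_all add: E_def E'_def)

lemma L_E:
  assumes "c \<in> obj C" "y \<in> obj M" "set xs \<subseteq> ob" "set ys \<subseteq> ob"
  shows "L xs (E c y) ys = L xs (mu' y (Ph c)) ys \<bullet> L xs (fm (Eb c y)) ys \<bullet> L xs (mu (Ph c) y) ys"
    "L xs (E' c y) ys = L xs (mu' (Ph c) y) ys \<bullet> L xs (fm (Eb' c y)) ys \<bullet> L xs (mu y (Ph c)) ys"
  using assms by (simp_all add: E_def E'_def L_cmp)

lemma L_Eb:
  assumes "c \<in> obj C" "y \<in> obj M" "set xs \<subseteq> ob" "set ys \<subseteq> ob"
  shows "L xs (fm (Eb c y)) ys = L xs (mu y (Ph c)) ys \<bullet> L xs (E c y) ys \<bullet> L xs (mu' (Ph c) y) ys"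
  using assms by (simp_all add: L_E cmp_assoc)

lemma E_E' [simp]:
  assumes "c \<in> obj C" "y \<in> obj M" "set xs \<subseteq> ob" "set ys \<subseteq> ob"
  shows "L xs (E c y) ys \<bullet> L xs (E' c y) ys = Id (xs @ fo y # p c # ys)"
    "L xs (E c y) ys \<bullet> L xs (E' c y) ys \<bullet> k = Id (xs @ fo y # p c # ys) \<bullet> k"
    "L xs (E' c y) ys \<bullet> L xs (E c y) ys = Id (xs @ p c # fo y # ys)"
    "L xs (E' c y) ys \<bullet> L xs (E c y) ys \<bullet> k = Id (xs @ p c # fo y # ys) \<bullet> k"
proof -
  have "L xs (E c y) ys \<bullet> L xs (E' c y) ys = Id (xs @ fo y # p c # ys)"
    "L xs (E' c y) ys \<bullet> L xs (E c y) ys = Id (xs @ p c # fo y # ys)"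
    using assms by (simp_all add: L_E cmp_assoc fm_cancel[OF Eb_arrow(8)] fm_cancel[OF Eb_arrow(9)])
  from this cmp_cancel[OF this(1)] cmp_cancel[OF this(2)]
  show "L xs (E c y) ys \<bullet> L xs (E' c y) ys = Id (xs @ fo y # p c # ys)"
    "L xs (E c y) ys \<bullet> L xs (E' c y) ys \<bullet> k = Id (xs @ fo y # p c # ys) \<bullet> k"
    "L xs (E' c y) ys \<bullet> L xs (E c y) ys = Id (xs @ p c # fo y # ys)"
    "L xs (E' c y) ys \<bullet> L xs (E c y) ys \<bullet> k = Id (xs @ p c # fo y # ys) \<bullet> k"
    by auto
qed

lemma E_natural0:
  assumes [simp]: "c \<in> obj C" "tAr M F"
  shows "L [] (E c (tcod F)) [] \<bullet> L [p c] (fm F) [] = L [] (fm F) [p c] \<bullet> L [] (E c (tdom F)) []"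
proof -
  have "L [] (mu' (tcod F) (Ph c)) [] \<bullet> L [] (fm (Eb c (tcod F) \<bullet>\<^sub>D (tid M (Ph c) \<boxtimes>\<^sub>D F))) [] \<bullet> L [] (mu (Ph c) (tdom F)) []
    = L [] (mu' (tcod F) (Ph c)) [] \<bullet> L [] (fm ((F \<boxtimes>\<^sub>D tid M (Ph c)) \<bullet>\<^sub>D Eb c (tdom F))) [] \<bullet> L [] (mu (Ph c) (tdom F)) []"
    by (simp only: Eb_natural assms)
  then show ?thesis
    by (simp add: L_fm L_Eb cmp_assoc)
qed

lemma E_tns0:
  assumes [simp]: "c \<in> obj C" "y \<in> obj M" "z \<in> obj M"
  shows "L [] (E c (y \<otimes>\<^sub>M z)) [] \<bullet> L [p c] (mu y z) []
    = L [] (mu y z) [p c] \<bullet> L [fo y] (E c z) [] \<bullet> L [] (E c y) [fo z]"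
  by (simp add: L_E[of c "y \<otimes>\<^sub>M z"] Eb_tns)
    (simp add: L_fm L_Eb cmp_assoc)

lemma E_natural_left0:
  assumes [simp]: "tAr C X" "y \<in> obj M"
  shows "L [fo y] (fm (tF X)) [] \<bullet> L [] (E (tdom X) y) [] = L [] (E (tcod X) y) [] \<bullet> L [] (fm (tF X)) [fo y]"
proof -
  have "L [] (mu' y (Ph (tcod X))) [] \<bullet> L [] (fm ((tid M y \<boxtimes>\<^sub>D tF X) \<bullet>\<^sub>D Eb (tdom X) y)) [] \<bullet> L [] (mu (Ph (tdom X)) y) []
   = L [] (mu' y (Ph (tcod X))) [] \<bullet> L [] (fm (Eb (tcod X) y \<bullet>\<^sub>D (tF X \<boxtimes>\<^sub>D tid M y))) [] \<bullet> L [] (mu (Ph (tdom X)) y) []"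
    by (simp only: Eb_natural_left assms)
  then show ?thesis
    by (simp add: L_fm L_Eb cmp_assoc)
qed

lemma E_tns_left0:
  assumes [simp]: "a \<in> obj C" "b \<in> obj C" "y \<in> obj M"
  shows "L [] (E (a \<otimes> b) y) [] \<bullet> L [] (cmu a b) [fo y]
    = L [fo y] (cmu a b) [] \<bullet> L [] (E a y) [p b] \<bullet> L [p a] (E b y) []"
proof -
  let ?k = "L [] (mu (Ph a \<otimes>\<^sub>M Ph b) y) [] \<bullet> L [] (mu (Ph a) (Ph b)) [fo y]"
  let ?l = "L [] (mu' y (Ph (a \<otimes> b))) []"
  have "?l \<bullet> L [] (fm ((tid M y \<boxtimes>\<^sub>D tFm a b) \<bullet>\<^sub>D D.As y (Ph a) (Ph b) \<bullet>\<^sub>D (Eb a y \<boxtimes>\<^sub>D tid M (Ph b)) \<bullet>\<^sub>D D.Ai (Ph a) y (Ph b)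
      \<bullet>\<^sub>D (tid M (Ph a) \<boxtimes>\<^sub>D Eb b y) \<bullet>\<^sub>D D.As (Ph a) (Ph b) y)) [] \<bullet> ?k
    = ?l \<bullet> L [] (fm (Eb (a \<otimes> b) y \<bullet>\<^sub>D (tFm a b \<boxtimes>\<^sub>D tid M y))) [] \<bullet> ?k"
    by (simp only: Eb_tns_left assms)
  then show ?thesis
    by (simp add: L_fm L_Eb L_cmu cmp_assoc)
qed

lemma E_unit_left0:
  assumes [simp]: "y \<in> obj M"
  shows "L [] (E \<one> y) [] \<bullet> L [] cnu [fo y] = L [fo y] cnu []"
proof -
  let ?k = "L [] (mu \<one>\<^bsub>M\<^esub> y) [] \<bullet> L [] nu [fo y]"
  let ?l = "L [] (mu' y (Ph \<one>)) []"
  have "?l \<bullet> L [] (fm ((tid M y \<boxtimes>\<^sub>D tFn) \<bullet>\<^sub>D D.Ri y \<bullet>\<^sub>D D.Lu y)) [] \<bullet> ?k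
    = ?l \<bullet> L [] (fm (Eb \<one> y \<bullet>\<^sub>D (tFn \<boxtimes>\<^sub>D tid M y))) [] \<bullet> ?k"
    by (simp only: Eb_unit_left assms)
  then show ?thesis
    by (simp add: L_fm L_Eb L_cnu cmp_assoc)
qed

end

context strict_monoidal
begin

lemma L_cong: "s = t \<Longrightarrow> L xs s ys = L xs t ys"
  by simp

end

context trace_setting
begin

text \<open>Triviality at the unit is derived from the axioms of a half-braiding. Naturality along
  the unitor and multiplicativity, both at the unit object, show that crossing a unit letter equals
  itself composed with the same crossing stripped of its unit letter; since crossings are
  invertible, the stripped one is the identity.\<close>

lemma E_unit0:
  assumes [simp]: "c \<in> obj C"
  shows "L [] (E c \<one>\<^bsub>M\<^esub>) [] \<bullet> L [p c] nu [] = L [] nu [p c]"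
proof -
  let ?E = "E c \<one>\<^bsub>M\<^esub>" and ?u = "fo \<one>\<^bsub>M\<^esub>"
  \<comment> \<open>\<open>N\<close> is the crossing with the unit letter created before it and
    removed after it; the aim is \<open>L [] N [?u] = Id [p c, ?u]\<close>.\<close>
  define N where "N = L [] nu' [p c] \<bullet> L [] ?E [] \<bullet> L [p c] nu []"
  have N [simp]: "Ar N" "Dom N = [p c]" "Cod N = [p c]"
    by (simp_all add: N_def)
  have "L [] ?E [] \<bullet> L [p c] (fm (D.Lu \<one>\<^bsub>M\<^esub>)) [] \<bullet> L [p c] (mu \<one>\<^bsub>M\<^esub> \<one>\<^bsub>M\<^esub>) []
      = L [] (fm (D.Lu \<one>\<^bsub>M\<^esub>)) [p c] \<bullet> L [] (mu \<one>\<^bsub>M\<^esub> \<one>\<^bsub>M\<^esub>) [p c] \<bullet> L [?u] ?E [] \<bullet> L [] ?E [?u]"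
    using cmp_cancel[OF E_natural0[of c "D.Lu \<one>\<^bsub>M\<^esub>", simplified], of "L [p c] (mu \<one>\<^bsub>M\<^esub> \<one>\<^bsub>M\<^esub>) []"] E_tns0[of c "\<one>\<^bsub>M\<^esub>" "\<one>\<^bsub>M\<^esub>"]
    by (simp add: cmp_assoc)
  then have "L [] ?E [] \<bullet> L [p c] nu' [?u] = L [] nu' [?u, p c] \<bullet> L [?u] ?E [] \<bullet> L [] ?E [?u]"
    by (simp add: L_fm cmp_assoc)
  from cmp_cancel[OF this, of "L [p c] nu [?u]"]
  have "L [] ?E [] = L [] nu' [?u, p c] \<bullet> L [?u] ?E [] \<bullet> L [] ?E [?u] \<bullet> L [p c] nu [?u]"
    by (simp add: cmp_assoc)
  also have "\<dots> = L [] ?E [] \<bullet> L [] N [?u]"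
    using exchange0[of nu' ?E "[]" "[]" "[]"] cmp_cancel[OF exchange0[of nu' ?E "[]" "[]" "[]"]]
    by (simp add: N_def L_cmp cmp_assoc)
  finally have "L [] (E' c \<one>\<^bsub>M\<^esub>) [] \<bullet> L [] ?E [] = L [] (E' c \<one>\<^bsub>M\<^esub>) [] \<bullet> L [] ?E [] \<bullet> L [] N [?u]"
    by simp
  then have NI: "L [] N [?u] = Id [p c, ?u]"
    by simp
  have "N = L [] N [] \<bullet> L [p c] nu' [] \<bullet> L [p c] nu []"
    by (simp add: L_Nil)
  also have "\<dots> = L [p c] nu' [] \<bullet> L [] N [?u] \<bullet> L [p c] nu []"
    using cmp_cancel[OF exchange0[of N nu' "[]" "[]" "[]"], of "L [p c] nu []"] by (simp add: cmp_assoc del: nu_cancel)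
  also have "\<dots> = Id [p c]"
    by (simp add: NI)
  finally have "L [] nu [p c] \<bullet> N = L [] nu [p c]"
    by simp
  then show ?thesis
    by (simp add: N_def)
qed

lemma E_unit0':
  assumes [simp]: "c \<in> obj C"
  shows "L [] nu' [p c] \<bullet> L [] (E c \<one>\<^bsub>M\<^esub>) [] = L [p c] nu' []"
proof -
  have "L [] nu' [p c] \<bullet> L [] (E c \<one>\<^bsub>M\<^esub>) [] = L [] nu' [p c] \<bullet> (L [] (E c \<one>\<^bsub>M\<^esub>) [] \<bullet> L [p c] nu []) \<bullet> L [p c] nu' []"
    by (simp add: cmp_assoc)
  then show ?thesis
    unfolding E_unit0[OF assms] by (simp add: cmp_assoc)
qed

lemma E_tns0':
  assumes [simp]: "c \<in> obj C" "y \<in> obj M" "z \<in> obj M"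
  shows "L [] (mu' y z) [p c] \<bullet> L [] (E c (y \<otimes>\<^sub>M z)) []
    = L [fo y] (E c z) [] \<bullet> L [] (E c y) [fo z] \<bullet> L [p c] (mu' y z) []"
proof -
  have "L [] (mu' y z) [p c] \<bullet> L [] (E c (y \<otimes>\<^sub>M z)) []
    = L [] (mu' y z) [p c] \<bullet> (L [] (E c (y \<otimes>\<^sub>M z)) [] \<bullet> L [p c] (mu y z) []) \<bullet> L [p c] (mu' y z) []"
    by (simp add: cmp_assoc)
  then show ?thesis
    unfolding E_tns0[OF assms] by (simp add: cmp_assoc)
qed

lemma fullE:
  assumes "Ar X" "Dom X = [fo a]" "Cod X = [fo b]" "a \<in> obj M" "b \<in> obj M"
  obtains F where "tAr M F" "tdom F = a" "tcod F = b" "fm F = X"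
  using fm_full[OF assms] by blast

text \<open>Half-braidings are natural only for arrows between letters. So the ends of
  \<open>X\<close> are closed by \<open>mu\<close> and \<open>nu'\<close>, fullness of
  \<open>fm\<close> produces an arrow of \<open>M\<close>, and multiplicativity at \<open>y\<close>,
  \<open>z\<close> and triviality at the unit open them again. The two digits in this family of
  names count the letters of the source and of the target.\<close>

lemma slide02:
  assumes [simp]: "c \<in> obj C" "y \<in> obj M" "z \<in> obj M" "Ar X" "Dom X = []" "Cod X = [fo y, fo z]"
  shows "L [fo y] (E c z) [] \<bullet> L [] (E c y) [fo z] \<bullet> L [p c] X [] = L [] X [p c]"
proof -
  obtain F where F [simp]: "tAr M F" "tdom F = \<one>\<^bsub>M\<^esub>" "tcod F = y \<otimes>\<^sub>M z" "fm F = mu y z \<bullet> X \<bullet> nu'"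
    by (rule fullE[of "mu y z \<bullet> X \<bullet> nu'" "\<one>\<^bsub>M\<^esub>" "y \<otimes>\<^sub>M z"]) simp_all
  have X: "L xs X ys = L xs (mu' y z) ys \<bullet> L xs (fm F) ys \<bullet> L xs nu ys" if "set xs \<subseteq> ob" "set ys \<subseteq> ob" for xs ys
    using that by (simp add: L_cmp cmp_assoc)
  show ?thesis
    using E_natural0[of c F] cmp_cancel[OF E_natural0[of c F]] cmp_cancel[OF E_tns0'[of c y z]] E_unit0[of c]
    by (simp add: X cmp_assoc del: F(4)) (metis cmp_assoc)
qed

lemma slide20:
  assumes [simp]: "c \<in> obj C" "y \<in> obj M" "z \<in> obj M" "Ar X" "Cod X = []" "Dom X = [fo y, fo z]"
  shows "L [] X [p c] \<bullet> L [fo y] (E c z) [] \<bullet> L [] (E c y) [fo z] = L [p c] X []"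
proof -
  obtain F where F [simp]: "tAr M F" "tcod F = \<one>\<^bsub>M\<^esub>" "tdom F = y \<otimes>\<^sub>M z" "fm F = nu \<bullet> X \<bullet> mu' y z"
    by (rule fullE[of "nu \<bullet> X \<bullet> mu' y z" "y \<otimes>\<^sub>M z" "\<one>\<^bsub>M\<^esub>"]) simp_all
  have X: "L xs X ys = L xs nu' ys \<bullet> L xs (fm F) ys \<bullet> L xs (mu y z) ys" if "set xs \<subseteq> ob" "set ys \<subseteq> ob" for xs ys
    using that by (simp add: L_cmp cmp_assoc)
  show ?thesis
    using E_natural0[of c F] cmp_cancel[OF E_natural0[of c F]] E_tns0[of c y z] cmp_cancel[OF E_unit0'[of c]]
    by (simp add: X cmp_assoc del: F(4)) (metis cmp_assoc)
qed

lemma slide21: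
  assumes [simp]: "c \<in> obj C" "y \<in> obj M" "z \<in> obj M" "w \<in> obj M" "Ar X" "Dom X = [fo y, fo z]" "Cod X = [fo w]"
  shows "L [] X [p c] \<bullet> L [fo y] (E c z) [] \<bullet> L [] (E c y) [fo z] = L [] (E c w) [] \<bullet> L [p c] X []"
proof -
  obtain F where F [simp]: "tAr M F" "tcod F = w" "tdom F = y \<otimes>\<^sub>M z" "fm F = X \<bullet> mu' y z"
    by (rule fullE[of "X \<bullet> mu' y z" "y \<otimes>\<^sub>M z" w]) simp_all
  have X: "L xs X ys = L xs (fm F) ys \<bullet> L xs (mu y z) ys" if "set xs \<subseteq> ob" "set ys \<subseteq> ob" for xs ys
    using that by (simp add: L_cmp cmp_assoc)
  show ?thesis
    using E_natural0[of c F] cmp_cancel[OF E_natural0[of c F]] E_tns0[of c y z]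
    by (simp add: X cmp_assoc del: F(4))
qed

lemma slide01:
  assumes [simp]: "c \<in> obj C" "w \<in> obj M" "Ar X" "Dom X = []" "Cod X = [fo w]"
  shows "L [] (E c w) [] \<bullet> L [p c] X [] = L [] X [p c]"
proof -
  obtain F where F [simp]: "tAr M F" "tcod F = w" "tdom F = \<one>\<^bsub>M\<^esub>" "fm F = X \<bullet> nu'"
    by (rule fullE[of "X \<bullet> nu'" "\<one>\<^bsub>M\<^esub>" w]) simp_all
  have X: "L xs X ys = L xs (fm F) ys \<bullet> L xs nu ys" if "set xs \<subseteq> ob" "set ys \<subseteq> ob" for xs ys
    using that by (simp add: L_cmp cmp_assoc)
  show ?thesis
    using E_natural0[of c F] cmp_cancel[OF E_natural0[of c F]] E_unit0[of c]
    by (simp add: X cmp_assoc del: F(4))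
qed

text \<open>The traciator on the level of mates: the last letter \<open>y\<close> of the target of
  \<open>s\<close> is bent around the strand \<open>p c\<close> and arrives in front. The remaining
  letters form an arbitrary word \<open>xs\<close>, so that the fourfold products inside the
  multiplication are covered. \<open>rot'\<close> rotates the first letter back, crossing the dual
  of \<open>y\<close> instead.\<close>

definition rot where
  "rot c xs y s = L (fo y # xs) (sevt y) [] \<bullet> L [fo y] s [fo (dual M y)]
    \<bullet> L [] (E c y) [fo (dual M y)] \<bullet> L [p c] (sco y) []"

definition rot' where
  "rot' c x y r = L [] (sev y) [fo x, fo y] \<bullet> L [fo (dual M y)] r [fo y]
    \<bullet> L [] (E c (dual M y)) [fo y] \<bullet> L [p c] (scot y) []"

lemma rot_arrow [simp]:
  assumes "c \<in> obj C" "x \<in> obj M" "y \<in> obj M" "Ar s" "Dom s = [p c]"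
  shows "Cod s = [fo x, fo y] \<Longrightarrow> Ar (rot c [fo x] y s)" "Cod s = [fo x, fo y] \<Longrightarrow> Dom (rot c [fo x] y s) = [p c]"
    "Cod s = [fo x, fo y] \<Longrightarrow> Cod (rot c [fo x] y s) = [fo y, fo x]"
    "Cod s = [fo y, fo x] \<Longrightarrow> Ar (rot' c x y s)" "Cod s = [fo y, fo x] \<Longrightarrow> Dom (rot' c x y s) = [p c]"
    "Cod s = [fo y, fo x] \<Longrightarrow> Cod (rot' c x y s) = [fo x, fo y]"
  using assms by (simp_all add: rot_def rot'_def)

text \<open>After exchanging independent pieces, the crossings with \<open>y\<close> and with its
  dual stand under the cap of \<open>y\<close>; together they pass it by \<open>slide20\<close>, and
  two zig-zags remain.\<close>

lemma rot'_rot: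
  assumes [simp]: "c \<in> obj C" "x \<in> obj M" "y \<in> obj M" "Ar s" "Dom s = [p c]" "Cod s = [fo x, fo y]"
  shows "rot' c x y (rot c [fo x] y s) = s"
proof -
  let ?y = "fo y" and ?d = "fo (dual M y)" and ?E = "E c y" and ?F = "E c (dual M y)"
  have "rot' c x y (rot c [fo x] y s) = L [] (sev y) [fo x, ?y] \<bullet> L [?d, ?y, fo x] (sevt y) [?y] \<bullet> L [?d, ?y] s [?d, ?y]
      \<bullet> L [?d] ?E [?d, ?y] \<bullet> L [?d, p c] (sco y) [?y] \<bullet> L [] ?F [?y] \<bullet> L [p c] (scot y) []"
    by (simp add: rot_def rot'_def L_cmp cmp_assoc)
  also have "\<dots> = L [fo x] (sevt y) [?y] \<bullet> L [] s [?d, ?y]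
      \<bullet> L [] (L [] (sev y) [p c] \<bullet> L [?d] ?E [] \<bullet> L [] ?F [?y]) [?d, ?y] \<bullet> L [p c, ?d] (sco y) [?y] \<bullet> L [p c] (scot y) []"
    by (simp add: L_cmp cmp_assoc exch)
  also have "\<dots> = s"
    by (simp add: slide20 L_cmp cmp_assoc zz)
      (simp add: exch zzt L_Nil)
  finally show ?thesis .
qed

text \<open>The same with the cup of \<open>y\<close> and \<open>slide02\<close>; here a zig-zag of
  the pivotal pair is removed before the two crossings meet.\<close>

lemma rot_rot':
  assumes [simp]: "c \<in> obj C" "x \<in> obj M" "y \<in> obj M" "Ar r" "Dom r = [p c]" "Cod r = [fo y, fo x]"
  shows "rot c [fo x] y (rot' c x y r) = r"
proof -
  let ?y = "fo y" and ?d = "fo (dual M y)" and ?E = "E c y" and ?F = "E c (dual M y)"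
  have "rot c [fo x] y (rot' c x y r) = L [?y, fo x] (sevt y) [] \<bullet> L [?y] (sev y) [fo x, ?y, ?d] \<bullet> L [?y, ?d] r [?y, ?d]
      \<bullet> L [?y] ?F [?y, ?d] \<bullet> L [?y, p c] (scot y) [?d] \<bullet> L [] ?E [?d] \<bullet> L [p c] (sco y) []"
    by (simp add: rot_def rot'_def L_cmp cmp_assoc)
  also have "\<dots> = L [?y] (sev y) [fo x] \<bullet> L [?y, ?d] r [] \<bullet> L [?y] ?F []
      \<bullet> L [] ?E [?d] \<bullet> L [p c, ?y] (L [?d] (sevt y) [] \<bullet> L [] (scot y) [?d]) [] \<bullet> L [p c] (sco y) []"
    by (simp add: L_cmp cmp_assoc exch)
  also have "\<dots> = L [?y] (sev y) [fo x] \<bullet> L [?y, ?d] r [] \<bullet> (L [?y] ?F [] \<bullet> L [] ?E [?d] \<bullet> L [p c] (sco y) [])"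
    by (simp add: zzt)
  also have "\<dots> = L [?y] (sev y) [fo x] \<bullet> L [] (sco y) [?y, fo x] \<bullet> L [] r []"
    using exchange0[of "sco y" r "[]" "[]" "[]"] by (simp add: slide02)
  also have "\<dots> = r"
    by (simp add: zz L_Nil)
  finally show ?thesis .
qed

text \<open>Arrows of \<open>C\<close> commute with the crossing, so they can be pulled to the
  source of the rotated diagram.\<close>

lemma rot_natural:
  assumes [simp]: "x \<in> obj M" "y \<in> obj M" "tAr C X" "Ar s" "Dom s = [p (tcod X)]" "Cod s = [fo x, fo y]"
  shows "rot (tdom X) [fo x] y (s \<bullet> fm (tF X)) = rot (tcod X) [fo x] y s \<bullet> fm (tF X)"
proof -
  let ?y = "fo y" and ?d = "fo (dual M y)"
  have "rot (tdom X) [fo x] y (s \<bullet> fm (tF X)) = L [?y, fo x] (sevt y) [] \<bullet> L [?y] s [?d]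
    \<bullet> L [] (L [fo y] (fm (tF X)) [] \<bullet> L [] (E (tdom X) y) []) [?d] \<bullet> L [p (tdom X)] (sco y) []"
    by (simp add: rot_def L_cmp cmp_assoc)
  also have "\<dots> = L [?y, fo x] (sevt y) [] \<bullet> L [?y] s [?d]
    \<bullet> L [] (E (tcod X) y) [?d] \<bullet> L [] (fm (tF X)) [?y, ?d] \<bullet> L [p (tdom X)] (sco y) []"
    by (simp add: E_natural_left0 L_cmp cmp_assoc)
  also have "\<dots> = rot (tcod X) [fo x] y s \<bullet> L [] (fm (tF X)) []"
    by (simp add: rot_def cmp_assoc exch)
  finally show ?thesis
    by (simp add: L_Nil)
qed

lemma rot'_natural:
  assumes [simp]: "x \<in> obj M" "y \<in> obj M" "tAr C X" "Ar s" "Dom s = [p (tcod X)]" "Cod s = [fo y, fo x]"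
  shows "rot' (tdom X) x y (s \<bullet> fm (tF X)) = rot' (tcod X) x y s \<bullet> fm (tF X)"
proof -
  let ?y = "fo y" and ?d = "fo (dual M y)"
  have "rot' (tdom X) x y (s \<bullet> fm (tF X)) = L [] (sev y) [fo x, ?y] \<bullet> L [?d] s [?y]
    \<bullet> L [] (L [?d] (fm (tF X)) [] \<bullet> L [] (E (tdom X) (dual M y)) []) [?y] \<bullet> L [p (tdom X)] (scot y) []"
    by (simp add: rot'_def L_cmp cmp_assoc)
  also have "\<dots> = L [] (sev y) [fo x, ?y] \<bullet> L [?d] s [?y]
    \<bullet> L [] (E (tcod X) (dual M y)) [?y] \<bullet> L [] (fm (tF X)) [?d, ?y] \<bullet> L [p (tdom X)] (scot y) []"
    by (simp add: E_natural_left0 L_cmp cmp_assoc)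
  also have "\<dots> = rot' (tcod X) x y s \<bullet> L [] (fm (tF X)) []"
    by (simp add: rot'_def cmp_assoc exch)
  finally show ?thesis
    by (simp add: L_Nil)
qed

section \<open>Mates under the adjunction\<close>

sublocale R: linear_functor M C Tr
  by (rule right_functor)

abbreviation tr where "tr x \<equiv> fobj Tr x"

definition "Ep x = mk M (Ph (tr x)) (\<epsilon> x) x"
definition "tTr F = mk C (tr (tdom F)) (fmor Tr (mor F)) (tr (tcod F))"

declare R.fobj_obj [simp]

lemma Ep_arrow [simp]:
  "x \<in> obj M \<Longrightarrow> tAr M (Ep x)" "x \<in> obj M \<Longrightarrow> tdom (Ep x) = Ph (tr x)" "x \<in> obj M \<Longrightarrow> tcod (Ep x) = x"
  "x \<in> obj M \<Longrightarrow> mor (Ep x) = \<epsilon> x"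
  using counit_in_hom[of x] by (simp_all add: Ep_def)

lemma tTr_arrow [simp]:
  assumes "tAr M F"
  shows "tAr C (tTr F)" "tdom (tTr F) = tr (tdom F)" "tcod (tTr F) = tr (tcod F)" "mor (tTr F) = fmor Tr (mor F)"
  using assms R.fmor_in_hom[OF tAr_sel[OF assms]] by (simp_all add: tTr_def)

lemma Ep_natural: "tAr M F \<Longrightarrow> F \<bullet>\<^sub>D Ep (tdom F) = Ep (tcod F) \<bullet>\<^sub>D tF (tTr F)"
  using counit_natural[OF tAr_sel, of F] by (intro tarr_eqI[of M]) simp_all

definition "Et c = mk C c (\<eta> c) (tr (Ph c))"

lemma Et_arrow [simp]:
  "c \<in> obj C \<Longrightarrow> tAr C (Et c)" "c \<in> obj C \<Longrightarrow> tdom (Et c) = c" "c \<in> obj C \<Longrightarrow> tcod (Et c) = tr (Ph c)"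
  "c \<in> obj C \<Longrightarrow> mor (Et c) = \<eta> c"
  using unit_in_hom[of c] by (simp_all add: Et_def)

lemma tTr_cmp: "\<lbrakk>tAr M Y; tAr M X; tdom Y = tcod X\<rbrakk> \<Longrightarrow> tTr (Y \<bullet>\<^sub>D X) = tTr Y \<bullet>\<^sub>t tTr X"
  using R.fmor_comp[of "tdom X" "tcod X" "tcod Y" "mor X" "mor Y"] tAr_sel[of M X] tAr_sel[of M Y]
  by (intro tarr_eqI[of C]) simp_all

lemma Et_natural: "tAr C X \<Longrightarrow> tTr (tF X) \<bullet>\<^sub>t Et (tdom X) = Et (tcod X) \<bullet>\<^sub>t X"
  using unit_natural[OF tAr_sel, of X] by (intro tarr_eqI[of C]) simp_all

lemma Ep_Et: "c \<in> obj C \<Longrightarrow> Ep (Ph c) \<bullet>\<^sub>D tF (Et c) = tid M (Ph c)"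
  using triangle_left by (intro tarr_eqI[of M]) simp_all

lemma Ep_Et': "x \<in> obj M \<Longrightarrow> tTr (Ep x) \<bullet>\<^sub>t Et (tr x) = tid C (tr x)"
  using triangle_right by (intro tarr_eqI[of C]) simp_all

text \<open>The usual formula for the adjoint transpose, free of the description operator in
  \<open>unmate\<close>.\<close>

definition "um c Y = tTr Y \<bullet>\<^sub>t Et c"

lemma um_arrow [simp]:
  assumes "tAr M Y" "c \<in> obj C" "tdom Y = Ph c"
  shows "tAr C (um c Y)" "tdom (um c Y) = c" "tcod (um c Y) = tr (tcod Y)"
  using assms by (simp_all add: um_def)

lemma Ep_um:
  assumes "tAr M Y" "c \<in> obj C" "tdom Y = Ph c"
  shows "Ep (tcod Y) \<bullet>\<^sub>D tF (um c Y) = Y"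
proof -
  have "Ep (tcod Y) \<bullet>\<^sub>D tF (um c Y) = (Ep (tcod Y) \<bullet>\<^sub>D tF (tTr Y)) \<bullet>\<^sub>D tF (Et c)"
    using assms by (simp add: um_def tF_cmp D.cmp_assoc)
  also have "\<dots> = Y"
    using assms unfolding Ep_natural[OF assms(1), symmetric] by (simp add: D.cmp_assoc Ep_Et)
  finally show ?thesis .
qed

lemma um_Ep:
  assumes "tAr C X" "x \<in> obj M" "tcod X = tr x"
  shows "um (tdom X) (Ep x \<bullet>\<^sub>D tF X) = X"
  using assms Et_natural[OF assms(1)] C.cmp_cancel[OF Ep_Et'[OF assms(2)], of X]
  by (simp add: um_def tTr_cmp C.cmp_assoc)

lemma mate_inj:
  assumes "Ep x \<bullet>\<^sub>D tF X = Ep x \<bullet>\<^sub>D tF X'" "x \<in> obj M" "tAr C X" "tAr C X'"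
    "tdom X = tdom X'" "tcod X = tr x" "tcod X' = tr x"
  shows "X = X'"
  using um_Ep[of X x] um_Ep[of X' x] assms by metis

text \<open>\<open>Ep_um\<close> supplies existence and \<open>mate_inj\<close> uniqueness for the
  description in \<open>unmate\<close>.\<close>

lemma unmate_eq:
  assumes [simp]: "tAr M Y" "c \<in> obj C" "tdom Y = Ph c" "tcod Y = x"
  shows "unmate C M \<Phi>Z Tr \<epsilon> c x (mor Y) = mor (um c Y)"
  unfolding unmate_def
proof (rule the_equality)
  have x: "x \<in> obj M"
    using assms by (metis tAr_sel(2))
  show "mor (um c Y) \<in> hom C c (tr x) \<and> \<epsilon> x \<cdot>\<^bsub>M\<^esub> fmor (phi M \<Phi>Z) (mor (um c Y)) = mor Y"
    using tAr_sel(3)[of C "um c Y"] arg_cong[OF Ep_um[of Y c], of mor] x by simp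
  fix g
  assume g: "g \<in> hom C c (tr x) \<and> \<epsilon> x \<cdot>\<^bsub>M\<^esub> fmor (phi M \<Phi>Z) g = mor Y"
  have "mk C c g (tr x) = um c Y"
  proof (rule mate_inj)
    show "Ep x \<bullet>\<^sub>D tF (mk C c g (tr x)) = Ep x \<bullet>\<^sub>D tF (um c Y)"
      using g x Ep_um[of Y c] by (intro tarr_eqI[of M]) simp_all
  qed (use g x in simp_all)
  then show "g = mor (um c Y)"
    using g x mk_sel(3)[of c C "tr x" g] by simp
qed

text \<open>The counit at a product with its target split into two letters, the form in which it
  enters strict diagrams. By \<open>ep_inj\<close> and \<open>ep_surj\<close>, composition with it
  is a bijection from the arrows into the trace of the product of \<open>x\<close> and
  \<open>y\<close> to the strict diagrams with target \<open>[fo x, fo y]\<close>.\<close>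

definition ep where "ep x y = mu' x y \<bullet> fm (Ep (x \<otimes>\<^sub>M y))"

lemma ep_arrow [simp]:
  assumes "x \<in> obj M" "y \<in> obj M"
  shows "Ar (ep x y)" "Dom (ep x y) = [p (tr (x \<otimes>\<^sub>M y))]" "Cod (ep x y) = [fo x, fo y]"
  using assms by (simp_all add: ep_def)

lemma L_Ep:
  assumes "x \<in> obj M" "y \<in> obj M" "set xs \<subseteq> ob" "set ys \<subseteq> ob"
  shows "L xs (fm (Ep (x \<otimes>\<^sub>M y))) ys = L xs (mu x y) ys \<bullet> L xs (ep x y) ys"
  using assms by (simp add: ep_def L_cmp)

lemma ep_inj:
  assumes "ep x y \<bullet> fm (tF X) = ep x y \<bullet> fm (tF X')" "x \<in> obj M" "y \<in> obj M" "tAr C X" "tAr C X'"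
    "tdom X = tdom X'" "tcod X = tr (x \<otimes>\<^sub>M y)" "tcod X' = tr (x \<otimes>\<^sub>M y)"
  shows "X = X'"
proof (rule mate_inj)
  have "mu x y \<bullet> ep x y \<bullet> fm (tF X) = mu x y \<bullet> ep x y \<bullet> fm (tF X')"
    using assms by simp
  then have "fm (Ep (x \<otimes>\<^sub>M y) \<bullet>\<^sub>D tF X) = fm (Ep (x \<otimes>\<^sub>M y) \<bullet>\<^sub>D tF X')"
    using assms cmp_cancel[OF mu_mu'[of x y]] by (simp add: ep_def cmp_assoc fm_cmp)
  then show "Ep (x \<otimes>\<^sub>M y) \<bullet>\<^sub>D tF X = Ep (x \<otimes>\<^sub>M y) \<bullet>\<^sub>D tF X'"
    by (rule fm_faithful) (use assms in simp_all)
qed (use assms in simp_all)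

lemma ep_surj:
  assumes "x \<in> obj M" "y \<in> obj M" "c \<in> obj C" "Ar s" "Dom s = [p c]" "Cod s = [fo x, fo y]"
  obtains X where "tAr C X" "tdom X = c" "tcod X = tr (x \<otimes>\<^sub>M y)" "ep x y \<bullet> fm (tF X) = s"
proof -
  obtain F where F: "tAr M F" "tdom F = Ph c" "tcod F = x \<otimes>\<^sub>M y" "fm F = mu x y \<bullet> s"
    by (rule fullE[of "mu x y \<bullet> s" "Ph c" "x \<otimes>\<^sub>M y"]) (use assms in simp_all)
  have "ep x y \<bullet> fm (tF (um c F)) = mu' x y \<bullet> fm (Ep (x \<otimes>\<^sub>M y) \<bullet>\<^sub>D tF (um c F))"
    using assms F by (simp add: ep_def cmp_assoc fm_cmp)
  also have "\<dots> = s"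
    using F assms Ep_um[of F c] cmp_cancel[OF mu'_mu[of x y], of s] by simp
  finally show ?thesis
    using that[of "um c F"] F assms by simp
qed

section \<open>Traciators and multiplication maps as typed arrows\<close>

definition tau where
  "tau x y = (let c = tr (x \<otimes>\<^sub>M y); y' = dual M y in
     um c (D.Ru (y \<otimes>\<^sub>M x) \<bullet>\<^sub>D (tid M (y \<otimes>\<^sub>M x) \<boxtimes>\<^sub>D D.Evt y) \<bullet>\<^sub>D D.As (y \<otimes>\<^sub>M x) y y'
       \<bullet>\<^sub>D (D.Ai y x y \<boxtimes>\<^sub>D tid M y') \<bullet>\<^sub>D ((tid M y \<boxtimes>\<^sub>D Ep (x \<otimes>\<^sub>M y)) \<boxtimes>\<^sub>D tid M y')
       \<bullet>\<^sub>D (Eb c y \<boxtimes>\<^sub>D tid M y') \<bullet>\<^sub>D D.Ai (Ph c) y y' \<bullet>\<^sub>D (tid M (Ph c) \<boxtimes>\<^sub>D D.Co y) \<bullet>\<^sub>D D.Ri (Ph c)))"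

lemma tau_arrow [simp]:
  assumes "x \<in> obj M" "y \<in> obj M"
  shows "tAr C (tau x y)" "tdom (tau x y) = tr (x \<otimes>\<^sub>M y)" "tcod (tau x y) = tr (y \<otimes>\<^sub>M x)"
  using assms by (simp_all add: tau_def Let_def)

lemma mor_tau:
  assumes "x \<in> obj M" "y \<in> obj M"
  shows "traciator C M \<Phi>Z Tr \<epsilon> x y = mor (tau x y)"
  unfolding traciator_def tau_def Let_def
  by (subst unmate_eq[symmetric]) (use assms in simp_all)

text \<open>All associators and unitors in the definition of the traciator become merges and splits
  and cancel; what is left is the rotation of the counit.\<close>

lemma tau_mate:
  assumes [simp]: "x \<in> obj M" "y \<in> obj M"
  shows "ep y x \<bullet> fm (tF (tau x y)) = rot (tr (x \<otimes>\<^sub>M y)) [fo x] y (ep x y)"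
proof -
  have "ep y x \<bullet> fm (tF (tau x y)) = L [] (mu' y x) [] \<bullet> L [] (fm (Ep (y \<otimes>\<^sub>M x) \<bullet>\<^sub>D tF (tau x y))) []"
    by (simp add: ep_def cmp_assoc L_Nil fm_cmp del: L_fm_cmp)
  also have "Ep (y \<otimes>\<^sub>M x) \<bullet>\<^sub>D tF (tau x y) = (let c = tr (x \<otimes>\<^sub>M y); y' = dual M y in
       D.Ru (y \<otimes>\<^sub>M x) \<bullet>\<^sub>D (tid M (y \<otimes>\<^sub>M x) \<boxtimes>\<^sub>D D.Evt y) \<bullet>\<^sub>D D.As (y \<otimes>\<^sub>M x) y y'
       \<bullet>\<^sub>D (D.Ai y x y \<boxtimes>\<^sub>D tid M y') \<bullet>\<^sub>D ((tid M y \<boxtimes>\<^sub>D Ep (x \<otimes>\<^sub>M y)) \<boxtimes>\<^sub>D tid M y')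
       \<bullet>\<^sub>D (Eb c y \<boxtimes>\<^sub>D tid M y') \<bullet>\<^sub>D D.Ai (Ph c) y y' \<bullet>\<^sub>D (tid M (Ph c) \<boxtimes>\<^sub>D D.Co y) \<bullet>\<^sub>D D.Ri (Ph c))"
    unfolding tau_def Let_def by (subst Ep_um[symmetric]) simp_all
  also have "L [] (mu' y x) [] \<bullet> L [] (fm \<dots>) [] = rot (tr (x \<otimes>\<^sub>M y)) [fo x] y (ep x y)"
    by (simp add: Let_def L_fm L_fm_ev L_Eb L_Ep rot_def cmp_assoc exch)
  finally show ?thesis .
qed

text \<open>Why the multiplication with traciators has a simple mate. The argument of the first
  rotation nests the letters of \<open>r\<close> between the letters \<open>x\<close> and
  \<open>y\<close> of \<open>s\<close>, using an inverse crossing. Rotating \<open>y\<close> around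
  both strands undoes this crossing, so that the rotation of \<open>s\<close> appears next to
  \<open>r\<close>.\<close>

lemma rot_tns:
  assumes [simp]: "c \<in> obj C" "d \<in> obj C" "x \<in> obj M" "y \<in> obj M" "z \<in> obj M" "w \<in> obj M"
    "Ar s" "Dom s = [p c]" "Cod s = [fo x, fo y]" "Ar r" "Dom r = [p d]" "Cod r = [fo z, fo w]"
  shows "rot (c \<otimes> d) [fo x, fo z, fo w] y
      (L [fo x] r [fo y] \<bullet> L [fo x] (E' d y) [] \<bullet> L [] s [p d] \<bullet> L [] (cmu' c d) []) \<bullet> L [] (cmu c d) []
    = L [] (rot c [fo x] y s) [fo z, fo w] \<bullet> L [p c] r []"
proof -
  let ?x = "fo x" and ?y = "fo y" and ?d = "fo (dual M y)"
  have 1: "L [] (E d y) [?d] \<bullet> L [p d] (sco y) [] = L [?y] (E' d (dual M y)) [] \<bullet> L [] (sco y) [p d]"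
    by (subst slide02[of d y "dual M y", symmetric]) simp_all
  have "L [p d] (sevt y) [] \<bullet> L [] (E' d y) [?d] = L [] (sevt y) [p d] \<bullet> L [?y] (E d (dual M y)) []
      \<bullet> L [] (E d y) [?d] \<bullet> L [] (E' d y) [?d]"
    by (subst slide20[of d y "dual M y", symmetric]) (simp_all add: cmp_assoc)
  then have 2: "L [p d] (sevt y) [] \<bullet> L [] (E' d y) [?d] = L [] (sevt y) [p d] \<bullet> L [?y] (E d (dual M y)) []"
    by simp
  have "rot (c \<otimes> d) [?x, fo z, fo w] y
      (L [?x] r [?y] \<bullet> L [?x] (E' d y) [] \<bullet> L [] s [p d] \<bullet> L [] (cmu' c d) []) \<bullet> L [] (cmu c d) []
    = L [?y, ?x, fo z, fo w] (sevt y) [] \<bullet> L [?y, ?x] r [?y, ?d] \<bullet> L [?y, ?x] (E' d y) [?d]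
      \<bullet> L [?y] s [p d, ?d] \<bullet> L [?y] (cmu' c d) [?d] \<bullet> L [] (L [] (E (c \<otimes> d) y) [] \<bullet> L [] (cmu c d) [?y]) [?d]
      \<bullet> L [p c, p d] (sco y) []"
    by (simp add: rot_def L_cmp cmp_assoc exch)
  also have "\<dots> = L [?y, ?x] r [] \<bullet> L [?y, ?x] (L [p d] (sevt y) [] \<bullet> L [] (E' d y) [?d]) []
      \<bullet> L [?y] s [p d, ?d] \<bullet> L [] (E c y) [p d, ?d] \<bullet> L [p c] (L [] (E d y) [?d] \<bullet> L [p d] (sco y) []) []"
    by (simp add: E_tns_left0 L_cmp cmp_assoc FS.mu_cancel exch)
  also have "\<dots> = L [] (rot c [?x] y s) [fo z, fo w] \<bullet> L [p c] r []"
    unfolding 1 2 by (simp add: rot_def L_cmp cmp_assoc exch)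
  finally show ?thesis .
qed

text \<open>The rotation only moves the last letter, so an arrow \<open>k\<close> on the others may
  be applied before or after it. In \<open>product_formula\<close> this brings the merging of
  letters out of the rotation.\<close>

lemma rot_L:
  assumes [simp]: "c \<in> obj C" "y \<in> obj M" "Ar s" "Dom s = [p c]" "Cod s = xs @ [fo y]" "Ar k" "Dom k = xs"
  shows "rot c (Cod k) y (L [] k [fo y] \<bullet> s) = L [fo y] k [] \<bullet> rot c xs y s"
proof -
  have [simp]: "set xs \<subseteq> ob"
    using Dom_subset(1)[of k] by simp
  show ?thesis
    using cmp_cancel[OF exchange0[of k "sevt y" "[fo y]" "[]" "[]"]]
    by (simp add: rot_def L_cmp cmp_assoc)
qed

text \<open>Naturality of the counit, with the products split into letters at both ends.\<close>

lemma ep_tTr: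
  assumes [simp]: "tAr M F" "tdom F = x \<otimes>\<^sub>M y" "tcod F = z \<otimes>\<^sub>M w" "x \<in> obj M" "y \<in> obj M" "z \<in> obj M" "w \<in> obj M"
    "set xs \<subseteq> ob" "set ys \<subseteq> ob"
  shows "L xs (ep z w) ys \<bullet> L xs (fm (tF (tTr F))) ys
    = L xs (mu' z w) ys \<bullet> L xs (fm F) ys \<bullet> L xs (mu x y) ys \<bullet> L xs (ep x y) ys"
proof -
  have "Ep (z \<otimes>\<^sub>M w) \<bullet>\<^sub>D tF (tTr F) = F \<bullet>\<^sub>D Ep (x \<otimes>\<^sub>M y)"
    using Ep_natural[of F] by simp
  then have "L xs (mu' z w) ys \<bullet> L xs (fm (Ep (z \<otimes>\<^sub>M w) \<bullet>\<^sub>D tF (tTr F))) ys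
      = L xs (mu' z w) ys \<bullet> L xs (fm (F \<bullet>\<^sub>D Ep (x \<otimes>\<^sub>M y))) ys"
    by (simp only:)
  then show ?thesis
    by (simp add: L_Ep cmp_assoc)
qed

text \<open>The candidate is the arrow whose mate is \<open>rot'\<close> of the counit; naturality
  of the rotations reduces the two composites to \<open>rot_rot'\<close> and
  \<open>rot'_rot\<close>.\<close>

lemma ex_tau':
  assumes [simp]: "x \<in> obj M" "y \<in> obj M"
  shows "\<exists>X. tAr C X \<and> tdom X = tr (y \<otimes>\<^sub>M x) \<and> tcod X = tr (x \<otimes>\<^sub>M y)
    \<and> tau x y \<bullet>\<^sub>t X = tid C (tr (y \<otimes>\<^sub>M x)) \<and> X \<bullet>\<^sub>t tau x y = tid C (tr (x \<otimes>\<^sub>M y))"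
proof -
  let ?c = "tr (x \<otimes>\<^sub>M y)" and ?d = "tr (y \<otimes>\<^sub>M x)"
  obtain X where X [simp]: "tAr C X" "tdom X = ?d" "tcod X = ?c" and epX: "ep x y \<bullet> fm (tF X) = rot' ?d x y (ep y x)"
    by (rule ep_surj[of x y ?d "rot' ?d x y (ep y x)"]) simp_all
  have "ep y x \<bullet> fm (tF (tau x y \<bullet>\<^sub>t X)) = (ep y x \<bullet> fm (tF (tau x y))) \<bullet> fm (tF X)"
    by (simp add: tF_cmp fm_cmp cmp_assoc)
  also have "\<dots> = rot ?d [fo x] y (ep x y \<bullet> fm (tF X))"
    using rot_natural[of x y X "ep x y"] by (simp add: tau_mate)
  also have "\<dots> = ep y x \<bullet> fm (tF (tid C ?d))"
    by (simp add: epX rot_rot' tF_id fm_id)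
  finally have 1: "tau x y \<bullet>\<^sub>t X = tid C ?d"
    by (rule ep_inj) simp_all
  have "ep x y \<bullet> fm (tF (X \<bullet>\<^sub>t tau x y)) = (ep x y \<bullet> fm (tF X)) \<bullet> fm (tF (tau x y))"
    by (simp add: tF_cmp fm_cmp cmp_assoc)
  also have "\<dots> = rot' ?c x y (ep y x \<bullet> fm (tF (tau x y)))"
    using rot'_natural[of x y "tau x y" "ep y x"] by (simp add: epX)
  also have "\<dots> = ep x y \<bullet> fm (tF (tid C ?c))"
    by (simp add: tau_mate rot'_rot tF_id fm_id)
  finally have 2: "X \<bullet>\<^sub>t tau x y = tid C ?c"
    by (rule ep_inj) simp_all
  show ?thesis
    using 1 2 X by blast
qed

text \<open>The value comes from \<open>inv_mor\<close>, so it is only formally an arrow here;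
  typing and inverse laws follow from \<open>ex_tau'\<close> and the uniqueness of inverses.\<close>

definition tau' where
  "tau' x y = mk C (tr (y \<otimes>\<^sub>M x)) (traciator_minus C M \<Phi>Z Tr \<epsilon> y x) (tr (x \<otimes>\<^sub>M y))"

lemma tau'_arrow [simp]:
  assumes [simp]: "x \<in> obj M" "y \<in> obj M"
  shows "tAr C (tau' x y)" "tdom (tau' x y) = tr (y \<otimes>\<^sub>M x)" "tcod (tau' x y) = tr (x \<otimes>\<^sub>M y)"
    "tau x y \<bullet>\<^sub>t tau' x y = tid C (tr (y \<otimes>\<^sub>M x))" "tau' x y \<bullet>\<^sub>t tau x y = tid C (tr (x \<otimes>\<^sub>M y))"
    "mor (tau' x y) = traciator_minus C M \<Phi>Z Tr \<epsilon> y x"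
proof -
  obtain X where X: "tAr C X" "tdom X = tr (y \<otimes>\<^sub>M x)" "tcod X = tr (x \<otimes>\<^sub>M y)"
    "tau x y \<bullet>\<^sub>t X = tid C (tr (y \<otimes>\<^sub>M x))" "X \<bullet>\<^sub>t tau x y = tid C (tr (x \<otimes>\<^sub>M y))"
    using ex_tau'[OF assms] by blast
  have "is_inverse C (tr (x \<otimes>\<^sub>M y)) (tr (y \<otimes>\<^sub>M x)) (mor (tau x y)) (mor X)"
    using X tAr_sel(3)[of C X] tAr_sel(3)[of C "tau x y"] by (subst C.is_inverse_iff) simp_all
  then have m: "traciator_minus C M \<Phi>Z Tr \<epsilon> y x = mor X"
    unfolding traciator_minus_def mor_tau[OF assms] by (rule C.inv_mor_eq) simp_all
  then have "tau' x y = X"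
    using X unfolding tau'_def by simp
  then show "tAr C (tau' x y)" "tdom (tau' x y) = tr (y \<otimes>\<^sub>M x)" "tcod (tau' x y) = tr (x \<otimes>\<^sub>M y)"
    "tau x y \<bullet>\<^sub>t tau' x y = tid C (tr (y \<otimes>\<^sub>M x))" "tau' x y \<bullet>\<^sub>t tau x y = tid C (tr (x \<otimes>\<^sub>M y))"
    "mor (tau' x y) = traciator_minus C M \<Phi>Z Tr \<epsilon> y x"
    using X m by simp_all
qed

definition tmult where
  "tmult x y = um (tr x \<otimes> tr y) ((Ep x \<boxtimes>\<^sub>D Ep y) \<bullet>\<^sub>D tFm' (tr x) (tr y))"

lemma tmult_arrow [simp]:
  assumes "x \<in> obj M" "y \<in> obj M"
  shows "tAr C (tmult x y)" "tdom (tmult x y) = tr x \<otimes> tr y" "tcod (tmult x y) = tr (x \<otimes>\<^sub>M y)"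
  using assms by (simp_all add: tmult_def)

lemma mor_tmult:
  assumes "x \<in> obj M" "y \<in> obj M"
  shows "tr_mult C M \<Phi>Z Tr \<epsilon> x y = mor (tmult x y)"
proof -
  have "mor (tFm' (tr x) (tr y)) = inv_mor M (Ph (tr x) \<otimes>\<^sub>M Ph (tr y)) (Ph (tr x \<otimes> tr y)) (fmult (phi M \<Phi>Z) (tr x) (tr y))"
    using D.inverse_arrows(2)[OF fmult_iso[of "tr x" "tr y"]] assms by (simp add: tFm'_def)
  then show ?thesis
    unfolding tr_mult_def tmult_def by (subst unmate_eq[symmetric]) (use assms in simp_all)
qed

lemma ep_tmult:
  assumes [simp]: "x \<in> obj M" "y \<in> obj M"
  shows "L [] (ep x y) [] \<bullet> L [] (fm (tF (tmult x y))) [] \<bullet> L [] (cmu (tr x) (tr y)) []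
    = L [] (fm (Ep x)) [fo y] \<bullet> L [p (tr x)] (fm (Ep y)) []"
proof -
  have "Ep (x \<otimes>\<^sub>M y) \<bullet>\<^sub>D tF (tmult x y) = (Ep x \<boxtimes>\<^sub>D Ep y) \<bullet>\<^sub>D tFm' (tr x) (tr y)"
    using Ep_um[of "(Ep x \<boxtimes>\<^sub>D Ep y) \<bullet>\<^sub>D tFm' (tr x) (tr y)" "tr x \<otimes> tr y"] by (simp add: tmult_def)
  then have "L [] (mu' x y) [] \<bullet> L [] (fm (Ep (x \<otimes>\<^sub>M y) \<bullet>\<^sub>D tF (tmult x y))) [] \<bullet> L [] (cmu (tr x) (tr y)) []
    = L [] (mu' x y) [] \<bullet> L [] (fm ((Ep x \<boxtimes>\<^sub>D Ep y) \<bullet>\<^sub>D tFm' (tr x) (tr y))) [] \<bullet> L [] (cmu (tr x) (tr y)) []"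
    by (simp only:)
  then show ?thesis
    by (simp add: L_Ep L_fm L_cmu fm_cancel[OF tFm_arrow(9)] cmp_assoc)
qed

end

section \<open>Algebra objects as strict diagrams\<close>

context strong_functor
begin

definition "smult A = fm (mk C (alg_obj A \<otimes> alg_obj A) (alg_mult A) (alg_obj A)) \<bullet> mu (alg_obj A) (alg_obj A)"
definition "sunit A = fm (mk C \<one> (alg_unit A) (alg_obj A)) \<bullet> nu"

lemma is_algebraD:
  assumes "is_algebra C A"
  shows "alg_obj A \<in> obj C" "alg_mult A \<in> hom C (alg_obj A \<otimes> alg_obj A) (alg_obj A)" "alg_unit A \<in> hom C \<one> (alg_obj A)"
    "alg_mult A \<cdot> (alg_mult A \<star> idm C (alg_obj A))
      = alg_mult A \<cdot> (idm C (alg_obj A) \<star> alg_mult A) \<cdot> assoc C (alg_obj A) (alg_obj A) (alg_obj A)"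
    "alg_mult A \<cdot> (alg_unit A \<star> idm C (alg_obj A)) = lunit C (alg_obj A)"
    "alg_mult A \<cdot> (idm C (alg_obj A) \<star> alg_unit A) = runit C (alg_obj A)"
  using assms by (simp_all add: is_algebra_def Let_def)

lemma salg_arrow:
  assumes "is_algebra C A"
  shows "Ar (smult A)" "Dom (smult A) = [fo (alg_obj A), fo (alg_obj A)]" "Cod (smult A) = [fo (alg_obj A)]"
    "Ar (sunit A)" "Dom (sunit A) = []" "Cod (sunit A) = [fo (alg_obj A)]"
  using is_algebraD(1-3)[OF assms] by (simp_all add: smult_def sunit_def)

lemma L_salg:
  assumes "is_algebra C A" "set xs \<subseteq> ob" "set ys \<subseteq> ob"
  shows "L xs (smult A) ys = L xs (fm (mk C (alg_obj A \<otimes> alg_obj A) (alg_mult A) (alg_obj A))) ys \<bullet> L xs (mu (alg_obj A) (alg_obj A)) ys"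
    "L xs (sunit A) ys = L xs (fm (mk C \<one> (alg_unit A) (alg_obj A))) ys \<bullet> L xs nu ys"
  using is_algebraD(1-3)[OF assms(1)] assms(2,3) by (simp_all add: smult_def sunit_def L_cmp)

lemma L_fm_alg:
  assumes "is_algebra C A" "set xs \<subseteq> ob" "set ys \<subseteq> ob"
  shows "L xs (fm (mk C (alg_obj A \<otimes> alg_obj A) (alg_mult A) (alg_obj A))) ys = L xs (smult A) ys \<bullet> L xs (mu' (alg_obj A) (alg_obj A)) ys"
    "L xs (fm (mk C \<one> (alg_unit A) (alg_obj A))) ys = L xs (sunit A) ys \<bullet> L xs nu' ys"
  using is_algebraD(1-3)[OF assms(1)] assms(2,3) by (simp_all add: L_salg[OF assms] cmp_assoc)

lemma salg_laws:
  assumes A: "is_algebra C A"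
  defines "a \<equiv> fo (alg_obj A)"
  shows "L [] (smult A) [] \<bullet> L [] (smult A) [a] = L [] (smult A) [] \<bullet> L [a] (smult A) []"
    "L [] (smult A) [] \<bullet> L [] (sunit A) [a] = Id [a]"
    "L [] (smult A) [] \<bullet> L [a] (sunit A) [] = Id [a]"
proof -
  let ?a = "alg_obj A"
  let ?m = "mk C (?a \<otimes> ?a) (alg_mult A) ?a" and ?i = "mk C \<one> (alg_unit A) ?a"
  note [simp] = is_algebraD(1-3)[OF A] salg_arrow[OF A]
  note laws = is_algebraD(4-6)[OF A]
  have "?m \<bullet>\<^sub>t (?m \<boxtimes>\<^sub>t tid C ?a) = ?m \<bullet>\<^sub>t (tid C ?a \<boxtimes>\<^sub>t ?m) \<bullet>\<^sub>t C.As ?a ?a ?a"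
    by (rule tarr_eqI[of C]) (simp_all add: laws)
  then have "L [] (fm (?m \<bullet>\<^sub>t (?m \<boxtimes>\<^sub>t tid C ?a))) [] \<bullet> L [] (mu (?a \<otimes> ?a) ?a) [] \<bullet> L [] (mu ?a ?a) [a]
    = L [] (fm (?m \<bullet>\<^sub>t (tid C ?a \<boxtimes>\<^sub>t ?m) \<bullet>\<^sub>t C.As ?a ?a ?a)) [] \<bullet> L [] (mu (?a \<otimes> ?a) ?a) [] \<bullet> L [] (mu ?a ?a) [a]"
    by (simp only:)
  then show "L [] (smult A) [] \<bullet> L [] (smult A) [a] = L [] (smult A) [] \<bullet> L [a] (smult A) []"
    by (simp add: L_fm L_fm_alg[OF A] cmp_assoc a_def)
  have "?m \<bullet>\<^sub>t (?i \<boxtimes>\<^sub>t tid C ?a) = C.Lu ?a"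
    by (rule tarr_eqI[of C]) (simp_all add: laws)
  then have "L [] (fm (?m \<bullet>\<^sub>t (?i \<boxtimes>\<^sub>t tid C ?a))) [] \<bullet> L [] (mu \<one> ?a) [] \<bullet> L [] nu [a]
     = L [] (fm (C.Lu ?a)) [] \<bullet> L [] (mu \<one> ?a) [] \<bullet> L [] nu [a]"
    by (simp only:)
  then show "L [] (smult A) [] \<bullet> L [] (sunit A) [a] = Id [a]"
    by (simp add: L_fm L_fm_alg[OF A] cmp_assoc a_def)
  have "?m \<bullet>\<^sub>t (tid C ?a \<boxtimes>\<^sub>t ?i) = C.Ru ?a"
    by (rule tarr_eqI[of C]) (simp_all add: laws)
  then have "L [] (fm (?m \<bullet>\<^sub>t (tid C ?a \<boxtimes>\<^sub>t ?i))) [] \<bullet> L [] (mu ?a \<one>) [] \<bullet> L [a] nu []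
     = L [] (fm (C.Ru ?a)) [] \<bullet> L [] (mu ?a \<one>) [] \<bullet> L [a] nu []"
    by (simp only:)
  then show "L [] (smult A) [] \<bullet> L [a] (sunit A) [] = Id [a]"
    by (simp add: L_fm L_fm_alg[OF A] cmp_assoc a_def)
qed

end

section \<open>The algebra structure on the trace of a tensor product\<close>

locale trace_of_algebras = trace_setting +
  fixes A B
  assumes A: "is_algebra M A" and B: "is_algebra M B"
begin

abbreviation a where "a \<equiv> alg_obj A"
abbreviation b where "b \<equiv> alg_obj B"
abbreviation t where "t \<equiv> tr (a \<otimes>\<^sub>M b)"
abbreviation \<alpha> where "\<alpha> \<equiv> fo a"
abbreviation \<beta> where "\<beta> \<equiv> fo b"
abbreviation mA where "mA \<equiv> smult A"
abbreviation mB where "mB \<equiv> smult B"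
abbreviation iA where "iA \<equiv> sunit A"
abbreviation iB where "iB \<equiv> sunit B"
abbreviation e where "e \<equiv> ep a b"

lemmas [simp] = is_algebraD(1-3)[OF A] is_algebraD(1-3)[OF B] salg_arrow[OF A] salg_arrow[OF B]

abbreviation "tmA \<equiv> mk M (a \<otimes>\<^sub>M a) (alg_mult A) a"
abbreviation "tmB \<equiv> mk M (b \<otimes>\<^sub>M b) (alg_mult B) b"
abbreviation "tiA \<equiv> mk M \<one>\<^bsub>M\<^esub> (alg_unit A) a"
abbreviation "tiB \<equiv> mk M \<one>\<^bsub>M\<^esub> (alg_unit B) b"

text \<open>The multiplication and the unit of \<open>tr_algebra\<close>, rebuilt as typed arrows;
  \<open>tr_algebra_eq\<close> makes the identification.\<close>

definition "mT = tTr (tmA \<boxtimes>\<^sub>D tmB) \<bullet>\<^sub>t tTr (D.As (a \<otimes>\<^sub>M a) b b) \<bullet>\<^sub>t tau' ((a \<otimes>\<^sub>M a) \<otimes>\<^sub>M b) b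
  \<bullet>\<^sub>t tTr ((tid M b \<boxtimes>\<^sub>D D.Ai a a b) \<bullet>\<^sub>D D.As b a (a \<otimes>\<^sub>M b)) \<bullet>\<^sub>t tmult (b \<otimes>\<^sub>M a) (a \<otimes>\<^sub>M b)
  \<bullet>\<^sub>t (tau a b \<boxtimes>\<^sub>t tid C t)"

definition "iT = tTr ((tiA \<boxtimes>\<^sub>D tiB) \<bullet>\<^sub>D D.Li \<one>\<^bsub>M\<^esub>) \<bullet>\<^sub>t tTr tFn' \<bullet>\<^sub>t Et \<one>"

lemma mT_arrow [simp]: "tAr C mT" "tdom mT = t \<otimes> t" "tcod mT = t"
  by (simp_all add: mT_def)

lemma iT_arrow [simp]: "tAr C iT" "tdom iT = \<one>" "tcod iT = t"
  by (simp_all add: iT_def)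

lemma tr_algebra_eq: "tr_algebra C M \<Phi>Z Tr \<eta> \<epsilon> A B = \<lparr>alg_obj = t, alg_mult = mor mT, alg_unit = mor iT\<rparr>"
proof -
  have n: "mor tFn' = inv_mor M \<one>\<^bsub>M\<^esub> (Ph \<one>) (funit (phi M \<Phi>Z))"
    using D.inverse_arrows(2)[OF funit_iso] unfolding tFn'_def by (intro mk_sel(3)) simp_all
  have i: "mor iT = alg_unit (tr_algebra C M \<Phi>Z Tr \<eta> \<epsilon> A B)"
    unfolding tr_algebra_def Let_def iT_def tr_unit_def n[symmetric] by simp
  have m: "mor mT = alg_mult (tr_algebra C M \<Phi>Z Tr \<eta> \<epsilon> A B)"
    unfolding tr_algebra_def Let_def mT_def
    by (simp add: mor_tau mor_tmult)
  show ?thesis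
    unfolding i m by (simp add: tr_algebra_def Let_def)
qed

lemma L_tau_mate:
  assumes "x \<in> obj M" "y \<in> obj M" "set xs \<subseteq> ob" "set ys \<subseteq> ob"
  shows "L xs (ep y x) ys \<bullet> L xs (fm (tF (tau x y))) ys = L xs (rot (tr (x \<otimes>\<^sub>M y)) [fo x] y (ep x y)) ys"
    "L xs (ep y x) ys \<bullet> L xs (fm (tF (tau x y))) ys \<bullet> k = L xs (rot (tr (x \<otimes>\<^sub>M y)) [fo x] y (ep x y)) ys \<bullet> k"
proof -
  show "L xs (ep y x) ys \<bullet> L xs (fm (tF (tau x y))) ys = L xs (rot (tr (x \<otimes>\<^sub>M y)) [fo x] y (ep x y)) ys"
    using assms L_cong[OF tau_mate[of x y], of xs ys] by (simp add: L_cmp)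
  then show "L xs (ep y x) ys \<bullet> L xs (fm (tF (tau x y))) ys \<bullet> k = L xs (rot (tr (x \<otimes>\<^sub>M y)) [fo x] y (ep x y)) ys \<bullet> k"
    by (rule cmp_cancel)
qed

text \<open>Two counits nested: the first copy produces the outer letters of
  \<open>[\<alpha>, \<alpha>, \<beta>, \<beta>]\<close>, the second copy is moved across the letter
  \<open>\<beta>\<close> of the first and produces the inner ones. Consequently factors are
  multiplied in order in \<open>A\<close> and in reversed order in \<open>B\<close>.\<close>

definition "sig = L [\<alpha>] e [\<beta>] \<bullet> L [\<alpha>] (E' t b) [] \<bullet> L [] e [p t]"

text \<open>The definition rotates \<open>b\<close> to the front of the first factor, juxtaposes
  both factors and rotates \<open>b\<close> back to the end. By \<open>rot_tns\<close> the rotation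
  of the nested diagram \<open>sig\<close> is exactly that juxtaposition, so undoing it yields
  \<open>sig\<close>; then the two products are applied.\<close>

lemma product_formula:
  "L [] e [] \<bullet> L [] (fm (tF mT)) [] \<bullet> L [] (cmu t t) [] = L [] mA [\<beta>] \<bullet> L [\<alpha>, \<alpha>] mB [] \<bullet> sig"
proof -
  \<comment> \<open>These products stay folded, since the outer traciator treats the product of
    \<open>a\<close>, \<open>a\<close> and \<open>b\<close> as one letter.\<close>
  define aa where "aa = a \<otimes>\<^sub>M a"
  define aab where "aab = aa \<otimes>\<^sub>M b"
  have [simp]: "aa \<in> obj M" "aab \<in> obj M"
    by (simp_all add: aa_def aab_def)
  define F where "F = (tid M b \<boxtimes>\<^sub>D D.Ai a a b) \<bullet>\<^sub>D D.As b a (a \<otimes>\<^sub>M b)"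
  have F [simp]: "tAr M F" "tdom F = (b \<otimes>\<^sub>M a) \<otimes>\<^sub>M (a \<otimes>\<^sub>M b)" "tcod F = b \<otimes>\<^sub>M aab"
    by (simp_all add: F_def aa_def aab_def)
  define X0 where "X0 = tmult (b \<otimes>\<^sub>M a) (a \<otimes>\<^sub>M b) \<bullet>\<^sub>t (tau a b \<boxtimes>\<^sub>t tid C t)"
  have X0 [simp]: "tAr C X0" "tdom X0 = t \<otimes> t" "tcod X0 = tr ((b \<otimes>\<^sub>M a) \<otimes>\<^sub>M (a \<otimes>\<^sub>M b))"
    by (simp_all add: X0_def)
  \<comment> \<open>\<open>?k\<close> merges the letters \<open>\<alpha>\<close>,
    \<open>\<alpha>\<close>, \<open>\<beta>\<close> into the single letter
    \<open>fo aab\<close>.\<close>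
  let ?k = "L [] (mu aa b) [] \<bullet> L [] (mu a a) [\<beta>]"
  have k: "Ar ?k" "Dom ?k = [\<alpha>, \<alpha>, \<beta>]" "Cod ?k = [fo aab]"
    by (simp_all add: aa_def aab_def)
  have sig: "Ar sig" "Dom sig = [p t, p t]" "Cod sig = [\<alpha>, \<alpha>, \<beta>, \<beta>]"
    by (simp_all add: sig_def)
  have 0: "L [] (ep (b \<otimes>\<^sub>M a) (a \<otimes>\<^sub>M b)) [] \<bullet> L [] (fm (tF X0)) [] \<bullet> L [] (cmu t t) []
      = L [] (fm (Ep (b \<otimes>\<^sub>M a))) [fo (a \<otimes>\<^sub>M b)] \<bullet> L [p (tr (b \<otimes>\<^sub>M a))] (fm (Ep (a \<otimes>\<^sub>M b))) []
        \<bullet> L [] (fm (tF (tau a b))) [p t]"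
  proof -
    have "L [] (fm (tF X0)) [] \<bullet> L [] (cmu t t) []
        = L [] (fm (tF (tmult (b \<otimes>\<^sub>M a) (a \<otimes>\<^sub>M b)))) [] \<bullet> L [] (cmu (tr (b \<otimes>\<^sub>M a)) t) [] \<bullet> L [] (fm (tF (tau a b))) [p t]"
      by (simp add: X0_def tF_cmp FS.L_fm cmp_assoc)
    then show ?thesis
      using cmp_cancel[OF ep_tmult[of "b \<otimes>\<^sub>M a" "a \<otimes>\<^sub>M b"], of "L [] (fm (tF (tau a b))) [p t]"]
      by (simp add: cmp_assoc)
  qed
  have 1: "L [] (ep b aab) [] \<bullet> L [] (fm (tF (tTr F \<bullet>\<^sub>t X0))) [] \<bullet> L [] (cmu t t) []
      = L [\<beta>] ?k [] \<bullet> L [] (rot t [\<alpha>] b e) [\<alpha>, \<beta>] \<bullet> L [p t] e []"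
  proof -
    have "L [] (ep b aab) [] \<bullet> L [] (fm (tF (tTr F \<bullet>\<^sub>t X0))) [] \<bullet> L [] (cmu t t) []
      = L [] (mu' b aab) [] \<bullet> L [] (fm F) [] \<bullet> L [] (mu (b \<otimes>\<^sub>M a) (a \<otimes>\<^sub>M b)) []
        \<bullet> L [] (ep (b \<otimes>\<^sub>M a) (a \<otimes>\<^sub>M b)) [] \<bullet> L [] (fm (tF X0)) [] \<bullet> L [] (cmu t t) []"
      using cmp_cancel[OF ep_tTr[OF F, of "[]" "[]"]] by (simp add: tF_cmp cmp_assoc)
    also have "\<dots> = L [\<beta>] ?k [] \<bullet> L [] (ep b a) [\<alpha>, \<beta>] \<bullet> L [p (tr (b \<otimes>\<^sub>M a))] e [] \<bullet> L [] (fm (tF (tau a b))) [p t]"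
      unfolding 0 F_def aab_def aa_def by (simp add: L_fm L_Ep L_cmp cmp_assoc exch)
    also have "\<dots> = L [\<beta>] ?k [] \<bullet> L [] (rot t [\<alpha>] b e) [\<alpha>, \<beta>] \<bullet> L [p t] e []"
      using exchange0[of "fm (tF (tau a b))" e "[]" "[]" "[]", symmetric] by (simp add: L_tau_mate)
    finally show ?thesis .
  qed
  \<comment> \<open>\<open>X\<close> is the arrow with mate \<open>sig\<close>, up to merging
    letters. It is shown to be the output of the inverse traciator by comparing mates after applying
    the traciator, so the inverse itself is never computed.\<close>
  obtain X where X [simp]: "tAr C X" "tdom X = t \<otimes> t" "tcod X = tr (aab \<otimes>\<^sub>M b)"
    and epX: "ep aab b \<bullet> fm (tF X) = L [] ?k [\<beta>] \<bullet> sig \<bullet> L [] (cmu' t t) []"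
    by (rule ep_surj[of aab b "t \<otimes> t" "L [] ?k [\<beta>] \<bullet> sig \<bullet> L [] (cmu' t t) []"]) (simp_all add: k sig, simp_all add: aab_def aa_def)
  have "tau aab b \<bullet>\<^sub>t X = tTr F \<bullet>\<^sub>t X0"
  proof (rule ep_inj)
    have "(ep b aab \<bullet> fm (tF (tau aab b \<bullet>\<^sub>t X))) \<bullet> L [] (cmu t t) []
        = (rot (tr (aab \<otimes>\<^sub>M b)) [fo aab] b (ep aab b) \<bullet> fm (tF X)) \<bullet> L [] (cmu t t) []"
      using cmp_cancel[OF tau_mate[of aab b]] by (simp add: tF_cmp fm_cmp cmp_assoc)
    also have "\<dots> = rot (t \<otimes> t) [fo aab] b (L [] ?k [\<beta>] \<bullet> sig \<bullet> L [] (cmu' t t) []) \<bullet> L [] (cmu t t) []"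
      using rot_natural[of aab b X "ep aab b"] by (simp add: epX)
    also have "\<dots> = L [\<beta>] ?k [] \<bullet> rot (t \<otimes> t) [\<alpha>, \<alpha>, \<beta>] b (sig \<bullet> L [] (cmu' t t) []) \<bullet> L [] (cmu t t) []"
      using rot_L[of "t \<otimes> t" b "sig \<bullet> L [] (cmu' t t) []" "[\<alpha>, \<alpha>, \<beta>]" ?k] k sig by (simp add: cmp_assoc)
    also have "\<dots> = L [\<beta>] ?k [] \<bullet> L [] (rot t [\<alpha>] b e) [\<alpha>, \<beta>] \<bullet> L [p t] e []"
      using rot_tns[of t t a b a b e e] by (simp add: sig_def cmp_assoc)
    also have "\<dots> = (ep b aab \<bullet> fm (tF (tTr F \<bullet>\<^sub>t X0))) \<bullet> L [] (cmu t t) []"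
      using 1 by (simp add: L_Nil cmp_assoc tF_cmp fm_cmp)
    finally have *: "(ep b aab \<bullet> fm (tF (tau aab b \<bullet>\<^sub>t X))) \<bullet> L [] (cmu t t) []
        = (ep b aab \<bullet> fm (tF (tTr F \<bullet>\<^sub>t X0))) \<bullet> L [] (cmu t t) []" .
    show "ep b aab \<bullet> fm (tF (tau aab b \<bullet>\<^sub>t X)) = ep b aab \<bullet> fm (tF (tTr F \<bullet>\<^sub>t X0))"
      by (rule iso_epi[OF _ *, of "L [] (cmu' t t) []" "[p (t \<otimes> t)]"]) simp_all
  qed simp_all
  then have "tau' aab b \<bullet>\<^sub>t tTr F \<bullet>\<^sub>t X0 = tau' aab b \<bullet>\<^sub>t tau aab b \<bullet>\<^sub>t X"
    by simp
  also have "\<dots> = X"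
    using C.cmp_cancel[OF tau'_arrow(5)[of aab b], of X] by simp
  finally have mT: "mT = tTr (tmA \<boxtimes>\<^sub>D tmB) \<bullet>\<^sub>t tTr (D.As aa b b) \<bullet>\<^sub>t X"
    unfolding mT_def aa_def[symmetric] aab_def[symmetric] by (simp add: F_def X0_def aa_def C.cmp_assoc)
  \<comment> \<open>What remains, the products of \<open>A\<close> and \<open>B\<close> and the last
    reassociation, is moved past the counit by naturality.\<close>
  define G where "G = tmA \<boxtimes>\<^sub>D tmB"
  have G [simp]: "tAr M G" "tdom G = aa \<otimes>\<^sub>M (b \<otimes>\<^sub>M b)" "tcod G = a \<otimes>\<^sub>M b"
    by (simp_all add: G_def aa_def)
  have fmG: "L [] (fm G) [] = L [] (mu a b) [] \<bullet> L [] mA [\<beta>] \<bullet> L [\<alpha>, \<alpha>] mB [] \<bullet> L [] (mu' a a) [\<beta>, \<beta>]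
      \<bullet> L [fo aa] (mu' b b) [] \<bullet> L [] (mu' aa (b \<otimes>\<^sub>M b)) []"
    unfolding G_def aa_def by (simp add: L_fm L_fm_alg[OF A] L_fm_alg[OF B] cmp_assoc exch)
  have fmAs: "L [] (mu' aa (b \<otimes>\<^sub>M b)) [] \<bullet> L [] (fm (D.As aa b b)) [] \<bullet> L [] (mu aab b) []
      = L [fo aa] (mu b b) [] \<bullet> L [] (mu' aa b) [\<beta>]"
    by (simp add: L_fm aab_def cmp_assoc)
  have "L [] e [] \<bullet> L [] (fm (tF mT)) []
      = (L [] e [] \<bullet> L [] (fm (tF (tTr G))) []) \<bullet> L [] (fm (tF (tTr (D.As aa b b)))) [] \<bullet> L [] (fm (tF X)) []"
    unfolding mT G_def[symmetric] by (simp add: tF_cmp cmp_assoc aab_def)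
  also have "\<dots> = L [] mA [\<beta>] \<bullet> L [\<alpha>, \<alpha>] mB [] \<bullet> L [] (mu' a a) [\<beta>, \<beta>] \<bullet> L [fo aa] (mu' b b) []
      \<bullet> (L [] (ep aa (b \<otimes>\<^sub>M b)) [] \<bullet> L [] (fm (tF (tTr (D.As aa b b)))) []) \<bullet> L [] (fm (tF X)) []"
    by (subst ep_tTr[of G aa "b \<otimes>\<^sub>M b" a b]) (simp_all add: fmG cmp_assoc, simp_all add: aa_def aab_def)
  also have "L [] (ep aa (b \<otimes>\<^sub>M b)) [] \<bullet> L [] (fm (tF (tTr (D.As aa b b)))) []
      = L [fo aa] (mu b b) [] \<bullet> L [] (mu' aa b) [\<beta>] \<bullet> L [] (ep aab b) []"
    using cmp_cancel[OF fmAs] by (subst ep_tTr[of _ aab b]) (simp_all add: cmp_assoc, simp_all add: aab_def aa_def)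
  also have "L [] mA [\<beta>] \<bullet> L [\<alpha>, \<alpha>] mB [] \<bullet> L [] (mu' a a) [\<beta>, \<beta>] \<bullet> L [fo aa] (mu' b b) []
      \<bullet> (L [fo aa] (mu b b) [] \<bullet> L [] (mu' aa b) [\<beta>] \<bullet> L [] (ep aab b) []) \<bullet> L [] (fm (tF X)) []
    = L [] mA [\<beta>] \<bullet> L [\<alpha>, \<alpha>] mB [] \<bullet> L [] (mu' a a) [\<beta>, \<beta>] \<bullet> L [] (mu' aa b) [\<beta>]
     \<bullet> L [] (ep aab b) [] \<bullet> L [] (fm (tF X)) []"
    by (simp add: cmp_assoc) (simp add: aab_def)
  also have "\<dots> = L [] mA [\<beta>] \<bullet> L [\<alpha>, \<alpha>] mB [] \<bullet> sig \<bullet> L [] (cmu' t t) []"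
  proof -
    have 2: "L [] ?k [\<beta>] = L [] (mu aa b) [\<beta>] \<bullet> L [] (mu a a) [\<beta>, \<beta>]"
      by (simp add: L_cmp aa_def)
    have "L [] (ep aab b) [] \<bullet> L [] (fm (tF X)) [] = L [] (mu aa b) [\<beta>] \<bullet> L [] (mu a a) [\<beta>, \<beta>] \<bullet> sig \<bullet> L [] (cmu' t t) []"
      using epX unfolding 2 by (simp add: L_Nil cmp_assoc)
    then show ?thesis
      using sig by (simp only:) (simp add: aa_def)
  qed
  finally have "(L [] e [] \<bullet> L [] (fm (tF mT)) []) \<bullet> L [] (cmu t t) []
    = (L [] mA [\<beta>] \<bullet> L [\<alpha>, \<alpha>] mB [] \<bullet> sig \<bullet> L [] (cmu' t t) []) \<bullet> L [] (cmu t t) []"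
    by simp
  then show ?thesis
    using sig by (simp add: cmp_assoc)
qed

text \<open>The unit is \<open>Tr\<close> of a map applied after the transpose of
  \<open>tFn'\<close>; naturality of the counit leaves the units of \<open>A\<close> and
  \<open>B\<close> and the inverse of \<open>funit\<close>, which \<open>cnu\<close>
  cancels.\<close>

lemma unit_formula: "L [] e [] \<bullet> L [] (fm (tF iT)) [] \<bullet> L [] cnu [] = L [] iA [\<beta>] \<bullet> L [] iB []"
proof -
  have 1: "Ep \<one>\<^bsub>M\<^esub> \<bullet>\<^sub>D tF (tTr tFn' \<bullet>\<^sub>t Et \<one>) = tFn'"
    using Ep_um[of tFn' \<one>] by (simp add: um_def)
  let ?G = "(tiA \<boxtimes>\<^sub>D tiB) \<bullet>\<^sub>D D.Li \<one>\<^bsub>M\<^esub>"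
  have "Ep (a \<otimes>\<^sub>M b) \<bullet>\<^sub>D tF iT = (Ep (a \<otimes>\<^sub>M b) \<bullet>\<^sub>D tF (tTr ?G)) \<bullet>\<^sub>D tF (tTr tFn' \<bullet>\<^sub>t Et \<one>)"
    by (simp add: iT_def tF_cmp D.cmp_assoc)
  also have "Ep (a \<otimes>\<^sub>M b) \<bullet>\<^sub>D tF (tTr ?G) = ?G \<bullet>\<^sub>D Ep \<one>\<^bsub>M\<^esub>"
    using Ep_natural[of ?G] by simp
  finally have "Ep (a \<otimes>\<^sub>M b) \<bullet>\<^sub>D tF iT = ?G \<bullet>\<^sub>D tFn'"
    by (simp add: D.cmp_assoc 1)
  then have "L [] (mu' a b) [] \<bullet> L [] (fm (Ep (a \<otimes>\<^sub>M b) \<bullet>\<^sub>D tF iT)) [] \<bullet> L [] cnu []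
     = L [] (mu' a b) [] \<bullet> L [] (fm (?G \<bullet>\<^sub>D tFn')) [] \<bullet> L [] cnu []"
    by (simp only:)
  then show ?thesis
    by (simp add: L_Ep L_fm L_fm_alg[OF A] L_fm_alg[OF B] L_cnu fm_cancel[OF tFn_arrow(9)] cmp_assoc)
      (simp add: exch)
qed

section \<open>Inverse crossings and the algebra laws\<close>

lemma E'_natural_left:
  assumes [simp]: "tAr C X" "y \<in> obj M" "set xs \<subseteq> ob" "set ys \<subseteq> ob"
  shows "L xs (E' (tcod X) y) ys \<bullet> L (xs @ [fo y]) (fm (tF X)) ys
    = L xs (fm (tF X)) (fo y # ys) \<bullet> L xs (E' (tdom X) y) ys"
proof -
  have "L [] (E' (tcod X) y) [] \<bullet> L [fo y] (fm (tF X)) []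
      = L [] (E' (tcod X) y) [] \<bullet> (L [fo y] (fm (tF X)) [] \<bullet> L [] (E (tdom X) y) []) \<bullet> L [] (E' (tdom X) y) []"
    by (simp add: cmp_assoc)
  also have "\<dots> = L [] (fm (tF X)) [fo y] \<bullet> L [] (E' (tdom X) y) []"
    unfolding E_natural_left0[OF assms(1,2)] by (simp add: cmp_assoc)
  finally have *: "L [] (E' (tcod X) y) [] \<bullet> L [fo y] (fm (tF X)) [] = L [] (fm (tF X)) [fo y] \<bullet> L [] (E' (tdom X) y) []" .
  show ?thesis
    using L_cong[OF *, of xs ys] by (simp add: L_cmp)
qed

lemma E'_tns_left:
  assumes [simp]: "c \<in> obj C" "d \<in> obj C" "y \<in> obj M" "set xs \<subseteq> ob" "set ys \<subseteq> ob"
  shows "L xs (E' (c \<otimes> d) y) ys \<bullet> L (xs @ [fo y]) (cmu c d) ys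
    = L xs (cmu c d) (fo y # ys) \<bullet> L (xs @ [p c]) (E' d y) ys \<bullet> L xs (E' c y) (p d # ys)"
proof -
  have "L [] (E' (c \<otimes> d) y) [] \<bullet> L [fo y] (cmu c d) []
      = L [] (E' (c \<otimes> d) y) [] \<bullet> (L [fo y] (cmu c d) [] \<bullet> L [] (E c y) [p d] \<bullet> L [p c] (E d y) [])
        \<bullet> L [p c] (E' d y) [] \<bullet> L [] (E' c y) [p d]"
    by (simp add: cmp_assoc)
  also have "\<dots> = L [] (cmu c d) [fo y] \<bullet> L [p c] (E' d y) [] \<bullet> L [] (E' c y) [p d]"
    unfolding E_tns_left0[OF assms(1-3), symmetric] by (simp add: cmp_assoc)
  finally have *: "L [] (E' (c \<otimes> d) y) [] \<bullet> L [fo y] (cmu c d) []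
    = L [] (cmu c d) [fo y] \<bullet> L [p c] (E' d y) [] \<bullet> L [] (E' c y) [p d]" .
  show ?thesis
    using L_cong[OF *, of xs ys] by (simp add: L_cmp)
qed

lemma E'_tns_left':
  assumes [simp]: "c \<in> obj C" "d \<in> obj C" "y \<in> obj M" "set xs \<subseteq> ob" "set ys \<subseteq> ob"
  shows "L xs (cmu' c d) (fo y # ys) \<bullet> L xs (E' (c \<otimes> d) y) ys
    = L (xs @ [p c]) (E' d y) ys \<bullet> L xs (E' c y) (p d # ys) \<bullet> L (xs @ [fo y]) (cmu' c d) ys"
proof -
  have "L xs (cmu' c d) (fo y # ys) \<bullet> L xs (E' (c \<otimes> d) y) ys
    = L xs (cmu' c d) (fo y # ys) \<bullet> (L xs (E' (c \<otimes> d) y) ys \<bullet> L (xs @ [fo y]) (cmu c d) ys) \<bullet> L (xs @ [fo y]) (cmu' c d) ys"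
    by (simp add: cmp_assoc)
  then show ?thesis
    unfolding E'_tns_left[OF assms] by (simp add: cmp_assoc)
qed

lemma E'_unit_left:
  assumes [simp]: "y \<in> obj M" "set xs \<subseteq> ob" "set ys \<subseteq> ob"
  shows "L xs (E' \<one> y) ys \<bullet> L (xs @ [fo y]) cnu ys = L xs cnu (fo y # ys)"
proof -
  have *: "L [] (E' \<one> y) [] \<bullet> L [fo y] cnu [] = L [] cnu [fo y]"
    unfolding E_unit_left0[OF assms(1), symmetric] by simp
  show ?thesis
    using L_cong[OF *, of xs ys] by (simp add: L_cmp)
qed

text \<open>\<open>slide21\<close> for the multiplication of \<open>B\<close>, solved for the
  inverse crossings; the next lemma does the same for the unit with \<open>slide01\<close>.\<close>

lemma E'_mB:
  assumes [simp]: "c \<in> obj C" "set xs \<subseteq> ob" "set ys \<subseteq> ob"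
  shows "L xs (E' c b) ys \<bullet> L xs mB (p c # ys)
    = L (xs @ [p c]) mB ys \<bullet> L xs (E' c b) (\<beta> # ys) \<bullet> L (xs @ [\<beta>]) (E' c b) ys"
proof -
  have "L [] (E' c b) [] \<bullet> L [] mB [p c]
      = L [] (E' c b) [] \<bullet> (L [] mB [p c] \<bullet> L [\<beta>] (E c b) [] \<bullet> L [] (E c b) [\<beta>])
        \<bullet> L [] (E' c b) [\<beta>] \<bullet> L [\<beta>] (E' c b) []"
    by (simp add: cmp_assoc)
  also have "\<dots> = L [p c] mB [] \<bullet> L [] (E' c b) [\<beta>] \<bullet> L [\<beta>] (E' c b) []"
    by (subst slide21[of c b b b mB]) (simp_all add: cmp_assoc)
  finally have *: "L [] (E' c b) [] \<bullet> L [] mB [p c] = L [p c] mB [] \<bullet> L [] (E' c b) [\<beta>] \<bullet> L [\<beta>] (E' c b) []" .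
  show ?thesis
    using L_cong[OF *, of xs ys] by (simp add: L_cmp)
qed

lemma E'_iB:
  assumes [simp]: "c \<in> obj C" "set xs \<subseteq> ob" "set ys \<subseteq> ob"
  shows "L xs (E' c b) ys \<bullet> L xs iB (p c # ys) = L (xs @ [p c]) iB ys"
proof -
  have *: "L [] (E' c b) [] \<bullet> L [] iB [p c] = L [p c] iB []"
    by (subst slide01[of c b iB, symmetric]) simp_all
  show ?thesis
    using L_cong[OF *, of xs ys] by (simp add: L_cmp)
qed

lemma L_product:
  assumes [simp]: "set xs \<subseteq> ob" "set ys \<subseteq> ob"
  shows "L xs e ys \<bullet> L xs (fm (tF mT)) ys \<bullet> L xs (cmu t t) ys
    = L xs mA (\<beta> # ys) \<bullet> L (xs @ [\<alpha>, \<alpha>]) mB ys \<bullet> L (xs @ [\<alpha>]) e (\<beta> # ys)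
      \<bullet> L (xs @ [\<alpha>]) (E' t b) ys \<bullet> L xs e (p t # ys)"
  using L_cong[OF product_formula, of xs ys] by (simp add: L_cmp sig_def)

lemma L_unit:
  assumes [simp]: "set xs \<subseteq> ob" "set ys \<subseteq> ob"
  shows "L xs e ys \<bullet> L xs (fm (tF iT)) ys \<bullet> L xs cnu ys = L xs iA (\<beta> # ys) \<bullet> L xs iB ys"
  using L_cong[OF unit_formula, of xs ys] by (simp add: L_cmp)

text \<open>Compared through mates, on three letters \<open>p t\<close>. Either bracketing gives the
  threefold nested counit \<open>?Z\<close> followed by products in \<open>A\<close> and
  \<open>B\<close>; on the left the crossing must pass \<open>mB\<close>, on the right it must pass
  the image of \<open>mT\<close>. Associativity of \<open>A\<close> and of \<open>B\<close> then
  matches the products.\<close>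

lemma mT_assoc: "mT \<bullet>\<^sub>t (mT \<boxtimes>\<^sub>t tid C t) = mT \<bullet>\<^sub>t (tid C t \<boxtimes>\<^sub>t mT) \<bullet>\<^sub>t C.As t t t"
proof (rule ep_inj)
  let ?P = "p t" and ?E = "E' t b"
  let ?k = "L [] (cmu (t \<otimes> t) t) [] \<bullet> L [] (cmu t t) [?P]"
  let ?Z = "L [\<alpha>, \<alpha>] e [\<beta>, \<beta>] \<bullet> L [\<alpha>, \<alpha>] ?E [\<beta>] \<bullet> L [\<alpha>, \<alpha>, \<beta>] ?E [] \<bullet> L [\<alpha>] e [\<beta>, ?P] \<bullet> L [\<alpha>] ?E [?P] \<bullet> L [] e [?P, ?P]"
  have "L [] e [] \<bullet> L [] (fm (tF (mT \<bullet>\<^sub>t (mT \<boxtimes>\<^sub>t tid C t)))) [] \<bullet> ?k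
      = (L [] e [] \<bullet> L [] (fm (tF mT)) [] \<bullet> L [] (cmu t t) []) \<bullet> L [] (fm (tF mT)) [?P] \<bullet> L [] (cmu t t) [?P]"
    by (simp add: tF_cmp FS.L_fm cmp_assoc)
  also have "\<dots> = L [] mA [\<beta>] \<bullet> L [\<alpha>, \<alpha>] mB [] \<bullet> L [\<alpha>] e [\<beta>] \<bullet> L [\<alpha>] ?E []
     \<bullet> (L [] e [?P] \<bullet> L [] (fm (tF mT)) [?P] \<bullet> L [] (cmu t t) [?P])"
    by (subst L_product) (simp_all add: cmp_assoc)
  also have "\<dots> = L [] mA [\<beta>] \<bullet> L [\<alpha>, \<alpha>] mB [] \<bullet> L [\<alpha>] e [\<beta>] \<bullet> L [] mA [?P, \<beta>]
     \<bullet> (L [\<alpha>, \<alpha>] ?E [] \<bullet> L [\<alpha>, \<alpha>] mB [?P]) \<bullet> L [\<alpha>] e [\<beta>, ?P] \<bullet> L [\<alpha>] ?E [?P] \<bullet> L [] e [?P, ?P]"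
    using cmp_cancel[OF exchange0[of mA ?E "[]" "[]" "[]"]]
    by (subst L_product) (simp_all add: cmp_assoc exch)
  also have "\<dots> = (L [] mA [\<beta>] \<bullet> L [] mA [\<alpha>, \<beta>]) \<bullet> L [\<alpha>, \<alpha>, \<alpha>] mB [] \<bullet> L [\<alpha>, \<alpha>, \<alpha>, \<beta>] mB [] \<bullet> ?Z"
    by (subst E'_mB) (simp_all add: cmp_assoc exch)
  also have "\<dots> = (L [] mA [\<beta>] \<bullet> L [\<alpha>] mA [\<beta>]) \<bullet> L [\<alpha>, \<alpha>, \<alpha>] (L [] mB [] \<bullet> L [\<beta>] mB []) [] \<bullet> ?Z"
    using L_cong[OF salg_laws(1)[OF A], of "[]" "[\<beta>]"] by (simp add: L_cmp) (simp add: cmp_assoc)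
  also have "\<dots> = (L [] mA [\<beta>] \<bullet> L [\<alpha>] mA [\<beta>]) \<bullet> L [\<alpha>, \<alpha>, \<alpha>] (L [] mB [] \<bullet> L [] mB [\<beta>]) [] \<bullet> ?Z"
    by (simp only: salg_laws(1)[OF B])
  finally have 1: "L [] e [] \<bullet> L [] (fm (tF (mT \<bullet>\<^sub>t (mT \<boxtimes>\<^sub>t tid C t)))) [] \<bullet> ?k
    = L [] mA [\<beta>] \<bullet> L [\<alpha>] mA [\<beta>] \<bullet> L [\<alpha>, \<alpha>, \<alpha>] mB [] \<bullet> L [\<alpha>, \<alpha>, \<alpha>] mB [\<beta>] \<bullet> ?Z"
    by (simp add: L_cmp cmp_assoc)
  have "L [] e [] \<bullet> L [] (fm (tF (mT \<bullet>\<^sub>t (tid C t \<boxtimes>\<^sub>t mT) \<bullet>\<^sub>t C.As t t t))) [] \<bullet> ?k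
      = (L [] e [] \<bullet> L [] (fm (tF mT)) [] \<bullet> L [] (cmu t t) []) \<bullet> L [?P] (fm (tF mT)) [] \<bullet> L [?P] (cmu t t) []"
    by (simp add: tF_cmp FS.L_fm cmp_assoc)
  also have "\<dots> = L [] mA [\<beta>] \<bullet> L [\<alpha>, \<alpha>] mB [] \<bullet> L [\<alpha>] e [\<beta>]
     \<bullet> (L [\<alpha>] ?E [] \<bullet> L [\<alpha>, \<beta>] (fm (tF mT)) []) \<bullet> L [\<alpha>, \<beta>] (cmu t t) [] \<bullet> L [] e [?P, ?P]"
    by (subst L_product) (simp_all add: cmp_assoc exch)
  also have "\<dots> = L [] mA [\<beta>] \<bullet> L [\<alpha>, \<alpha>] mB [] \<bullet> L [\<alpha>] e [\<beta>] \<bullet> L [\<alpha>] (fm (tF mT)) [\<beta>]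
     \<bullet> (L [\<alpha>] (E' (t \<otimes> t) b) [] \<bullet> L [\<alpha>, \<beta>] (cmu t t) []) \<bullet> L [] e [?P, ?P]"
    using E'_natural_left[of mT b "[\<alpha>]" "[]"] by (simp add: cmp_assoc)
  also have "\<dots> = L [] mA [\<beta>] \<bullet> L [\<alpha>, \<alpha>] mB [] \<bullet> (L [\<alpha>] e [\<beta>] \<bullet> L [\<alpha>] (fm (tF mT)) [\<beta>]
     \<bullet> L [\<alpha>] (cmu t t) [\<beta>]) \<bullet> L [\<alpha>, ?P] ?E [] \<bullet> L [\<alpha>] ?E [?P] \<bullet> L [] e [?P, ?P]"
    using E'_tns_left[of t t b "[\<alpha>]" "[]"] by (simp add: cmp_assoc)
  also have "\<dots> = L [] mA [\<beta>] \<bullet> L [\<alpha>] mA [\<beta>] \<bullet> L [\<alpha>, \<alpha>, \<alpha>] mB [] \<bullet> L [\<alpha>, \<alpha>, \<alpha>] mB [\<beta>] \<bullet> ?Z"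
    by (subst L_product) (simp_all add: cmp_assoc exch)
  finally have "(ep a b \<bullet> fm (tF (mT \<bullet>\<^sub>t (mT \<boxtimes>\<^sub>t tid C t)))) \<bullet> ?k
     = (ep a b \<bullet> fm (tF (mT \<bullet>\<^sub>t (tid C t \<boxtimes>\<^sub>t mT) \<bullet>\<^sub>t C.As t t t))) \<bullet> ?k"
    using 1 by (simp add: L_Nil cmp_assoc tF_cmp fm_cmp)
  then show "ep a b \<bullet> fm (tF (mT \<bullet>\<^sub>t (mT \<boxtimes>\<^sub>t tid C t))) = ep a b \<bullet> fm (tF (mT \<bullet>\<^sub>t (tid C t \<boxtimes>\<^sub>t mT) \<bullet>\<^sub>t C.As t t t))"
    by (rule iso_epi[rotated, where u' = "L [] (cmu' t t) [?P] \<bullet> L [] (cmu' (t \<otimes> t) t) []" and a = "[p ((t \<otimes> t) \<otimes> t)]"])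
      (simp_all add: cmp_assoc)
qed simp_all

text \<open>The unit in the first factor is expanded by \<open>unit_formula\<close>; its part in
  \<open>B\<close> loses the crossing by \<open>E'_iB\<close>, and both parts are absorbed by the
  products.\<close>

lemma mT_unit_left: "mT \<bullet>\<^sub>t (iT \<boxtimes>\<^sub>t tid C t) = C.Lu t"
proof (rule ep_inj)
  let ?P = "p t" and ?E = "E' t b"
  let ?k = "L [] (cmu \<one> t) [] \<bullet> L [] cnu [?P]"
  have "L [] e [] \<bullet> L [] (fm (tF (mT \<bullet>\<^sub>t (iT \<boxtimes>\<^sub>t tid C t)))) [] \<bullet> ?k
      = (L [] e [] \<bullet> L [] (fm (tF mT)) [] \<bullet> L [] (cmu t t) []) \<bullet> L [] (fm (tF iT)) [?P] \<bullet> L [] cnu [?P]"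
    by (simp add: tF_cmp FS.L_fm cmp_assoc)
  also have "\<dots> = L [] mA [\<beta>] \<bullet> L [\<alpha>, \<alpha>] mB [] \<bullet> L [\<alpha>] e [\<beta>] \<bullet> L [\<alpha>] ?E []
     \<bullet> (L [] e [?P] \<bullet> L [] (fm (tF iT)) [?P] \<bullet> L [] cnu [?P])"
    by (subst L_product) (simp_all add: cmp_assoc)
  also have "\<dots> = L [] mA [\<beta>] \<bullet> L [\<alpha>, \<alpha>] mB [] \<bullet> L [\<alpha>] e [\<beta>] \<bullet> L [] iA [?P, \<beta>] \<bullet> (L [] ?E [] \<bullet> L [] iB [?P])"
    using cmp_cancel[OF exchange0[of iA ?E "[]" "[]" "[]"]]
    by (subst L_unit) (simp_all add: cmp_assoc exch)
  also have "\<dots> = L [] (L [] mA [] \<bullet> L [] iA [\<alpha>]) [\<beta>] \<bullet> L [\<alpha>] (L [] mB [] \<bullet> L [\<beta>] iB []) [] \<bullet> L [] e []"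
    by (subst E'_iB) (simp_all add: L_cmp cmp_assoc exch)
  also have "\<dots> = L [] e [] \<bullet> L [] (fm (tF (C.Lu t))) [] \<bullet> ?k"
    by (simp only: salg_laws[OF A] salg_laws[OF B]) (simp add: FS.L_fm cmp_assoc)
  finally have "(ep a b \<bullet> fm (tF (mT \<bullet>\<^sub>t (iT \<boxtimes>\<^sub>t tid C t)))) \<bullet> ?k = (ep a b \<bullet> fm (tF (C.Lu t))) \<bullet> ?k"
    by (simp add: L_Nil cmp_assoc tF_cmp fm_cmp)
  then show "ep a b \<bullet> fm (tF (mT \<bullet>\<^sub>t (iT \<boxtimes>\<^sub>t tid C t))) = ep a b \<bullet> fm (tF (C.Lu t))"
    by (rule iso_epi[rotated, where u' = "L [] cnu' [?P] \<bullet> L [] (cmu' \<one> t) []" and a = "[p (\<one> \<otimes> t)]"])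
      (simp_all add: cmp_assoc)
qed simp_all

text \<open>Here the unit takes the inner position, so the crossing passes the image of
  \<open>iT\<close> and disappears at the unit object.\<close>

lemma mT_unit_right: "mT \<bullet>\<^sub>t (tid C t \<boxtimes>\<^sub>t iT) = C.Ru t"
proof (rule ep_inj)
  let ?P = "p t" and ?E = "E' t b"
  let ?k = "L [] (cmu t \<one>) [] \<bullet> L [?P] cnu []"
  have "L [] e [] \<bullet> L [] (fm (tF (mT \<bullet>\<^sub>t (tid C t \<boxtimes>\<^sub>t iT)))) [] \<bullet> ?k
      = (L [] e [] \<bullet> L [] (fm (tF mT)) [] \<bullet> L [] (cmu t t) []) \<bullet> L [?P] (fm (tF iT)) [] \<bullet> L [?P] cnu []"
    by (simp add: tF_cmp FS.L_fm cmp_assoc)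
  also have "\<dots> = L [] mA [\<beta>] \<bullet> L [\<alpha>, \<alpha>] mB [] \<bullet> L [\<alpha>] e [\<beta>]
     \<bullet> (L [\<alpha>] ?E [] \<bullet> L [\<alpha>, \<beta>] (fm (tF iT)) []) \<bullet> L [\<alpha>, \<beta>] cnu [] \<bullet> L [] e []"
    using exchange0[of e "fm (tF iT)" "[]" "[]" "[]"] exchange0[of e cnu "[]" "[]" "[]"]
      cmp_cancel[OF exchange0[of e "fm (tF iT)" "[]" "[]" "[]"]]
    by (subst L_product) (simp_all add: cmp_assoc)
  also have "\<dots> = L [] mA [\<beta>] \<bullet> L [\<alpha>, \<alpha>] mB [] \<bullet> L [\<alpha>] e [\<beta>] \<bullet> L [\<alpha>] (fm (tF iT)) [\<beta>]
     \<bullet> (L [\<alpha>] (E' \<one> b) [] \<bullet> L [\<alpha>, \<beta>] cnu []) \<bullet> L [] e []"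
    using E'_natural_left[of iT b "[\<alpha>]" "[]"] by (simp add: cmp_assoc)
  also have "\<dots> = L [] mA [\<beta>] \<bullet> L [\<alpha>, \<alpha>] mB [] \<bullet> (L [\<alpha>] e [\<beta>] \<bullet> L [\<alpha>] (fm (tF iT)) [\<beta>] \<bullet> L [\<alpha>] cnu [\<beta>]) \<bullet> L [] e []"
    using E'_unit_left[of b "[\<alpha>]" "[]"] by (simp add: cmp_assoc)
  also have "\<dots> = L [] (L [] mA [] \<bullet> L [\<alpha>] iA []) [\<beta>] \<bullet> L [\<alpha>] (L [] mB [] \<bullet> L [] iB [\<beta>]) [] \<bullet> L [] e []"
    by (subst L_unit) (simp_all add: L_cmp cmp_assoc exch)
  also have "\<dots> = L [] e [] \<bullet> L [] (fm (tF (C.Ru t))) [] \<bullet> ?k"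
    by (simp only: salg_laws[OF A] salg_laws[OF B]) (simp add: FS.L_fm cmp_assoc)
  finally have "(ep a b \<bullet> fm (tF (mT \<bullet>\<^sub>t (tid C t \<boxtimes>\<^sub>t iT)))) \<bullet> ?k = (ep a b \<bullet> fm (tF (C.Ru t))) \<bullet> ?k"
    by (simp add: L_Nil cmp_assoc tF_cmp fm_cmp)
  then show "ep a b \<bullet> fm (tF (mT \<bullet>\<^sub>t (tid C t \<boxtimes>\<^sub>t iT))) = ep a b \<bullet> fm (tF (C.Ru t))"
    by (rule iso_epi[rotated, where u' = "L [?P] cnu' [] \<bullet> L [] (cmu' t \<one>) []" and a = "[p (t \<otimes> \<one>)]"])
      (simp_all add: cmp_assoc)
qed simp_all

lemma is_algebra_tr: "is_algebra C (tr_algebra C M \<Phi>Z Tr \<eta> \<epsilon> A B)"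
  using arg_cong[OF mT_assoc, of mor] arg_cong[OF mT_unit_left, of mor] arg_cong[OF mT_unit_right, of mor]
    tAr_sel(3)[of C mT] tAr_sel(3)[of C iT]
  by (simp add: tr_algebra_eq is_algebra_def)

end

section \<open>Free modules and free bimodules\<close>

context tensor_category
begin

lemma str_inj:
  assumes "str F = str G" "tAr C F" "tAr C G" "tdom F = tdom G" "tcod F = tcod G"
  shows "F = G"
proof (rule tns_unit_inj)
  have "und C (str F) = und C (str G)"
    by (simp only: assms(1))
  then show "F \<boxtimes>\<^sub>t tid C \<one> = G \<boxtimes>\<^sub>t tid C \<one>"
    using assms(2,3) by simp
qed (fact assms)+

text \<open>Conjugation with the right unitor removes the unit from an arrow between one-letter
  words. With \<open>str_inj\<close> this gives the full faithfulness that
  \<open>trace_setting\<close> demands.\<close>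

lemma str_full:
  assumes "tAr (lcat C) X" "tdom X = [x]" "tcod X = [y]" "x \<in> obj C" "y \<in> obj C"
  shows "\<exists>F. tAr C F \<and> tdom F = x \<and> tcod F = y \<and> str F = X"
proof -
  let ?F = "Ru y \<bullet>\<^sub>t und C X \<bullet>\<^sub>t Ri x"
  have F: "tAr C ?F" "tdom ?F = x" "tcod ?F = y"
    using assms by simp_all
  have "?F \<boxtimes>\<^sub>t tid C \<one> = und C X"
  proof (rule iso_mono)
    show "Ri y \<bullet>\<^sub>t Ru y = tid C (y \<otimes> \<one>)"
      using assms by simp
    show "Ru y \<bullet>\<^sub>t (?F \<boxtimes>\<^sub>t tid C \<one>) = Ru y \<bullet>\<^sub>t und C X"
      using assms Ru_natural[OF F(1)] by (simp add: cmp_assoc)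
  qed (use assms in simp_all)
  then have "str ?F = X"
    using assms by (intro und_inj) simp_all
  then show ?thesis
    using F by blast
qed

end

context trace_of_algebras
begin

text \<open>Composition in the Kleisli category of the monad that tensors with \<open>t\<close> on
  the left, that is, composition of the maps of free left modules generated by \<open>f\<close> and
  \<open>g\<close>. \<open>star\<close> below is the same for the monad that tensors with
  \<open>a\<close> on the left and \<open>b\<close> on the right, whose modules are
  bimodules.\<close>

definition "kl h g f = (mT \<boxtimes>\<^sub>t tid C h) \<bullet>\<^sub>t C.Ai t t h \<bullet>\<^sub>t (tid C t \<boxtimes>\<^sub>t g) \<bullet>\<^sub>t f"

definition "star z k h = L [] mA [fo z, \<beta>] \<bullet> L [\<alpha>, \<alpha>, fo z] mB [] \<bullet> L [\<alpha>] k [\<beta>] \<bullet> h"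

text \<open>The counit applied to the tensor factor \<open>t\<close> only; \<open>Q\<close>
  afterwards moves \<open>p c\<close> between the two letters. \<open>Q c\<close> is the bijection
  between generators of maps of free modules and generators of maps of free bimodules.\<close>

definition "PP c f = L [] e [p c] \<bullet> L [] (cmu' t c) [] \<bullet> L [] (fm (tF f)) []"

definition "Q c f = L [\<alpha>] (E' c b) [] \<bullet> PP c f"

lemma kl_arrow [simp]:
  assumes "tAr C f" "tAr C g" "h \<in> obj C" "tcod f = t \<otimes> tdom g" "tcod g = t \<otimes> h"
  shows "tAr C (kl h g f)" "tdom (kl h g f) = tdom f" "tcod (kl h g f) = t \<otimes> h"
  using assms by (simp_all add: kl_def)

lemma PP_arrow [simp]:
  assumes "tAr C f" "c \<in> obj C" "tcod f = t \<otimes> c"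
  shows "Ar (PP c f)" "Dom (PP c f) = [p (tdom f)]" "Cod (PP c f) = [\<alpha>, \<beta>, p c]"
  using assms by (simp_all add: PP_def)

lemma Q_arrow [simp]:
  assumes "tAr C f" "c \<in> obj C" "tcod f = t \<otimes> c"
  shows "Ar (Q c f)" "Dom (Q c f) = [p (tdom f)]" "Cod (Q c f) = [\<alpha>, p c, \<beta>]"
  using assms by (simp_all add: Q_def)

text \<open>By the product formula the left hand side is a nested counit multiplied in
  \<open>A\<close> and \<open>B\<close>. Moving the last strand inwards past \<open>mB\<close>
  doubles its crossing; on the other side, naturality along \<open>g\<close> and the tensor law for
  crossings produce the same slices from \<open>star\<close>.\<close>

lemma Q_kl:
  assumes [simp]: "tAr C f" "tAr C g" "c \<in> obj C" "h \<in> obj C" "tdom g = c" "tcod f = t \<otimes> c" "tcod g = t \<otimes> h"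
  shows "Q h (kl h g f) = star (Ph h) (Q h g) (Q c f)"
proof -
  let ?P = "p t" and ?E = "E' t b"
  let ?Y = "L [] (cmu' t c) [] \<bullet> L [] (fm (tF f)) []"
  let ?X = "L [\<alpha>] e [\<beta>, p h] \<bullet> L [\<alpha>] ?E [p h] \<bullet> L [] e [?P, p h] \<bullet> L [?P] (cmu' t h) [] \<bullet> L [?P] (fm (tF g)) [] \<bullet> ?Y"
  have X: "?X = L [\<alpha>] e [\<beta>, p h] \<bullet> L [\<alpha>] ?E [p h] \<bullet> L [\<alpha>, \<beta>] (cmu' t h) [] \<bullet> L [\<alpha>, \<beta>] (fm (tF g)) [] \<bullet> L [] e [p c] \<bullet> ?Y"
    by (simp add: exch)
  have "Q h (kl h g f) = L [\<alpha>] (E' h b) [] \<bullet> L [] e [p h] \<bullet> L [] (fm (tF mT)) [p h] \<bullet> L [] (cmu t t) [p h]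
      \<bullet> L [?P] (cmu' t h) [] \<bullet> L [?P] (fm (tF g)) [] \<bullet> ?Y"
    by (simp add: Q_def PP_def kl_def tF_cmp FS.L_fm cmp_assoc)
  also have "\<dots> = L [\<alpha>] (E' h b) [] \<bullet> L [] mA [\<beta>, p h] \<bullet> L [\<alpha>, \<alpha>] mB [p h] \<bullet> ?X"
    using cmp_cancel[OF L_product[of "[]" "[p h]"]] by (simp add: cmp_assoc)
  also have "\<dots> = L [] mA [p h, \<beta>] \<bullet> (L [\<alpha>, \<alpha>] (E' h b) [] \<bullet> L [\<alpha>, \<alpha>] mB [p h]) \<bullet> ?X"
    using cmp_cancel[OF exchange0[of mA "E' h b" "[]" "[]" "[]"]] by (simp add: cmp_assoc)
  also have "\<dots> = L [] mA [p h, \<beta>] \<bullet> L [\<alpha>, \<alpha>, p h] mB [] \<bullet> L [\<alpha>, \<alpha>] (E' h b) [\<beta>] \<bullet> L [\<alpha>, \<alpha>, \<beta>] (E' h b) [] \<bullet> ?X"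
    by (subst E'_mB) (simp_all add: cmp_assoc)
  finally have 1: "Q h (kl h g f) = L [] mA [p h, \<beta>] \<bullet> L [\<alpha>, \<alpha>, p h] mB [] \<bullet> L [\<alpha>, \<alpha>] (E' h b) [\<beta>] \<bullet> L [\<alpha>, \<alpha>, \<beta>] (E' h b) [] \<bullet> ?X" .
  have "star (Ph h) (Q h g) (Q c f) = L [] mA [p h, \<beta>] \<bullet> L [\<alpha>, \<alpha>, p h] mB [] \<bullet> L [\<alpha>, \<alpha>] (E' h b) [\<beta>] \<bullet> L [\<alpha>] e [p h, \<beta>]
     \<bullet> L [\<alpha>] (cmu' t h) [\<beta>] \<bullet> (L [\<alpha>] (fm (tF g)) [\<beta>] \<bullet> L [\<alpha>] (E' c b) []) \<bullet> L [] e [p c] \<bullet> ?Y"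
    by (simp add: star_def Q_def PP_def L_cmp cmp_assoc)
  also have "\<dots> = L [] mA [p h, \<beta>] \<bullet> L [\<alpha>, \<alpha>, p h] mB [] \<bullet> L [\<alpha>, \<alpha>] (E' h b) [\<beta>] \<bullet> L [\<alpha>] e [p h, \<beta>]
     \<bullet> (L [\<alpha>] (cmu' t h) [\<beta>] \<bullet> L [\<alpha>] (E' (t \<otimes> h) b) []) \<bullet> L [\<alpha>, \<beta>] (fm (tF g)) [] \<bullet> L [] e [p c] \<bullet> ?Y"
    using E'_natural_left[of g b "[\<alpha>]" "[]", symmetric] by (simp add: cmp_assoc)
  also have "\<dots> = L [] mA [p h, \<beta>] \<bullet> L [\<alpha>, \<alpha>, p h] mB [] \<bullet> L [\<alpha>, \<alpha>] (E' h b) [\<beta>] \<bullet> (L [\<alpha>] e [p h, \<beta>]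
     \<bullet> L [\<alpha>, ?P] (E' h b) []) \<bullet> L [\<alpha>] ?E [p h] \<bullet> L [\<alpha>, \<beta>] (cmu' t h) [] \<bullet> L [\<alpha>, \<beta>] (fm (tF g)) [] \<bullet> L [] e [p c] \<bullet> ?Y"
    using E'_tns_left'[of t h b "[\<alpha>]" "[]"] by (simp add: cmp_assoc)
  also have "L [\<alpha>] e [p h, \<beta>] \<bullet> L [\<alpha>, ?P] (E' h b) [] = L [\<alpha>, \<alpha>, \<beta>] (E' h b) [] \<bullet> L [\<alpha>] e [\<beta>, p h]"
    using exchange0[of e "E' h b" "[\<alpha>]" "[]" "[]"] by simp
  finally show ?thesis
    unfolding 1 X by (simp add: cmp_assoc)
qed

text \<open>The mate of \<open>f : d \<rightarrow> t \<otimes> c\<close> with \<open>c\<close> bent down, and its inverse.\<close>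

definition "bend c f = C.Ru t \<bullet>\<^sub>t (tid C t \<boxtimes>\<^sub>t C.Evt c) \<bullet>\<^sub>t C.As t c (dual C c) \<bullet>\<^sub>t (f \<boxtimes>\<^sub>t tid C (dual C c))"

definition "unbend d c X = (X \<boxtimes>\<^sub>t tid C c) \<bullet>\<^sub>t C.Ai d (dual C c) c \<bullet>\<^sub>t (tid C d \<boxtimes>\<^sub>t C.Cot c) \<bullet>\<^sub>t C.Ri d"

lemma bend_arrow [simp]:
  assumes "tAr C f" "c \<in> obj C" "tcod f = t \<otimes> c"
  shows "tAr C (bend c f)" "tdom (bend c f) = tdom f \<otimes> dual C c" "tcod (bend c f) = t"
  using assms by (simp_all add: bend_def)

lemma unbend_arrow [simp]:
  assumes "tAr C X" "c \<in> obj C" "d \<in> obj C" "tdom X = d \<otimes> dual C c" "tcod X = t"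
  shows "tAr C (unbend d c X)" "tdom (unbend d c X) = d" "tcod (unbend d c X) = t \<otimes> c"
  using assms by (simp_all add: unbend_def)

text \<open>A zig-zag in \<open>C\<close>, computed in the strictification of \<open>C\<close>
  itself instead of words over \<open>M\<close>.\<close>

lemma unbend_bend:
  assumes [simp]: "tAr C f" "c \<in> obj C" "tcod f = t \<otimes> c"
  shows "unbend (tdom f) c (bend c f) = f"
proof (rule C.str_inj)
  have "C.S.L [] (C.str (unbend (tdom f) c (bend c f))) [] = C.S.L [] (C.str f) []"
    by (simp add: unbend_def bend_def C.Str.L_fm C.Str.L_fm_ev C.LC.cmp_assoc)
      (simp add: C.S.exch C.Str.zzt)
  then show "C.str (unbend (tdom f) c (bend c f)) = C.str f"
    by (simp add: C.S.L_Nil)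
qed simp_all

text \<open>Bending \<open>c\<close> to the source leaves the trace \<open>t\<close> as target, so
  that the arrow has a mate; this mate is \<open>PP c f\<close> with the last strand closed by a
  cap.\<close>

lemma mate_bend:
  assumes [simp]: "tAr C f" "c \<in> obj C" "tcod f = t \<otimes> c"
  shows "L [] e [] \<bullet> L [] (fm (tF (bend c f))) [] \<bullet> L [] (cmu (tdom f) (dual C c)) []
    = L [\<alpha>, \<beta>] (FS.sevt c) [] \<bullet> L [] (PP c f) [p (dual C c)]"
  by (simp add: bend_def PP_def tF_cmp FS.L_fm FS.L_fm_ev L_cmp cmp_assoc)
    (simp add: exch)

lemma PP_inj:
  assumes "PP c f = PP c f'" and [simp]: "tAr C f" "tAr C f'" "c \<in> obj C" "tcod f = t \<otimes> c" "tcod f' = t \<otimes> c" "tdom f' = tdom f"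
  shows "f = f'"
proof -
  have "bend c f = bend c f'"
  proof (rule ep_inj)
    have "(e \<bullet> fm (tF (bend c f))) \<bullet> L [] (cmu (tdom f) (dual C c)) [] = (e \<bullet> fm (tF (bend c f'))) \<bullet> L [] (cmu (tdom f) (dual C c)) []"
      using mate_bend[of f c] mate_bend[of f' c] assms(1) by (simp add: L_Nil cmp_assoc)
    then show "e \<bullet> fm (tF (bend c f)) = e \<bullet> fm (tF (bend c f'))"
      by (rule iso_epi[rotated, where u' = "L [] (cmu' (tdom f) (dual C c)) []" and a = "[p (tdom f \<otimes> dual C c)]"])
        simp_all
  qed simp_all
  then show ?thesis
    using assms(2-7) by (metis unbend_bend)
qed

text \<open>The given diagram is closed by a cap, turned into an arrow of \<open>C\<close> by
  \<open>ep_surj\<close>, and bent back; a zig-zag for the letter \<open>p c\<close> recovers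
  it.\<close>

lemma PP_surj:
  assumes [simp]: "c \<in> obj C" "d \<in> obj C" "Ar h" "Dom h = [p d]" "Cod h = [\<alpha>, \<beta>, p c]"
  shows "\<exists>f. tAr C f \<and> tdom f = d \<and> tcod f = t \<otimes> c \<and> PP c f = h"
proof -
  let ?s = "L [\<alpha>, \<beta>] (FS.sevt c) [] \<bullet> L [] h [p (dual C c)] \<bullet> L [] (cmu' d (dual C c)) []"
  obtain X where X [simp]: "tAr C X" "tdom X = d \<otimes> dual C c" "tcod X = t" and eX: "e \<bullet> fm (tF X) = ?s"
    by (rule ep_surj[of a b "d \<otimes> dual C c" ?s]) simp_all
  have eX': "L [] e [p c] \<bullet> L [] (fm (tF X)) [p c]
      = L [\<alpha>, \<beta>] (FS.sevt c) [p c] \<bullet> L [] h [p (dual C c), p c] \<bullet> L [] (cmu' d (dual C c)) [p c]"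
    using L_cong[OF eX, of "[]" "[p c]"] by (simp add: L_cmp)
  have "PP c (unbend d c X) = (L [] e [p c] \<bullet> L [] (fm (tF X)) [p c]) \<bullet> L [] (cmu d (dual C c)) [p c] \<bullet> L [p d] (FS.scot c) []"
    by (simp add: PP_def unbend_def tF_cmp FS.L_fm FS.L_fm_ev cmp_assoc)
  also have "\<dots> = L [\<alpha>, \<beta>] (FS.sevt c) [p c] \<bullet> L [] h [p (dual C c), p c] \<bullet> L [p d] (FS.scot c) []"
    unfolding eX' by (simp add: cmp_assoc)
  also have "\<dots> = L [\<alpha>, \<beta>] (FS.sevt c) [p c] \<bullet> L [\<alpha>, \<beta>, p c] (FS.scot c) [] \<bullet> h"
    using exchange0[of h "FS.scot c" "[]" "[]" "[]"] by (simp add: L_Nil)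
  also have "\<dots> = h"
    by (simp add: FS.zzt)
  finally have "PP c (unbend d c X) = h" .
  then show ?thesis
    by (intro exI[of _ "unbend d c X"]) simp
qed

lemma Q_inj:
  assumes "Q c f = Q c f'" and [simp]: "tAr C f" "tAr C f'" "c \<in> obj C" "tcod f = t \<otimes> c" "tcod f' = t \<otimes> c" "tdom f' = tdom f"
  shows "f = f'"
proof (rule PP_inj)
  show "PP c f = PP c f'"
    by (rule iso_mono[where u = "L [\<alpha>] (E' c b) []" and u' = "L [\<alpha>] (E c b) []"])
      (use assms(1) in \<open>simp_all add: Q_def\<close>)
qed simp_all

lemma Q_surj:
  assumes [simp]: "c \<in> obj C" "d \<in> obj C" "Ar h" "Dom h = [p d]" "Cod h = [\<alpha>, p c, \<beta>]"
  shows "\<exists>f. tAr C f \<and> tdom f = d \<and> tcod f = t \<otimes> c \<and> Q c f = h"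
  using PP_surj[of c d "L [\<alpha>] (E c b) [] \<bullet> h"] cmp_cancel[OF E_E'(3)[of c b "[\<alpha>]" "[]"]]
  by (auto simp: Q_def)

text \<open>The quasi-inverse found on the side of \<open>M\<close> is again of the form
  \<open>Q d g\<close>, and \<open>Q_kl\<close> together with injectivity of \<open>Q\<close>
  transports the equation.\<close>

lemma kleisli_regular:
  assumes reg: "\<And>x y h. \<lbrakk>x \<in> obj M; y \<in> obj M; Ar h; Dom h = [fo x]; Cod h = [\<alpha>, fo y, \<beta>]\<rbrakk>
      \<Longrightarrow> \<exists>k. Ar k \<and> Dom k = [fo y] \<and> Cod k = [\<alpha>, fo x, \<beta>] \<and> star y h (star x k h) = h"
    and [simp]: "tAr C f" "c \<in> obj C" "d \<in> obj C" "tdom f = d" "tcod f = t \<otimes> c"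
  shows "\<exists>g. tAr C g \<and> tdom g = c \<and> tcod g = t \<otimes> d \<and> kl c f (kl d g f) = f"
proof -
  obtain k where k: "Ar k" "Dom k = [p c]" "Cod k = [\<alpha>, p d, \<beta>]" "star (Ph c) (Q c f) (star (Ph d) k (Q c f)) = Q c f"
    using reg[of "Ph d" "Ph c" "Q c f"] by auto
  obtain g where g [simp]: "tAr C g" "tdom g = c" "tcod g = t \<otimes> d" and Qg: "Q d g = k"
    using Q_surj[of d c k] k by auto
  have "Q c (kl c f (kl d g f)) = Q c f"
    using Q_kl[of "kl d g f" f d c] Q_kl[of f g c d] by (simp add: Qg k)
  then have "kl c f (kl d g f) = f"
    by (rule Q_inj) simp_all
  then show ?thesis
    using g by blast
qed

section \<open>Free bimodules and bilinear maps\<close>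

lemma mA_laws:
  assumes [simp]: "set xs \<subseteq> ob" "set ys \<subseteq> ob"
  shows "L xs mA ys \<bullet> L xs mA (\<alpha> # ys) = L xs mA ys \<bullet> L (xs @ [\<alpha>]) mA ys"
    "L xs mA ys \<bullet> L xs iA (\<alpha> # ys) = Id (xs @ \<alpha> # ys)"
    "L xs mA ys \<bullet> L (xs @ [\<alpha>]) iA ys = Id (xs @ \<alpha> # ys)"
  using L_cong[OF salg_laws(1)[OF A], of xs ys] L_cong[OF salg_laws(2)[OF A], of xs ys]
    L_cong[OF salg_laws(3)[OF A], of xs ys] by (simp_all add: L_cmp)

lemma mB_laws:
  assumes [simp]: "set xs \<subseteq> ob" "set ys \<subseteq> ob"
  shows "L xs mB ys \<bullet> L xs mB (\<beta> # ys) = L xs mB ys \<bullet> L (xs @ [\<beta>]) mB ys"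
    "L xs mB ys \<bullet> L xs iB (\<beta> # ys) = Id (xs @ \<beta> # ys)"
    "L xs mB ys \<bullet> L (xs @ [\<beta>]) iB ys = Id (xs @ \<beta> # ys)"
  using L_cong[OF salg_laws(1)[OF B], of xs ys] L_cong[OF salg_laws(2)[OF B], of xs ys]
    L_cong[OF salg_laws(3)[OF B], of xs ys] by (simp_all add: L_cmp)

text \<open>The map of free bimodules generated by \<open>h\<close>.\<close>

definition ext where
  "ext y h = L [] mA [fo y, \<beta>] \<bullet> L [\<alpha>, \<alpha>, fo y] mB [] \<bullet> L [\<alpha>] h [\<beta>]"

text \<open>Maps of free bimodules, stated on the strict words
  \<open>[\<alpha>, fo x, \<beta>]\<close> instead of objects of the category of bimodules; the two
  views are matched in \<open>bimodules_regular\<close>.\<close>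

definition bilinear where
  "bilinear x y G \<longleftrightarrow> Ar G \<and> Dom G = [\<alpha>, fo x, \<beta>] \<and> Cod G = [\<alpha>, fo y, \<beta>]
    \<and> G \<bullet> L [] mA [fo x, \<beta>] = L [] mA [fo y, \<beta>] \<bullet> L [\<alpha>] G []
    \<and> G \<bullet> L [\<alpha>, fo x] mB [] = L [\<alpha>, fo y] mB [] \<bullet> L [] G [\<beta>]"

lemma bilinear_ext:
  assumes [simp]: "x \<in> obj M" "y \<in> obj M" "Ar h" "Dom h = [fo x]" "Cod h = [\<alpha>, fo y, \<beta>]"
  shows "bilinear x y (ext y h)"
proof -
  let ?x = "fo x" and ?y = "fo y"
  have "ext y h \<bullet> L [] mA [?x, \<beta>]
      = (L [] mA [?y, \<beta>] \<bullet> L [] mA [\<alpha>, ?y, \<beta>]) \<bullet> L [\<alpha>, \<alpha>, \<alpha>, ?y] mB [] \<bullet> L [\<alpha>, \<alpha>] h [\<beta>]"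
    by (simp add: ext_def cmp_assoc exch)
  also have "\<dots> = L [] mA [?y, \<beta>] \<bullet> L [\<alpha>] (ext y h) []"
    using mA_laws(1)[of "[]" "[?y, \<beta>]"] by (simp add: ext_def L_cmp cmp_assoc)
  finally have 1: "ext y h \<bullet> L [] mA [?x, \<beta>] = L [] mA [?y, \<beta>] \<bullet> L [\<alpha>] (ext y h) []" .
  have "ext y h \<bullet> L [\<alpha>, ?x] mB []
      = L [] mA [?y, \<beta>] \<bullet> (L [\<alpha>, \<alpha>, ?y] mB [] \<bullet> L [\<alpha>, \<alpha>, ?y, \<beta>] mB []) \<bullet> L [\<alpha>] h [\<beta>, \<beta>]"
    using exchange0[of h mB "[\<alpha>]" "[]" "[]"] by (simp add: ext_def cmp_assoc)
  also have "\<dots> = L [] mA [?y, \<beta>] \<bullet> (L [\<alpha>, \<alpha>, ?y] mB [] \<bullet> L [\<alpha>, \<alpha>, ?y] mB [\<beta>]) \<bullet> L [\<alpha>] h [\<beta>, \<beta>]"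
    using mB_laws(1)[of "[\<alpha>, \<alpha>, ?y]" "[]"] by simp
  also have "\<dots> = L [\<alpha>, ?y] mB [] \<bullet> L [] (ext y h) [\<beta>]"
    using cmp_cancel[OF exchange0[of mA mB "[]" "[]" "[?y]"]] cmp_cancel[OF exchange0[of mA mB "[]" "[\<beta>]" "[?y]"]]
    by (simp add: ext_def L_cmp cmp_assoc)
  finally show ?thesis
    using 1 unfolding bilinear_def by (simp add: ext_def)
qed

lemma ext_unit:
  assumes [simp]: "x \<in> obj M" "y \<in> obj M" "Ar h" "Dom h = [fo x]" "Cod h = [\<alpha>, fo y, \<beta>]"
  shows "ext y h \<bullet> L [\<alpha>, fo x] iB [] \<bullet> L [] iA [fo x] = h"
proof -
  have "ext y h \<bullet> L [\<alpha>, fo x] iB [] \<bullet> L [] iA [fo x]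
    = L [] mA [fo y, \<beta>] \<bullet> L [\<alpha>, \<alpha>, fo y] mB [] \<bullet> L [\<alpha>, \<alpha>, fo y, \<beta>] iB [] \<bullet> L [] iA [\<alpha>, fo y, \<beta>] \<bullet> L [] h []"
    using cmp_cancel[OF exchange0[of h iB "[\<alpha>]" "[]" "[]"]] exchange0[of iA h "[]" "[]" "[]"]
    by (simp add: ext_def cmp_assoc)
  also have "\<dots> = h"
    using cmp_cancel[OF mB_laws(3)[of "[\<alpha>, \<alpha>, fo y]" "[]"]] cmp_cancel[OF mA_laws(2)[of "[]" "[fo y, \<beta>]"]]
    by (simp add: L_Nil)
  finally show ?thesis .
qed

text \<open>The quasi-inverse \<open>G\<close> is restricted along the units of \<open>A\<close> and
  \<open>B\<close> to \<open>?k\<close>. Bilinearity and the unit laws turn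
  \<open>star x ?k h\<close> into \<open>G \<bullet> h\<close>, and applying \<open>star y h\<close>
  is composing with \<open>ext y h\<close>.\<close>

lemma star_regular:
  assumes [simp]: "x \<in> obj M" "y \<in> obj M" "Ar h" "Dom h = [fo x]" "Cod h = [\<alpha>, fo y, \<beta>]"
    and G: "bilinear y x G" and reg: "ext y h \<bullet> G \<bullet> ext y h = ext y h"
  shows "\<exists>k. Ar k \<and> Dom k = [fo y] \<and> Cod k = [\<alpha>, fo x, \<beta>] \<and> star y h (star x k h) = h"
proof (intro exI conjI)
  let ?x = "fo x" and ?y = "fo y"
  have G' [simp]: "Ar G" "Dom G = [\<alpha>, ?y, \<beta>]" "Cod G = [\<alpha>, ?x, \<beta>]"
    and Gl: "G \<bullet> L [] mA [?y, \<beta>] = L [] mA [?x, \<beta>] \<bullet> L [\<alpha>] G []"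
    and Gr: "G \<bullet> L [\<alpha>, ?y] mB [] = L [\<alpha>, ?x] mB [] \<bullet> L [] G [\<beta>]"
    using G by (auto simp: bilinear_def)
  let ?k = "G \<bullet> L [\<alpha>, ?y] iB [] \<bullet> L [] iA [?y]"
  show "Ar ?k" "Dom ?k = [?y]" "Cod ?k = [\<alpha>, ?x, \<beta>]"
    by simp_all
  have "star x ?k h = L [] mA [?x, \<beta>] \<bullet> L [\<alpha>] (L [\<alpha>, ?x] mB [] \<bullet> L [] G [\<beta>]) [] \<bullet> L [\<alpha>, \<alpha>, ?y] iB [\<beta>] \<bullet> L [\<alpha>] iA [?y, \<beta>] \<bullet> h"
    by (simp add: star_def L_cmp cmp_assoc)
  also have "\<dots> = (L [] mA [?x, \<beta>] \<bullet> L [\<alpha>] G []) \<bullet> L [\<alpha>, \<alpha>, ?y] mB [] \<bullet> L [\<alpha>, \<alpha>, ?y] iB [\<beta>] \<bullet> L [\<alpha>] iA [?y, \<beta>] \<bullet> h"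
    unfolding Gr[symmetric] by (simp add: L_cmp cmp_assoc)
  also have "\<dots> = G \<bullet> h"
    unfolding Gl[symmetric] using cmp_cancel[OF mB_laws(2)[of "[\<alpha>, \<alpha>, ?y]" "[]"]] cmp_cancel[OF mA_laws(3)[of "[]" "[?y, \<beta>]"]]
    by (simp add: cmp_assoc)
  finally have "star y h (star x ?k h) = ext y h \<bullet> G \<bullet> h"
    by (simp add: star_def ext_def cmp_assoc)
  also have "\<dots> = (ext y h \<bullet> G \<bullet> ext y h) \<bullet> L [\<alpha>, ?x] iB [] \<bullet> L [] iA [?x]"
    by (simp add: cmp_assoc ext_unit)
  also have "\<dots> = h"
    by (simp add: reg ext_unit)
  finally show "star y h (star x ?k h) = h" .
qed

text \<open>Identifies the word \<open>[\<alpha>, fo x, \<beta>]\<close> with the letter of the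
  object \<open>free x\<close>, which is what the category of bimodules sees.\<close>

definition "kap x = L [] (mu a (x \<otimes>\<^sub>M b)) [] \<bullet> L [\<alpha>] (mu x b) []"
definition "kap' x = L [\<alpha>] (mu' x b) [] \<bullet> L [] (mu' a (x \<otimes>\<^sub>M b)) []"

abbreviation "free x \<equiv> a \<otimes>\<^sub>M (x \<otimes>\<^sub>M b)"

lemma kap_arrow [simp]:
  assumes "x \<in> obj M"
  shows "Ar (kap x)" "Dom (kap x) = [\<alpha>, fo x, \<beta>]" "Cod (kap x) = [fo (free x)]"
    "Ar (kap' x)" "Dom (kap' x) = [fo (free x)]" "Cod (kap' x) = [\<alpha>, fo x, \<beta>]"
  using assms by (simp_all add: kap_def kap'_def)

lemma kap_cancel0:
  assumes "x \<in> obj M"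
  shows "kap x \<bullet> kap' x = Id [fo (free x)]" "kap' x \<bullet> kap x = Id [\<alpha>, fo x, \<beta>]"
  using assms by (simp_all add: kap_def kap'_def cmp_assoc)

lemma kap_cancel [simp]:
  assumes "x \<in> obj M" "set xs \<subseteq> ob" "set ys \<subseteq> ob"
  shows "L xs (kap x) ys \<bullet> L xs (kap' x) ys = Id (xs @ fo (free x) # ys)"
    "L xs (kap x) ys \<bullet> L xs (kap' x) ys \<bullet> k = Id (xs @ fo (free x) # ys) \<bullet> k"
    "L xs (kap' x) ys \<bullet> L xs (kap x) ys = Id (xs @ \<alpha> # fo x # \<beta> # ys)"
    "L xs (kap' x) ys \<bullet> L xs (kap x) ys \<bullet> k = Id (xs @ \<alpha> # fo x # \<beta> # ys) \<bullet> k"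
  using assms L_iso[OF kap_cancel0(1)[of x]] L_iso[OF kap_cancel0(2)[of x]] by simp_all

text \<open>Fullness of \<open>fm\<close> provides actions on \<open>free x\<close> whose strict
  images are the two products; the bimodule axioms are checked on strict diagrams and pulled back by
  faithfulness.\<close>

lemma free_bimodule:
  assumes [simp]: "x \<in> obj M"
  shows "\<exists>l r. tAr M l \<and> tdom l = a \<otimes>\<^sub>M free x \<and> tcod l = free x \<and> tAr M r \<and> tdom r = free x \<otimes>\<^sub>M b \<and> tcod r = free x
    \<and> (free x, mor l, mor r) \<in> obj (bimodules M A B)
    \<and> fm l = L [] (kap x) [] \<bullet> L [] mA [fo x, \<beta>] \<bullet> L [\<alpha>] (kap' x) [] \<bullet> L [] (mu' a (free x)) []
    \<and> fm r = L [] (kap x) [] \<bullet> L [\<alpha>, fo x] mB [] \<bullet> L [] (kap' x) [\<beta>] \<bullet> L [] (mu' (free x) b) []"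
proof -
  let ?x = "fo x" and ?X = "free x"
  let ?l = "L [] (kap x) [] \<bullet> L [] mA [?x, \<beta>] \<bullet> L [\<alpha>] (kap' x) [] \<bullet> L [] (mu' a ?X) []"
  let ?r = "L [] (kap x) [] \<bullet> L [\<alpha>, ?x] mB [] \<bullet> L [] (kap' x) [\<beta>] \<bullet> L [] (mu' ?X b) []"
  obtain l where l [simp]: "tAr M l" "tdom l = a \<otimes>\<^sub>M ?X" "tcod l = ?X" and fl: "fm l = ?l"
    by (rule fullE[of ?l "a \<otimes>\<^sub>M ?X" ?X]) simp_all
  obtain r where r [simp]: "tAr M r" "tdom r = ?X \<otimes>\<^sub>M b" "tcod r = ?X" and fr: "fm r = ?r"
    by (rule fullE[of ?r "?X \<otimes>\<^sub>M b" ?X]) simp_all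
  have Ll: "L xs (fm l) ys = L xs (kap x) ys \<bullet> L xs mA (?x # \<beta> # ys) \<bullet> L (xs @ [\<alpha>]) (kap' x) ys \<bullet> L xs (mu' a ?X) ys"
    if "set xs \<subseteq> ob" "set ys \<subseteq> ob" for xs ys
    using that by (simp add: fl L_cmp)
  have Lr: "L xs (fm r) ys = L xs (kap x) ys \<bullet> L (xs @ [\<alpha>, ?x]) mB ys \<bullet> L xs (kap' x) (\<beta> # ys) \<bullet> L xs (mu' ?X b) ys"
    if "set xs \<subseteq> ob" "set ys \<subseteq> ob" for xs ys
    using that by (simp add: fr L_cmp)
  \<comment> \<open>Arrows with a product as source are compared after precomposition with a merging
    \<open>k\<close>, which cancels the splits at the source.\<close>
  have eqI: "F = G" if "L [] (fm F) [] \<bullet> k = L [] (fm G) [] \<bullet> k" "k \<bullet> k' = Id [fo (tdom F)]"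
    "tAr M F" "tAr M G" "tdom F = tdom G" "tcod F = tcod G" for F G k k'
  proof (rule fm_faithful)
    have "L [] (fm F) [] = L [] (fm G) []"
      by (rule iso_epi[OF that(2,1)]) (use that in simp_all)
    then show "fm F = fm G"
      using that by (simp add: L_Nil)
  qed (use that in simp_all)
  note defs = L_fm Ll Lr L_fm_alg[OF A] L_fm_alg[OF B] cmp_assoc
  have l1: "l \<bullet>\<^sub>D (tmA \<boxtimes>\<^sub>D tid M ?X) = l \<bullet>\<^sub>D (tid M a \<boxtimes>\<^sub>D l) \<bullet>\<^sub>D D.As a a ?X"
  proof (rule eqI)
    show "L [] (fm (l \<bullet>\<^sub>D (tmA \<boxtimes>\<^sub>D tid M ?X))) [] \<bullet> L [] (mu (a \<otimes>\<^sub>M a) ?X) [] \<bullet> L [] (mu a a) [fo ?X]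
      = L [] (fm (l \<bullet>\<^sub>D (tid M a \<boxtimes>\<^sub>D l) \<bullet>\<^sub>D D.As a a ?X)) [] \<bullet> L [] (mu (a \<otimes>\<^sub>M a) ?X) [] \<bullet> L [] (mu a a) [fo ?X]"
      using cmp_cancel[OF mA_laws(1)[of "[]" "[?x, \<beta>]"], of "L [\<alpha>, \<alpha>] (kap' x) []"] exchange0[of mA "kap' x" "[]" "[]" "[]"]
      by (simp add: defs)
    show "(L [] (mu (a \<otimes>\<^sub>M a) ?X) [] \<bullet> L [] (mu a a) [fo ?X]) \<bullet> L [] (mu' a a) [fo ?X] \<bullet> L [] (mu' (a \<otimes>\<^sub>M a) ?X) []
      = Id [fo (tdom (l \<bullet>\<^sub>D (tmA \<boxtimes>\<^sub>D tid M ?X)))]"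
      by (simp add: cmp_assoc)
  qed simp_all
  have l2: "l \<bullet>\<^sub>D (tiA \<boxtimes>\<^sub>D tid M ?X) = D.Lu ?X"
  proof (rule eqI)
    show "L [] (fm (l \<bullet>\<^sub>D (tiA \<boxtimes>\<^sub>D tid M ?X))) [] \<bullet> L [] (mu \<one>\<^bsub>M\<^esub> ?X) [] \<bullet> L [] nu [fo ?X]
      = L [] (fm (D.Lu ?X)) [] \<bullet> L [] (mu \<one>\<^bsub>M\<^esub> ?X) [] \<bullet> L [] nu [fo ?X]"
      using exchange0[of iA "kap' x" "[]" "[]" "[]", symmetric] cmp_cancel[OF mA_laws(2)[of "[]" "[?x, \<beta>]"]]
      by (simp add: defs)
    show "(L [] (mu \<one>\<^bsub>M\<^esub> ?X) [] \<bullet> L [] nu [fo ?X]) \<bullet> L [] nu' [fo ?X] \<bullet> L [] (mu' \<one>\<^bsub>M\<^esub> ?X) []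
      = Id [fo (tdom (l \<bullet>\<^sub>D (tiA \<boxtimes>\<^sub>D tid M ?X)))]"
      by (simp add: cmp_assoc)
  qed simp_all
  have r1: "r \<bullet>\<^sub>D (r \<boxtimes>\<^sub>D tid M b) = r \<bullet>\<^sub>D (tid M ?X \<boxtimes>\<^sub>D tmB) \<bullet>\<^sub>D D.As ?X b b"
  proof (rule eqI)
    show "L [] (fm (r \<bullet>\<^sub>D (r \<boxtimes>\<^sub>D tid M b))) [] \<bullet> L [] (mu (?X \<otimes>\<^sub>M b) b) [] \<bullet> L [] (mu ?X b) [\<beta>]
      = L [] (fm (r \<bullet>\<^sub>D (tid M ?X \<boxtimes>\<^sub>D tmB) \<bullet>\<^sub>D D.As ?X b b)) [] \<bullet> L [] (mu (?X \<otimes>\<^sub>M b) b) [] \<bullet> L [] (mu ?X b) [\<beta>]"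
      using cmp_cancel[OF mB_laws(1)[of "[\<alpha>, ?x]" "[]"]] exchange0[of "kap' x" mB "[]" "[]" "[]"]
      by (simp add: defs)
    show "(L [] (mu (?X \<otimes>\<^sub>M b) b) [] \<bullet> L [] (mu ?X b) [\<beta>]) \<bullet> L [] (mu' ?X b) [\<beta>] \<bullet> L [] (mu' (?X \<otimes>\<^sub>M b) b) []
      = Id [fo (tdom (r \<bullet>\<^sub>D (r \<boxtimes>\<^sub>D tid M b)))]"
      by (simp add: cmp_assoc)
  qed simp_all
  have r2: "r \<bullet>\<^sub>D (tid M ?X \<boxtimes>\<^sub>D tiB) = D.Ru ?X"
  proof (rule eqI)
    show "L [] (fm (r \<bullet>\<^sub>D (tid M ?X \<boxtimes>\<^sub>D tiB))) [] \<bullet> L [] (mu ?X \<one>\<^bsub>M\<^esub>) [] \<bullet> L [fo ?X] nu []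
      = L [] (fm (D.Ru ?X)) [] \<bullet> L [] (mu ?X \<one>\<^bsub>M\<^esub>) [] \<bullet> L [fo ?X] nu []"
      using exchange0[of "kap' x" iB "[]" "[]" "[]"] cmp_cancel[OF mB_laws(3)[of "[\<alpha>, ?x]" "[]"]]
      by (simp add: defs)
    show "(L [] (mu ?X \<one>\<^bsub>M\<^esub>) [] \<bullet> L [fo ?X] nu []) \<bullet> L [fo ?X] nu' [] \<bullet> L [] (mu' ?X \<one>\<^bsub>M\<^esub>) []
      = Id [fo (tdom (r \<bullet>\<^sub>D (tid M ?X \<boxtimes>\<^sub>D tiB)))]"
      by (simp add: cmp_assoc)
  qed simp_all
  have lr: "r \<bullet>\<^sub>D (l \<boxtimes>\<^sub>D tid M b) = l \<bullet>\<^sub>D (tid M a \<boxtimes>\<^sub>D r) \<bullet>\<^sub>D D.As a ?X b"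
  proof (rule eqI)
    show "L [] (fm (r \<bullet>\<^sub>D (l \<boxtimes>\<^sub>D tid M b))) [] \<bullet> L [] (mu (a \<otimes>\<^sub>M ?X) b) [] \<bullet> L [] (mu a ?X) [\<beta>]
      = L [] (fm (l \<bullet>\<^sub>D (tid M a \<boxtimes>\<^sub>D r) \<bullet>\<^sub>D D.As a ?X b)) [] \<bullet> L [] (mu (a \<otimes>\<^sub>M ?X) b) [] \<bullet> L [] (mu a ?X) [\<beta>]"
      using cmp_cancel[OF exchange0[of mA mB "[]" "[]" "[?x]"]] by (simp add: defs)
    show "(L [] (mu (a \<otimes>\<^sub>M ?X) b) [] \<bullet> L [] (mu a ?X) [\<beta>]) \<bullet> L [] (mu' a ?X) [\<beta>] \<bullet> L [] (mu' (a \<otimes>\<^sub>M ?X) b) []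
      = Id [fo (tdom (r \<bullet>\<^sub>D (l \<boxtimes>\<^sub>D tid M b)))]"
      by (simp add: cmp_assoc)
  qed simp_all
  have "(?X, mor l, mor r) \<in> obj (bimodules M A B)"
    using tAr_sel(3)[of M l] tAr_sel(3)[of M r] arg_cong[OF l1, of mor] arg_cong[OF l2, of mor]
      arg_cong[OF r1, of mor] arg_cong[OF r2, of mor] arg_cong[OF lr, of mor]
    by (simp add: bimodules_def is_left_action_def is_right_action_def Let_def)
  then show ?thesis
    using fl fr l r by blast
qed

text \<open>Conjugation by \<open>kap\<close> turns \<open>ext y h\<close> into a bimodule map of
  free bimodules; a quasi-inverse of it, conjugated back, is bilinear in the strict sense.\<close>

lemma bimodules_regular:
  assumes reg: "\<And>X Y f. \<lbrakk>X \<in> obj (bimodules M A B); Y \<in> obj (bimodules M A B); f \<in> hom (bimodules M A B) X Y\<rbrakk>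
      \<Longrightarrow> \<exists>g\<in>hom (bimodules M A B) Y X. f \<cdot>\<^bsub>M\<^esub> g \<cdot>\<^bsub>M\<^esub> f = f"
    and [simp]: "x \<in> obj M" "y \<in> obj M" "Ar h" "Dom h = [fo x]" "Cod h = [\<alpha>, fo y, \<beta>]"
  shows "\<exists>G. bilinear y x G \<and> ext y h \<bullet> G \<bullet> ext y h = ext y h"
proof -
  let ?X = "free x" and ?Y = "free y"
  obtain l r where l [simp]: "tAr M l" "tdom l = a \<otimes>\<^sub>M ?X" "tcod l = ?X" and r [simp]: "tAr M r" "tdom r = ?X \<otimes>\<^sub>M b" "tcod r = ?X"
    and X: "(?X, mor l, mor r) \<in> obj (bimodules M A B)"
    and fl: "fm l = L [] (kap x) [] \<bullet> L [] mA [fo x, \<beta>] \<bullet> L [\<alpha>] (kap' x) [] \<bullet> L [] (mu' a ?X) []"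
    and fr: "fm r = L [] (kap x) [] \<bullet> L [\<alpha>, fo x] mB [] \<bullet> L [] (kap' x) [\<beta>] \<bullet> L [] (mu' ?X b) []"
    using free_bimodule[of x] by auto
  obtain l' r' where l' [simp]: "tAr M l'" "tdom l' = a \<otimes>\<^sub>M ?Y" "tcod l' = ?Y" and r' [simp]: "tAr M r'" "tdom r' = ?Y \<otimes>\<^sub>M b" "tcod r' = ?Y"
    and Y: "(?Y, mor l', mor r') \<in> obj (bimodules M A B)"
    and fl': "fm l' = L [] (kap y) [] \<bullet> L [] mA [fo y, \<beta>] \<bullet> L [\<alpha>] (kap' y) [] \<bullet> L [] (mu' a ?Y) []"
    and fr': "fm r' = L [] (kap y) [] \<bullet> L [\<alpha>, fo y] mB [] \<bullet> L [] (kap' y) [\<beta>] \<bullet> L [] (mu' ?Y b) []"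
    using free_bimodule[of y] by auto
  have H: "Ar (ext y h)" "Dom (ext y h) = [\<alpha>, fo x, \<beta>]" "Cod (ext y h) = [\<alpha>, fo y, \<beta>]"
    and Hl: "ext y h \<bullet> L [] mA [fo x, \<beta>] = L [] mA [fo y, \<beta>] \<bullet> L [\<alpha>] (ext y h) []"
    and Hr: "ext y h \<bullet> L [\<alpha>, fo x] mB [] = L [\<alpha>, fo y] mB [] \<bullet> L [] (ext y h) [\<beta>]"
    using bilinear_ext[of x y h] by (simp_all add: bilinear_def)
  obtain F where F [simp]: "tAr M F" "tdom F = ?X" "tcod F = ?Y" and fF: "fm F = L [] (kap y) [] \<bullet> ext y h \<bullet> L [] (kap' x) []"
    by (rule fullE[of "L [] (kap y) [] \<bullet> ext y h \<bullet> L [] (kap' x) []" ?X ?Y]) (simp_all add: H)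
  have eqI: "P = R" if "L [] (fm P) [] \<bullet> k = L [] (fm R) [] \<bullet> k" "k \<bullet> k' = Id [fo (tdom P)]"
    "tAr M P" "tAr M R" "tdom P = tdom R" "tcod P = tcod R" for P R k k'
  proof (rule fm_faithful)
    have "L [] (fm P) [] = L [] (fm R) []"
      by (rule iso_epi[OF that(2,1)]) (use that in simp_all)
    then show "fm P = fm R"
      using that by (simp add: L_Nil)
  qed (use that in simp_all)
  have Fl: "F \<bullet>\<^sub>D l = l' \<bullet>\<^sub>D (tid M a \<boxtimes>\<^sub>D F)"
  proof (rule eqI)
    show "L [] (fm (F \<bullet>\<^sub>D l)) [] \<bullet> L [] (mu a ?X) [] = L [] (fm (l' \<bullet>\<^sub>D (tid M a \<boxtimes>\<^sub>D F))) [] \<bullet> L [] (mu a ?X) []"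
      using cmp_cancel[OF Hl] by (simp add: L_fm fl fl' fF L_cmp H cmp_assoc L_Nil[OF H(1)])
    show "L [] (mu a ?X) [] \<bullet> L [] (mu' a ?X) [] = Id [fo (tdom (F \<bullet>\<^sub>D l))]"
      by simp
  qed simp_all
  have Fr: "F \<bullet>\<^sub>D r = r' \<bullet>\<^sub>D (F \<boxtimes>\<^sub>D tid M b)"
  proof (rule eqI)
    show "L [] (fm (F \<bullet>\<^sub>D r)) [] \<bullet> L [] (mu ?X b) [] = L [] (fm (r' \<bullet>\<^sub>D (F \<boxtimes>\<^sub>D tid M b))) [] \<bullet> L [] (mu ?X b) []"
      using cmp_cancel[OF Hr] by (simp add: L_fm fr fr' fF L_cmp H cmp_assoc L_Nil[OF H(1)])
    show "L [] (mu ?X b) [] \<bullet> L [] (mu' ?X b) [] = Id [fo (tdom (F \<bullet>\<^sub>D r))]"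
      by simp
  qed simp_all
  have "mor F \<in> hom (bimodules M A B) (?X, mor l, mor r) (?Y, mor l', mor r')"
    using arg_cong[OF Fl, of mor] arg_cong[OF Fr, of mor] tAr_sel(3)[of M F] by (simp add: bimodules_def)
  then obtain g where g: "g \<in> hom (bimodules M A B) (?Y, mor l', mor r') (?X, mor l, mor r)" "mor F \<cdot>\<^bsub>M\<^esub> g \<cdot>\<^bsub>M\<^esub> mor F = mor F"
    using reg[OF X Y] by blast
  define G where "G = mk M ?Y g ?X"
  have G [simp]: "tAr M G" "tdom G = ?Y" "tcod G = ?X" "mor G = g"
    using g(1) by (simp_all add: G_def bimodules_def)
  have Gl: "G \<bullet>\<^sub>D l' = l \<bullet>\<^sub>D (tid M a \<boxtimes>\<^sub>D G)" and Gr: "G \<bullet>\<^sub>D r' = r \<bullet>\<^sub>D (G \<boxtimes>\<^sub>D tid M b)"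
    using g(1) by (auto intro!: tarr_eqI[of M] simp: bimodules_def)
  have FGF: "F \<bullet>\<^sub>D G \<bullet>\<^sub>D F = F"
    using g(2) by (intro tarr_eqI[of M]) simp_all
  let ?G = "L [] (kap' x) [] \<bullet> L [] (fm G) [] \<bullet> L [] (kap y) []"
  have "L [] (kap' x) [] \<bullet> L [] (fm (G \<bullet>\<^sub>D l')) [] \<bullet> L [] (mu a ?Y) [] \<bullet> L [\<alpha>] (kap y) []
      = L [] (kap' x) [] \<bullet> L [] (fm (l \<bullet>\<^sub>D (tid M a \<boxtimes>\<^sub>D G))) [] \<bullet> L [] (mu a ?Y) [] \<bullet> L [\<alpha>] (kap y) []"
    by (simp only: Gl)
  then have 1: "?G \<bullet> L [] mA [fo y, \<beta>] = L [] mA [fo x, \<beta>] \<bullet> L [\<alpha>] ?G []"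
    by (simp add: L_fm fl fl' L_cmp cmp_assoc)
  have "L [] (kap' x) [] \<bullet> L [] (fm (G \<bullet>\<^sub>D r')) [] \<bullet> L [] (mu ?Y b) [] \<bullet> L [] (kap y) [\<beta>]
      = L [] (kap' x) [] \<bullet> L [] (fm (r \<bullet>\<^sub>D (G \<boxtimes>\<^sub>D tid M b))) [] \<bullet> L [] (mu ?Y b) [] \<bullet> L [] (kap y) [\<beta>]"
    by (simp only: Gr)
  then have 2: "?G \<bullet> L [\<alpha>, fo y] mB [] = L [\<alpha>, fo x] mB [] \<bullet> L [] ?G [\<beta>]"
    by (simp add: L_fm fr fr' L_cmp cmp_assoc)
  have "bilinear y x ?G"
    using 1 2 by (simp add: bilinear_def)
  moreover have "L [] (kap' y) [] \<bullet> L [] (fm (F \<bullet>\<^sub>D G \<bullet>\<^sub>D F)) [] \<bullet> L [] (kap x) [] = L [] (kap' y) [] \<bullet> L [] (fm F) [] \<bullet> L [] (kap x) []"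
    by (simp only: FGF)
  then have "ext y h \<bullet> ?G \<bullet> ext y h = ext y h"
    by (simp add: fF L_cmp cmp_assoc H L_Nil[OF H(1)])
  ultimately show ?thesis
    by blast
qed

end

text \<open>The splitting is a map of bimodules, and its left and right linearity become the two
  equations for the section composed with the multiplication.\<close>

lemma (in strong_functor) separable_section:
  assumes sep: "separable_algebra C A"
  defines "a \<equiv> fo (alg_obj A)"
  shows "\<exists>s. Ar s \<and> Dom s = [a] \<and> Cod s = [a, a] \<and> L [] (smult A) [] \<bullet> L [] s [] = Id [a]
    \<and> L [] s [] \<bullet> L [] (smult A) [] = L [] (smult A) [a] \<bullet> L [a] s []
    \<and> L [] s [] \<bullet> L [] (smult A) [] = L [a] (smult A) [] \<bullet> L [] s [a]"
proof -
  let ?a = "alg_obj A"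
  have A: "is_algebra C A"
    using sep by (simp add: separable_algebra_def)
  note [simp] = is_algebraD(1-3)[OF A] salg_arrow[OF A]
  let ?m = "mk C (?a \<otimes> ?a) (alg_mult A) ?a"
  obtain s where s [simp]: "s \<in> hom C ?a (?a \<otimes> ?a)"
    and s1: "s \<cdot> alg_mult A = ((alg_mult A \<star> idm C ?a) \<cdot> assoc_inv C ?a ?a ?a) \<cdot> (idm C ?a \<star> s)"
    and s2: "s \<cdot> alg_mult A = ((idm C ?a \<star> alg_mult A) \<cdot> assoc C ?a ?a ?a) \<cdot> (s \<star> idm C ?a)"
    and s3: "alg_mult A \<cdot> s = idm C ?a"
    using sep by (auto simp: separable_algebra_def Let_def bimodules_def)
  let ?s = "mk C ?a s (?a \<otimes> ?a)"
  define s' where "s' = mu' ?a ?a \<bullet> fm ?s"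
  have Ls: "L xs (fm ?s) ys = L xs (mu ?a ?a) ys \<bullet> L xs s' ys" if "set xs \<subseteq> ob" "set ys \<subseteq> ob" for xs ys
    using that by (simp add: s'_def L_cmp)
  have s' [simp]: "Ar s'" "Dom s' = [a]" "Cod s' = [a, a]"
    by (simp_all add: s'_def a_def)
  note defs = L_fm L_fm_alg[OF A] Ls cmp_assoc
  have "?s \<bullet>\<^sub>t ?m = (?m \<boxtimes>\<^sub>t tid C ?a) \<bullet>\<^sub>t C.Ai ?a ?a ?a \<bullet>\<^sub>t (tid C ?a \<boxtimes>\<^sub>t ?s)"
    using s1 by (subst C.cmp_assoc[symmetric], intro tarr_eqI[of C]) simp_all
  then have "L [] (mu' ?a ?a) [] \<bullet> L [] (fm (?s \<bullet>\<^sub>t ?m)) [] \<bullet> L [] (mu ?a ?a) []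
    = L [] (mu' ?a ?a) [] \<bullet> L [] (fm ((?m \<boxtimes>\<^sub>t tid C ?a) \<bullet>\<^sub>t C.Ai ?a ?a ?a \<bullet>\<^sub>t (tid C ?a \<boxtimes>\<^sub>t ?s))) [] \<bullet> L [] (mu ?a ?a) []"
    by (simp only:)
  then have 1: "L [] s' [] \<bullet> L [] (smult A) [] = L [] (smult A) [a] \<bullet> L [a] s' []"
    by (simp add: defs) (simp add: a_def)
  have "?s \<bullet>\<^sub>t ?m = (tid C ?a \<boxtimes>\<^sub>t ?m) \<bullet>\<^sub>t C.As ?a ?a ?a \<bullet>\<^sub>t (?s \<boxtimes>\<^sub>t tid C ?a)"
    using s2 by (subst C.cmp_assoc[symmetric], intro tarr_eqI[of C]) simp_all
  then have "L [] (mu' ?a ?a) [] \<bullet> L [] (fm (?s \<bullet>\<^sub>t ?m)) [] \<bullet> L [] (mu ?a ?a) []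
    = L [] (mu' ?a ?a) [] \<bullet> L [] (fm ((tid C ?a \<boxtimes>\<^sub>t ?m) \<bullet>\<^sub>t C.As ?a ?a ?a \<bullet>\<^sub>t (?s \<boxtimes>\<^sub>t tid C ?a))) [] \<bullet> L [] (mu ?a ?a) []"
    by (simp only:)
  then have 2: "L [] s' [] \<bullet> L [] (smult A) [] = L [a] (smult A) [] \<bullet> L [] s' [a]"
    by (simp add: defs) (simp add: a_def)
  have "?m \<bullet>\<^sub>t ?s = tid C ?a"
    using s3 by (intro tarr_eqI[of C]) simp_all
  then have "L [] (fm (?m \<bullet>\<^sub>t ?s)) [] = L [] (fm (tid C ?a)) []"
    by (simp only:)
  then have "L [] (smult A) [] \<bullet> L [] s' [] = Id [a]"
    by (simp add: defs) (simp add: a_def)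
  then show ?thesis
    using 1 2 s' by blast
qed

context trace_of_algebras
begin

text \<open>As in Maschke's theorem, a quasi-inverse that exists in \<open>M\<close> is averaged:
  the sections create extra factors of \<open>A\<close> and \<open>B\<close>, the quasi-inverse acts
  in between, and the products absorb the factors. Since \<open>ext y h\<close> is bilinear it
  slides through the averaging, which therefore preserves the equation.\<close>

lemma separable_regular:
  assumes sep: "separable_algebra M A" "separable_algebra M B"
    and reg: "\<And>F. tAr M F \<Longrightarrow> \<exists>G. tAr M G \<and> tdom G = tcod F \<and> tcod G = tdom F \<and> F \<bullet>\<^sub>D G \<bullet>\<^sub>D F = F"
    and [simp]: "x \<in> obj M" "y \<in> obj M" "Ar h" "Dom h = [fo x]" "Cod h = [\<alpha>, fo y, \<beta>]"
  shows "\<exists>G. bilinear y x G \<and> ext y h \<bullet> G \<bullet> ext y h = ext y h"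
proof -
  let ?x = "fo x" and ?y = "fo y"
  obtain sA where sA [simp]: "Ar sA" "Dom sA = [\<alpha>]" "Cod sA = [\<alpha>, \<alpha>]" and A1: "L [] mA [] \<bullet> L [] sA [] = Id [\<alpha>]"
    and A2: "L [] sA [] \<bullet> L [] mA [] = L [] mA [\<alpha>] \<bullet> L [\<alpha>] sA []" and A3: "L [] sA [] \<bullet> L [] mA [] = L [\<alpha>] mA [] \<bullet> L [] sA [\<alpha>]"
    using separable_section[OF sep(1)] by auto
  obtain sB where sB [simp]: "Ar sB" "Dom sB = [\<beta>]" "Cod sB = [\<beta>, \<beta>]" and B1: "L [] mB [] \<bullet> L [] sB [] = Id [\<beta>]"
    and B2: "L [] sB [] \<bullet> L [] mB [] = L [] mB [\<beta>] \<bullet> L [\<beta>] sB []" and B3: "L [] sB [] \<bullet> L [] mB [] = L [\<beta>] mB [] \<bullet> L [] sB [\<beta>]"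
    using separable_section[OF sep(2)] by auto
  let ?H = "ext y h"
  have H [simp]: "Ar ?H" "Dom ?H = [\<alpha>, ?x, \<beta>]" "Cod ?H = [\<alpha>, ?y, \<beta>]"
    and Hl: "?H \<bullet> L [] mA [?x, \<beta>] = L [] mA [?y, \<beta>] \<bullet> L [\<alpha>] ?H []"
    and Hr: "?H \<bullet> L [\<alpha>, ?x] mB [] = L [\<alpha>, ?y] mB [] \<bullet> L [] ?H [\<beta>]"
    using bilinear_ext[of x y h] by (simp_all add: bilinear_def)
  \<comment> \<open>A quasi-inverse of the underlying arrow of \<open>M\<close> between the objects
    \<open>free x\<close> and \<open>free y\<close>, not yet bilinear.\<close>
  obtain g where g [simp]: "Ar g" "Dom g = [\<alpha>, ?y, \<beta>]" "Cod g = [\<alpha>, ?x, \<beta>]" and HgH: "?H \<bullet> g \<bullet> ?H = ?H"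
  proof -
    obtain F where F [simp]: "tAr M F" "tdom F = free x" "tcod F = free y" and fF: "fm F = kap y \<bullet> ?H \<bullet> kap' x"
      by (rule fullE[of "kap y \<bullet> ?H \<bullet> kap' x" "free x" "free y"]) simp_all
    obtain G where G [simp]: "tAr M G" "tdom G = free y" "tcod G = free x" and FGF: "F \<bullet>\<^sub>D G \<bullet>\<^sub>D F = F"
      using reg[of F] by auto
    have "kap' y \<bullet> fm (F \<bullet>\<^sub>D G \<bullet>\<^sub>D F) \<bullet> kap x = kap' y \<bullet> fm F \<bullet> kap x"
      by (simp only: FGF)
    then have "?H \<bullet> (kap' x \<bullet> fm G \<bullet> kap y) \<bullet> ?H = ?H"
      using cmp_cancel[OF kap_cancel0(2)[of y]] by (simp add: fm_cmp fF cmp_assoc kap_cancel0)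
    then show ?thesis
      by (rule that[rotated 3]) simp_all
  qed
  \<comment> \<open>Read from the source: split each outer letter in two, apply \<open>g\<close> to
    the three inner letters, and multiply the outer letters back.\<close>
  define G where "G = L [] mA [?x, \<beta>] \<bullet> L [\<alpha>, \<alpha>, ?x] mB [] \<bullet> L [\<alpha>] g [\<beta>] \<bullet> L [] sA [?y, \<beta>, \<beta>] \<bullet> L [\<alpha>, ?y] sB []"
  have G: "Ar G" "Dom G = [\<alpha>, ?y, \<beta>]" "Cod G = [\<alpha>, ?x, \<beta>]"
    by (simp_all add: G_def)
  have sA: "L [] sA ys \<bullet> L [] mA ys = L [] mA (\<alpha> # ys) \<bullet> L [\<alpha>] sA ys"
    "L [] sA ys \<bullet> L [] mA ys = L [\<alpha>] mA ys \<bullet> L [] sA (\<alpha> # ys)"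
    "L [] mA ys \<bullet> L [] sA ys = Id (\<alpha> # ys)" if "set ys \<subseteq> ob" for ys
    using that L_cong[OF A2, of "[]" ys] L_cong[OF A3, of "[]" ys] L_cong[OF A1, of "[]" ys] by (simp_all add: L_cmp)
  have sB: "L xs sB [] \<bullet> L xs mB [] = L xs mB [\<beta>] \<bullet> L (xs @ [\<beta>]) sB []"
    "L xs sB [] \<bullet> L xs mB [] = L (xs @ [\<beta>]) mB [] \<bullet> L xs sB [\<beta>]"
    "L xs mB [] \<bullet> L xs sB [] = Id (xs @ [\<beta>])" if "set xs \<subseteq> ob" for xs
    using that L_cong[OF B2, of xs "[]"] L_cong[OF B3, of xs "[]"] L_cong[OF B1, of xs "[]"] by (simp_all add: L_cmp)
  have "G \<bullet> L [] mA [?y, \<beta>] = L [] mA [?x, \<beta>] \<bullet> L [\<alpha>, \<alpha>, ?x] mB [] \<bullet> L [\<alpha>] g [\<beta>]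
      \<bullet> (L [] sA [?y, \<beta>, \<beta>] \<bullet> L [] mA [?y, \<beta>, \<beta>]) \<bullet> L [\<alpha>, \<alpha>, ?y] sB []"
    using exchange0[of mA sB "[]" "[]" "[?y]"] by (simp add: G_def cmp_assoc)
  also have "\<dots> = (L [] mA [?x, \<beta>] \<bullet> L [] mA [\<alpha>, ?x, \<beta>]) \<bullet> L [\<alpha>, \<alpha>, \<alpha>, ?x] mB [] \<bullet> L [\<alpha>, \<alpha>] g [\<beta>]
      \<bullet> L [\<alpha>] sA [?y, \<beta>, \<beta>] \<bullet> L [\<alpha>, \<alpha>, ?y] sB []"
    by (subst sA(1)) (simp_all add: cmp_assoc exch)
  also have "\<dots> = L [] mA [?x, \<beta>] \<bullet> L [\<alpha>] G []"
    using mA_laws(1)[of "[]" "[?x, \<beta>]"] by (simp add: G_def L_cmp cmp_assoc)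
  finally have Gl: "G \<bullet> L [] mA [?y, \<beta>] = L [] mA [?x, \<beta>] \<bullet> L [\<alpha>] G []" .
  have "G \<bullet> L [\<alpha>, ?y] mB [] = L [] mA [?x, \<beta>] \<bullet> L [\<alpha>, \<alpha>, ?x] mB [] \<bullet> L [\<alpha>] g [\<beta>]
      \<bullet> L [] sA [?y, \<beta>, \<beta>] \<bullet> (L [\<alpha>, ?y] sB [] \<bullet> L [\<alpha>, ?y] mB [])"
    by (simp add: G_def cmp_assoc)
  also have "\<dots> = L [] mA [?x, \<beta>] \<bullet> L [\<alpha>, \<alpha>, ?x] mB [] \<bullet> (L [\<alpha>] g [\<beta>]
      \<bullet> L [\<alpha>, \<alpha>, ?y, \<beta>] mB []) \<bullet> L [] sA [?y, \<beta>, \<beta>, \<beta>] \<bullet> L [\<alpha>, ?y] sB [\<beta>]"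
    using cmp_cancel[OF exchange0[of sA mB "[]" "[]" "[?y, \<beta>]"]] by (subst sB(2)) (simp_all add: cmp_assoc)
  also have "\<dots> = L [] mA [?x, \<beta>] \<bullet> (L [\<alpha>, \<alpha>, ?x] mB [] \<bullet> L [\<alpha>, \<alpha>, ?x, \<beta>] mB []) \<bullet> L [\<alpha>] g [\<beta>, \<beta>]
      \<bullet> L [] sA [?y, \<beta>, \<beta>, \<beta>] \<bullet> L [\<alpha>, ?y] sB [\<beta>]"
    using exchange0[of g mB "[\<alpha>]" "[]" "[]"] by (simp add: cmp_assoc)
  also have "\<dots> = L [\<alpha>, ?x] mB [] \<bullet> L [] G [\<beta>]"
    using mB_laws(1)[of "[\<alpha>, \<alpha>, ?x]" "[]", symmetric] cmp_cancel[OF exchange0[of mA mB "[]" "[]" "[?x]"]]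
      cmp_cancel[OF exchange0[of mA mB "[]" "[\<beta>]" "[?x]"]]
    by (simp add: G_def L_cmp cmp_assoc)
  finally have Gr: "G \<bullet> L [\<alpha>, ?y] mB [] = L [\<alpha>, ?x] mB [] \<bullet> L [] G [\<beta>]" .
  \<comment> \<open>\<open>HH\<close> moves \<open>?H\<close> inwards past the products, and
    \<open>sH\<close> moves it inwards past the sections; between them \<open>?H\<close>,
    \<open>g\<close>, \<open>?H\<close> meet and collapse by \<open>HgH\<close>.\<close>
  have HH: "?H \<bullet> L [] mA [?x, \<beta>] \<bullet> L [\<alpha>, \<alpha>, ?x] mB [] = L [] mA [?y, \<beta>] \<bullet> L [\<alpha>, \<alpha>, ?y] mB [] \<bullet> L [\<alpha>] ?H [\<beta>]"
    using cmp_cancel[OF Hl] L_cong[OF Hr, of "[\<alpha>]" "[]"] by (simp add: L_cmp cmp_assoc)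
  have sH: "L [] sA [?y, \<beta>, \<beta>] \<bullet> L [\<alpha>, ?y] sB [] \<bullet> ?H = L [\<alpha>] ?H [\<beta>] \<bullet> L [] sA [?x, \<beta>, \<beta>] \<bullet> L [\<alpha>, ?x] sB []"
  proof -
    have "L [] sA [?y, \<beta>, \<beta>] \<bullet> L [\<alpha>, ?y] sB [] \<bullet> ?H
      = (L [] sA [?y, \<beta>, \<beta>] \<bullet> L [] mA [?y, \<beta>, \<beta>]) \<bullet> (L [\<alpha>, \<alpha>, ?y] sB [] \<bullet> L [\<alpha>, \<alpha>, ?y] mB []) \<bullet> L [\<alpha>] h [\<beta>]"
      using cmp_cancel[OF exchange0[of mA sB "[]" "[]" "[?y]"]] by (simp add: ext_def cmp_assoc)
    also have "\<dots> = L [\<alpha>] mA [?y, \<beta>, \<beta>] \<bullet> L [] sA [\<alpha>, ?y, \<beta>, \<beta>] \<bullet> L [\<alpha>, \<alpha>, ?y] mB [\<beta>] \<bullet> L [\<alpha>, \<alpha>, ?y, \<beta>] sB [] \<bullet> L [\<alpha>] h [\<beta>]"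
      by (simp add: sA(2)) (subst sB(1); simp add: cmp_assoc)
    also have "\<dots> = L [\<alpha>] ?H [\<beta>] \<bullet> L [] sA [?x, \<beta>, \<beta>] \<bullet> L [\<alpha>, ?x] sB []"
      using exchange0[of h sB "[\<alpha>]" "[]" "[]", symmetric] cmp_cancel[OF exchange0[of sA mB "[]" "[\<beta>]" "[\<alpha>, ?y]"]]
        cmp_cancel[OF exchange0[of sA h "[]" "[\<beta>, \<beta>]" "[]"]]
      by (simp add: ext_def L_cmp cmp_assoc)
    finally show ?thesis .
  qed
  have "?H \<bullet> G \<bullet> ?H = L [] mA [?y, \<beta>] \<bullet> L [\<alpha>, \<alpha>, ?y] mB [] \<bullet> L [\<alpha>] (?H \<bullet> g \<bullet> ?H) [\<beta>] \<bullet> L [] sA [?x, \<beta>, \<beta>] \<bullet> L [\<alpha>, ?x] sB []"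
    using cmp_cancel[OF HH] by (simp add: G_def sH L_cmp cmp_assoc)
  also have "\<dots> = (?H \<bullet> L [] mA [?x, \<beta>] \<bullet> L [\<alpha>, \<alpha>, ?x] mB []) \<bullet> L [] sA [?x, \<beta>, \<beta>] \<bullet> L [\<alpha>, ?x] sB []"
    unfolding HgH HH by (simp add: cmp_assoc)
  also have "\<dots> = ?H"
    using cmp_cancel[OF exchange0[of sA mB "[]" "[]" "[?x]", symmetric]]
      sA(3)[of "[?x, \<beta>]"] sB(3)[of "[\<alpha>, ?x]"]
    by (simp add: cmp_assoc)
  finally have "?H \<bullet> G \<bullet> ?H = ?H" .
  then show ?thesis
    using G Gl Gr unfolding bilinear_def by blast
qed

end

section \<open>Semisimple linear categories\<close>

context
  fixes C :: "('k::field, 'o, 'm, 'x) LinCat_scheme" (structure)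
begin

definition tadd :: "('o, 'm) tarr \<Rightarrow> ('o, 'm) tarr \<Rightarrow> ('o, 'm) tarr" where
  "tadd F G = (tdom F, if tAr C F \<and> tAr C G \<and> tdom F = tdom G \<and> tcod F = tcod G
     then Some (mor F \<oplus> mor G) else None, tcod F)"

definition tscale :: "'k \<Rightarrow> ('o, 'm) tarr \<Rightarrow> ('o, 'm) tarr" where
  "tscale r F = (tdom F, if tAr C F then Some (r \<odot> mor F) else None, tcod F)"

definition tsub :: "('o, 'm) tarr \<Rightarrow> ('o, 'm) tarr \<Rightarrow> ('o, 'm) tarr" where
  "tsub F G = tadd F (tscale (- 1) G)"

definition tzero :: "'o \<Rightarrow> 'o \<Rightarrow> ('o, 'm) tarr" where
  "tzero x y = mk C x (zerom C x y) y"

definition tsum :: "'o \<Rightarrow> 'o \<Rightarrow> ('o, 'm) tarr list \<Rightarrow> ('o, 'm) tarr" where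
  "tsum x y Fs = foldr tadd Fs (tzero x y)"

lemma tadd_sel [simp]: "tdom (tadd F G) = tdom F" "tcod (tadd F G) = tcod F"
  by (simp_all add: tadd_def)

lemma tscale_sel [simp]: "tdom (tscale r F) = tdom F" "tcod (tscale r F) = tcod F"
  by (simp_all add: tscale_def)

lemma tsub_sel [simp]: "tdom (tsub F G) = tdom F" "tcod (tsub F G) = tcod F"
  by (simp_all add: tsub_def)

lemma tzero_sel [simp]: "tdom (tzero x y) = x" "tcod (tzero x y) = y"
  by (simp_all add: tzero_def)

end

lemma mor_in_hom [simp]: "\<lbrakk>tAr C F; tdom F = x; tcod F = y\<rbrakk> \<Longrightarrow> mor F \<in> hom C x y"
  using tAr_sel(3) by metis

context linear_category
begin

lemma tadd_Ar [simp]: "tAr C (tadd C F G) \<longleftrightarrow> tAr C F \<and> tAr C G \<and> tdom F = tdom G \<and> tcod F = tcod G"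
  using add_in_hom[of "tdom F" "tcod F" "mor F" "mor G"] tAr_sel[of C F] tAr_sel[of C G]
  by (auto simp: tadd_def)

lemma tscale_Ar [simp]: "tAr C (tscale C r F) \<longleftrightarrow> tAr C F"
  using scale_in_hom[of "tdom F" "tcod F" "mor F" r] tAr_sel[of C F]
  by (auto simp: tscale_def)

lemma tsub_Ar [simp]: "tAr C (tsub C F G) \<longleftrightarrow> tAr C F \<and> tAr C G \<and> tdom F = tdom G \<and> tcod F = tcod G"
  by (simp add: tsub_def)

lemma tzero_Ar [simp]: "tAr C (tzero C x y) \<longleftrightarrow> x \<in> obj C \<and> y \<in> obj C"
  using zero_in_hom by (auto simp: tzero_def)

lemma mor_tadd: "\<lbrakk>tAr C F; tAr C G; tdom F = tdom G; tcod F = tcod G\<rbrakk> \<Longrightarrow> mor (tadd C F G) = mor F \<oplus> mor G"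
  by (simp add: tadd_def)

lemma mor_tscale: "tAr C F \<Longrightarrow> mor (tscale C r F) = r \<odot> mor F"
  by (simp add: tscale_def)

lemma mor_tzero: "\<lbrakk>x \<in> obj C; y \<in> obj C\<rbrakk> \<Longrightarrow> mor (tzero C x y) = zerom C x y"
  using zero_in_hom by (simp add: tzero_def)

lemma tadd_commute:
  "\<lbrakk>tAr C F; tAr C G; tdom F = tdom G; tcod F = tcod G\<rbrakk> \<Longrightarrow> tadd C F G = tadd C G F"
  using add_commute[of "tdom F" "tcod F" "mor F" "mor G"] tAr_sel[of C F] tAr_sel[of C G]
  by (intro tarr_eqI[of C]) (simp_all add: mor_tadd)

lemma tadd_assoc:
  "\<lbrakk>tAr C F; tAr C G; tAr C H; tdom F = tdom G; tcod F = tcod G; tdom G = tdom H; tcod G = tcod H\<rbrakk>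
    \<Longrightarrow> tadd C (tadd C F G) H = tadd C F (tadd C G H)"
  using add_assoc[of "tdom F" "tcod F" "mor F" "mor G" "mor H"] tAr_sel[of C F] tAr_sel[of C G] tAr_sel[of C H]
  by (intro tarr_eqI[of C]) (simp_all add: mor_tadd)

lemma tadd_zero [simp]: "\<lbrakk>tAr C F; tdom F = x; tcod F = y\<rbrakk> \<Longrightarrow> tadd C F (tzero C x y) = F"
  using add_zero[of "tdom F" "tcod F" "mor F"] tAr_sel[of C F]
  by (intro tarr_eqI[of C]) (auto simp: mor_tadd mor_tzero)

lemma tzero_add [simp]: "\<lbrakk>tAr C F; tdom F = x; tcod F = y\<rbrakk> \<Longrightarrow> tadd C (tzero C x y) F = F"
  using tadd_commute[of "tzero C x y" F] by auto

lemma tscale_one: "tAr C F \<Longrightarrow> tscale C 1 F = F"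
  using scale_one[of "tdom F" "tcod F" "mor F"] tAr_sel[of C F]
  by (intro tarr_eqI[of C]) (auto simp: mor_tscale)

lemma tscale_add_left: "tAr C F \<Longrightarrow> tscale C (r + s) F = tadd C (tscale C r F) (tscale C s F)"
  using scale_add_left[of "tdom F" "tcod F" "mor F" r s] tAr_sel[of C F]
  by (intro tarr_eqI[of C]) (auto simp: mor_tscale mor_tadd)

lemma tadd_left_cancel:
  assumes "tadd C F G = tadd C F H" "tAr C F" "tAr C G" "tAr C H" "tdom F = tdom G" "tcod F = tcod G"
    "tdom F = tdom H" "tcod F = tcod H"
  shows "G = H"
proof -
  obtain n where "n \<in> hom C (tdom F) (tcod F)" "mor F \<oplus> n = zerom C (tdom F) (tcod F)"
    using add_inverse[OF tAr_sel[OF assms(2)]] by blast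
  then obtain N where N: "tAr C N" "tdom N = tdom F" "tcod N = tcod F" "mor F \<oplus> mor N = zerom C (tdom F) (tcod F)"
    using tAr_sel(1,2)[OF assms(2)] by (metis mk_sel tAr_mk)
  then have "tadd C F N = tzero C (tdom F) (tcod F)"
    using assms(2) by (intro tarr_eqI[of C]) (simp_all add: mor_tadd mor_tzero)
  then have *: "tadd C N F = tzero C (tdom F) (tcod F)"
    using tadd_commute[of F N] N assms(2) by metis
  have "tadd C (tadd C N F) G = tadd C (tadd C N F) H"
    using N assms(2-) tadd_assoc[of N F G] tadd_assoc[of N F H] assms(1) by metis
  then show ?thesis
    unfolding * using assms(2-) by simp
qed

lemma tscale_zero: "tAr C F \<Longrightarrow> tscale C 0 F = tzero C (tdom F) (tcod F)"
  using tscale_add_left[of F 0 0] tadd_left_cancel[of "tscale C 0 F" "tscale C 0 F" "tzero C (tdom F) (tcod F)"]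
  by simp

lemma tsub_self [simp]: "tAr C F \<Longrightarrow> tsub C F F = tzero C (tdom F) (tcod F)"
  using tscale_add_left[of F 1 "- 1"] tscale_one[of F] tscale_zero[of F] by (simp add: tsub_def)

lemma tsub_add:
  assumes "tAr C F" "tAr C G" "tdom F = tdom G" "tcod F = tcod G"
  shows "tadd C (tsub C F G) G = F"
proof -
  have "tadd C (tscale C (- 1) G) G = tzero C (tdom G) (tcod G)"
    using assms tsub_self[of G] tadd_commute[of G "tscale C (- 1) G"] by (simp add: tsub_def)
  then show ?thesis
    using assms by (simp add: tsub_def tadd_assoc)
qed

lemma tsub_eq_zero:
  assumes "tsub C F G = tzero C (tdom F) (tcod F)" "tAr C F" "tAr C G" "tdom F = tdom G" "tcod F = tcod G"
  shows "F = G"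
proof -
  have "tadd C (tzero C (tdom F) (tcod F)) G = F"
    using tsub_add[of F G] assms(2-) unfolding assms(1) by blast
  then show ?thesis
    using tzero_add[of G "tdom F" "tcod F"] assms by metis
qed

lemma tsub_zero [simp]: "\<lbrakk>tAr C F; tdom F = x; tcod F = y\<rbrakk> \<Longrightarrow> tsub C F (tzero C x y) = F"
  using tsub_add[of F "tzero C x y"] tadd_zero[of "tsub C F (tzero C x y)" x y]
  by (metis tAr_sel(1,2) tsub_Ar tsub_sel tzero_Ar tzero_sel)

lemma cmp_tadd:
  "\<lbrakk>tAr C F; tAr C G; tdom F = tdom G; tcod F = tcod G; tAr C H; tdom H = tcod F\<rbrakk>
    \<Longrightarrow> H \<bullet>\<^sub>t tadd C F G = tadd C (H \<bullet>\<^sub>t F) (H \<bullet>\<^sub>t G)"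
  using comp_add_right[of "tdom F" "tcod F" "tcod H" "mor F" "mor G" "mor H"] tAr_sel[of C F] tAr_sel[of C G] tAr_sel[of C H]
  by (intro tarr_eqI[of C]) (simp_all add: mor_tadd)

lemma tadd_cmp:
  "\<lbrakk>tAr C F; tAr C G; tdom F = tdom G; tcod F = tcod G; tAr C H; tdom F = tcod H\<rbrakk>
    \<Longrightarrow> tadd C F G \<bullet>\<^sub>t H = tadd C (F \<bullet>\<^sub>t H) (G \<bullet>\<^sub>t H)"
  using comp_add_left[of "tdom H" "tcod H" "tcod F" "mor H" "mor F" "mor G"] tAr_sel[of C F] tAr_sel[of C G] tAr_sel[of C H]
  by (intro tarr_eqI[of C]) (simp_all add: mor_tadd)

lemma cmp_tscale: "\<lbrakk>tAr C F; tAr C H; tdom H = tcod F\<rbrakk> \<Longrightarrow> H \<bullet>\<^sub>t tscale C r F = tscale C r (H \<bullet>\<^sub>t F)"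
  using comp_scale_right[of "tdom F" "tcod F" "tcod H" "mor F" "mor H" r] tAr_sel[of C F] tAr_sel[of C H]
  by (intro tarr_eqI[of C]) (simp_all add: mor_tscale)

lemma tscale_cmp: "\<lbrakk>tAr C F; tAr C H; tdom F = tcod H\<rbrakk> \<Longrightarrow> tscale C r F \<bullet>\<^sub>t H = tscale C r (F \<bullet>\<^sub>t H)"
  using comp_scale_left[of "tdom H" "tcod H" "tcod F" "mor H" "mor F" r] tAr_sel[of C F] tAr_sel[of C H]
  by (intro tarr_eqI[of C]) (simp_all add: mor_tscale)

lemma cmp_tsub:
  "\<lbrakk>tAr C F; tAr C G; tdom F = tdom G; tcod F = tcod G; tAr C H; tdom H = tcod F\<rbrakk>
    \<Longrightarrow> H \<bullet>\<^sub>t tsub C F G = tsub C (H \<bullet>\<^sub>t F) (H \<bullet>\<^sub>t G)"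
  by (simp add: tsub_def cmp_tadd cmp_tscale)

lemma tsub_cmp:
  "\<lbrakk>tAr C F; tAr C G; tdom F = tdom G; tcod F = tcod G; tAr C H; tdom F = tcod H\<rbrakk>
    \<Longrightarrow> tsub C F G \<bullet>\<^sub>t H = tsub C (F \<bullet>\<^sub>t H) (G \<bullet>\<^sub>t H)"
  by (simp add: tsub_def tadd_cmp tscale_cmp)

lemma cmp_tzero [simp]: "\<lbrakk>tAr C H; tdom H = y; x \<in> obj C\<rbrakk> \<Longrightarrow> H \<bullet>\<^sub>t tzero C x y = tzero C x (tcod H)"
proof -
  assume a [simp]: "tAr C H" "tdom H = y" "x \<in> obj C"
  then have [simp]: "y \<in> obj C"
    using tAr_sel by blast
  have "H \<bullet>\<^sub>t tsub C (tzero C x y) (tzero C x y) = tsub C (H \<bullet>\<^sub>t tzero C x y) (H \<bullet>\<^sub>t tzero C x y)"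
    by (rule cmp_tsub) simp_all
  then show ?thesis
    by (simp del: tsub_zero)
qed

lemma tzero_cmp [simp]: "\<lbrakk>tAr C H; tcod H = x; y \<in> obj C\<rbrakk> \<Longrightarrow> tzero C x y \<bullet>\<^sub>t H = tzero C (tdom H) y"
proof -
  assume a [simp]: "tAr C H" "tcod H = x" "y \<in> obj C"
  then have [simp]: "x \<in> obj C"
    using tAr_sel by blast
  have "tsub C (tzero C x y) (tzero C x y) \<bullet>\<^sub>t H = tsub C (tzero C x y \<bullet>\<^sub>t H) (tzero C x y \<bullet>\<^sub>t H)"
    by (rule tsub_cmp) simp_all
  then show ?thesis
    by (simp del: tsub_zero)
qed

lemma tsum_simps [simp]: "tsum C x y [] = tzero C x y" "tsum C x y (F # Fs) = tadd C F (tsum C x y Fs)"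
  by (simp_all add: tsum_def)

lemma tsum_sel:
  assumes "x \<in> obj C" "y \<in> obj C" "\<forall>F\<in>set Fs. tAr C F \<and> tdom F = x \<and> tcod F = y"
  shows "tAr C (tsum C x y Fs)" "tdom (tsum C x y Fs) = x" "tcod (tsum C x y Fs) = y"
    "mor (tsum C x y Fs) = lsum C x y (map mor Fs)"
  using assms by (induction Fs) (auto simp: lsum_def mor_tzero mor_tadd)

lemma cmp_tsum:
  assumes "x \<in> obj C" "y \<in> obj C" "\<forall>F\<in>set Fs. tAr C F \<and> tdom F = x \<and> tcod F = y" "tAr C H" "tdom H = y"
  shows "H \<bullet>\<^sub>t tsum C x y Fs = tsum C x (tcod H) (map (\<lambda>F. H \<bullet>\<^sub>t F) Fs)"
  using assms(3) by (induction Fs) (use assms in \<open>auto simp: cmp_tadd tsum_sel\<close>)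

lemma tsum_cmp:
  assumes "x \<in> obj C" "y \<in> obj C" "\<forall>F\<in>set Fs. tAr C F \<and> tdom F = x \<and> tcod F = y" "tAr C H" "tcod H = x"
  shows "tsum C x y Fs \<bullet>\<^sub>t H = tsum C (tdom H) y (map (\<lambda>F. F \<bullet>\<^sub>t H) Fs)"
  using assms(3) by (induction Fs) (use assms in \<open>auto simp: tadd_cmp tsum_sel\<close>)

lemma tsum_append:
  assumes "x \<in> obj C" "y \<in> obj C" "\<forall>F\<in>set Fs \<union> set Gs. tAr C F \<and> tdom F = x \<and> tcod F = y"
  shows "tsum C x y (Fs @ Gs) = tadd C (tsum C x y Fs) (tsum C x y Gs)"
  using assms(3) by (induction Fs) (use assms(1,2) in \<open>auto simp: tsum_sel tadd_assoc\<close>)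

lemma tsum_eq_zero:
  assumes "x \<in> obj C" "y \<in> obj C" "\<forall>F\<in>set Fs. F = tzero C x y"
  shows "tsum C x y Fs = tzero C x y"
  using assms(3) by (induction Fs) (use assms(1,2) in auto)

section \<open>Direct sums, kernels and regular arrows\<close>

definition dsum where
  "dsum x ss I P \<longleftrightarrow> x \<in> obj C \<and> set ss \<subseteq> obj C
    \<and> (\<forall>j<length ss. tAr C (I j) \<and> tdom (I j) = ss ! j \<and> tcod (I j) = x
      \<and> tAr C (P j) \<and> tdom (P j) = x \<and> tcod (P j) = ss ! j)
    \<and> (\<forall>j<length ss. \<forall>l<length ss. P j \<bullet>\<^sub>t I l = (if j = l then tid C (ss ! j) else tzero C (ss ! l) (ss ! j)))
    \<and> tsum C x x (map (\<lambda>j. I j \<bullet>\<^sub>t P j) [0..<length ss]) = tid C x"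

lemma is_direct_sum_iff:
  assumes "x \<in> obj C" "set ss \<subseteq> obj C"
  shows "is_direct_sum C x ss \<longleftrightarrow> (\<exists>I P. dsum x ss I P)"
proof
  assume "is_direct_sum C x ss"
  then obtain i p where ip: "\<forall>j<length ss. i j \<in> hom C (ss ! j) x \<and> p j \<in> hom C x (ss ! j)"
    "\<forall>j<length ss. \<forall>l<length ss. p j \<cdot> i l = (if j = l then idm C (ss ! j) else zerom C (ss ! l) (ss ! j))"
    "lsum C x x (map (\<lambda>j. i j \<cdot> p j) [0..<length ss]) = idm C x"
    unfolding is_direct_sum_def by blast
  let ?I = "\<lambda>j. mk C (ss ! j) (i j) x" and ?P = "\<lambda>j. mk C x (p j) (ss ! j)"
  have o: "j < length ss \<Longrightarrow> ss ! j \<in> obj C" for j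
    using assms by auto
  have "tsum C x x (map (\<lambda>j. ?I j \<bullet>\<^sub>t ?P j) [0..<length ss]) = tid C x"
  proof (rule tarr_eqI[of C])
    have m: "map mor (map (\<lambda>j. ?I j \<bullet>\<^sub>t ?P j) [0..<length ss]) = map (\<lambda>j. i j \<cdot> p j) [0..<length ss]"
      using ip o assms by simp
    have "mor (tsum C x x (map (\<lambda>j. ?I j \<bullet>\<^sub>t ?P j) [0..<length ss]))
        = lsum C x x (map mor (map (\<lambda>j. ?I j \<bullet>\<^sub>t ?P j) [0..<length ss]))"
      by (rule tsum_sel(4)) (use ip o assms in auto)
    then show "mor (tsum C x x (map (\<lambda>j. ?I j \<bullet>\<^sub>t ?P j) [0..<length ss])) = mor (tid C x)"
      unfolding m using ip(3) assms by simp
  qed (use assms ip o in \<open>simp_all add: tsum_sel\<close>)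
  moreover have "?P j \<bullet>\<^sub>t ?I l = (if j = l then tid C (ss ! j) else tzero C (ss ! l) (ss ! j))"
    if "j < length ss" "l < length ss" for j l
    using ip o that assms by (intro tarr_eqI[of C]) (auto simp: mor_tzero)
  ultimately have "dsum x ss ?I ?P"
    unfolding dsum_def using ip(1) o assms by simp
  then show "\<exists>I P. dsum x ss I P"
    by blast
next
  assume "\<exists>I P. dsum x ss I P"
  then obtain I P where IP: "dsum x ss I P"
    by blast
  note d = IP[unfolded dsum_def]
  show "is_direct_sum C x ss"
    unfolding is_direct_sum_def
  proof (intro exI conjI)
    show "\<forall>j<length ss. mor (I j) \<in> hom C (ss ! j) x \<and> mor (P j) \<in> hom C x (ss ! j)"
      using d by simp
    show "\<forall>j<length ss. \<forall>l<length ss. mor (P j) \<cdot> mor (I l) = (if j = l then idm C (ss ! j) else zerom C (ss ! l) (ss ! j))"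
    proof (intro allI impI)
      fix j l assume jl: "j < length ss" "l < length ss"
      then have "ss ! j \<in> obj C" "ss ! l \<in> obj C"
        using d nth_mem by blast+
      moreover have "tAr C (P j)" "tAr C (I l)" "tdom (P j) = x" "tcod (I l) = x"
        using d jl by auto
      then have "mor (P j) \<cdot> mor (I l) = mor (P j \<bullet>\<^sub>t I l)"
        by simp
      moreover have "P j \<bullet>\<^sub>t I l = (if j = l then tid C (ss ! j) else tzero C (ss ! l) (ss ! j))"
        using d jl by blast
      ultimately show "mor (P j) \<cdot> mor (I l) = (if j = l then idm C (ss ! j) else zerom C (ss ! l) (ss ! j))"
        by (simp add: mor_tzero)
    qed
    have m: "map mor (map (\<lambda>j. I j \<bullet>\<^sub>t P j) [0..<length ss]) = map (\<lambda>j. mor (I j) \<cdot> mor (P j)) [0..<length ss]"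
      using d by simp
    have "lsum C x x (map mor (map (\<lambda>j. I j \<bullet>\<^sub>t P j) [0..<length ss])) = mor (tsum C x x (map (\<lambda>j. I j \<bullet>\<^sub>t P j) [0..<length ss]))"
      by (rule tsum_sel(4)[symmetric]) (use d in auto)
    then show "lsum C x x (map (\<lambda>j. mor (I j) \<cdot> mor (P j)) [0..<length ss]) = idm C x"
      unfolding m using d by simp
  qed
qed

text \<open>Compose with the decomposition of the identity of the source.\<close>

lemma dsum_zero_left:
  assumes d: "dsum x ss I P" and F: "tAr C F" "tdom F = x" "\<And>j. j < length ss \<Longrightarrow> F \<bullet>\<^sub>t I j = tzero C (ss ! j) (tcod F)"
  shows "F = tzero C x (tcod F)"
proof -
  note d' = d[unfolded dsum_def]
  have "F = F \<bullet>\<^sub>t tsum C x x (map (\<lambda>j. I j \<bullet>\<^sub>t P j) [0..<length ss])"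
    using d' F by simp
  also have "\<dots> = tsum C x (tcod F) (map (\<lambda>H. F \<bullet>\<^sub>t H) (map (\<lambda>j. I j \<bullet>\<^sub>t P j) [0..<length ss]))"
    by (rule cmp_tsum) (use d' F in auto)
  also have "\<dots> = tzero C x (tcod F)"
  proof (rule tsum_eq_zero)
    have "F \<bullet>\<^sub>t I j \<bullet>\<^sub>t P j = tzero C x (tcod F)" if "j < length ss" for j
      using cmp_cancel[OF F(3)[OF that], of "P j"] d' F that by simp
    then show "\<forall>G\<in>set (map (\<lambda>H. F \<bullet>\<^sub>t H) (map (\<lambda>j. I j \<bullet>\<^sub>t P j) [0..<length ss])). G = tzero C x (tcod F)"
      by simp
  qed (use d' F in auto)
  finally show ?thesis .
qed

lemma dsum_zero_right:
  assumes d: "dsum y ss I P" and F: "tAr C F" "tcod F = y" "\<And>j. j < length ss \<Longrightarrow> P j \<bullet>\<^sub>t F = tzero C (tdom F) (ss ! j)"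
  shows "F = tzero C (tdom F) y"
proof -
  note d' = d[unfolded dsum_def]
  have "F = tsum C y y (map (\<lambda>j. I j \<bullet>\<^sub>t P j) [0..<length ss]) \<bullet>\<^sub>t F"
    using d' F by simp
  also have "\<dots> = tsum C (tdom F) y (map (\<lambda>H. H \<bullet>\<^sub>t F) (map (\<lambda>j. I j \<bullet>\<^sub>t P j) [0..<length ss]))"
    by (rule tsum_cmp) (use d' F in auto)
  also have "\<dots> = tzero C (tdom F) y"
    by (rule tsum_eq_zero) (use d' F in \<open>auto simp: cmp_assoc\<close>)
  finally show ?thesis .
qed

text \<open>Universal properties in the definitions quantify over bare morphisms; this lemma and
  \<open>is_kernel_iff\<close> restate them for typed arrows.\<close>

lemma ex1_arrow_iff:
  assumes "x \<in> obj C" "y \<in> obj C"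
  shows "(\<exists>!h. h \<in> hom C x y \<and> Q h) \<longleftrightarrow> (\<exists>!U. tAr C U \<and> tdom U = x \<and> tcod U = y \<and> Q (mor U))"
proof
  assume "\<exists>!h. h \<in> hom C x y \<and> Q h"
  then obtain h where h: "h \<in> hom C x y" "Q h" and u: "\<And>h'. h' \<in> hom C x y \<Longrightarrow> Q h' \<Longrightarrow> h' = h"
    by blast
  show "\<exists>!U. tAr C U \<and> tdom U = x \<and> tcod U = y \<and> Q (mor U)"
  proof (rule ex1I[of _ "mk C x h y"])
    show "tAr C (mk C x h y) \<and> tdom (mk C x h y) = x \<and> tcod (mk C x h y) = y \<and> Q (mor (mk C x h y))"
      using h assms by simp
    fix U assume U: "tAr C U \<and> tdom U = x \<and> tcod U = y \<and> Q (mor U)"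
    then have "mor U = h"
      by (intro u) auto
    then show "U = mk C x h y"
      using U by auto
  qed
next
  assume "\<exists>!U. tAr C U \<and> tdom U = x \<and> tcod U = y \<and> Q (mor U)"
  then obtain U where U: "tAr C U" "tdom U = x" "tcod U = y" "Q (mor U)"
    and u: "\<And>V. \<lbrakk>tAr C V; tdom V = x; tcod V = y; Q (mor V)\<rbrakk> \<Longrightarrow> V = U"
    by blast
  show "\<exists>!h. h \<in> hom C x y \<and> Q h"
  proof (rule ex1I[of _ "mor U"])
    show "mor U \<in> hom C x y \<and> Q (mor U)"
      using U by simp
    fix h assume "h \<in> hom C x y \<and> Q h"
    then show "h = mor U"
      using u[of "mk C x h y"] assms by auto
  qed
qed

lemma mor_cmp_eq_iff:
  assumes "tAr C F" "tAr C G" "tdom F = tcod G" "tAr C H" "tdom H = tdom G" "tcod H = tcod F"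
  shows "mor F \<cdot> mor G = mor H \<longleftrightarrow> F \<bullet>\<^sub>t G = H"
  using assms by (metis mor_cmp tarr_eqI Ar_cmp tcmp_sel)

lemma is_kernel_iff:
  assumes "tAr C F" "tAr C K" "tcod K = tdom F"
  shows "is_kernel C (tdom F) (tcod F) (mor F) (tdom K) (mor K) \<longleftrightarrow> F \<bullet>\<^sub>t K = tzero C (tdom K) (tcod F)
    \<and> (\<forall>G. tAr C G \<and> tcod G = tdom F \<and> F \<bullet>\<^sub>t G = tzero C (tdom G) (tcod F)
      \<longrightarrow> (\<exists>!U. tAr C U \<and> tdom U = tdom G \<and> tcod U = tdom K \<and> K \<bullet>\<^sub>t U = G))"
proof -
  have z: "mor F \<cdot> mor G = zerom C (tdom G) (tcod F) \<longleftrightarrow> F \<bullet>\<^sub>t G = tzero C (tdom G) (tcod F)"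
    if "tAr C G" "tcod G = tdom F" for G
    using mor_cmp_eq_iff[of F G "tzero C (tdom G) (tcod F)"] assms that by (simp add: mor_tzero)
  have u: "(\<exists>!h. h \<in> hom C (tdom G) (tdom K) \<and> mor K \<cdot> h = mor G)
    \<longleftrightarrow> (\<exists>!U. tAr C U \<and> tdom U = tdom G \<and> tcod U = tdom K \<and> K \<bullet>\<^sub>t U = G)"
    if "tAr C G" "tcod G = tdom F" for G
    using assms that by (subst ex1_arrow_iff) (auto simp: mor_cmp_eq_iff cong: conj_cong)
  have "(\<forall>z\<in>obj C. \<forall>g\<in>hom C z (tdom F). mor F \<cdot> g = zerom C z (tcod F) \<longrightarrow> (\<exists>!h. h \<in> hom C z (tdom K) \<and> mor K \<cdot> h = g))
    \<longleftrightarrow> (\<forall>G. tAr C G \<and> tcod G = tdom F \<longrightarrow> mor F \<cdot> mor G = zerom C (tdom G) (tcod F)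
      \<longrightarrow> (\<exists>!h. h \<in> hom C (tdom G) (tdom K) \<and> mor K \<cdot> h = mor G))" (is "?l \<longleftrightarrow> ?r")
  proof
    assume ?r
    show ?l
    proof (intro ballI impI)
      fix z g assume *: "z \<in> obj C" "g \<in> hom C z (tdom F)" "mor F \<cdot> g = zerom C z (tcod F)"
      then show "\<exists>!h. h \<in> hom C z (tdom K) \<and> mor K \<cdot> h = g"
        using \<open>?r\<close>[rule_format, of "mk C z g (tdom F)"] assms by simp
    qed
  next
    assume ?l
    show ?r
    proof (intro allI impI)
      fix G assume "tAr C G \<and> tcod G = tdom F" "mor F \<cdot> mor G = zerom C (tdom G) (tcod F)"
      then show "\<exists>!h. h \<in> hom C (tdom G) (tdom K) \<and> mor K \<cdot> h = mor G"
        by (intro \<open>?l\<close>[rule_format]) auto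
    qed
  qed
  then show ?thesis
    unfolding is_kernel_def using assms z u by simp blast
qed

definition regular_arrow where
  "regular_arrow F \<longleftrightarrow> (\<exists>G. tAr C G \<and> tdom G = tcod F \<and> tcod G = tdom F \<and> F \<bullet>\<^sub>t G \<bullet>\<^sub>t F = F)"

text \<open>McCoy's lemma on von Neumann regular rings. If H is a quasi-inverse of F - FGF, then (1
  - GF)H(1 - FG) + G is one of F, because each outer factor turns F into F - FGF. It allows a
  quasi-inverse to be built by successive corrections.\<close>

lemma regular_arrow_sub:
  assumes "tAr C F" "tAr C G" "tdom G = tcod F" "tcod G = tdom F" "regular_arrow (tsub C F (F \<bullet>\<^sub>t G \<bullet>\<^sub>t F))"
  shows "regular_arrow F"
proof -
  note [simp] = assms(1-4)
  let ?U = "tsub C F (F \<bullet>\<^sub>t G \<bullet>\<^sub>t F)"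
  obtain H where H [simp]: "tAr C H" "tdom H = tcod F" "tcod H = tdom F" and UHU: "?U \<bullet>\<^sub>t H \<bullet>\<^sub>t ?U = ?U"
    using assms(5) by (auto simp: regular_arrow_def)
  let ?L = "tsub C (tid C (tdom F)) (G \<bullet>\<^sub>t F)" and ?R = "tsub C (tid C (tcod F)) (F \<bullet>\<^sub>t G)"
  have U: "F \<bullet>\<^sub>t ?L = ?U" "?R \<bullet>\<^sub>t F = ?U"
    by (simp_all add: cmp_tsub tsub_cmp cmp_assoc)
  let ?K = "tadd C (?L \<bullet>\<^sub>t H \<bullet>\<^sub>t ?R) G"
  have "F \<bullet>\<^sub>t ?K \<bullet>\<^sub>t F = tadd C ((F \<bullet>\<^sub>t ?L) \<bullet>\<^sub>t H \<bullet>\<^sub>t (?R \<bullet>\<^sub>t F)) (F \<bullet>\<^sub>t G \<bullet>\<^sub>t F)"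
    by (simp add: cmp_tadd tadd_cmp cmp_assoc)
  also have "\<dots> = F"
    unfolding U UHU by (simp add: tsub_add)
  finally show ?thesis
    unfolding regular_arrow_def by (intro exI[of _ ?K]) simp
qed

end

section \<open>Morphisms of a semisimple category are regular\<close>

context semisimple_category
begin

text \<open>The kernel of \<open>F\<close> is a subobject of the simple object \<open>s\<close>,
  hence zero or everything; the latter would make \<open>F\<close> zero. So \<open>F\<close> is a
  non-zero monomorphism into the simple object \<open>t\<close>, hence invertible.\<close>

lemma schur:
  assumes s: "simple_object C s" and t: "simple_object C t" and F: "tAr C F" "tdom F = s" "tcod F = t" "F \<noteq> tzero C s t"
  shows "\<exists>G. tAr C G \<and> tdom G = t \<and> tcod G = s \<and> G \<bullet>\<^sub>t F = tid C s"
proof -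
  have o [simp]: "s \<in> obj C" "t \<in> obj C"
    using s t by (auto simp: simple_object_def)
  obtain n k where n: "n \<in> obj C" "is_kernel C s t (mor F) n k"
    using kernels[of s t "mor F"] F by auto
  define K where "K = mk C n k s"
  have K [simp]: "tAr C K" "tcod K = s" "tdom K = n" "mor K = k"
    using n by (simp_all add: K_def is_kernel_def)
  have FK: "F \<bullet>\<^sub>t K = tzero C n t"
    and ker: "\<And>G. \<lbrakk>tAr C G; tcod G = s; F \<bullet>\<^sub>t G = tzero C (tdom G) t\<rbrakk>
      \<Longrightarrow> \<exists>!U. tAr C U \<and> tdom U = tdom G \<and> tcod U = n \<and> K \<bullet>\<^sub>t U = G"
  proof -
    have "is_kernel C (tdom F) (tcod F) (mor F) (tdom K) (mor K)"
      using n F by simp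
    from iffD1[OF is_kernel_iff this] show "F \<bullet>\<^sub>t K = tzero C n t"
      "\<And>G. \<lbrakk>tAr C G; tcod G = s; F \<bullet>\<^sub>t G = tzero C (tdom G) t\<rbrakk>
        \<Longrightarrow> \<exists>!U. tAr C U \<and> tdom U = tdom G \<and> tcod U = n \<and> K \<bullet>\<^sub>t U = G"
      using F K(1-3) by metis+
  qed
  have "mono_mor C n s (mor K)"
    unfolding mono_mor_def
  proof (intro conjI ballI impI)
    show "mor K \<in> hom C n s"
      using K(1-3) by (simp del: K(4))
    fix z g h assume z: "z \<in> obj C" "g \<in> hom C z n" "h \<in> hom C z n" "mor K \<cdot> g = mor K \<cdot> h"
    let ?g = "mk C z g n" and ?h = "mk C z h n"
    have e: "K \<bullet>\<^sub>t ?g = K \<bullet>\<^sub>t ?h"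
      using z n K(1-3) by (intro tarr_eqI[of C]) (simp_all del: K(4))
    have ar: "tAr C ?g" "tAr C ?h" "tAr C (K \<bullet>\<^sub>t ?g)"
      using z n by simp_all
    have "F \<bullet>\<^sub>t K \<bullet>\<^sub>t ?g = tzero C z t"
      using z n F cmp_cancel[OF FK, of ?g] by simp
    then have "\<exists>!U. tAr C U \<and> tdom U = z \<and> tcod U = n \<and> K \<bullet>\<^sub>t U = K \<bullet>\<^sub>t ?g"
      using ker[of "K \<bullet>\<^sub>t ?g"] ar(3) unfolding tcmp_sel mk_sel K(2) by blast
    then have "?g = ?h"
      using ar(1,2) e by (metis mk_sel(1,2))
    then show "g = h"
      using z n mk_eq_iff[of z C n g h] by blast
  qed
  then have "mor K = zerom C n s \<or> iso_mor C n s (mor K)"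
    using s n unfolding simple_object_def by blast
  moreover have "\<not> iso_mor C n s (mor K)"
  proof
    assume i: "iso_mor C n s (mor K)"
    let ?V = "mk C s (inv_mor C n s (mor K)) n"
    have KK: "mk C n (mor K) s = K"
      unfolding K(4) unfolding K_def ..
    have V: "tAr C ?V" "K \<bullet>\<^sub>t ?V = tid C s"
      using inverse_arrows[OF i] n unfolding KK by simp_all
    have "F \<bullet>\<^sub>t K \<bullet>\<^sub>t ?V = tzero C s t"
      using cmp_cancel[OF FK, of ?V] V(1) by simp
    then show False
      using F V by simp
  qed
  ultimately have K0: "K = tzero C n s"
    using n by (intro tarr_eqI[of C]) (simp_all add: mor_tzero)
  have "mono_mor C s t (mor F)"
    unfolding mono_mor_def
  proof (intro conjI ballI impI)
    show "mor F \<in> hom C s t"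
      using F by simp
    fix z g h assume z: "z \<in> obj C" "g \<in> hom C z s" "h \<in> hom C z s" "mor F \<cdot> g = mor F \<cdot> h"
    let ?g = "mk C z g s" and ?h = "mk C z h s"
    have "F \<bullet>\<^sub>t ?g = F \<bullet>\<^sub>t ?h"
      using z F by (intro tarr_eqI[of C]) simp_all
    then have "F \<bullet>\<^sub>t tsub C ?g ?h = tzero C z t"
      using z F by (simp add: cmp_tsub)
    moreover have "tAr C (tsub C ?g ?h)"
      using z by simp
    ultimately obtain U where U: "tAr C U" "tdom U = z" "tcod U = n" "K \<bullet>\<^sub>t U = tsub C ?g ?h"
      using ker[of "tsub C ?g ?h"] unfolding tsub_sel mk_sel by blast
    then have "tsub C ?g ?h = tzero C z s"
      unfolding K0 by simp
    then have "?g = ?h"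
      by (intro tsub_eq_zero[of ?g ?h]) (use z in simp_all)
    then show "g = h"
      using z o mk_eq_iff[of z C s g h] by blast
  qed
  moreover have "mor F \<noteq> zerom C s t"
    using F mk_mor[OF F(1-3)] unfolding tzero_def by metis
  ultimately have "iso_mor C s t (mor F)"
    using t o(1) unfolding simple_object_def by blast
  from inverse_arrows[OF this] F show ?thesis
    by (intro exI[of _ "mk C t (inv_mor C s t (mor F)) s"]) simp
qed

text \<open>Gaussian elimination, by induction on the number of simple summands of the source on
  which the morphism does not vanish. Schur's lemma inverts one non-zero component, and subtracting
  the corresponding product GHG kills that summand while those already killed stay killed.
  \<open>regular_arrow_sub\<close> returns to the original morphism.\<close>

theorem semisimple_regular:
  assumes "tAr C F"
  shows "regular_arrow F"
proof -
  let ?x = "tdom F" and ?y = "tcod F"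
  have o [simp]: "?x \<in> obj C" "?y \<in> obj C"
    using assms by simp_all
  obtain ss where ss: "\<forall>s\<in>set ss. simple_object C s" "is_direct_sum C ?x ss"
    using sum_of_simples[of ?x] by auto
  obtain ts where ts: "\<forall>s\<in>set ts. simple_object C s" "is_direct_sum C ?y ts"
    using sum_of_simples[of ?y] by auto
  obtain I P where x: "dsum ?x ss I P"
    using ss is_direct_sum_iff[of ?x ss] by (auto simp: simple_object_def)
  obtain J Q where y: "dsum ?y ts J Q"
    using ts is_direct_sum_iff[of ?y ts] by (auto simp: simple_object_def)
  note dx = x[unfolded dsum_def] and dy = y[unfolded dsum_def]
  let ?S = "\<lambda>G. {j. j < length ss \<and> G \<bullet>\<^sub>t I j \<noteq> tzero C (ss ! j) ?y}"
  have "regular_arrow G" if "tAr C G" "tdom G = ?x" "tcod G = ?y" for G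
    using that
  proof (induction "card (?S G)" arbitrary: G rule: less_induct)
    case less
    note [simp] = less.prems
    show ?case
    proof (cases "?S G = {}")
      case True
      then have "G = tzero C ?x ?y"
        using dsum_zero_left[OF x, of G] by auto
      then show ?thesis
        unfolding regular_arrow_def by (intro exI[of _ "tzero C ?y ?x"]) simp
    next
      case False
      then obtain j where j: "j < length ss" "G \<bullet>\<^sub>t I j \<noteq> tzero C (ss ! j) ?y"
        by blast
      have Ij [simp]: "tAr C (I j)" "tdom (I j) = ss ! j" "tcod (I j) = ?x" "ss ! j \<in> obj C"
        using dx j(1) by auto
      obtain l where l: "l < length ts" "Q l \<bullet>\<^sub>t G \<bullet>\<^sub>t I j \<noteq> tzero C (ss ! j) (ts ! l)"
        using dsum_zero_right[OF y, of "G \<bullet>\<^sub>t I j"] j(2) by auto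
      have Ql [simp]: "tAr C (Q l)" "tdom (Q l) = ?y" "tcod (Q l) = ts ! l"
        using dy l(1) by auto
      obtain K where K [simp]: "tAr C K" "tdom K = ts ! l" "tcod K = ss ! j" and K1: "K \<bullet>\<^sub>t Q l \<bullet>\<^sub>t G \<bullet>\<^sub>t I j = tid C (ss ! j)"
        using schur[of "ss ! j" "ts ! l" "Q l \<bullet>\<^sub>t G \<bullet>\<^sub>t I j"] ss(1) ts(1) j l by auto
      \<comment> \<open>The left inverse \<open>K\<close> of the chosen component, extended by
        projection and inclusion to an arrow from \<open>?y\<close> to \<open>?x\<close>.\<close>
      let ?H = "I j \<bullet>\<^sub>t K \<bullet>\<^sub>t Q l"
      let ?G = "tsub C G (G \<bullet>\<^sub>t ?H \<bullet>\<^sub>t G)"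
      have GI: "?G \<bullet>\<^sub>t I m = tsub C (G \<bullet>\<^sub>t I m) (G \<bullet>\<^sub>t I j \<bullet>\<^sub>t K \<bullet>\<^sub>t Q l \<bullet>\<^sub>t (G \<bullet>\<^sub>t I m))" if "m < length ss" for m
        using dx that by (simp add: tsub_cmp cmp_assoc)
      have "?S ?G \<subset> ?S G"
      proof
        show "?S ?G \<subseteq> ?S G"
          using dx by (auto simp: GI dest: nth_mem)
        have "?G \<bullet>\<^sub>t I j = tzero C (ss ! j) ?y"
          using j by (simp add: GI K1)
        then show "?S ?G \<noteq> ?S G"
          using j by blast
      qed
      then have "card (?S ?G) < card (?S G)"
        by (intro psubset_card_mono) auto
      then have "regular_arrow ?G"
        by (rule less.hyps) simp_all
      then show ?thesis
        by (intro regular_arrow_sub[of G ?H]) simp_all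
    qed
  qed
  then show ?thesis
    using assms by simp
qed

end

section \<open>Split idempotents\<close>

context linear_category
begin

definition splits where
  "splits x e y I P \<longleftrightarrow> y \<in> obj C \<and> tAr C I \<and> tdom I = y \<and> tcod I = x \<and> tAr C P \<and> tdom P = x \<and> tcod P = y
    \<and> P \<bullet>\<^sub>t I = tid C y \<and> I \<bullet>\<^sub>t P = e"

definition idempotents_split where
  "idempotents_split \<longleftrightarrow> (\<forall>e. tAr C e \<and> tdom e = tcod e \<and> e \<bullet>\<^sub>t e = e \<longrightarrow> (\<exists>y I P. splits (tdom e) e y I P))"

text \<open>The image of the idempotent \<open>e\<close> is constructed as the kernel of
  \<open>?f\<close>, which is 1 - \<open>e\<close>.\<close>

lemma (in abelian_category) abelian_idempotents_split: "idempotents_split"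
  unfolding idempotents_split_def
proof (intro allI impI)
  fix e assume e: "tAr C e \<and> tdom e = tcod e \<and> e \<bullet>\<^sub>t e = e"
  let ?x = "tdom e"
  have [simp]: "tAr C e" "tcod e = ?x" "e \<bullet>\<^sub>t e = e" "?x \<in> obj C"
    using e by auto
  let ?f = "tsub C (tid C ?x) e"
  obtain n k where n [simp]: "n \<in> obj C" and k: "is_kernel C ?x ?x (mor ?f) n k"
    using kernels[of ?x ?x "mor ?f"] by auto
  define K where "K = mk C n k ?x"
  have K [simp]: "tAr C K" "tcod K = ?x" "tdom K = n"
    using k by (simp_all add: K_def is_kernel_def)
  have "mor K = k"
    using k by (simp add: K_def is_kernel_def)
  then have fK: "?f \<bullet>\<^sub>t K = tzero C n ?x"
    and ker: "\<And>G. \<lbrakk>tAr C G; tcod G = ?x; ?f \<bullet>\<^sub>t G = tzero C (tdom G) ?x\<rbrakk>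
      \<Longrightarrow> \<exists>!U. tAr C U \<and> tdom U = tdom G \<and> tcod U = n \<and> K \<bullet>\<^sub>t U = G"
  proof -
    have "is_kernel C (tdom ?f) (tcod ?f) (mor ?f) (tdom K) (mor K)"
      using k \<open>mor K = k\<close> by simp
    note kk = iffD1[OF is_kernel_iff this, unfolded tsub_sel tid_sel]
    have ar: "tAr C ?f" "tAr C K" "tcod K = tdom e"
      by simp_all
    show "?f \<bullet>\<^sub>t K = tzero C n ?x"
      using kk[OF ar] by simp
    show "\<exists>!U. tAr C U \<and> tdom U = tdom G \<and> tcod U = n \<and> K \<bullet>\<^sub>t U = G"
      if "tAr C G" "tcod G = ?x" "?f \<bullet>\<^sub>t G = tzero C (tdom G) ?x" for G
      using kk[OF ar] that unfolding K(3) by blast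
  qed
  have eK: "e \<bullet>\<^sub>t K = K"
    using fK tsub_eq_zero[of K "e \<bullet>\<^sub>t K"] by (simp add: tsub_cmp)
  have "?f \<bullet>\<^sub>t e = tzero C ?x ?x"
    by (simp add: tsub_cmp)
  then obtain H where H [simp]: "tAr C H" "tdom H = ?x" "tcod H = n" and KH: "K \<bullet>\<^sub>t H = e"
    using ker[of e] e by metis
  have "K \<bullet>\<^sub>t H \<bullet>\<^sub>t K = K"
    using cmp_cancel[OF KH, of K] eK by simp
  then have "H \<bullet>\<^sub>t K = tid C n"
    using ker[of K] fK by (metis (no_types, lifting) Ar_Id Ar_cmp H K Cod_Id Dom_Id cmp_Id n tcmp_sel)
  with KH have "splits ?x e n K H"
    unfolding splits_def by (intro conjI) (assumption | rule n K H | simp)+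
  then show "\<exists>y I P. splits ?x e y I P"
    by (intro exI)
qed

section \<open>Spanning lists as a substitute for dimension\<close>

definition span_of where
  "span_of a b Fs = {lsum C a b (map2 (scale C) rs Fs) | rs. length rs = length Fs}"

definition hom_subspace where
  "hom_subspace a b W \<longleftrightarrow> W \<subseteq> hom C a b \<and> zerom C a b \<in> W
    \<and> (\<forall>f\<in>W. \<forall>g\<in>W. f \<oplus> g \<in> W) \<and> (\<forall>r. \<forall>f\<in>W. r \<odot> f \<in> W)"

lemma span_of_Nil [simp]: "span_of a b [] = {zerom C a b}"
  by (simp add: span_of_def lsum_def)

lemma span_of_Cons: "span_of a b (F # Fs) = {r \<odot> F \<oplus> v | r v. v \<in> span_of a b Fs}"
proof
  show "span_of a b (F # Fs) \<subseteq> {r \<odot> F \<oplus> v | r v. v \<in> span_of a b Fs}"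
  proof
    fix w assume "w \<in> span_of a b (F # Fs)"
    then obtain r rs where "length rs = length Fs" "w = lsum C a b (map2 (scale C) (r # rs) (F # Fs))"
      by (auto simp: span_of_def length_Suc_conv)
    then show "w \<in> {r \<odot> F \<oplus> v | r v. v \<in> span_of a b Fs}"
      by (auto simp: span_of_def lsum_def)
  qed
  show "{r \<odot> F \<oplus> v | r v. v \<in> span_of a b Fs} \<subseteq> span_of a b (F # Fs)"
  proof
    fix w assume "w \<in> {r \<odot> F \<oplus> v | r v. v \<in> span_of a b Fs}"
    then obtain r rs where "length rs = length Fs" "w = r \<odot> F \<oplus> lsum C a b (map2 (scale C) rs Fs)"
      by (auto simp: span_of_def)
    then have "length (r # rs) = length (F # Fs)" "w = lsum C a b (map2 (scale C) (r # rs) (F # Fs))"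
      by (simp_all add: lsum_def)
    then show "w \<in> span_of a b (F # Fs)"
      unfolding span_of_def by blast
  qed
qed

lemma scale_zero_left: "\<lbrakk>a \<in> obj C; b \<in> obj C; f \<in> hom C a b\<rbrakk> \<Longrightarrow> 0 \<odot> f = zerom C a b"
  using tscale_zero[of "mk C a f b"] mor_tscale[of "mk C a f b" 0] mor_tzero[of a b] by simp

lemma scale_zero_right: "\<lbrakk>a \<in> obj C; b \<in> obj C\<rbrakk> \<Longrightarrow> r \<odot> zerom C a b = zerom C a b"
  using scale_zero_left[of a b "zerom C a b"] scale_scale[of a b "zerom C a b" r 0] zero_in_hom[of a b] by simp

lemma add_interchange:
  assumes o: "a \<in> obj C" "b \<in> obj C" and h: "f \<in> hom C a b" "g \<in> hom C a b" "f' \<in> hom C a b" "g' \<in> hom C a b"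
  shows "(f \<oplus> g) \<oplus> (f' \<oplus> g') = (f \<oplus> f') \<oplus> (g \<oplus> g')"
proof -
  have "(f \<oplus> g) \<oplus> (f' \<oplus> g') = f \<oplus> ((g \<oplus> f') \<oplus> g')"
    using o h by (simp add: add_assoc add_in_hom)
  also have "g \<oplus> f' = f' \<oplus> g"
    using o h by (simp add: add_commute)
  finally show ?thesis
    using o h by (simp add: add_assoc add_in_hom)
qed

lemma span_of_subspace:
  assumes o: "a \<in> obj C" "b \<in> obj C" and "set Fs \<subseteq> hom C a b"
  shows "hom_subspace a b (span_of a b Fs)"
  using assms(3)
proof (induction Fs)
  case Nil
  show ?case
    using o by (simp add: hom_subspace_def zero_in_hom add_zero scale_zero_right)
next
  case (Cons F Fs)
  then have F: "F \<in> hom C a b" and IH: "span_of a b Fs \<subseteq> hom C a b" "zerom C a b \<in> span_of a b Fs"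
    "\<And>f g. \<lbrakk>f \<in> span_of a b Fs; g \<in> span_of a b Fs\<rbrakk> \<Longrightarrow> f \<oplus> g \<in> span_of a b Fs"
    "\<And>r f. f \<in> span_of a b Fs \<Longrightarrow> r \<odot> f \<in> span_of a b Fs"
    by (auto simp: hom_subspace_def)
  show ?case
    unfolding hom_subspace_def
  proof (intro conjI ballI allI)
    show "span_of a b (F # Fs) \<subseteq> hom C a b"
      using F IH(1) o by (auto simp: span_of_Cons intro!: add_in_hom scale_in_hom)
    have "zerom C a b = 0 \<odot> F \<oplus> zerom C a b"
      using F o by (simp add: add_zero scale_zero_left zero_in_hom)
    then show "zerom C a b \<in> span_of a b (F # Fs)"
      unfolding span_of_Cons using IH(2) by blast
  next
    fix f g assume "f \<in> span_of a b (F # Fs)" "g \<in> span_of a b (F # Fs)"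
    then obtain r v s w where *: "v \<in> span_of a b Fs" "w \<in> span_of a b Fs" "f = r \<odot> F \<oplus> v" "g = s \<odot> F \<oplus> w"
      unfolding span_of_Cons by blast
    then have "f \<oplus> g = (r \<odot> F \<oplus> s \<odot> F) \<oplus> (v \<oplus> w)"
      using F IH(1) o by (auto intro!: add_interchange[OF o] scale_in_hom)
    then have "f \<oplus> g = (r + s) \<odot> F \<oplus> (v \<oplus> w)"
      using F o by (simp add: scale_add_left)
    then show "f \<oplus> g \<in> span_of a b (F # Fs)"
      unfolding span_of_Cons using IH(3)[OF *(1,2)] by blast
  next
    fix r f assume "f \<in> span_of a b (F # Fs)"
    then obtain s v where *: "v \<in> span_of a b Fs" "f = s \<odot> F \<oplus> v"
      unfolding span_of_Cons by blast
    then have "r \<odot> f = r \<odot> (s \<odot> F) \<oplus> r \<odot> v"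
      unfolding *(2) by (intro scale_add_right[OF o]) (use * F IH(1) o in \<open>auto intro!: scale_in_hom\<close>)
    then have "r \<odot> f = (r * s) \<odot> F \<oplus> r \<odot> v"
      using F o by (simp add: scale_scale)
    then show "r \<odot> f \<in> span_of a b (F # Fs)"
      unfolding span_of_Cons using IH(4)[OF *(1)] by blast
  qed
qed

text \<open>Elimination of one vector at a time, without bases: if \<open>W\<close> contains a
  vector with non-zero coefficient at \<open>F\<close>, it is normalized to
  \<open>F \<oplus> u\<close> and the others are reduced by it. The last clause says that a proper
  subspace of the span needs fewer generators; this makes the induction on endomorphism spaces
  decrease.\<close>

lemma subspace_spanning:
  assumes o: "a \<in> obj C" "b \<in> obj C" and "set Fs \<subseteq> hom C a b" "hom_subspace a b W" "W \<subseteq> span_of a b Fs"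
  shows "\<exists>Gs. set Gs \<subseteq> W \<and> W \<subseteq> span_of a b Gs \<and> length Gs \<le> length Fs
    \<and> (span_of a b Fs \<subseteq> W \<or> length Gs < length Fs)"
  using assms(3-5)
proof (induction Fs arbitrary: W)
  case Nil
  then show ?case
    by (intro exI[of _ "[]"]) (auto simp: hom_subspace_def)
next
  case (Cons F Fs)
  let ?V = "span_of a b Fs"
  have F: "F \<in> hom C a b" and Fs: "set Fs \<subseteq> hom C a b"
    using Cons.prems by auto
  note V = span_of_subspace[OF o Fs, unfolded hom_subspace_def]
  note W = Cons.prems(2)[unfolded hom_subspace_def]
  have "hom_subspace a b (W \<inter> ?V)"
    unfolding hom_subspace_def using V W by blast
  from Cons.IH[OF Fs this] obtain Gs where Gs: "set Gs \<subseteq> W \<inter> ?V" "W \<inter> ?V \<subseteq> span_of a b Gs"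
    "length Gs \<le> length Fs" "?V \<subseteq> W \<or> length Gs < length Fs"
    by blast
  show ?case
  proof (cases "W \<subseteq> ?V")
    case True
    then show ?thesis
      using Gs by (intro exI[of _ Gs]) auto
  next
    case False
    then obtain w where w: "w \<in> W" "w \<notin> ?V"
      by blast
    then obtain r v where rv: "v \<in> ?V" "w = r \<odot> F \<oplus> v"
      using Cons.prems(3) unfolding span_of_Cons by blast
    have v: "v \<in> hom C a b"
      using rv V by blast
    have "r \<noteq> 0"
    proof
      assume "r = 0"
      then have "w = v"
        using rv F o v add_commute[of a b "zerom C a b" v] by (simp add: scale_zero_left add_zero zero_in_hom)
      then show False
        using w rv by blast
    qed
    \<comment> \<open>The vector \<open>w\<close>, scaled so that its coefficient at
      \<open>F\<close> is 1, equals \<open>F \<oplus> u\<close> with \<open>u\<close> in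
      \<open>?V\<close>.\<close>
    define u where "u = (1 / r) \<odot> v"
    have u: "u \<in> ?V" "u \<in> hom C a b"
      using rv V unfolding u_def by blast+
    have "(1 / r) \<odot> w = (1 / r) \<odot> (r \<odot> F) \<oplus> u"
      unfolding rv u_def by (intro scale_add_right[OF o] o v scale_in_hom F)
    then have Fu: "F \<oplus> u \<in> W"
      using w W F o \<open>r \<noteq> 0\<close> by (metis scale_scale scale_one nonzero_divide_eq_eq)
    have Fuh: "F \<oplus> u \<in> hom C a b"
      using Fu W by blast
    show ?thesis
    proof (intro exI[of _ "(F \<oplus> u) # Gs"] conjI)
      show "set ((F \<oplus> u) # Gs) \<subseteq> W"
        using Fu Gs by auto
      show "length ((F \<oplus> u) # Gs) \<le> length (F # Fs)"
        using Gs by simp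
      show "W \<subseteq> span_of a b ((F \<oplus> u) # Gs)"
      proof
        fix x assume x: "x \<in> W"
        then obtain s y where sy: "y \<in> ?V" "x = s \<odot> F \<oplus> y"
          using Cons.prems(3) unfolding span_of_Cons by blast
        have xh: "x \<in> hom C a b" and yh: "y \<in> hom C a b"
          using x W sy V by blast+
        \<comment> \<open>Subtracting the right multiple of \<open>F \<oplus> u\<close> removes the
          component of \<open>x\<close> along \<open>F\<close>; the remainder lies in
          \<open>W\<close> and in \<open>?V\<close>, hence in the span of \<open>Gs\<close>.\<close>
        define z where "z = x \<oplus> (- s) \<odot> (F \<oplus> u)"
        have "z = (s \<odot> F \<oplus> y) \<oplus> ((- s) \<odot> F \<oplus> (- s) \<odot> u)"
          unfolding z_def sy(2) using scale_add_right[OF o F u(2)] by simp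
        also have "\<dots> = (s \<odot> F \<oplus> (- s) \<odot> F) \<oplus> (y \<oplus> (- s) \<odot> u)"
          by (intro add_interchange[OF o] o scale_in_hom F yh u(2))
        also have "s \<odot> F \<oplus> (- s) \<odot> F = zerom C a b"
          using scale_add_left[OF o F, of s "- s"] scale_zero_left[OF o F] by simp
        also have "zerom C a b \<oplus> (y \<oplus> (- s) \<odot> u) = y \<oplus> (- s) \<odot> u"
          using o yh u(2) by (metis add_commute add_zero add_in_hom scale_in_hom zero_in_hom)
        finally have "z \<in> ?V"
          using sy(1) u(1) V by auto
        moreover have "z \<in> W"
          unfolding z_def using x Fu W by blast
        ultimately have "z \<in> span_of a b Gs"
          using Gs by blast
        moreover have "x = s \<odot> (F \<oplus> u) \<oplus> z"
        proof -
          have "s \<odot> (F \<oplus> u) \<oplus> z = z \<oplus> s \<odot> (F \<oplus> u)"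
            unfolding z_def by (intro add_commute[OF o] add_in_hom o scale_in_hom Fuh xh)
          also have "\<dots> = x \<oplus> ((- s) \<odot> (F \<oplus> u) \<oplus> s \<odot> (F \<oplus> u))"
            unfolding z_def by (intro add_assoc[OF o] o scale_in_hom Fuh xh)
          also have "(- s) \<odot> (F \<oplus> u) \<oplus> s \<odot> (F \<oplus> u) = zerom C a b"
            using scale_add_left[OF o Fuh, of "- s" s] scale_zero_left[OF o Fuh] by simp
          finally show ?thesis
            using add_zero[OF o xh] by simp
        qed
        ultimately show "x \<in> span_of a b ((F \<oplus> u) # Gs)"
          unfolding span_of_Cons by blast
      qed
      \<comment> \<open>If \<open>?V\<close> lies in \<open>W\<close>, then so do \<open>u\<close>
        and \<open>F\<close>, and with them the whole span; otherwise the induction hypothesis has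
        already saved a generator.\<close>
      show "span_of a b (F # Fs) \<subseteq> W \<or> length ((F \<oplus> u) # Gs) < length (F # Fs)"
      proof (cases "?V \<subseteq> W")
        case True
        then have "u \<in> W"
          using u by blast
        then have "(F \<oplus> u) \<oplus> (- 1) \<odot> u \<in> W"
          using Fu W by blast
        moreover have "(F \<oplus> u) \<oplus> (- 1) \<odot> u = F \<oplus> (u \<oplus> (- 1) \<odot> u)"
          by (intro add_assoc[OF o] o scale_in_hom u F)
        moreover have "u \<oplus> (- 1) \<odot> u = zerom C a b"
          using scale_add_left[OF o u(2), of 1 "- 1"] scale_zero_left[OF o u(2)] scale_one[OF o u(2)] by simp
        ultimately have "F \<in> W"
          using add_zero[OF o F] by simp
        then show ?thesis
          using True W unfolding span_of_Cons by blast
      next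
        case False
        then show ?thesis
          using Gs by simp
      qed
    qed
  qed
qed

lemma finite_dimensional_span: "\<lbrakk>a \<in> obj C; b \<in> obj C\<rbrakk> \<Longrightarrow> \<exists>Fs. set Fs \<subseteq> hom C a b \<and> hom C a b \<subseteq> span_of a b Fs"
  using finite_dimensional_hom[of a b] unfolding span_of_def by blast

text \<open>\<open>K\<close> has a left inverse \<open>P\<close>, so a factorization of
  \<open>G\<close> through \<open>K\<close> can only be \<open>P \<bullet>\<^sub>t G\<close>. All
  kernels and, dually, all cokernels constructed below split in this way.\<close>

lemma is_kernelI:
  assumes ar: "tAr C F" "tAr C K" "tcod K = tdom F" "tAr C P" "tdom P = tdom F" "tcod P = tdom K"
    and e: "P \<bullet>\<^sub>t K = tid C (tdom K)" "F \<bullet>\<^sub>t K = tzero C (tdom K) (tcod F)"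
    and f: "\<And>H. \<lbrakk>tAr C H; tcod H = tdom F; F \<bullet>\<^sub>t H = tzero C (tdom H) (tcod F)\<rbrakk> \<Longrightarrow> K \<bullet>\<^sub>t P \<bullet>\<^sub>t H = H"
  shows "is_kernel C (tdom F) (tcod F) (mor F) (tdom K) (mor K)"
  unfolding is_kernel_iff[OF ar(1-3)]
proof (intro conjI allI impI)
  fix G assume G: "tAr C G \<and> tcod G = tdom F \<and> F \<bullet>\<^sub>t G = tzero C (tdom G) (tcod F)"
  show "\<exists>!U. tAr C U \<and> tdom U = tdom G \<and> tcod U = tdom K \<and> K \<bullet>\<^sub>t U = G"
  proof (rule ex1I[of _ "P \<bullet>\<^sub>t G"])
    show "tAr C (P \<bullet>\<^sub>t G) \<and> tdom (P \<bullet>\<^sub>t G) = tdom G \<and> tcod (P \<bullet>\<^sub>t G) = tdom K \<and> K \<bullet>\<^sub>t P \<bullet>\<^sub>t G = G"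
      using G f[of G] ar by simp
    fix U assume U: "tAr C U \<and> tdom U = tdom G \<and> tcod U = tdom K \<and> K \<bullet>\<^sub>t U = G"
    then have "P \<bullet>\<^sub>t K \<bullet>\<^sub>t U = U"
      using cmp_cancel[OF e(1), of U] by simp
    then show "U = P \<bullet>\<^sub>t G"
      using U by metis
  qed
qed (rule e)

lemma is_cokernelI:
  assumes ar: "tAr C F" "tAr C P" "tdom P = tcod F" "tAr C I" "tdom I = tcod P" "tcod I = tcod F"
    and e: "P \<bullet>\<^sub>t I = tid C (tcod P)" "P \<bullet>\<^sub>t F = tzero C (tdom F) (tcod P)"
    and f: "\<And>H. \<lbrakk>tAr C H; tdom H = tcod F; H \<bullet>\<^sub>t F = tzero C (tdom F) (tcod H)\<rbrakk> \<Longrightarrow> H \<bullet>\<^sub>t I \<bullet>\<^sub>t P = H"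
  shows "is_cokernel C (tdom F) (tcod F) (mor F) (tcod P) (mor P)"
  unfolding is_cokernel_def
proof (intro conjI ballI impI)
  have o [simp]: "tdom F \<in> obj C" "tcod F \<in> obj C" "tcod P \<in> obj C"
    using ar by simp_all
  show "mor P \<in> hom C (tcod F) (tcod P)"
    using ar by simp
  have "mor P \<cdot> mor F = mor (P \<bullet>\<^sub>t F)"
    using ar by simp
  then show "mor P \<cdot> mor F = zerom C (tdom F) (tcod P)"
    unfolding e(2) by (simp add: mor_tzero)
  fix z g assume z: "z \<in> obj C" "g \<in> hom C (tcod F) z" "g \<cdot> mor F = zerom C (tdom F) z"
  let ?G = "mk C (tcod F) g z"
  have "?G \<bullet>\<^sub>t F = tzero C (tdom F) z"
    using z ar(1) by (intro tarr_eqI[of C]) (simp_all add: mor_tzero)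
  then have G: "?G \<bullet>\<^sub>t I \<bullet>\<^sub>t P = ?G"
    using z f[of ?G] by simp
  show "\<exists>!h. h \<in> hom C (tcod P) z \<and> h \<cdot> mor P = g"
  proof (rule ex1I[of _ "mor (?G \<bullet>\<^sub>t I)"])
    have "mor (?G \<bullet>\<^sub>t I) \<cdot> mor P = mor ((?G \<bullet>\<^sub>t I) \<bullet>\<^sub>t P)"
      using ar z by (intro mor_cmp[symmetric]) simp_all
    also have "\<dots> = g"
      unfolding cmp_assoc G using z by simp
    finally show "mor (?G \<bullet>\<^sub>t I) \<in> hom C (tcod P) z \<and> mor (?G \<bullet>\<^sub>t I) \<cdot> mor P = g"
      using ar z by (intro conjI mor_in_hom) simp_all
    fix h assume h: "h \<in> hom C (tcod P) z \<and> h \<cdot> mor P = g"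
    let ?H = "mk C (tcod P) h z"
    have "?H \<bullet>\<^sub>t P = ?G"
      using h z ar by (intro tarr_eqI[of C]) simp_all
    then have "?G \<bullet>\<^sub>t I = ?H \<bullet>\<^sub>t P \<bullet>\<^sub>t I"
      by (metis cmp_assoc)
    also have "\<dots> = ?H"
      unfolding e(1) using h z by simp
    finally show "h = mor (?G \<bullet>\<^sub>t I)"
      using h z o by (metis mk_sel(3))
  qed
qed

lemma dsum_single: "x \<in> obj C \<Longrightarrow> dsum x [x] (\<lambda>_. tid C x) (\<lambda>_. tid C x)"
  by (simp add: dsum_def)

lemma dsum_pairI:
  assumes "tAr C I" "tAr C J" "tAr C P" "tAr C Q" "tcod I = x" "tcod J = x" "tdom P = x" "tdom Q = x"
    "tdom I = y" "tdom J = z" "tcod P = y" "tcod Q = z"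
    "P \<bullet>\<^sub>t I = tid C y" "Q \<bullet>\<^sub>t J = tid C z" "P \<bullet>\<^sub>t J = tzero C z y" "Q \<bullet>\<^sub>t I = tzero C y z"
    "tadd C (I \<bullet>\<^sub>t P) (J \<bullet>\<^sub>t Q) = tid C x"
  shows "dsum x [y, z] (\<lambda>j. if j = 0 then I else J) (\<lambda>j. if j = 0 then P else Q)"
proof -
  have o: "x \<in> obj C" "y \<in> obj C" "z \<in> obj C"
    using assms tAr_sel by metis+
  show ?thesis
    unfolding dsum_def using assms o by (simp add: less_Suc_eq all_conj_distrib)
qed

lemma dsum_pairE:
  assumes "dsum x [y, z] I P"
  shows "tAr C (I 0)" "tAr C (I 1)" "tAr C (P 0)" "tAr C (P 1)" "tcod (I 0) = x" "tcod (I 1) = x"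
    "tdom (P 0) = x" "tdom (P 1) = x" "tdom (I 0) = y" "tdom (I 1) = z" "tcod (P 0) = y" "tcod (P 1) = z"
    "P 0 \<bullet>\<^sub>t I 0 = tid C y" "P 1 \<bullet>\<^sub>t I 1 = tid C z" "P 0 \<bullet>\<^sub>t I 1 = tzero C z y" "P 1 \<bullet>\<^sub>t I 0 = tzero C y z"
    "tadd C (I 0 \<bullet>\<^sub>t P 0) (I 1 \<bullet>\<^sub>t P 1) = tid C x"
proof -
  note d = assms[unfolded dsum_def]
  have *: "0 < length [y, z]" "1 < length [y, z]"
    by simp_all
  show ar: "tAr C (I 0)" "tAr C (I 1)" "tAr C (P 0)" "tAr C (P 1)" "tcod (I 0) = x" "tcod (I 1) = x"
    "tdom (P 0) = x" "tdom (P 1) = x" "tdom (I 0) = y" "tdom (I 1) = z" "tcod (P 0) = y" "tcod (P 1) = z"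
    using d * by simp_all
  show "P 0 \<bullet>\<^sub>t I 0 = tid C y" "P 1 \<bullet>\<^sub>t I 1 = tid C z" "P 0 \<bullet>\<^sub>t I 1 = tzero C z y" "P 1 \<bullet>\<^sub>t I 0 = tzero C y z"
    using d * by simp_all
  have "tsum C x x (map (\<lambda>j. I j \<bullet>\<^sub>t P j) [0..<length [y, z]]) = tid C x"
    using d by blast
  then show "tadd C (I 0 \<bullet>\<^sub>t P 0) (I 1 \<bullet>\<^sub>t P 1) = tid C x"
    using ar by simp
qed

text \<open>Refines a binary sum by decompositions of both summands. It serves to build finite sums
  from binary ones and to combine decompositions into simple objects.\<close>

lemma dsum_append:
  assumes x: "dsum x [y, z] I P" and y: "dsum y ss J Q" and z: "dsum z ts K R"
  shows "\<exists>I P. dsum x (ss @ ts) I P"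
proof -
  note pr [simp] = dsum_pairE(1-16)[OF x, unfolded One_nat_def]
  note dy = y[unfolded dsum_def] and dz = z[unfolded dsum_def]
  have o [simp]: "x \<in> obj C" "y \<in> obj C" "z \<in> obj C"
    using x y z by (auto simp: dsum_def)
  let ?n = "length ss"
  let ?I = "\<lambda>j. if j < ?n then I 0 \<bullet>\<^sub>t J j else I 1 \<bullet>\<^sub>t K (j - ?n)"
  let ?P = "\<lambda>j. if j < ?n then Q j \<bullet>\<^sub>t P 0 else R (j - ?n) \<bullet>\<^sub>t P 1"
  have J: "tAr C (J j)" "tdom (J j) = ss ! j" "tcod (J j) = y" "tAr C (Q j)" "tdom (Q j) = y" "tcod (Q j) = ss ! j" "ss ! j \<in> obj C"
    if "j < ?n" for j
    using dy that by auto
  have K: "tAr C (K j)" "tdom (K j) = ts ! j" "tcod (K j) = z" "tAr C (R j)" "tdom (R j) = z" "tcod (R j) = ts ! j" "ts ! j \<in> obj C"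
    if "j < length ts" for j
    using dz that by auto
  have c: "P 0 \<bullet>\<^sub>t I 0 \<bullet>\<^sub>t F = tid C y \<bullet>\<^sub>t F" "P 1 \<bullet>\<^sub>t I 1 \<bullet>\<^sub>t F = tid C z \<bullet>\<^sub>t F"
    "P 0 \<bullet>\<^sub>t I 1 \<bullet>\<^sub>t F = tzero C z y \<bullet>\<^sub>t F" "P 1 \<bullet>\<^sub>t I 0 \<bullet>\<^sub>t F = tzero C y z \<bullet>\<^sub>t F" for F
    using pr(13-16)[THEN cmp_cancel] by simp_all
  note c = c[unfolded One_nat_def]
  have "dsum x (ss @ ts) ?I ?P"
    unfolding dsum_def
  proof (intro conjI allI impI)
    show "x \<in> obj C" "set (ss @ ts) \<subseteq> obj C"
      using dy dz by auto
    fix j assume j: "j < length (ss @ ts)"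
    show "tAr C (?I j)" "tdom (?I j) = (ss @ ts) ! j" "tcod (?I j) = x"
      "tAr C (?P j)" "tdom (?P j) = x" "tcod (?P j) = (ss @ ts) ! j"
      using j J[of j] K[of "j - ?n"] by (auto simp: nth_append)
    fix l assume l: "l < length (ss @ ts)"
    have "Q j \<bullet>\<^sub>t J l = (if j = l then tid C (ss ! j) else tzero C (ss ! l) (ss ! j))" if "j < ?n" "l < ?n"
      using dy that by blast
    moreover have "R (j - ?n) \<bullet>\<^sub>t K (l - ?n) = (if j = l then tid C (ts ! (j - ?n)) else tzero C (ts ! (l - ?n)) (ts ! (j - ?n)))"
      if "\<not> j < ?n" "\<not> l < ?n"
    proof -
      have "j - ?n < length ts" "l - ?n < length ts" "j - ?n = l - ?n \<longleftrightarrow> j = l"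
        using j l that by auto
      then show ?thesis
        using dz by metis
    qed
    moreover have "j - ?n < length ts" if "\<not> j < ?n"
      using that j by simp
    moreover have "l - ?n < length ts" if "\<not> l < ?n"
      using that l by simp
    ultimately show "?P j \<bullet>\<^sub>t ?I l = (if j = l then tid C ((ss @ ts) ! j) else tzero C ((ss @ ts) ! l) ((ss @ ts) ! j))"
      using J[of j] J[of l] K[of "j - ?n"] K[of "l - ?n"]
      by (cases "j < ?n"; cases "l < ?n") (simp_all add: nth_append cmp_assoc c)
  next
    have u: "[0..<length (ss @ ts)] = [0..<?n] @ map (\<lambda>j. j + ?n) [0..<length ts]"
      using upt_add_eq_append[of 0 ?n "length ts"] by (simp add: map_add_upt add.commute)
    let ?A = "map (\<lambda>j. J j \<bullet>\<^sub>t Q j) [0..<?n]" and ?B = "map (\<lambda>j. K j \<bullet>\<^sub>t R j) [0..<length ts]"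
    let ?A' = "map (\<lambda>F. F \<bullet>\<^sub>t P 0) (map (\<lambda>F. I 0 \<bullet>\<^sub>t F) ?A)" and ?B' = "map (\<lambda>F. F \<bullet>\<^sub>t P 1) (map (\<lambda>F. I 1 \<bullet>\<^sub>t F) ?B)"
    have 1: "map (\<lambda>j. ?I j \<bullet>\<^sub>t ?P j) [0..<length (ss @ ts)] = ?A' @ ?B'"
      unfolding u by (simp add: cmp_assoc)
    have 2: "tsum C x x (?A' @ ?B') = tadd C (tsum C x x ?A') (tsum C x x ?B')"
      by (rule tsum_append) (use J K in auto)
    have 3: "tsum C x x ?A' = tsum C y x (map (\<lambda>F. I 0 \<bullet>\<^sub>t F) ?A) \<bullet>\<^sub>t P 0"
      by (rule tsum_cmp[of y x "map (\<lambda>F. I 0 \<bullet>\<^sub>t F) ?A" "P 0", unfolded dsum_pairE(7)[OF x], symmetric])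
        (use J in auto)
    have 4: "tsum C y x (map (\<lambda>F. I 0 \<bullet>\<^sub>t F) ?A) = I 0 \<bullet>\<^sub>t tsum C y y ?A"
      by (rule cmp_tsum[of y y ?A "I 0", unfolded dsum_pairE(5)[OF x], symmetric]) (use J in auto)
    have 5: "tsum C x x ?B' = tsum C z x (map (\<lambda>F. I 1 \<bullet>\<^sub>t F) ?B) \<bullet>\<^sub>t P 1"
      by (rule tsum_cmp[of z x "map (\<lambda>F. I 1 \<bullet>\<^sub>t F) ?B" "P 1", unfolded dsum_pairE(8)[OF x], symmetric])
        (use K in auto)
    have 6: "tsum C z x (map (\<lambda>F. I 1 \<bullet>\<^sub>t F) ?B) = I 1 \<bullet>\<^sub>t tsum C z z ?B"
      by (rule cmp_tsum[of z z ?B "I 1", unfolded dsum_pairE(6)[OF x], symmetric]) (use K in auto)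
    have 7: "tsum C y y ?A = tid C y" "tsum C z z ?B = tid C z"
      using dy dz by blast+
    show "tsum C x x (map (\<lambda>j. ?I j \<bullet>\<^sub>t ?P j) [0..<length (ss @ ts)]) = tid C x"
      unfolding 1 2 3 4 5 6 7 using dsum_pairE(17)[OF x] by simp
  qed
  then show ?thesis
    by blast
qed

text \<open>An upper bound for the dimension of the endomorphism space, realized by a spanning list;
  it measures the progress when an object is split into simple ones.\<close>

definition span_length where
  "span_length x n \<longleftrightarrow> (\<exists>Fs. length Fs = n \<and> set Fs \<subseteq> hom C x x \<and> hom C x x \<subseteq> span_of x x Fs)"

text \<open>Conjugation is linear, so it carries spans to spans; used to pass from endomorphisms of
  \<open>x\<close> to those of a retract.\<close>

lemma conj_lsum:
  assumes "tAr C I" "tAr C P" "tdom P = x" "tcod I = x" "tcod P = y" "tdom I = y" "set Gs \<subseteq> hom C x x"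
    "w \<in> span_of x x Gs"
  shows "mor P \<cdot> w \<cdot> mor I \<in> span_of y y (map (\<lambda>g. mor P \<cdot> g \<cdot> mor I) Gs)"
  using assms(7,8)
proof (induction Gs arbitrary: w)
  case Nil
  have o: "x \<in> obj C" "y \<in> obj C"
    using assms tAr_sel by metis+
  have "P \<bullet>\<^sub>t tzero C x x \<bullet>\<^sub>t I = tzero C y y"
    using assms(1-6) o by simp
  then have "mor (P \<bullet>\<^sub>t tzero C x x \<bullet>\<^sub>t I) = mor (tzero C y y)"
    by simp
  then show ?case
    using Nil o assms(1-6) by (simp add: mor_tzero del: tzero_cmp cmp_tzero)
next
  case (Cons G Gs)
  have o: "x \<in> obj C" "y \<in> obj C" and h: "mor I \<in> hom C y x" "mor P \<in> hom C x y"
    using assms by auto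
  obtain r v where v: "v \<in> span_of x x Gs" "w = r \<odot> G \<oplus> v"
    using Cons.prems(2) unfolding span_of_Cons by blast
  have G: "G \<in> hom C x x" "set Gs \<subseteq> hom C x x" "v \<in> hom C x x"
    using Cons.prems(1) v span_of_subspace[OF o(1,1), of Gs] by (auto simp: hom_subspace_def)
  have "w \<cdot> mor I = r \<odot> (G \<cdot> mor I) \<oplus> (v \<cdot> mor I)"
    unfolding v(2) using o h G comp_add_left[of y x x "mor I" "r \<odot> G" v] comp_scale_left[of y x x "mor I" G r]
    by (simp add: scale_in_hom)
  then have "mor P \<cdot> w \<cdot> mor I = r \<odot> (mor P \<cdot> G \<cdot> mor I) \<oplus> (mor P \<cdot> v \<cdot> mor I)"
    using o h G comp_add_right[of y x y "r \<odot> (G \<cdot> mor I)" "v \<cdot> mor I" "mor P"]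
      comp_scale_right[of y x y "G \<cdot> mor I" "mor P" r] comp_in_hom[of y x x "mor I" G] comp_in_hom[of y x x "mor I" v]
    by (simp add: scale_in_hom)
  then show ?case
    unfolding list.map span_of_Cons using Cons.IH[OF G(2) v(1)] by blast
qed

text \<open>The endomorphisms of the retract \<open>y\<close> embed into those of \<open>x\<close>
  as the morphisms that factor through \<open>e\<close> on both sides. The identity of
  \<open>x\<close> is not among them when \<open>e\<close> differs from it, so they form a proper
  subspace, which needs fewer generators.\<close>

lemma splits_span_length:
  assumes s: "splits x e y I P" and x: "x \<in> obj C" "e \<noteq> tid C x" and n: "span_length x n"
  shows "\<exists>m<n. span_length y m"
proof -
  obtain Fs where Fs: "length Fs = n" "set Fs \<subseteq> hom C x x" "hom C x x \<subseteq> span_of x x Fs"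
    using n by (auto simp: span_length_def)
  have [simp]: "y \<in> obj C" "tAr C I" "tAr C P" "tdom P = x" "tcod P = y" "tdom I = y" "tcod I = x"
    and PI: "P \<bullet>\<^sub>t I = tid C y" and e: "I \<bullet>\<^sub>t P = e"
    using s by (auto simp: splits_def)
  \<comment> \<open>\<open>?W\<close> is the corner of the endomorphism space of \<open>x\<close>
    cut out by \<open>e\<close>.\<close>
  let ?W = "{mor (I \<bullet>\<^sub>t U \<bullet>\<^sub>t P) | U. tAr C U \<and> tdom U = y \<and> tcod U = y}"
  have hs: "hom_subspace x x ?W"
    unfolding hom_subspace_def
  proof (intro conjI ballI allI)
    show "?W \<subseteq> hom C x x"
      by (auto intro!: mor_in_hom)
    have "zerom C x x = mor (I \<bullet>\<^sub>t tzero C y y \<bullet>\<^sub>t P)"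
      using x by (simp add: mor_tzero)
    then show "zerom C x x \<in> ?W"
      by (intro CollectI exI[of _ "tzero C y y"]) simp
  next
    fix f g assume "f \<in> ?W" "g \<in> ?W"
    then obtain U V where U: "tAr C U" "tdom U = y" "tcod U = y" "f = mor (I \<bullet>\<^sub>t U \<bullet>\<^sub>t P)"
      and V: "tAr C V" "tdom V = y" "tcod V = y" "g = mor (I \<bullet>\<^sub>t V \<bullet>\<^sub>t P)"
      by blast
    have "f \<oplus> g = mor (tadd C (I \<bullet>\<^sub>t U \<bullet>\<^sub>t P) (I \<bullet>\<^sub>t V \<bullet>\<^sub>t P))"
      unfolding U(4) V(4) using U V by (intro mor_tadd[symmetric]) simp_all
    also have "tadd C (I \<bullet>\<^sub>t U \<bullet>\<^sub>t P) (I \<bullet>\<^sub>t V \<bullet>\<^sub>t P) = I \<bullet>\<^sub>t tadd C U V \<bullet>\<^sub>t P"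
      using U V by (simp add: tadd_cmp cmp_tadd)
    finally show "f \<oplus> g \<in> ?W"
      using U V by (intro CollectI exI[of _ "tadd C U V"]) simp
  next
    fix r f assume "f \<in> ?W"
    then obtain U where U: "tAr C U" "tdom U = y" "tcod U = y" "f = mor (I \<bullet>\<^sub>t U \<bullet>\<^sub>t P)"
      by blast
    have "r \<odot> f = mor (tscale C r (I \<bullet>\<^sub>t U \<bullet>\<^sub>t P))"
      unfolding U(4) using U by (intro mor_tscale[symmetric]) simp
    also have "tscale C r (I \<bullet>\<^sub>t U \<bullet>\<^sub>t P) = I \<bullet>\<^sub>t tscale C r U \<bullet>\<^sub>t P"
      using U by (simp add: tscale_cmp cmp_tscale)
    finally show "r \<odot> f \<in> ?W"
      using U by (intro CollectI exI[of _ "tscale C r U"]) simp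
  qed
  have "\<not> span_of x x Fs \<subseteq> ?W"
  proof
    assume "span_of x x Fs \<subseteq> ?W"
    moreover have "mor (tid C x) \<in> hom C x x"
      using x by (intro mor_in_hom) simp_all
    ultimately have "mor (tid C x) \<in> ?W"
      using Fs(3) by blast
    then obtain U where U: "tAr C U" "tdom U = y" "tcod U = y" "mor (tid C x) = mor (I \<bullet>\<^sub>t U \<bullet>\<^sub>t P)"
      by blast
    then have "tid C x = I \<bullet>\<^sub>t U \<bullet>\<^sub>t P"
      using x by (intro tarr_eqI[of C]) (simp_all del: mor_cmp)
    moreover have "e \<bullet>\<^sub>t I \<bullet>\<^sub>t U \<bullet>\<^sub>t P = I \<bullet>\<^sub>t U \<bullet>\<^sub>t P"
      unfolding e[symmetric] cmp_assoc using cmp_cancel[OF PI, of "U \<bullet>\<^sub>t P"] U by simp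
    ultimately have "e \<bullet>\<^sub>t tid C x = tid C x"
      by simp
    then show False
      using x e by (metis Ar_cmp \<open>tAr C I\<close> \<open>tAr C P\<close> \<open>tcod P = y\<close> \<open>tdom I = y\<close> \<open>tdom P = x\<close> cmp_Id tcmp_sel(1))
  qed
  moreover have "?W \<subseteq> span_of x x Fs"
    using hs Fs(3) by (auto simp: hom_subspace_def)
  ultimately obtain Gs where Gs: "set Gs \<subseteq> ?W" "?W \<subseteq> span_of x x Gs" "length Gs < n"
    using subspace_spanning[OF x(1,1) Fs(2) hs] Fs(1) by blast
  have GsX: "set Gs \<subseteq> hom C x x"
    using Gs(1) hs by (auto simp: hom_subspace_def)
  let ?H = "map (\<lambda>g. mor P \<cdot> g \<cdot> mor I) Gs"
  have "set ?H \<subseteq> hom C y y"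
  proof
    fix h assume "h \<in> set ?H"
    then obtain g where g: "g \<in> hom C x x" "h = mor P \<cdot> g \<cdot> mor I"
      using GsX by auto
    then have "h = mor (P \<bullet>\<^sub>t mk C x g x \<bullet>\<^sub>t I)"
      using x by simp
    then show "h \<in> hom C y y"
      using g x by (auto intro!: mor_in_hom simp del: mor_cmp)
  qed
  moreover have "hom C y y \<subseteq> span_of y y ?H"
  proof
    fix u assume u: "u \<in> hom C y y"
    let ?U = "mk C y u y"
    have "mor (I \<bullet>\<^sub>t ?U \<bullet>\<^sub>t P) \<in> span_of x x Gs"
    proof (rule subsetD[OF Gs(2)], intro CollectI exI conjI)
      show "mor (I \<bullet>\<^sub>t ?U \<bullet>\<^sub>t P) = mor (I \<bullet>\<^sub>t ?U \<bullet>\<^sub>t P)" ..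
    qed (use u in simp_all)
    then have "mor P \<cdot> mor (I \<bullet>\<^sub>t ?U \<bullet>\<^sub>t P) \<cdot> mor I \<in> span_of y y ?H"
      by (intro conj_lsum[where x = x]) (simp_all add: GsX)
    moreover have "P \<bullet>\<^sub>t (I \<bullet>\<^sub>t ?U \<bullet>\<^sub>t P) \<bullet>\<^sub>t I = ?U"
      unfolding cmp_assoc PI using cmp_cancel[OF PI, of "?U"] u by simp
    then have "mor (P \<bullet>\<^sub>t (I \<bullet>\<^sub>t ?U \<bullet>\<^sub>t P) \<bullet>\<^sub>t I) = u"
      using u by simp
    then have "mor P \<cdot> mor (I \<bullet>\<^sub>t ?U \<bullet>\<^sub>t P) \<cdot> mor I = u"
      using u by (subst (asm) mor_cmp; simp del: mor_cmp) (subst (asm) mor_cmp; simp del: mor_cmp)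
    ultimately show "u \<in> span_of y y ?H"
      by simp
  qed
  ultimately show ?thesis
    using Gs(3) unfolding span_length_def by (intro exI[of _ "length Gs"] conjI exI[of _ ?H]) simp_all
qed

text \<open>The direction from regularity to semisimplicity. If f = f g f, then the kernel of f is
  the image of the idempotent 1 - g f and its cokernel the image of 1 - f g; monomorphisms get left
  inverses and epimorphisms right inverses; and a non-zero object whose only idempotents are zero
  and the identity is simple. Splitting off idempotents ends because endomorphism spaces
  shrink.\<close>

theorem semisimple_categoryI:
  assumes z: "z \<in> obj C" "idm C z = zerom C z z"
    and bip: "\<And>x y. \<lbrakk>x \<in> obj C; y \<in> obj C\<rbrakk> \<Longrightarrow> \<exists>u I P. dsum u [x, y] I P"
    and split: idempotents_split and reg: "\<And>F. tAr C F \<Longrightarrow> regular_arrow F"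
  shows "semisimple_category C"
proof
  have sp: "\<exists>y I P. splits x e y I P" if "tAr C e" "tdom e = x" "tcod e = x" "e \<bullet>\<^sub>t e = e" for e x
    using split that unfolding idempotents_split_def by metis
  have compl: "tsub C (tid C x) e \<bullet>\<^sub>t tsub C (tid C x) e = tsub C (tid C x) e"
    if "tAr C e" "tdom e = x" "tcod e = x" "e \<bullet>\<^sub>t e = e" for e x
  proof -
    have x: "x \<in> obj C"
      using that by auto
    have "tsub C (tid C x) e \<bullet>\<^sub>t e = tzero C x x"
      using that x by (simp add: tsub_cmp)
    moreover have "tsub C (tid C x) e \<bullet>\<^sub>t tsub C (tid C x) e
        = tsub C (tsub C (tid C x) e \<bullet>\<^sub>t tid C x) (tsub C (tid C x) e \<bullet>\<^sub>t e)"
      using that x by (intro cmp_tsub) simp_all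
    ultimately show ?thesis
      using that x by simp
  qed
  \<comment> \<open>Finite sums are assembled from the zero object \<open>z\<close> and binary
    sums.\<close>
  show "\<exists>x\<in>obj C. is_direct_sum C x ss" if "set ss \<subseteq> obj C" for ss
  proof -
    have "\<exists>x I P. dsum x ss I P"
      using that
    proof (induction ss)
      case Nil
      have "tid C z = tzero C z z"
        using z by (intro tarr_eqI[of C]) (simp_all add: mor_tzero)
      then have "dsum z [] undefined undefined"
        using z by (simp add: dsum_def)
      then show ?case
        by blast
    next
      case (Cons s ss)
      then obtain y I P where y: "dsum y ss I P"
        by auto
      then obtain u J Q where "dsum u [s, y] J Q"
        using bip[of s y] Cons.prems by (auto simp: dsum_def)
      from dsum_append[OF this dsum_single y] show ?case
        using Cons.prems by auto
    qed
    then show ?thesis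
      using is_direct_sum_iff that by (metis dsum_def)
  qed
  show "\<exists>n\<in>obj C. \<exists>k. is_kernel C a b f n k" if ab: "a \<in> obj C" "b \<in> obj C" "f \<in> hom C a b" for a b f
  proof -
    let ?F = "mk C a f b"
    note [simp] = ab
    have F [simp]: "tAr C ?F"
      using ab by simp
    obtain G where [simp]: "tAr C G" "tdom G = b" "tcod G = a" and G: "?F \<bullet>\<^sub>t G \<bullet>\<^sub>t ?F = ?F"
      using reg[OF F, unfolded regular_arrow_def mk_sel(1,2)] by blast
    have c: "?F \<bullet>\<^sub>t G \<bullet>\<^sub>t ?F \<bullet>\<^sub>t H = ?F \<bullet>\<^sub>t H" for H
      using G by (metis cmp_assoc)
    let ?e = "tsub C (tid C a) (G \<bullet>\<^sub>t ?F)"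
    have "?e \<bullet>\<^sub>t ?e = ?e"
      by (intro compl) (simp_all add: G cmp_assoc)
    then obtain n I P where s: "splits a ?e n I P"
      using sp[of ?e a] ab by auto
    have [simp]: "tAr C I" "tAr C P" "tdom P = a" "tcod P = n" "tdom I = n" "tcod I = a" "n \<in> obj C"
      and PI: "P \<bullet>\<^sub>t I = tid C n" and IP: "I \<bullet>\<^sub>t P = ?e"
      using s by (simp_all add: splits_def)
    \<comment> \<open>\<open>I\<close> is the inclusion of the image of 1 - GF; an \<open>H\<close>
      with FH = 0 is fixed by this idempotent and so factors through \<open>I\<close>.\<close>
    have "is_kernel C (tdom ?F) (tcod ?F) (mor ?F) (tdom I) (mor I)"
    proof (rule is_kernelI[of ?F I P])
      have "?F \<bullet>\<^sub>t ?e = tzero C a b"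
        using ab by (simp add: cmp_tsub G)
      then have "?F \<bullet>\<^sub>t I \<bullet>\<^sub>t P \<bullet>\<^sub>t I = tzero C n b"
        unfolding IP[symmetric] using ab by (metis (no_types) \<open>tAr C I\<close> \<open>tcod I = a\<close> \<open>tdom I = n\<close> cmp_assoc tzero_cmp)
      then show "?F \<bullet>\<^sub>t I = tzero C (tdom I) (tcod ?F)"
        unfolding PI by simp
      fix H assume H: "tAr C H" "tcod H = tdom ?F" "?F \<bullet>\<^sub>t H = tzero C (tdom H) (tcod ?F)"
      have "?e \<bullet>\<^sub>t H = H"
        using H ab by (simp add: tsub_cmp cmp_assoc)
      then show "I \<bullet>\<^sub>t P \<bullet>\<^sub>t H = H"
        unfolding IP[symmetric] cmp_assoc .
    qed (simp_all add: PI)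
    then show ?thesis
      using ab by auto
  qed
  show "\<exists>q\<in>obj C. \<exists>p. is_cokernel C a b f q p" if ab: "a \<in> obj C" "b \<in> obj C" "f \<in> hom C a b" for a b f
  proof -
    let ?F = "mk C a f b"
    note [simp] = ab
    have F [simp]: "tAr C ?F"
      using ab by simp
    obtain G where [simp]: "tAr C G" "tdom G = b" "tcod G = a" and G: "?F \<bullet>\<^sub>t G \<bullet>\<^sub>t ?F = ?F"
      using reg[OF F, unfolded regular_arrow_def mk_sel(1,2)] by blast
    have c: "?F \<bullet>\<^sub>t G \<bullet>\<^sub>t ?F \<bullet>\<^sub>t H = ?F \<bullet>\<^sub>t H" for H
      using G by (metis cmp_assoc)
    let ?e = "tsub C (tid C b) (?F \<bullet>\<^sub>t G)"
    have "?e \<bullet>\<^sub>t ?e = ?e"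
      by (intro compl) (simp_all add: c cmp_assoc)
    then obtain q I P where s: "splits b ?e q I P"
      using sp[of ?e b] ab by auto
    have [simp]: "tAr C I" "tAr C P" "tdom P = b" "tcod P = q" "tdom I = q" "tcod I = b" "q \<in> obj C"
      and PI: "P \<bullet>\<^sub>t I = tid C q" and IP: "I \<bullet>\<^sub>t P = ?e"
      using s by (simp_all add: splits_def)
    have "is_cokernel C (tdom ?F) (tcod ?F) (mor ?F) (tcod P) (mor P)"
    proof (rule is_cokernelI[of ?F P I])
      have "?e \<bullet>\<^sub>t ?F = tzero C a b"
        using ab by (simp add: tsub_cmp G cmp_assoc)
      then have "I \<bullet>\<^sub>t P \<bullet>\<^sub>t ?F = tzero C a b"
        unfolding IP[symmetric] cmp_assoc .
      then have "P \<bullet>\<^sub>t I \<bullet>\<^sub>t P \<bullet>\<^sub>t ?F = tzero C a q"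
        using ab by simp
      then show "P \<bullet>\<^sub>t ?F = tzero C (tdom ?F) (tcod P)"
        using cmp_cancel[OF PI, of "P \<bullet>\<^sub>t ?F"] by simp
      fix H assume H: "tAr C H" "tdom H = tcod ?F" "H \<bullet>\<^sub>t ?F = tzero C (tdom ?F) (tcod H)"
      have "H \<bullet>\<^sub>t ?F \<bullet>\<^sub>t G = tzero C b (tcod H)"
        using cmp_cancel[OF H(3), of G] H by simp
      then have "H \<bullet>\<^sub>t ?e = H"
        using H ab by (simp add: cmp_tsub)
      then show "H \<bullet>\<^sub>t I \<bullet>\<^sub>t P = H"
        unfolding IP .
    qed (simp_all add: PI)
    then show ?thesis
      using ab by auto
  qed
  \<comment> \<open>Cancelling the monomorphism in f g f = f leaves a left inverse.\<close>
  have left_inv: "\<exists>G. tAr C G \<and> tdom G = b \<and> tcod G = a \<and> G \<bullet>\<^sub>t mk C a f b = tid C a"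
    if ab: "a \<in> obj C" "b \<in> obj C" "mono_mor C a b f" for a b f
  proof -
    let ?F = "mk C a f b"
    note [simp] = ab
    have f [simp]: "f \<in> hom C a b"
      using ab by (simp add: mono_mor_def)
    have F [simp]: "tAr C ?F"
      using ab f by simp
    obtain G where [simp]: "tAr C G" "tdom G = b" "tcod G = a" and G: "?F \<bullet>\<^sub>t G \<bullet>\<^sub>t ?F = ?F"
      using reg[OF F, unfolded regular_arrow_def mk_sel(1,2)] by blast
    have "mor (?F \<bullet>\<^sub>t (G \<bullet>\<^sub>t ?F)) = mor (?F \<bullet>\<^sub>t tid C a)"
      using G by simp
    moreover have "mor (?F \<bullet>\<^sub>t (G \<bullet>\<^sub>t ?F)) = f \<cdot> mor (G \<bullet>\<^sub>t ?F)"
      using mor_cmp[of ?F "G \<bullet>\<^sub>t ?F"] ab f by (simp del: mor_cmp)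
    moreover have "mor (?F \<bullet>\<^sub>t tid C a) = f \<cdot> mor (tid C a)"
      using mor_cmp[of ?F "tid C a"] ab f by (simp del: mor_cmp cmp_Id)
    ultimately have "f \<cdot> mor (G \<bullet>\<^sub>t ?F) = f \<cdot> mor (tid C a)"
      by simp
    moreover have "mor (G \<bullet>\<^sub>t ?F) \<in> hom C a a" "mor (tid C a) \<in> hom C a a"
      using ab by (intro mor_in_hom; simp)+
    ultimately have "mor (G \<bullet>\<^sub>t ?F) = mor (tid C a)"
      using ab unfolding mono_mor_def by blast
    then have "G \<bullet>\<^sub>t ?F = tid C a"
      using ab by (intro tarr_eqI[of C]) (simp_all del: mor_cmp)
    then show ?thesis
      by (intro exI[of _ G]) simp
  qed
  show "\<exists>c\<in>obj C. \<exists>g\<in>hom C b c. is_kernel C b c g a f" if ab: "a \<in> obj C" "b \<in> obj C" "mono_mor C a b f" for a b f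
  proof -
    let ?F = "mk C a f b"
    note [simp] = ab
    have f [simp]: "f \<in> hom C a b"
      using ab by (simp add: mono_mor_def)
    have F [simp]: "tAr C ?F"
      using ab f by simp
    obtain G where [simp]: "tAr C G" "tdom G = b" "tcod G = a" and G: "G \<bullet>\<^sub>t ?F = tid C a"
      using left_inv[OF ab] by blast
    \<comment> \<open>A split monomorphism with left inverse \<open>G\<close> is the kernel of 1 -
      FG.\<close>
    let ?E = "tsub C (tid C b) (?F \<bullet>\<^sub>t G)"
    have "is_kernel C (tdom ?E) (tcod ?E) (mor ?E) (tdom ?F) (mor ?F)"
    proof (rule is_kernelI[of ?E ?F G])
      show "?E \<bullet>\<^sub>t ?F = tzero C (tdom ?F) (tcod ?E)"
        using ab by (simp add: tsub_cmp cmp_assoc G)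
      fix H assume H: "tAr C H" "tcod H = tdom ?E" "?E \<bullet>\<^sub>t H = tzero C (tdom H) (tcod ?E)"
      then have "tsub C H (?F \<bullet>\<^sub>t G \<bullet>\<^sub>t H) = tzero C (tdom H) (tcod H)"
        using ab by (simp add: tsub_cmp cmp_assoc)
      then have "H = ?F \<bullet>\<^sub>t G \<bullet>\<^sub>t H"
        by (rule tsub_eq_zero) (use H in simp_all)
      then show "?F \<bullet>\<^sub>t G \<bullet>\<^sub>t H = H" ..
    qed (use ab G in simp_all)
    moreover have "mor ?E \<in> hom C b b"
      using ab by (intro mor_in_hom) simp_all
    ultimately show ?thesis
      using ab f by (intro bexI[of _ b] bexI[of _ "mor ?E"]) simp_all
  qed
  show "\<exists>c\<in>obj C. \<exists>g\<in>hom C c a. is_cokernel C c a g b f" if ab: "a \<in> obj C" "b \<in> obj C" "epi_mor C a b f" for a b f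
  proof -
    let ?F = "mk C a f b"
    note [simp] = ab
    have f [simp]: "f \<in> hom C a b"
      using ab by (simp add: epi_mor_def)
    have F [simp]: "tAr C ?F"
      using ab f by simp
    obtain G where [simp]: "tAr C G" "tdom G = b" "tcod G = a" and G': "?F \<bullet>\<^sub>t G \<bullet>\<^sub>t ?F = ?F"
      using reg[OF F, unfolded regular_arrow_def mk_sel(1,2)] by blast
    \<comment> \<open>An epimorphism is cancelled on the right in the same equation, which gives a
      right inverse.\<close>
    have "mor ((?F \<bullet>\<^sub>t G) \<bullet>\<^sub>t ?F) = mor (tid C b \<bullet>\<^sub>t ?F)"
      using G' ab by (simp add: cmp_assoc del: mor_cmp)
    moreover have "mor ((?F \<bullet>\<^sub>t G) \<bullet>\<^sub>t ?F) = mor (?F \<bullet>\<^sub>t G) \<cdot> f"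
      using mor_cmp[of "?F \<bullet>\<^sub>t G" ?F] ab f by (simp del: mor_cmp)
    moreover have "mor (tid C b \<bullet>\<^sub>t ?F) = mor (tid C b) \<cdot> f"
      using mor_cmp[of "tid C b" ?F] ab f by (simp del: mor_cmp Id_cmp)
    ultimately have "mor (?F \<bullet>\<^sub>t G) \<cdot> f = mor (tid C b) \<cdot> f"
      by simp
    moreover have "mor (?F \<bullet>\<^sub>t G) \<in> hom C b b" "mor (tid C b) \<in> hom C b b"
      using ab by (intro mor_in_hom; simp)+
    ultimately have "mor (?F \<bullet>\<^sub>t G) = mor (tid C b)"
      using ab unfolding epi_mor_def by blast
    then have G: "?F \<bullet>\<^sub>t G = tid C b"
      using ab by (intro tarr_eqI[of C]) (simp_all del: mor_cmp)
    \<comment> \<open>Dually, a split epimorphism with right inverse \<open>G\<close> is the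
      cokernel of 1 - GF.\<close>
    let ?E = "tsub C (tid C a) (G \<bullet>\<^sub>t ?F)"
    have "is_cokernel C (tdom ?E) (tcod ?E) (mor ?E) (tcod ?F) (mor ?F)"
    proof (rule is_cokernelI[of ?E ?F G])
      show "?F \<bullet>\<^sub>t ?E = tzero C (tdom ?E) (tcod ?F)"
        using ab by (simp add: cmp_tsub G')
      fix H assume H: "tAr C H" "tdom H = tcod ?E" "H \<bullet>\<^sub>t ?E = tzero C (tdom ?E) (tcod H)"
      then have "tsub C H (H \<bullet>\<^sub>t G \<bullet>\<^sub>t ?F) = tzero C (tdom H) (tcod H)"
        using ab by (simp add: cmp_tsub)
      then have "H = H \<bullet>\<^sub>t G \<bullet>\<^sub>t ?F"
        by (rule tsub_eq_zero) (use H in simp_all)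
      then show "H \<bullet>\<^sub>t G \<bullet>\<^sub>t ?F = H" ..
    qed (use ab G in simp_all)
    moreover have "mor ?E \<in> hom C a a"
      using ab by (intro mor_in_hom) simp_all
    ultimately show ?thesis
      using ab f by (intro bexI[of _ a] bexI[of _ "mor ?E"]) simp_all
  qed
  have simples: "\<exists>ss I P. (\<forall>s\<in>set ss. simple_object C s) \<and> dsum x ss I P" if "x \<in> obj C" "span_length x n" for x n
    using that
  proof (induction n arbitrary: x rule: less_induct)
    case (less n)
    note [simp] = less.prems(1)
    \<comment> \<open>Either the object is zero and the empty sum works, or it has no proper
      idempotents and is simple, or a proper idempotent splits it into two retracts with shorter
      spanning lists.\<close>
    consider "tid C x = tzero C x x" | "tid C x \<noteq> tzero C x x" "\<And>e. \<lbrakk>tAr C e; tdom e = x; tcod e = x; e \<bullet>\<^sub>t e = e\<rbrakk> \<Longrightarrow> e = tzero C x x \<or> e = tid C x"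
      | e where "tAr C e" "tdom e = x" "tcod e = x" "e \<bullet>\<^sub>t e = e" "e \<noteq> tzero C x x" "e \<noteq> tid C x"
      by blast
    then show ?case
    proof cases
      case 1
      then have "dsum x [] undefined undefined"
        by (simp add: dsum_def)
      then show ?thesis
        by (intro exI[of _ "[]"]) auto
    next
      case 2
      have "simple_object C x"
        unfolding simple_object_def
      proof (intro conjI ballI allI impI)
        show "idm C x \<noteq> zerom C x x"
          using 2(1) less.prems(1) by (simp add: tzero_def tid_def mk_eq_iff id_in_hom zero_in_hom)
        fix a f assume af: "a \<in> obj C" "mono_mor C a x f"
        then have f: "f \<in> hom C a x"
          by (simp add: mono_mor_def)
        note [simp] = af f
        let ?F = "mk C a f x"
        have F [simp]: "tAr C ?F"
          using af f by simp
        obtain G where [simp]: "tAr C G" "tdom G = x" "tcod G = a" and G: "G \<bullet>\<^sub>t ?F = tid C a"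
          using left_inv[of a x f] af by auto
        \<comment> \<open>A subobject of \<open>x\<close> yields the idempotent FG. If this is zero,
          so is the inclusion; if it is the identity, the inclusion is invertible.\<close>
        have "?F \<bullet>\<^sub>t G \<bullet>\<^sub>t ?F \<bullet>\<^sub>t G = ?F \<bullet>\<^sub>t G"
          using cmp_cancel[OF G, of G] by simp
        then have "?F \<bullet>\<^sub>t G = tzero C x x \<or> ?F \<bullet>\<^sub>t G = tid C x"
          by (intro 2(2)) (simp_all add: cmp_assoc)
        then show "f = zerom C a x \<or> iso_mor C a x f"
        proof
          assume "?F \<bullet>\<^sub>t G = tzero C x x"
          then have "?F \<bullet>\<^sub>t G \<bullet>\<^sub>t ?F = tzero C a x"
            using cmp_cancel[of ?F G "tzero C x x" ?F] by simp
          then have "?F = tzero C a x"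
            unfolding G by simp
          then have "mor ?F = mor (tzero C a x)"
            by simp
          then show ?thesis
            using af f by (simp add: mor_tzero)
        next
          assume FG: "?F \<bullet>\<^sub>t G = tid C x"
          have "is_inverse C a x f (mor G)"
            unfolding is_inverse_def
            using f arg_cong[OF FG, of mor] arg_cong[OF G, of mor] af by simp
          then show ?thesis
            by (auto simp: iso_mor_def)
        qed
      qed simp
      then show ?thesis
        by (intro exI[of _ "[x]"] exI[of _ "\<lambda>_. tid C x"]) (simp add: dsum_single)
    next
      case 3
      note [simp] = 3(1-4)
      let ?e = "tsub C (tid C x) e"
      obtain y I P where s: "splits x e y I P"
        using sp[of e x] by auto
      obtain w J Q where t: "splits x ?e w J Q"
        using sp[of ?e x] compl[of e x] by auto
      have [simp]: "tAr C I" "tAr C P" "tdom P = x" "tcod P = y" "tdom I = y" "tcod I = x" "y \<in> obj C"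
        and PI: "P \<bullet>\<^sub>t I = tid C y" and IP: "I \<bullet>\<^sub>t P = e"
        using s by (simp_all add: splits_def)
      have [simp]: "tAr C J" "tAr C Q" "tdom Q = x" "tcod Q = w" "tdom J = w" "tcod J = x" "w \<in> obj C"
        and QJ: "Q \<bullet>\<^sub>t J = tid C w" and JQ: "J \<bullet>\<^sub>t Q = ?e"
        using t by (simp_all add: splits_def)
      have "?e \<noteq> tid C x"
      proof
        assume "?e = tid C x"
        then have "tadd C (tid C x) e = tadd C (tid C x) (tzero C x x)"
          using tsub_add[of "tid C x" e] by simp
        then have "e = tzero C x x"
          by (rule tadd_left_cancel) simp_all
        then show False
          using 3(5) by simp
      qed
      then obtain m where "m < n" "span_length w m"
        using splits_span_length[OF t _ _ less.prems(2)] by auto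
      with less.IH[of m w] obtain ts J' Q' where ts: "\<forall>s\<in>set ts. simple_object C s" "dsum w ts J' Q'"
        by auto
      obtain m where "m < n" "span_length y m"
        using splits_span_length[OF s _ _ less.prems(2)] 3(6) by auto
      with less.IH[of m y] obtain ss I' P' where ss: "\<forall>s\<in>set ss. simple_object C s" "dsum y ss I' P'"
        by auto
      have eI: "e \<bullet>\<^sub>t I = I" and Pe: "P \<bullet>\<^sub>t e = P"
        unfolding IP[symmetric] using cmp_cancel[OF PI, of P] by (simp_all add: cmp_assoc PI)
      have fJ: "?e \<bullet>\<^sub>t J = J" and Qf: "Q \<bullet>\<^sub>t ?e = Q"
        unfolding JQ[symmetric] using cmp_cancel[OF QJ, of Q] by (simp_all add: cmp_assoc QJ)
      have "P \<bullet>\<^sub>t ?e \<bullet>\<^sub>t J = tzero C w y"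
        using cmp_cancel[of P ?e "tzero C x y" J] by (simp add: cmp_tsub Pe)
      then have PJ: "P \<bullet>\<^sub>t J = tzero C w y"
        unfolding fJ .
      have "Q \<bullet>\<^sub>t ?e \<bullet>\<^sub>t I = tzero C y w"
        by (simp add: tsub_cmp eI)
      then have QI: "Q \<bullet>\<^sub>t I = tzero C y w"
        using cmp_cancel[OF Qf, of I] by simp
      have "tadd C (I \<bullet>\<^sub>t P) (J \<bullet>\<^sub>t Q) = tid C x"
        unfolding IP JQ using tsub_add[of "tid C x" e] tadd_commute[of e ?e] by simp
      then have "dsum x [y, w] (\<lambda>j. if j = 0 then I else J) (\<lambda>j. if j = 0 then P else Q)"
        using PI QJ PJ QI by (intro dsum_pairI) simp_all
      from dsum_append[OF this ss(2) ts(2)] show ?thesis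
        using ss(1) ts(1) by (metis UnE set_append)
    qed
  qed
  show "\<exists>ss. (\<forall>s\<in>set ss. simple_object C s) \<and> is_direct_sum C x ss" if x: "x \<in> obj C" for x
  proof -
    obtain n where "span_length x n"
      using finite_dimensional_span[OF x x] unfolding span_length_def by blast
    then obtain ss I P where *: "\<forall>s\<in>set ss. simple_object C s" "dsum x ss I P"
      using simples[OF x] by blast
    then have "is_direct_sum C x ss"
      using is_direct_sum_iff[of x ss] x unfolding dsum_def by blast
    then show ?thesis
      using * by blast
  qed
qed

end

section \<open>Modules over a monad whose free modules have regular morphisms\<close>

text \<open>The monad that tensors with an algebra is abstracted, so that associators are confined
  to the verification of the monad laws in its interpretation.\<close>

locale linear_monad = linear_category C
  for C :: "('k::field, 'o, 'm, 'x) LinCat_scheme" (structure) +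
  fixes To :: "'o \<Rightarrow> 'o" and T :: "('o, 'm) tarr \<Rightarrow> ('o, 'm) tarr" and mu et :: "'o \<Rightarrow> ('o, 'm) tarr"
  assumes To_obj [simp]: "x \<in> obj C \<Longrightarrow> To x \<in> obj C"
    and T_Ar [simp]: "tAr C F \<Longrightarrow> tAr C (T F)"
    and T_sel [simp]: "tdom (T F) = To (tdom F)" "tcod (T F) = To (tcod F)"
    and T_cmp: "\<lbrakk>tAr C F; tAr C G; tdom G = tcod F\<rbrakk> \<Longrightarrow> T (G \<bullet>\<^sub>t F) = T G \<bullet>\<^sub>t T F"
    and T_id [simp]: "x \<in> obj C \<Longrightarrow> T (tid C x) = tid C (To x)"
    and T_sub: "\<lbrakk>tAr C F; tAr C G; tdom F = tdom G; tcod F = tcod G\<rbrakk> \<Longrightarrow> T (tsub C F G) = tsub C (T F) (T G)"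
    and mu_Ar [simp]: "x \<in> obj C \<Longrightarrow> tAr C (mu x)"
    and mu_sel [simp]: "tdom (mu x) = To (To x)" "tcod (mu x) = To x"
    and et_Ar [simp]: "x \<in> obj C \<Longrightarrow> tAr C (et x)"
    and et_sel [simp]: "tdom (et x) = x" "tcod (et x) = To x"
    and mu_natural: "tAr C F \<Longrightarrow> mu (tcod F) \<bullet>\<^sub>t T (T F) = T F \<bullet>\<^sub>t mu (tdom F)"
    and et_natural: "tAr C F \<Longrightarrow> et (tcod F) \<bullet>\<^sub>t F = T F \<bullet>\<^sub>t et (tdom F)"
    and mu_mu: "x \<in> obj C \<Longrightarrow> mu x \<bullet>\<^sub>t mu (To x) = mu x \<bullet>\<^sub>t T (mu x)"
    and mu_et: "x \<in> obj C \<Longrightarrow> mu x \<bullet>\<^sub>t et (To x) = tid C (To x)"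
    and mu_T_et: "x \<in> obj C \<Longrightarrow> mu x \<bullet>\<^sub>t T (et x) = tid C (To x)"
begin

definition action where
  "action x l \<longleftrightarrow> x \<in> obj C \<and> tAr C l \<and> tdom l = To x \<and> tcod l = x \<and> l \<bullet>\<^sub>t mu x = l \<bullet>\<^sub>t T l \<and> l \<bullet>\<^sub>t et x = tid C x"

text \<open>An arrow into a free module generates a map of free modules; conversely such a map is
  generated by its restriction along the unit, by \<open>ext_of_module_map\<close>.\<close>

lemma mu_T_ext:
  assumes "tAr C F" "tcod F = To y" "y \<in> obj C"
  shows "(mu y \<bullet>\<^sub>t T F) \<bullet>\<^sub>t mu (tdom F) = mu y \<bullet>\<^sub>t T (mu y \<bullet>\<^sub>t T F)"
proof -
  have "(mu y \<bullet>\<^sub>t T F) \<bullet>\<^sub>t mu (tdom F) = mu y \<bullet>\<^sub>t mu (To y) \<bullet>\<^sub>t T (T F)"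
    using assms mu_natural[of F] by (simp add: cmp_assoc)
  also have "\<dots> = mu y \<bullet>\<^sub>t T (mu y) \<bullet>\<^sub>t T (T F)"
    using cmp_cancel[OF mu_mu[OF assms(3)], of "T (T F)"] by (simp add: cmp_assoc)
  also have "\<dots> = mu y \<bullet>\<^sub>t T (mu y \<bullet>\<^sub>t T F)"
    using assms by (simp add: T_cmp)
  finally show ?thesis .
qed

lemma ext_of_module_map:
  assumes "tAr C F" "tdom F = To x" "tcod F = To y" "x \<in> obj C" "y \<in> obj C" "F \<bullet>\<^sub>t mu x = mu y \<bullet>\<^sub>t T F"
  shows "mu y \<bullet>\<^sub>t T (F \<bullet>\<^sub>t et x) = F"
proof -
  have "mu y \<bullet>\<^sub>t T (F \<bullet>\<^sub>t et x) = F \<bullet>\<^sub>t mu x \<bullet>\<^sub>t T (et x)"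
    using assms cmp_cancel[OF assms(6), of "T (et x)"] by (simp add: T_cmp cmp_assoc)
  then show ?thesis
    using assms by (simp add: mu_T_et)
qed

text \<open>Regularity of the maps between free modules in Kleisli form: \<open>G\<close> generates
  the quasi-inverse, and the equation is stated on generators.\<close>

context
  assumes kleisli: "\<And>x y F. \<lbrakk>x \<in> obj C; y \<in> obj C; tAr C F; tdom F = x; tcod F = To y\<rbrakk>
    \<Longrightarrow> \<exists>G. tAr C G \<and> tdom G = y \<and> tcod G = To x \<and> (mu y \<bullet>\<^sub>t T F) \<bullet>\<^sub>t (mu x \<bullet>\<^sub>t T G) \<bullet>\<^sub>t F = F"
begin

text \<open>A quasi-inverse of the difference \<open>mu x - T l\<close> of the two maps whose coequalizer is \<open>l\<close> exhibits
  every module as a retract of a free one.\<close>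

lemma action_section:
  assumes "action x l"
  obtains s where "tAr C s" "tdom s = x" "tcod s = To x" "l \<bullet>\<^sub>t s = tid C x" "s \<bullet>\<^sub>t l = mu x \<bullet>\<^sub>t T s"
proof -
  have [simp]: "x \<in> obj C" "tAr C l" "tdom l = To x" "tcod l = x" and l: "l \<bullet>\<^sub>t mu x = l \<bullet>\<^sub>t T l" "l \<bullet>\<^sub>t et x = tid C x"
    using assms by (auto simp: action_def)
  let ?d = "tsub C (mu x) (T l)"
  have d0: "?d \<bullet>\<^sub>t et (To x) = tsub C (tid C (To x)) (et x \<bullet>\<^sub>t l)"
    using et_natural[of l] by (simp add: tsub_cmp mu_et)
  have "?d \<bullet>\<^sub>t mu (To x) = tsub C (mu x \<bullet>\<^sub>t mu (To x)) (T l \<bullet>\<^sub>t mu (To x))"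
    by (rule tsub_cmp) simp_all
  also have "\<dots> = tsub C (mu x \<bullet>\<^sub>t T (mu x)) (mu x \<bullet>\<^sub>t T (T l))"
    using mu_natural[of l] by (simp add: mu_mu)
  also have "\<dots> = mu x \<bullet>\<^sub>t T ?d"
    by (simp add: T_sub cmp_tsub)
  finally have d: "mu x \<bullet>\<^sub>t T (?d \<bullet>\<^sub>t et (To x)) = ?d"
    by (intro ext_of_module_map) simp_all
  obtain g where [simp]: "tAr C g" "tdom g = x" "tcod g = To (To x)"
    and g: "?d \<bullet>\<^sub>t (mu (To x) \<bullet>\<^sub>t T g) \<bullet>\<^sub>t ?d \<bullet>\<^sub>t et (To x) = ?d \<bullet>\<^sub>t et (To x)"
    using kleisli[of "To x" x "?d \<bullet>\<^sub>t et (To x)"] unfolding d by auto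
  let ?g = "mu (To x) \<bullet>\<^sub>t T g"
  \<comment> \<open>\<open>?q\<close> is 1 - dg; it annihilates \<open>?d\<close> on generators. As
    \<open>?d\<close> on generators is the identity minus \<open>et x \<bullet>\<^sub>t l\<close>,
    this says that \<open>?q\<close> factors through \<open>l\<close>, and the section is the other
    factor \<open>?s\<close>.\<close>
  let ?q = "tsub C (tid C (To x)) (?d \<bullet>\<^sub>t ?g)"
  let ?s = "?q \<bullet>\<^sub>t et x"
  have g_map: "?g \<bullet>\<^sub>t mu x = mu (To x) \<bullet>\<^sub>t T ?g"
    using mu_T_ext[of g "To x"] by simp
  have d_map: "?d \<bullet>\<^sub>t mu (To x) = mu x \<bullet>\<^sub>t T ?d"
    using mu_T_ext[of "?d \<bullet>\<^sub>t et (To x)" x] unfolding d by simp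
  have q_map: "?q \<bullet>\<^sub>t mu x = mu x \<bullet>\<^sub>t T ?q"
  proof -
    have "?q \<bullet>\<^sub>t mu x = tsub C (tid C (To x) \<bullet>\<^sub>t mu x) ((?d \<bullet>\<^sub>t ?g) \<bullet>\<^sub>t mu x)"
      by (rule tsub_cmp) simp_all
    also have "(?d \<bullet>\<^sub>t ?g) \<bullet>\<^sub>t mu x = ?d \<bullet>\<^sub>t mu (To x) \<bullet>\<^sub>t T ?g"
      using g_map by (simp only: cmp_assoc)
    also have "\<dots> = mu x \<bullet>\<^sub>t T ?d \<bullet>\<^sub>t T ?g"
      using cmp_cancel[OF d_map, of "T ?g"] by (simp only: cmp_assoc)
    also have "\<dots> = mu x \<bullet>\<^sub>t T (?d \<bullet>\<^sub>t ?g)"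
      using T_cmp[of ?g ?d] by simp
    also have "tsub C (tid C (To x) \<bullet>\<^sub>t mu x) (mu x \<bullet>\<^sub>t T (?d \<bullet>\<^sub>t ?g)) = mu x \<bullet>\<^sub>t tsub C (tid C (To (To x))) (T (?d \<bullet>\<^sub>t ?g))"
      using cmp_tsub[of "tid C (To (To x))" "T (?d \<bullet>\<^sub>t ?g)" "mu x"] by simp
    also have "tsub C (tid C (To (To x))) (T (?d \<bullet>\<^sub>t ?g)) = T ?q"
      using T_sub[of "tid C (To x)" "?d \<bullet>\<^sub>t ?g"] by simp
    finally show ?thesis .
  qed
  have "?q \<bullet>\<^sub>t ?d \<bullet>\<^sub>t et (To x) = tsub C (tid C (To x) \<bullet>\<^sub>t ?d \<bullet>\<^sub>t et (To x)) ((?d \<bullet>\<^sub>t ?g) \<bullet>\<^sub>t ?d \<bullet>\<^sub>t et (To x))"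
    by (rule tsub_cmp) simp_all
  also have "(?d \<bullet>\<^sub>t ?g) \<bullet>\<^sub>t ?d \<bullet>\<^sub>t et (To x) = ?d \<bullet>\<^sub>t et (To x)"
    using g by (simp only: cmp_assoc)
  finally have "?q \<bullet>\<^sub>t ?d \<bullet>\<^sub>t et (To x) = tzero C (To x) (To x)"
    by simp
  moreover have "?q \<bullet>\<^sub>t ?d \<bullet>\<^sub>t et (To x) = tsub C (?q \<bullet>\<^sub>t tid C (To x)) (?q \<bullet>\<^sub>t et x \<bullet>\<^sub>t l)"
    unfolding d0 by (rule cmp_tsub) simp_all
  ultimately have "tsub C ?q (?q \<bullet>\<^sub>t et x \<bullet>\<^sub>t l) = tzero C (tdom ?q) (tcod ?q)"
    by simp
  then have "?q = ?q \<bullet>\<^sub>t et x \<bullet>\<^sub>t l"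
    by (rule tsub_eq_zero) simp_all
  then have sl: "?s \<bullet>\<^sub>t l = ?q"
    by (simp only: cmp_assoc)
  have "l \<bullet>\<^sub>t ?q = tsub C (l \<bullet>\<^sub>t tid C (To x)) (l \<bullet>\<^sub>t ?d \<bullet>\<^sub>t ?g)"
    by (rule cmp_tsub) simp_all
  also have "l \<bullet>\<^sub>t ?d \<bullet>\<^sub>t ?g = tzero C (To x) x"
  proof -
    have "l \<bullet>\<^sub>t ?d = tsub C (l \<bullet>\<^sub>t mu x) (l \<bullet>\<^sub>t T l)"
      by (rule cmp_tsub) simp_all
    then have "l \<bullet>\<^sub>t ?d = tzero C (To (To x)) x"
      by (simp add: l(1))
    from cmp_cancel[OF this, of ?g] show ?thesis
      by simp
  qed
  finally have lq: "l \<bullet>\<^sub>t ?q = l"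
    by simp
  have ls: "l \<bullet>\<^sub>t ?s = tid C x"
    using cmp_cancel[OF lq, of "et x"] l(2) by simp
  \<comment> \<open>Compatibility with the actions is tested after composition with
    \<open>T l\<close>, which has the right inverse \<open>T (et x)\<close>.\<close>
  have "?s \<bullet>\<^sub>t l = mu x \<bullet>\<^sub>t T ?s"
  proof (rule iso_epi[of "T l" "T (et x)"])
    show "T l \<bullet>\<^sub>t T (et x) = tid C (To x)"
      using T_cmp[of "et x" l] l(2) by simp
    have "(?s \<bullet>\<^sub>t l) \<bullet>\<^sub>t T l = ?s \<bullet>\<^sub>t l \<bullet>\<^sub>t mu x"
      by (simp only: cmp_assoc l(1))
    also have "\<dots> = ?q \<bullet>\<^sub>t mu x"
      using cmp_cancel[OF sl, of "mu x"] by simp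
    also have "\<dots> = mu x \<bullet>\<^sub>t T (?s \<bullet>\<^sub>t l)"
      unfolding q_map sl ..
    also have "T (?s \<bullet>\<^sub>t l) = T ?s \<bullet>\<^sub>t T l"
      by (rule T_cmp) simp_all
    finally show "(?s \<bullet>\<^sub>t l) \<bullet>\<^sub>t T l = (mu x \<bullet>\<^sub>t T ?s) \<bullet>\<^sub>t T l"
      by (simp only: cmp_assoc)
  qed simp_all
  with ls show thesis
    by (intro that[of ?s]) simp_all
qed

text \<open>With \<open>s\<close> a section of the action on \<open>y\<close>, the arrow
  \<open>s \<bullet>\<^sub>t F\<close> generates the map
  \<open>s \<bullet>\<^sub>t F \<bullet>\<^sub>t l\<close> between free modules. Its quasi-inverse
  is cut down to the modules by \<open>l\<close> and \<open>s\<close>.\<close>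

theorem module_map_regular:
  assumes "action x l" "action y k" "tAr C F" "tdom F = x" "tcod F = y" "F \<bullet>\<^sub>t l = k \<bullet>\<^sub>t T F"
  shows "\<exists>G. tAr C G \<and> tdom G = y \<and> tcod G = x \<and> G \<bullet>\<^sub>t k = l \<bullet>\<^sub>t T G \<and> F \<bullet>\<^sub>t G \<bullet>\<^sub>t F = F"
proof -
  note [simp] = assms(3-5)
  have l [simp]: "x \<in> obj C" "tAr C l" "tdom l = To x" "tcod l = x" and l': "l \<bullet>\<^sub>t mu x = l \<bullet>\<^sub>t T l"
    using assms by (auto simp: action_def)
  have k [simp]: "y \<in> obj C" "tAr C k" "tdom k = To y" "tcod k = y"
    using assms by (auto simp: action_def)
  obtain r where r [simp]: "tAr C r" "tdom r = x" "tcod r = To x" "l \<bullet>\<^sub>t r = tid C x"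
    by (rule action_section[OF assms(1)])
  obtain s where s [simp]: "tAr C s" "tdom s = y" "tcod s = To y" and ks: "k \<bullet>\<^sub>t s = tid C y" and sk: "s \<bullet>\<^sub>t k = mu y \<bullet>\<^sub>t T s"
    by (rule action_section[OF assms(2)])
  obtain h where h [simp]: "tAr C h" "tdom h = y" "tcod h = To x"
    and reg: "(mu y \<bullet>\<^sub>t T (s \<bullet>\<^sub>t F)) \<bullet>\<^sub>t (mu x \<bullet>\<^sub>t T h) \<bullet>\<^sub>t s \<bullet>\<^sub>t F = s \<bullet>\<^sub>t F"
    using kleisli[of x y "s \<bullet>\<^sub>t F"] by auto
  let ?h = "mu x \<bullet>\<^sub>t T h"
  let ?G = "l \<bullet>\<^sub>t ?h \<bullet>\<^sub>t s"
  have "mu y \<bullet>\<^sub>t T (s \<bullet>\<^sub>t F) = s \<bullet>\<^sub>t F \<bullet>\<^sub>t l"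
    using cmp_cancel[OF sk, of "T F"] assms(6) by (simp add: T_cmp cmp_assoc)
  then have "s \<bullet>\<^sub>t F \<bullet>\<^sub>t ?G \<bullet>\<^sub>t F = s \<bullet>\<^sub>t F"
    using reg by (simp add: cmp_assoc)
  then have "F \<bullet>\<^sub>t ?G \<bullet>\<^sub>t F = F"
    by (rule iso_mono[OF ks]) simp_all
  moreover have "?G \<bullet>\<^sub>t k = l \<bullet>\<^sub>t T ?G"
  proof -
    have "?G \<bullet>\<^sub>t k = l \<bullet>\<^sub>t ?h \<bullet>\<^sub>t mu y \<bullet>\<^sub>t T s"
      by (simp only: cmp_assoc sk)
    also have "\<dots> = l \<bullet>\<^sub>t (?h \<bullet>\<^sub>t mu y) \<bullet>\<^sub>t T s"
      by (simp only: cmp_assoc)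
    also have "?h \<bullet>\<^sub>t mu y = mu x \<bullet>\<^sub>t T ?h"
      using mu_T_ext[of h x] by simp
    also have "l \<bullet>\<^sub>t (mu x \<bullet>\<^sub>t T ?h) \<bullet>\<^sub>t T s = l \<bullet>\<^sub>t T l \<bullet>\<^sub>t T ?h \<bullet>\<^sub>t T s"
      using cmp_cancel[OF l', of "T ?h \<bullet>\<^sub>t T s"] by (simp only: cmp_assoc)
    also have "\<dots> = l \<bullet>\<^sub>t T ?G"
      using T_cmp[of s ?h] T_cmp[of "?h \<bullet>\<^sub>t s" l] by (simp add: cmp_assoc)
    finally show ?thesis .
  qed
  ultimately show ?thesis
    by (intro exI[of _ ?G]) simp
qed

end

end

section \<open>Modules over an algebra object\<close>

context tensor_category
begin

lemma ttns_tadd: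
  "\<lbrakk>tAr C F; tAr C G; tdom F = tdom G; tcod F = tcod G; tAr C H\<rbrakk> \<Longrightarrow> H \<boxtimes>\<^sub>t tadd C F G = tadd C (H \<boxtimes>\<^sub>t F) (H \<boxtimes>\<^sub>t G)"
  using tmor_add_right[of "tdom H" "tcod H" "tdom F" "tcod F" "mor H" "mor F" "mor G"] tAr_sel[of C F] tAr_sel[of C G] tAr_sel[of C H]
  by (intro tarr_eqI[of C]) (simp_all add: mor_tadd)

lemma ttns_tscale: "\<lbrakk>tAr C F; tAr C H\<rbrakk> \<Longrightarrow> H \<boxtimes>\<^sub>t tscale C r F = tscale C r (H \<boxtimes>\<^sub>t F)"
  using tmor_scale_right[of "tdom H" "tcod H" "tdom F" "tcod F" "mor H" "mor F" r] tAr_sel[of C F] tAr_sel[of C H]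
  by (intro tarr_eqI[of C]) (simp_all add: mor_tscale)

lemma Li_natural: "tAr C F \<Longrightarrow> Li (tcod F) \<bullet>\<^sub>t F = (tid C \<one> \<boxtimes>\<^sub>t F) \<bullet>\<^sub>t Li (tdom F)"
proof (rule iso_mono[of "Li (tcod F)" "Lu (tcod F)"])
  assume F: "tAr C F"
  have "Lu (tcod F) \<bullet>\<^sub>t Li (tcod F) \<bullet>\<^sub>t F = F"
    using cmp_cancel[OF Lu_arrow(3)[of "tcod F"], of F] F by simp
  moreover have "Lu (tcod F) \<bullet>\<^sub>t (tid C \<one> \<boxtimes>\<^sub>t F) \<bullet>\<^sub>t Li (tdom F) = F"
    using cmp_cancel[OF Lu_natural[OF F], of "Li (tdom F)"] F by (simp add: cmp_assoc)
  ultimately show "Lu (tcod F) \<bullet>\<^sub>t Li (tcod F) \<bullet>\<^sub>t F = Lu (tcod F) \<bullet>\<^sub>t (tid C \<one> \<boxtimes>\<^sub>t F) \<bullet>\<^sub>t Li (tdom F)"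
    by simp
qed simp_all

text \<open>The pentagon solved for inverse associators, as needed for the associativity of the
  monad.\<close>

lemma Ai_pentagon:
  assumes [simp]: "a \<in> obj C" "b \<in> obj C" "c \<in> obj C" "d \<in> obj C"
  shows "(As a b c \<boxtimes>\<^sub>t tid C d) \<bullet>\<^sub>t Ai (a \<otimes> b) c d \<bullet>\<^sub>t Ai a b (c \<otimes> d) = Ai a (b \<otimes> c) d \<bullet>\<^sub>t (tid C a \<boxtimes>\<^sub>t Ai b c d)"
proof -
  let ?V = "Ai a (b \<otimes> c) d \<bullet>\<^sub>t (tid C a \<boxtimes>\<^sub>t Ai b c d)"
  have "?V \<bullet>\<^sub>t (tid C a \<boxtimes>\<^sub>t As b c d) \<bullet>\<^sub>t As a (b \<otimes> c) d \<bullet>\<^sub>t (As a b c \<boxtimes>\<^sub>t tid C d)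
      = Ai a (b \<otimes> c) d \<bullet>\<^sub>t As a (b \<otimes> c) d \<bullet>\<^sub>t (As a b c \<boxtimes>\<^sub>t tid C d)"
    by (simp add: cmp_assoc tns_merge)
  also have "\<dots> = As a b c \<boxtimes>\<^sub>t tid C d"
    using cmp_cancel[OF As_arrow(4)[of a "b \<otimes> c" d], of "As a b c \<boxtimes>\<^sub>t tid C d"] by simp
  finally have "As a b c \<boxtimes>\<^sub>t tid C d = ?V \<bullet>\<^sub>t As a b (c \<otimes> d) \<bullet>\<^sub>t As (a \<otimes> b) c d"
    by (simp add: t_pentagon)
  then have "(As a b c \<boxtimes>\<^sub>t tid C d) \<bullet>\<^sub>t Ai (a \<otimes> b) c d \<bullet>\<^sub>t Ai a b (c \<otimes> d)
      = ?V \<bullet>\<^sub>t As a b (c \<otimes> d) \<bullet>\<^sub>t As (a \<otimes> b) c d \<bullet>\<^sub>t Ai (a \<otimes> b) c d \<bullet>\<^sub>t Ai a b (c \<otimes> d)"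
    by (simp only: cmp_assoc)
  also have "As (a \<otimes> b) c d \<bullet>\<^sub>t Ai (a \<otimes> b) c d \<bullet>\<^sub>t Ai a b (c \<otimes> d) = Ai a b (c \<otimes> d)"
    using cmp_cancel[OF As_arrow(3)[of "a \<otimes> b" c d], of "Ai a b (c \<otimes> d)"] by simp
  finally show ?thesis
    by simp
qed

end

locale algebra_object = tensor_category C
  for C :: "('k::field, 'o, 'm, 'x) TensorCat_scheme" (structure) +
  fixes A :: "('o, 'm) Alg"
  assumes algebra: "is_algebra C A"
begin

abbreviation "t \<equiv> alg_obj A"
definition "mt = mk C (t \<otimes> t) (alg_mult A) t"
definition "it = mk C \<one> (alg_unit A) t"

lemma algebra_sel [simp]:
  "t \<in> obj C" "tAr C mt" "tdom mt = t \<otimes> t" "tcod mt = t" "mor mt = alg_mult A"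
  "tAr C it" "tdom it = \<one>" "tcod it = t" "mor it = alg_unit A"
proof -
  have a: "t \<in> obj C" "alg_mult A \<in> hom C (t \<otimes> t) t" "alg_unit A \<in> hom C \<one> t"
    using algebra by (simp_all add: is_algebra_def Let_def)
  then show "t \<in> obj C" "tAr C mt" "tdom mt = t \<otimes> t" "tcod mt = t" "mor mt = alg_mult A"
    "tAr C it" "tdom it = \<one>" "tcod it = t" "mor it = alg_unit A"
    by (simp_all add: mt_def it_def)
qed

lemma algebra_laws:
  "mt \<bullet>\<^sub>t (mt \<boxtimes>\<^sub>t tid C t) = mt \<bullet>\<^sub>t (tid C t \<boxtimes>\<^sub>t mt) \<bullet>\<^sub>t As t t t"
  "mt \<bullet>\<^sub>t (it \<boxtimes>\<^sub>t tid C t) = Lu t" "mt \<bullet>\<^sub>t (tid C t \<boxtimes>\<^sub>t it) = Ru t"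
  using algebra by (auto simp: is_algebra_def Let_def intro!: tarr_eqI[of C])

sublocale linear_monad C "\<lambda>x. t \<otimes> x" "\<lambda>F. tid C t \<boxtimes>\<^sub>t F" "\<lambda>x. (mt \<boxtimes>\<^sub>t tid C x) \<bullet>\<^sub>t Ai t t x" "\<lambda>x. (it \<boxtimes>\<^sub>t tid C x) \<bullet>\<^sub>t Li x"
proof
  show "tid C t \<boxtimes>\<^sub>t tsub C F G = tsub C (tid C t \<boxtimes>\<^sub>t F) (tid C t \<boxtimes>\<^sub>t G)"
    if "tAr C F" "tAr C G" "tdom F = tdom G" "tcod F = tcod G" for F G
    using that by (simp add: tsub_def ttns_tadd ttns_tscale)
  show "((mt \<boxtimes>\<^sub>t tid C (tcod F)) \<bullet>\<^sub>t Ai t t (tcod F)) \<bullet>\<^sub>t (tid C t \<boxtimes>\<^sub>t (tid C t \<boxtimes>\<^sub>t F))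
      = (tid C t \<boxtimes>\<^sub>t F) \<bullet>\<^sub>t (mt \<boxtimes>\<^sub>t tid C (tdom F)) \<bullet>\<^sub>t Ai t t (tdom F)" if "tAr C F" for F
    using Ai_natural[of "tid C t" "tid C t" F, symmetric] that by (simp add: cmp_assoc tns_merge)
  show "((it \<boxtimes>\<^sub>t tid C (tcod F)) \<bullet>\<^sub>t Li (tcod F)) \<bullet>\<^sub>t F = (tid C t \<boxtimes>\<^sub>t F) \<bullet>\<^sub>t (it \<boxtimes>\<^sub>t tid C (tdom F)) \<bullet>\<^sub>t Li (tdom F)"
    if "tAr C F" for F
    using Li_natural[of F] that by (simp add: cmp_assoc tns_merge)
  show "tid C t \<boxtimes>\<^sub>t (G \<bullet>\<^sub>t F) = (tid C t \<boxtimes>\<^sub>t G) \<bullet>\<^sub>t (tid C t \<boxtimes>\<^sub>t F)"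
    if "tAr C F" "tAr C G" "tdom G = tcod F" for F G
    using that by (simp add: tns_merge)
  fix x assume [simp]: "x \<in> obj C"
  have 1: "Ai t t x \<bullet>\<^sub>t (mt \<boxtimes>\<^sub>t tid C (t \<otimes> x)) = ((mt \<boxtimes>\<^sub>t tid C t) \<boxtimes>\<^sub>t tid C x) \<bullet>\<^sub>t Ai (t \<otimes> t) t x"
    using Ai_natural[of mt "tid C t" "tid C x"] by simp
  have 2: "Ai t t x \<bullet>\<^sub>t (tid C t \<boxtimes>\<^sub>t (mt \<boxtimes>\<^sub>t tid C x)) = ((tid C t \<boxtimes>\<^sub>t mt) \<boxtimes>\<^sub>t tid C x) \<bullet>\<^sub>t Ai t (t \<otimes> t) x"
    using Ai_natural[of "tid C t" mt "tid C x"] by simp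
  have 3: "Ai t t x \<bullet>\<^sub>t (it \<boxtimes>\<^sub>t tid C (t \<otimes> x)) = ((it \<boxtimes>\<^sub>t tid C t) \<boxtimes>\<^sub>t tid C x) \<bullet>\<^sub>t Ai \<one> t x"
    using Ai_natural[of it "tid C t" "tid C x"] by simp
  have 4: "Ai t t x \<bullet>\<^sub>t (tid C t \<boxtimes>\<^sub>t (it \<boxtimes>\<^sub>t tid C x)) = ((tid C t \<boxtimes>\<^sub>t it) \<boxtimes>\<^sub>t tid C x) \<bullet>\<^sub>t Ai t \<one> x"
    using Ai_natural[of "tid C t" it "tid C x"] by simp
  have "((mt \<boxtimes>\<^sub>t tid C x) \<bullet>\<^sub>t Ai t t x) \<bullet>\<^sub>t (mt \<boxtimes>\<^sub>t tid C (t \<otimes> x)) \<bullet>\<^sub>t Ai t t (t \<otimes> x)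
      = ((mt \<bullet>\<^sub>t (mt \<boxtimes>\<^sub>t tid C t)) \<boxtimes>\<^sub>t tid C x) \<bullet>\<^sub>t Ai (t \<otimes> t) t x \<bullet>\<^sub>t Ai t t (t \<otimes> x)"
    using cmp_cancel[OF 1] by (simp add: cmp_assoc tns_merge)
  also have "\<dots> = (mt \<boxtimes>\<^sub>t tid C x) \<bullet>\<^sub>t ((tid C t \<boxtimes>\<^sub>t mt) \<boxtimes>\<^sub>t tid C x) \<bullet>\<^sub>t (As t t t \<boxtimes>\<^sub>t tid C x) \<bullet>\<^sub>t Ai (t \<otimes> t) t x \<bullet>\<^sub>t Ai t t (t \<otimes> x)"
    by (simp add: algebra_laws tns_merge)
  also have "\<dots> = (mt \<boxtimes>\<^sub>t tid C x) \<bullet>\<^sub>t Ai t t x \<bullet>\<^sub>t (tid C t \<boxtimes>\<^sub>t (mt \<boxtimes>\<^sub>t tid C x)) \<bullet>\<^sub>t (tid C t \<boxtimes>\<^sub>t Ai t t x)"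
    unfolding Ai_pentagon[OF algebra_sel(1,1,1) \<open>x \<in> obj C\<close>] using cmp_cancel[OF 2] by (simp only: cmp_assoc)
  also have "\<dots> = ((mt \<boxtimes>\<^sub>t tid C x) \<bullet>\<^sub>t Ai t t x) \<bullet>\<^sub>t (tid C t \<boxtimes>\<^sub>t ((mt \<boxtimes>\<^sub>t tid C x) \<bullet>\<^sub>t Ai t t x))"
    by (simp add: cmp_assoc tns_merge)
  finally show "((mt \<boxtimes>\<^sub>t tid C x) \<bullet>\<^sub>t Ai t t x) \<bullet>\<^sub>t (mt \<boxtimes>\<^sub>t tid C (t \<otimes> x)) \<bullet>\<^sub>t Ai t t (t \<otimes> x)
      = ((mt \<boxtimes>\<^sub>t tid C x) \<bullet>\<^sub>t Ai t t x) \<bullet>\<^sub>t (tid C t \<boxtimes>\<^sub>t ((mt \<boxtimes>\<^sub>t tid C x) \<bullet>\<^sub>t Ai t t x))" .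
  have "((mt \<boxtimes>\<^sub>t tid C x) \<bullet>\<^sub>t Ai t t x) \<bullet>\<^sub>t (it \<boxtimes>\<^sub>t tid C (t \<otimes> x)) \<bullet>\<^sub>t Li (t \<otimes> x)
      = (Lu t \<boxtimes>\<^sub>t tid C x) \<bullet>\<^sub>t Ai \<one> t x \<bullet>\<^sub>t Li (t \<otimes> x)"
    using cmp_cancel[OF 3] by (simp add: cmp_assoc tns_merge algebra_laws)
  also have "\<dots> = Lu (t \<otimes> x) \<bullet>\<^sub>t (As \<one> t x \<bullet>\<^sub>t Ai \<one> t x) \<bullet>\<^sub>t Li (t \<otimes> x)"
    using Lu_tns[of t x, symmetric] by (simp only: cmp_assoc algebra_sel \<open>x \<in> obj C\<close>)
  also have "\<dots> = tid C (t \<otimes> x)"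
    by simp
  finally show "((mt \<boxtimes>\<^sub>t tid C x) \<bullet>\<^sub>t Ai t t x) \<bullet>\<^sub>t (it \<boxtimes>\<^sub>t tid C (t \<otimes> x)) \<bullet>\<^sub>t Li (t \<otimes> x) = tid C (t \<otimes> x)" .
  have "((mt \<boxtimes>\<^sub>t tid C x) \<bullet>\<^sub>t Ai t t x) \<bullet>\<^sub>t (tid C t \<boxtimes>\<^sub>t ((it \<boxtimes>\<^sub>t tid C x) \<bullet>\<^sub>t Li x))
      = ((mt \<boxtimes>\<^sub>t tid C x) \<bullet>\<^sub>t Ai t t x) \<bullet>\<^sub>t (tid C t \<boxtimes>\<^sub>t (it \<boxtimes>\<^sub>t tid C x)) \<bullet>\<^sub>t (tid C t \<boxtimes>\<^sub>t Li x)"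
    by (simp add: tns_merge)
  also have "\<dots> = (mt \<boxtimes>\<^sub>t tid C x) \<bullet>\<^sub>t ((tid C t \<boxtimes>\<^sub>t it) \<boxtimes>\<^sub>t tid C x) \<bullet>\<^sub>t Ai t \<one> x \<bullet>\<^sub>t (tid C t \<boxtimes>\<^sub>t Li x)"
    using cmp_cancel[OF 4] by (simp only: cmp_assoc)
  also have "\<dots> = (Ru t \<boxtimes>\<^sub>t tid C x) \<bullet>\<^sub>t Ai t \<one> x \<bullet>\<^sub>t (tid C t \<boxtimes>\<^sub>t Li x)"
    by (simp add: tns_merge algebra_laws)
  also have "\<dots> = (tid C t \<boxtimes>\<^sub>t Lu x) \<bullet>\<^sub>t (As t \<one> x \<bullet>\<^sub>t Ai t \<one> x) \<bullet>\<^sub>t (tid C t \<boxtimes>\<^sub>t Li x)"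
    using t_triangle[of t x, symmetric] by (simp only: cmp_assoc algebra_sel \<open>x \<in> obj C\<close>)
  also have "\<dots> = tid C (t \<otimes> x)"
    by (simp add: tns_merge)
  finally show "((mt \<boxtimes>\<^sub>t tid C x) \<bullet>\<^sub>t Ai t t x) \<bullet>\<^sub>t (tid C t \<boxtimes>\<^sub>t ((it \<boxtimes>\<^sub>t tid C x) \<bullet>\<^sub>t Li x)) = tid C (t \<otimes> x)" .
qed simp_all

text \<open>The module axioms in the definitions carry an associator and a unitor on one side; in
  monad form their inverses appear on the other.\<close>

lemma action_iff:
  assumes x [simp]: "x \<in> obj C" and l: "l \<in> hom C (t \<otimes> x) x"
  shows "action x (mk C (t \<otimes> x) l x) \<longleftrightarrow> is_left_action C A x l"
proof -
  let ?l = "mk C (t \<otimes> x) l x"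
  note [simp] = l
  have "?l \<bullet>\<^sub>t (mt \<boxtimes>\<^sub>t tid C x) = ?l \<bullet>\<^sub>t (tid C t \<boxtimes>\<^sub>t ?l) \<bullet>\<^sub>t As t t x \<longleftrightarrow> l \<cdot> (alg_mult A \<star> idm C x) = l \<cdot> (idm C t \<star> l) \<cdot> assoc C t t x"
    using mor_cmp_eq_iff[of ?l "mt \<boxtimes>\<^sub>t tid C x" "?l \<bullet>\<^sub>t (tid C t \<boxtimes>\<^sub>t ?l) \<bullet>\<^sub>t As t t x"] l by simp
  moreover have "?l \<bullet>\<^sub>t (it \<boxtimes>\<^sub>t tid C x) = Lu x \<longleftrightarrow> l \<cdot> (alg_unit A \<star> idm C x) = lunit C x"
    using mor_cmp_eq_iff[of ?l "it \<boxtimes>\<^sub>t tid C x" "Lu x"] l by simp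
  moreover have "?l \<bullet>\<^sub>t (mt \<boxtimes>\<^sub>t tid C x) = ?l \<bullet>\<^sub>t (tid C t \<boxtimes>\<^sub>t ?l) \<bullet>\<^sub>t As t t x
      \<longleftrightarrow> ?l \<bullet>\<^sub>t (mt \<boxtimes>\<^sub>t tid C x) \<bullet>\<^sub>t Ai t t x = ?l \<bullet>\<^sub>t (tid C t \<boxtimes>\<^sub>t ?l)"
  proof
    assume "?l \<bullet>\<^sub>t (mt \<boxtimes>\<^sub>t tid C x) = ?l \<bullet>\<^sub>t (tid C t \<boxtimes>\<^sub>t ?l) \<bullet>\<^sub>t As t t x"
    from cmp_cancel[OF this, of "Ai t t x"] show "?l \<bullet>\<^sub>t (mt \<boxtimes>\<^sub>t tid C x) \<bullet>\<^sub>t Ai t t x = ?l \<bullet>\<^sub>t (tid C t \<boxtimes>\<^sub>t ?l)"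
      by (simp add: cmp_assoc)
  next
    assume "?l \<bullet>\<^sub>t (mt \<boxtimes>\<^sub>t tid C x) \<bullet>\<^sub>t Ai t t x = ?l \<bullet>\<^sub>t (tid C t \<boxtimes>\<^sub>t ?l)"
    then have "(?l \<bullet>\<^sub>t (mt \<boxtimes>\<^sub>t tid C x) \<bullet>\<^sub>t Ai t t x) \<bullet>\<^sub>t As t t x = (?l \<bullet>\<^sub>t (tid C t \<boxtimes>\<^sub>t ?l)) \<bullet>\<^sub>t As t t x"
      by (rule arg_cong)
    then show "?l \<bullet>\<^sub>t (mt \<boxtimes>\<^sub>t tid C x) = ?l \<bullet>\<^sub>t (tid C t \<boxtimes>\<^sub>t ?l) \<bullet>\<^sub>t As t t x"
      by (simp add: cmp_assoc)
  qed
  moreover have "?l \<bullet>\<^sub>t (it \<boxtimes>\<^sub>t tid C x) = Lu x \<longleftrightarrow> ?l \<bullet>\<^sub>t (it \<boxtimes>\<^sub>t tid C x) \<bullet>\<^sub>t Li x = tid C x"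
  proof
    assume "?l \<bullet>\<^sub>t (it \<boxtimes>\<^sub>t tid C x) = Lu x"
    from cmp_cancel[OF this, of "Li x"] show "?l \<bullet>\<^sub>t (it \<boxtimes>\<^sub>t tid C x) \<bullet>\<^sub>t Li x = tid C x"
      by simp
  next
    assume "?l \<bullet>\<^sub>t (it \<boxtimes>\<^sub>t tid C x) \<bullet>\<^sub>t Li x = tid C x"
    then have "(?l \<bullet>\<^sub>t (it \<boxtimes>\<^sub>t tid C x) \<bullet>\<^sub>t Li x) \<bullet>\<^sub>t Lu x = tid C x \<bullet>\<^sub>t Lu x"
      by (rule arg_cong)
    then show "?l \<bullet>\<^sub>t (it \<boxtimes>\<^sub>t tid C x) = Lu x"
      by (simp add: cmp_assoc)
  qed
  ultimately show ?thesis
    unfolding action_def is_left_action_def Let_def using l by simp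
qed

section \<open>The category of left modules\<close>

abbreviation "LM \<equiv> left_modules C A"

definition "ac X = mk C (t \<otimes> fst X) (snd X) (fst X)"

lemma LM_sel [simp]:
  "idm LM X = idm C (fst X)" "comp LM = comp C" "zerom LM X Y = zerom C (fst X) (fst Y)" "addm LM = addm C" "scale LM = scale C"
  by (simp_all add: left_modules_def split_beta)

lemma ac_sel [simp]: "tdom (ac X) = t \<otimes> fst X" "tcod (ac X) = fst X"
  by (simp_all add: ac_def)

lemma LM_obj_action: "X \<in> obj LM \<longleftrightarrow> snd X \<in> hom C (t \<otimes> fst X) (fst X) \<and> action (fst X) (ac X)"
proof -
  have "X \<in> obj LM \<longleftrightarrow> fst X \<in> obj C \<and> snd X \<in> hom C (t \<otimes> fst X) (fst X) \<and> is_left_action C A (fst X) (snd X)"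
    by (auto simp: left_modules_def is_left_action_def Let_def)
  then show ?thesis
    using action_iff[of "fst X" "snd X"] unfolding ac_def by (auto simp: action_def)
qed

lemma LM_obj [simp]: "X \<in> obj LM \<Longrightarrow> fst X \<in> obj C" "X \<in> obj LM \<Longrightarrow> tAr C (ac X)"
  by (auto simp: LM_obj_action action_def)

lemma action_LM:
  assumes "action x l"
  shows "(x, mor l) \<in> obj LM" "ac (x, mor l) = l"
proof -
  have l: "tAr C l" "tdom l = t \<otimes> x" "tcod l = x"
    using assms by (auto simp: action_def)
  then show ac: "ac (x, mor l) = l"
    by (simp add: ac_def)
  show "(x, mor l) \<in> obj LM"
    unfolding LM_obj_action ac using assms l by simp
qed

lemma LM_hom_iff:
  assumes "X \<in> obj LM" "Y \<in> obj LM"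
  shows "f \<in> hom LM X Y \<longleftrightarrow> f \<in> hom C (fst X) (fst Y)
    \<and> mk C (fst X) f (fst Y) \<bullet>\<^sub>t ac X = ac Y \<bullet>\<^sub>t (tid C t \<boxtimes>\<^sub>t mk C (fst X) f (fst Y))"
proof (cases "f \<in> hom C (fst X) (fst Y)")
  case True
  let ?f = "mk C (fst X) f (fst Y)"
  have o: "fst X \<in> obj C" "fst Y \<in> obj C" "tAr C (ac X)" "tAr C (ac Y)"
    using assms by simp_all
  have m: "mor (ac X) = snd X" "mor (ac Y) = snd Y"
    using assms o unfolding ac_def LM_obj_action by simp_all
  have "?f \<bullet>\<^sub>t ac X = ac Y \<bullet>\<^sub>t (tid C t \<boxtimes>\<^sub>t ?f) \<longleftrightarrow> f \<cdot> snd X = snd Y \<cdot> (idm C t \<star> f)"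
    using mor_cmp_eq_iff[of ?f "ac X" "ac Y \<bullet>\<^sub>t (tid C t \<boxtimes>\<^sub>t ?f)"] True o by (simp add: m)
  then show ?thesis
    using True by (simp add: left_modules_def split_beta)
qed (simp add: left_modules_def split_beta)

lemma LM_hom_sub: "hom LM X Y \<subseteq> hom C (fst X) (fst Y)"
  by (auto simp: left_modules_def split_beta)

end

context linear_category
begin

lemma mk_add:
  "\<lbrakk>x \<in> obj C; y \<in> obj C; f \<in> hom C x y; g \<in> hom C x y\<rbrakk> \<Longrightarrow> mk C x (f \<oplus> g) y = tadd C (mk C x f y) (mk C x g y)"
  by (intro tarr_eqI[of C]) (simp_all add: add_in_hom mor_tadd)

lemma mk_scale:
  "\<lbrakk>x \<in> obj C; y \<in> obj C; f \<in> hom C x y\<rbrakk> \<Longrightarrow> mk C x (r \<odot> f) y = tscale C r (mk C x f y)"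
  by (intro tarr_eqI[of C]) (simp_all add: scale_in_hom mor_tscale)

end

context algebra_object
begin

lemma LM_hom_subspace:
  assumes "X \<in> obj LM" "Y \<in> obj LM"
  shows "hom_subspace (fst X) (fst Y) (hom LM X Y)"
proof -
  note [simp] = LM_obj[OF assms(1)] LM_obj[OF assms(2)] zero_in_hom add_in_hom scale_in_hom
  show ?thesis
    unfolding hom_subspace_def
  proof (intro conjI ballI allI)
    show "zerom C (fst X) (fst Y) \<in> hom LM X Y"
    proof -
      have "mk C (fst X) (zerom C (fst X) (fst Y)) (fst Y) = tzero C (fst X) (fst Y)"
        by (simp add: tzero_def)
      moreover have "tid C t \<boxtimes>\<^sub>t tzero C (fst X) (fst Y) = tzero C (t \<otimes> fst X) (t \<otimes> fst Y)"
        using T_sub[of "tzero C (fst X) (fst Y)" "tzero C (fst X) (fst Y)"] by simp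
      ultimately show ?thesis
        unfolding LM_hom_iff[OF assms] by simp
    qed
    show "f \<oplus> g \<in> hom LM X Y" if "f \<in> hom LM X Y" "g \<in> hom LM X Y" for f g
      using that unfolding LM_hom_iff[OF assms] by (simp add: mk_add ttns_tadd tadd_cmp cmp_tadd)
    show "r \<odot> f \<in> hom LM X Y" if "f \<in> hom LM X Y" for r f
      using that unfolding LM_hom_iff[OF assms] by (simp add: mk_scale ttns_tscale tscale_cmp cmp_tscale)
  qed (use LM_hom_sub in auto)
qed

text \<open>Composition and addition are those of \<open>C\<close>, so equational axioms are
  inherited; closure under addition and scaling is \<open>LM_hom_subspace\<close>, and finite
  dimension comes from \<open>subspace_spanning\<close>.\<close>

lemma LM_linear: "linear_category LM"
proof
  fix a b c d f g h and r s :: 'k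
  note sub = LM_hom_subspace[unfolded hom_subspace_def]
  note h = subsetD[OF LM_hom_sub]
  show "idm LM a \<in> hom LM a a" if "a \<in> obj LM"
  proof -
    have "mk C (fst a) (idm C (fst a)) (fst a) = tid C (fst a)"
      by (simp add: tid_def)
    then show ?thesis
      unfolding LM_hom_iff[OF that that] using LM_obj[OF that] by (simp add: id_in_hom)
  qed
  show "g \<cdot>\<^bsub>LM\<^esub> f \<in> hom LM a c" if o: "a \<in> obj LM" "b \<in> obj LM" "c \<in> obj LM" and "f \<in> hom LM a b" "g \<in> hom LM b c"
  proof -
    note [simp] = LM_obj[OF o(1)] LM_obj[OF o(2)] LM_obj[OF o(3)]
    let ?f = "mk C (fst a) f (fst b)" and ?g = "mk C (fst b) g (fst c)"
    have fg: "f \<in> hom C (fst a) (fst b)" "g \<in> hom C (fst b) (fst c)"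
      and e: "?f \<bullet>\<^sub>t ac a = ac b \<bullet>\<^sub>t (tid C t \<boxtimes>\<^sub>t ?f)" "?g \<bullet>\<^sub>t ac b = ac c \<bullet>\<^sub>t (tid C t \<boxtimes>\<^sub>t ?g)"
      using that unfolding LM_hom_iff[OF o(1,2)] LM_hom_iff[OF o(2,3)] by auto
    have "(?g \<bullet>\<^sub>t ?f) \<bullet>\<^sub>t ac a = ac c \<bullet>\<^sub>t (tid C t \<boxtimes>\<^sub>t (?g \<bullet>\<^sub>t ?f))"
      using fg e(1) cmp_cancel[OF e(2), of "tid C t \<boxtimes>\<^sub>t ?f"] by (simp add: T_cmp cmp_assoc)
    moreover have "mk C (fst a) (g \<cdot> f) (fst c) = ?g \<bullet>\<^sub>t ?f"
      using fg comp_in_hom[of "fst a" "fst b" "fst c" f g] by (intro tarr_eqI[of C]) simp_all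
    ultimately show ?thesis
      unfolding LM_hom_iff[OF o(1,3)] using fg comp_in_hom[of "fst a" "fst b" "fst c" f g] by simp
  qed
  show "f \<cdot>\<^bsub>LM\<^esub> idm LM a = f" if "a \<in> obj LM" "b \<in> obj LM" "f \<in> hom LM a b"
    by (simp only: LM_sel) (rule comp_id[OF LM_obj(1)[OF that(1)] LM_obj(1)[OF that(2)] h[OF that(3)]])
  show "idm LM b \<cdot>\<^bsub>LM\<^esub> f = f" if "a \<in> obj LM" "b \<in> obj LM" "f \<in> hom LM a b"
    by (simp only: LM_sel) (rule id_comp[OF LM_obj(1)[OF that(1)] LM_obj(1)[OF that(2)] h[OF that(3)]])
  show "(h \<cdot>\<^bsub>LM\<^esub> g) \<cdot>\<^bsub>LM\<^esub> f = h \<cdot>\<^bsub>LM\<^esub> g \<cdot>\<^bsub>LM\<^esub> f"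
    if "a \<in> obj LM" "b \<in> obj LM" "c \<in> obj LM" "d \<in> obj LM" "f \<in> hom LM a b" "g \<in> hom LM b c" "h \<in> hom LM c d"
    by (simp only: LM_sel) (rule comp_assoc[OF LM_obj(1)[OF that(1)] LM_obj(1)[OF that(2)] LM_obj(1)[OF that(3)] LM_obj(1)[OF that(4)] h[OF that(5)] h[OF that(6)] h[OF that(7)]])
  show "zerom LM a b \<in> hom LM a b" if "a \<in> obj LM" "b \<in> obj LM"
    using sub[OF that] by simp
  show "f \<oplus>\<^bsub>LM\<^esub> g \<in> hom LM a b" if "a \<in> obj LM" "b \<in> obj LM" "f \<in> hom LM a b" "g \<in> hom LM a b"
    using sub[OF that(1,2)] that by simp
  show "r \<odot>\<^bsub>LM\<^esub> f \<in> hom LM a b" if "a \<in> obj LM" "b \<in> obj LM" "f \<in> hom LM a b"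
    using sub[OF that(1,2)] that by simp
  show "f \<oplus>\<^bsub>LM\<^esub> g \<oplus>\<^bsub>LM\<^esub> h = f \<oplus>\<^bsub>LM\<^esub> (g \<oplus>\<^bsub>LM\<^esub> h)"
    if "a \<in> obj LM" "b \<in> obj LM" "f \<in> hom LM a b" "g \<in> hom LM a b" "h \<in> hom LM a b"
    by (simp only: LM_sel) (rule add_assoc[OF LM_obj(1)[OF that(1)] LM_obj(1)[OF that(2)] h[OF that(3)] h[OF that(4)] h[OF that(5)]])
  show "f \<oplus>\<^bsub>LM\<^esub> g = g \<oplus>\<^bsub>LM\<^esub> f" if "a \<in> obj LM" "b \<in> obj LM" "f \<in> hom LM a b" "g \<in> hom LM a b"
    by (simp only: LM_sel) (rule add_commute[OF LM_obj(1)[OF that(1)] LM_obj(1)[OF that(2)] h[OF that(3)] h[OF that(4)]])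
  show "f \<oplus>\<^bsub>LM\<^esub> zerom LM a b = f" if "a \<in> obj LM" "b \<in> obj LM" "f \<in> hom LM a b"
    by (simp only: LM_sel) (rule add_zero[OF LM_obj(1)[OF that(1)] LM_obj(1)[OF that(2)] h[OF that(3)]])
  show "\<exists>g\<in>hom LM a b. f \<oplus>\<^bsub>LM\<^esub> g = zerom LM a b" if "a \<in> obj LM" "b \<in> obj LM" "f \<in> hom LM a b"
  proof (intro bexI[of _ "(- 1) \<odot> f"])
    have "1 \<odot> f \<oplus> (- 1) \<odot> f = zerom C (fst a) (fst b)"
      using that scale_add_left[OF _ _ h, of a b f 1 "- 1"] scale_zero_left[OF _ _ h, of a b f] by simp
    then show "f \<oplus>\<^bsub>LM\<^esub> (- 1) \<odot> f = zerom LM a b"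
      by (simp add: scale_one[OF LM_obj(1)[OF that(1)] LM_obj(1)[OF that(2)] h[OF that(3)]])
    show "(- 1) \<odot> f \<in> hom LM a b"
      using sub[OF that(1,2)] that by blast
  qed
  show "1 \<odot>\<^bsub>LM\<^esub> f = f" if "a \<in> obj LM" "b \<in> obj LM" "f \<in> hom LM a b"
    by (simp only: LM_sel) (rule scale_one[OF LM_obj(1)[OF that(1)] LM_obj(1)[OF that(2)] h[OF that(3)]])
  show "r \<odot>\<^bsub>LM\<^esub> s \<odot>\<^bsub>LM\<^esub> f = (r * s) \<odot>\<^bsub>LM\<^esub> f" if "a \<in> obj LM" "b \<in> obj LM" "f \<in> hom LM a b"
    by (simp only: LM_sel) (rule scale_scale[OF LM_obj(1)[OF that(1)] LM_obj(1)[OF that(2)] h[OF that(3)]])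
  show "(r + s) \<odot>\<^bsub>LM\<^esub> f = r \<odot>\<^bsub>LM\<^esub> f \<oplus>\<^bsub>LM\<^esub> s \<odot>\<^bsub>LM\<^esub> f" if "a \<in> obj LM" "b \<in> obj LM" "f \<in> hom LM a b"
    by (simp only: LM_sel) (rule scale_add_left[OF LM_obj(1)[OF that(1)] LM_obj(1)[OF that(2)] h[OF that(3)]])
  show "r \<odot>\<^bsub>LM\<^esub> (f \<oplus>\<^bsub>LM\<^esub> g) = r \<odot>\<^bsub>LM\<^esub> f \<oplus>\<^bsub>LM\<^esub> r \<odot>\<^bsub>LM\<^esub> g"
    if "a \<in> obj LM" "b \<in> obj LM" "f \<in> hom LM a b" "g \<in> hom LM a b"
    by (simp only: LM_sel) (rule scale_add_right[OF LM_obj(1)[OF that(1)] LM_obj(1)[OF that(2)] h[OF that(3)] h[OF that(4)]])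
  show "(g \<oplus>\<^bsub>LM\<^esub> h) \<cdot>\<^bsub>LM\<^esub> f = (g \<cdot>\<^bsub>LM\<^esub> f) \<oplus>\<^bsub>LM\<^esub> (h \<cdot>\<^bsub>LM\<^esub> f)"
    if "a \<in> obj LM" "b \<in> obj LM" "c \<in> obj LM" "f \<in> hom LM a b" "g \<in> hom LM b c" "h \<in> hom LM b c"
    by (simp only: LM_sel) (rule comp_add_left[OF LM_obj(1)[OF that(1)] LM_obj(1)[OF that(2)] LM_obj(1)[OF that(3)] h[OF that(4)] h[OF that(5)] h[OF that(6)]])
  show "h \<cdot>\<^bsub>LM\<^esub> (f \<oplus>\<^bsub>LM\<^esub> g) = (h \<cdot>\<^bsub>LM\<^esub> f) \<oplus>\<^bsub>LM\<^esub> (h \<cdot>\<^bsub>LM\<^esub> g)"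
    if "a \<in> obj LM" "b \<in> obj LM" "c \<in> obj LM" "f \<in> hom LM a b" "g \<in> hom LM a b" "h \<in> hom LM b c"
    by (simp only: LM_sel) (rule comp_add_right[OF LM_obj(1)[OF that(1)] LM_obj(1)[OF that(2)] LM_obj(1)[OF that(3)] h[OF that(4)] h[OF that(5)] h[OF that(6)]])
  show "(r \<odot>\<^bsub>LM\<^esub> g) \<cdot>\<^bsub>LM\<^esub> f = r \<odot>\<^bsub>LM\<^esub> (g \<cdot>\<^bsub>LM\<^esub> f)"
    if "a \<in> obj LM" "b \<in> obj LM" "c \<in> obj LM" "f \<in> hom LM a b" "g \<in> hom LM b c"
    by (simp only: LM_sel) (rule comp_scale_left[OF LM_obj(1)[OF that(1)] LM_obj(1)[OF that(2)] LM_obj(1)[OF that(3)] h[OF that(4)] h[OF that(5)]])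
  show "g \<cdot>\<^bsub>LM\<^esub> (r \<odot>\<^bsub>LM\<^esub> f) = r \<odot>\<^bsub>LM\<^esub> (g \<cdot>\<^bsub>LM\<^esub> f)"
    if "a \<in> obj LM" "b \<in> obj LM" "c \<in> obj LM" "f \<in> hom LM a b" "g \<in> hom LM b c"
    by (simp only: LM_sel) (rule comp_scale_right[OF LM_obj(1)[OF that(1)] LM_obj(1)[OF that(2)] LM_obj(1)[OF that(3)] h[OF that(4)] h[OF that(5)]])
  show "\<exists>fs. set fs \<subseteq> hom LM a b \<and> (\<forall>f\<in>hom LM a b. \<exists>rs. length rs = length fs \<and> f = lsum LM a b (map2 (scale LM) rs fs))"
    if o: "a \<in> obj LM" "b \<in> obj LM"
  proof -
    obtain Fs where Fs: "set Fs \<subseteq> hom C (fst a) (fst b)" "hom C (fst a) (fst b) \<subseteq> span_of (fst a) (fst b) Fs"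
      using finite_dimensional_span[of "fst a" "fst b"] o by auto
    then have "hom LM a b \<subseteq> span_of (fst a) (fst b) Fs"
      using LM_hom_sub by blast
    then obtain Gs where "set Gs \<subseteq> hom LM a b" "hom LM a b \<subseteq> span_of (fst a) (fst b) Gs"
      using subspace_spanning[OF _ _ Fs(1) LM_hom_subspace[OF o]] o by auto
    then show ?thesis
      unfolding span_of_def lsum_def by (intro exI[of _ Gs]) auto
  qed
qed

sublocale L: linear_category LM
  by (rule LM_linear)

text \<open>Forgets the actions. Equations in \<open>LM\<close> are checked on underlying arrows by
  \<open>underlying_eqI\<close>, and \<open>underlying_mk\<close> lifts arrows that commute with the
  actions.\<close>

definition "underlying F = mk C (fst (tdom F)) (mor F) (fst (tcod F))"

lemma underlying_sel [simp]: "tdom (underlying F) = fst (tdom F)" "tcod (underlying F) = fst (tcod F)"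
  by (simp_all add: underlying_def)

lemma underlying:
  assumes "tAr LM F"
  shows "tAr C (underlying F)" "mor (underlying F) = mor F" "underlying F \<bullet>\<^sub>t ac (tdom F) = ac (tcod F) \<bullet>\<^sub>t (tid C t \<boxtimes>\<^sub>t underlying F)"
proof -
  have o: "tdom F \<in> obj LM" "tcod F \<in> obj LM" and h: "mor F \<in> hom LM (tdom F) (tcod F)"
    using assms tAr_sel by metis+
  show "tAr C (underlying F)" "mor (underlying F) = mor F" "underlying F \<bullet>\<^sub>t ac (tdom F) = ac (tcod F) \<bullet>\<^sub>t (tid C t \<boxtimes>\<^sub>t underlying F)"
    using h o unfolding LM_hom_iff[OF o] underlying_def by simp_all
qed

lemma underlying_eqI: "\<lbrakk>underlying F = underlying G; tAr LM F; tAr LM G; tdom F = tdom G; tcod F = tcod G\<rbrakk> \<Longrightarrow> F = G"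
  by (rule tarr_eqI[of LM]) (use underlying(2) in metis)+

lemma underlying_cmp: "\<lbrakk>tAr LM F; tAr LM G; tdom G = tcod F\<rbrakk> \<Longrightarrow> underlying (tcmp LM G F) = underlying G \<bullet>\<^sub>t underlying F"
  using underlying(1,2)[of F] underlying(1,2)[of G] underlying(1)[of "tcmp LM G F"] underlying(2)[of "tcmp LM G F"]
  by (intro tarr_eqI[of C]) simp_all

lemma underlying_id: "X \<in> obj LM \<Longrightarrow> underlying (tid LM X) = tid C (fst X)"
  using underlying(1,2)[of "tid LM X"] by (intro tarr_eqI[of C]) simp_all

lemma underlying_zero: "\<lbrakk>X \<in> obj LM; Y \<in> obj LM\<rbrakk> \<Longrightarrow> underlying (tzero LM X Y) = tzero C (fst X) (fst Y)"
  using underlying(1,2)[of "tzero LM X Y"] by (intro tarr_eqI[of C]) (simp_all add: mor_tzero L.mor_tzero)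

lemma underlying_add:
  "\<lbrakk>tAr LM F; tAr LM G; tdom F = tdom G; tcod F = tcod G\<rbrakk> \<Longrightarrow> underlying (tadd LM F G) = tadd C (underlying F) (underlying G)"
  using underlying(1,2)[of F] underlying(1,2)[of G] underlying(1,2)[of "tadd LM F G"]
  by (intro tarr_eqI[of C]) (simp_all add: mor_tadd L.mor_tadd)

lemma underlying_mk:
  assumes o: "X \<in> obj LM" "Y \<in> obj LM" and G: "tAr C G" "tdom G = fst X" "tcod G = fst Y"
    and e: "G \<bullet>\<^sub>t ac X = ac Y \<bullet>\<^sub>t (tid C t \<boxtimes>\<^sub>t G)"
  shows "tAr LM (mk LM X (mor G) Y)" "underlying (mk LM X (mor G) Y) = G"
proof -
  have "mk C (fst X) (mor G) (fst Y) = G"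
    using G by simp
  then have "mor G \<in> hom LM X Y"
    unfolding LM_hom_iff[OF o] using G e by simp
  then show "tAr LM (mk LM X (mor G) Y)" "underlying (mk LM X (mor G) Y) = G"
    using o G by (simp_all add: underlying_def)
qed

text \<open>When the idempotent \<open>I \<bullet>\<^sub>t P\<close> commutes with the action on
  \<open>x\<close>, compressing this action along \<open>P\<close> and \<open>I\<close> makes both
  of them module maps, and the axioms for \<open>k\<close> follow because \<open>I\<close> is a
  split monomorphism.\<close>

lemma retract_action:
  assumes l: "action x l" and I: "tAr C I" "tdom I = y" "tcod I = x" and P: "tAr C P" "tdom P = x" "tcod P = y"
    and PI: "P \<bullet>\<^sub>t I = tid C y" and e: "(I \<bullet>\<^sub>t P) \<bullet>\<^sub>t l = l \<bullet>\<^sub>t (tid C t \<boxtimes>\<^sub>t (I \<bullet>\<^sub>t P))"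
  defines "k \<equiv> P \<bullet>\<^sub>t l \<bullet>\<^sub>t (tid C t \<boxtimes>\<^sub>t I)"
  shows "action y k" "I \<bullet>\<^sub>t k = l \<bullet>\<^sub>t (tid C t \<boxtimes>\<^sub>t I)" "P \<bullet>\<^sub>t l = k \<bullet>\<^sub>t (tid C t \<boxtimes>\<^sub>t P)"
proof -
  let ?T = "\<lambda>F. tid C t \<boxtimes>\<^sub>t F" and ?mu = "\<lambda>x. (mt \<boxtimes>\<^sub>t tid C x) \<bullet>\<^sub>t Ai t t x" and ?et = "\<lambda>x. (it \<boxtimes>\<^sub>t tid C x) \<bullet>\<^sub>t Li x"
  have [simp]: "x \<in> obj C" "y \<in> obj C"
    using I tAr_sel by metis+
  note [simp] = I P
  have l' [simp]: "tAr C l" "tdom l = t \<otimes> x" "tcod l = x" and lm: "l \<bullet>\<^sub>t ?mu x = l \<bullet>\<^sub>t ?T l" and le: "l \<bullet>\<^sub>t ?et x = tid C x"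
    using l by (auto simp: action_def)
  have e': "I \<bullet>\<^sub>t P \<bullet>\<^sub>t l = l \<bullet>\<^sub>t ?T I \<bullet>\<^sub>t ?T P"
    using e by (simp add: T_cmp cmp_assoc)
  have TPI: "?T P \<bullet>\<^sub>t ?T I = tid C (t \<otimes> y)"
    using T_cmp[of I P] by (simp add: PI)
  show Ik: "I \<bullet>\<^sub>t k = l \<bullet>\<^sub>t ?T I"
  proof -
    have "I \<bullet>\<^sub>t k = (I \<bullet>\<^sub>t P \<bullet>\<^sub>t l) \<bullet>\<^sub>t ?T I"
      unfolding k_def by (simp only: cmp_assoc)
    also have "\<dots> = l \<bullet>\<^sub>t ?T I \<bullet>\<^sub>t ?T P \<bullet>\<^sub>t ?T I"
      unfolding e' by (simp only: cmp_assoc)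
    also have "\<dots> = l \<bullet>\<^sub>t ?T I"
      unfolding TPI by simp
    finally show ?thesis .
  qed
  show "P \<bullet>\<^sub>t l = k \<bullet>\<^sub>t ?T P"
  proof -
    have "k \<bullet>\<^sub>t ?T P = P \<bullet>\<^sub>t I \<bullet>\<^sub>t P \<bullet>\<^sub>t l"
      unfolding k_def e' by (simp only: cmp_assoc)
    then show ?thesis
      using cmp_cancel[OF PI, of "P \<bullet>\<^sub>t l"] by simp
  qed
  have k [simp]: "tAr C k" "tdom k = t \<otimes> y" "tcod k = y"
    by (simp_all add: k_def)
  have "k \<bullet>\<^sub>t ?mu y = k \<bullet>\<^sub>t ?T k"
  proof (rule iso_mono[OF PI])
    have "I \<bullet>\<^sub>t k \<bullet>\<^sub>t ?mu y = l \<bullet>\<^sub>t ?T I \<bullet>\<^sub>t ?mu y"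
      by (rule trans[OF cmp_cancel[OF Ik] cmp_assoc])
    also have "?T I \<bullet>\<^sub>t ?mu y = ?mu x \<bullet>\<^sub>t ?T (?T I)"
      using mu_natural[of I] by simp
    also have "l \<bullet>\<^sub>t ?mu x \<bullet>\<^sub>t ?T (?T I) = l \<bullet>\<^sub>t ?T l \<bullet>\<^sub>t ?T (?T I)"
      by (rule trans[OF cmp_cancel[OF lm] cmp_assoc])
    also have "\<dots> = l \<bullet>\<^sub>t ?T (I \<bullet>\<^sub>t k)"
      unfolding Ik by (subst T_cmp) simp_all
    also have "\<dots> = I \<bullet>\<^sub>t k \<bullet>\<^sub>t ?T k"
      using cmp_cancel[OF Ik, of "?T k"] by (simp add: T_cmp cmp_assoc)
    finally show "I \<bullet>\<^sub>t k \<bullet>\<^sub>t ?mu y = I \<bullet>\<^sub>t k \<bullet>\<^sub>t ?T k" .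
  qed simp_all
  moreover have "k \<bullet>\<^sub>t ?et y = tid C y"
  proof (rule iso_mono[OF PI])
    have "I \<bullet>\<^sub>t k \<bullet>\<^sub>t ?et y = l \<bullet>\<^sub>t ?T I \<bullet>\<^sub>t ?et y"
      by (rule trans[OF cmp_cancel[OF Ik] cmp_assoc])
    also have "?T I \<bullet>\<^sub>t ?et y = ?et x \<bullet>\<^sub>t I"
      using et_natural[of I] by simp
    also have "l \<bullet>\<^sub>t ?et x \<bullet>\<^sub>t I = I"
      using cmp_cancel[OF le, of I] by simp
    finally show "I \<bullet>\<^sub>t k \<bullet>\<^sub>t ?et y = I \<bullet>\<^sub>t tid C y"
      by simp
  qed simp_all
  ultimately show "action y k"
    unfolding action_def by simp
qed

text \<open>Split the underlying idempotent in \<open>C\<close> and give the retract the compressed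
  action.\<close>

lemma LM_idempotents_split:
  assumes idempotents_split
  shows "L.idempotents_split"
  unfolding L.idempotents_split_def
proof (intro allI impI)
  fix E assume E: "tAr LM E \<and> tdom E = tcod E \<and> tcmp LM E E = E"
  let ?X = "tdom E"
  have EA: "tAr LM E" and cE: "tcod E = ?X" and EE: "tcmp LM E E = E"
    using E by auto
  have X: "?X \<in> obj LM"
    using EA tAr_sel by metis
  have "underlying E \<bullet>\<^sub>t underlying E = underlying E"
    using underlying_cmp[OF EA EA] cE EE by simp
  then obtain y I P where s: "splits (fst ?X) (underlying E) y I P"
    using assms underlying(1)[OF EA] cE unfolding idempotents_split_def by (metis underlying_sel)
  have y [simp]: "y \<in> obj C" and I: "tAr C I" "tdom I = y" "tcod I = fst ?X" and P: "tAr C P" "tdom P = fst ?X" "tcod P = y"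
    and PI: "P \<bullet>\<^sub>t I = tid C y" and IP: "I \<bullet>\<^sub>t P = underlying E"
    using s by (auto simp: splits_def)
  have e: "(I \<bullet>\<^sub>t P) \<bullet>\<^sub>t ac ?X = ac ?X \<bullet>\<^sub>t (tid C t \<boxtimes>\<^sub>t (I \<bullet>\<^sub>t P))"
    using underlying(3)[OF EA] unfolding IP cE .
  have aX: "action (fst ?X) (ac ?X)"
    using X by (simp add: LM_obj_action)
  note r = retract_action[OF aX I P PI e]
  let ?k = "P \<bullet>\<^sub>t ac ?X \<bullet>\<^sub>t (tid C t \<boxtimes>\<^sub>t I)"
  let ?Y = "(y, mor ?k)"
  have Y: "?Y \<in> obj LM" "ac ?Y = ?k"
    by (rule action_LM[OF r(1)])+
  let ?I = "mk LM ?Y (mor I) ?X" and ?P = "mk LM ?X (mor P) ?Y"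
  have uI: "tAr LM ?I" "underlying ?I = I"
    by (rule underlying_mk[OF Y(1) X I(1)]; use I r(2) Y(2) in simp)+
  have uP: "tAr LM ?P" "underlying ?P = P"
    by (rule underlying_mk[OF X Y(1) P(1)]; use P r(3) Y(2) in simp)+
  have PI': "tcmp LM ?P ?I = tid LM ?Y"
    by (rule underlying_eqI) (use uI uP Y PI in \<open>simp_all add: underlying_cmp underlying_id\<close>)
  have IP': "tcmp LM ?I ?P = E"
    by (rule underlying_eqI) (use uI uP Y IP EA cE in \<open>simp_all add: underlying_cmp\<close>)
  have "L.splits ?X E ?Y ?I ?P"
    unfolding L.splits_def using uI(1) uP(1) Y(1) PI' IP' by (intro conjI mk_sel) assumption+
  then show "\<exists>Y I P. L.splits ?X E Y I P"
    by blast
qed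

text \<open>The direct sum in \<open>C\<close> with the diagonal action \<open>w\<close>. Its axioms
  are checked after composition with the two projections, which are jointly monic
  (\<open>joint\<close>).\<close>

lemma LM_biproduct:
  assumes bip: "\<And>x y. \<lbrakk>x \<in> obj C; y \<in> obj C\<rbrakk> \<Longrightarrow> \<exists>u I P. dsum u [x, y] I P" and X: "X \<in> obj LM" and Y: "Y \<in> obj LM"
  shows "\<exists>U I P. L.dsum U [X, Y] I P"
proof -
  let ?T = "\<lambda>F. tid C t \<boxtimes>\<^sub>t F" and ?mu = "\<lambda>x. (mt \<boxtimes>\<^sub>t tid C x) \<bullet>\<^sub>t Ai t t x" and ?et = "\<lambda>x. (it \<boxtimes>\<^sub>t tid C x) \<bullet>\<^sub>t Li x"
  obtain u I' P' where "dsum u [fst X, fst Y] I' P'"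
    using bip X Y by (metis LM_obj(1))
  note d = dsum_pairE[OF this]
  define I where "I = I' 0"
  define J where "J = I' 1"
  define P where "P = P' 0"
  define Q where "Q = P' 1"
  note d = d[folded I_def J_def P_def Q_def]
  note [simp] = d(1-16) LM_obj[OF X] LM_obj[OF Y]
  have u [simp]: "u \<in> obj C"
    using d(1,5) tAr_sel by metis
  let ?l = "ac X" and ?k = "ac Y"
  have l: "?l \<bullet>\<^sub>t ?mu (fst X) = ?l \<bullet>\<^sub>t ?T ?l" "?l \<bullet>\<^sub>t ?et (fst X) = tid C (fst X)"
    and k: "?k \<bullet>\<^sub>t ?mu (fst Y) = ?k \<bullet>\<^sub>t ?T ?k" "?k \<bullet>\<^sub>t ?et (fst Y) = tid C (fst Y)"
    using X Y by (simp_all add: LM_obj_action action_def)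
  let ?p = "I \<bullet>\<^sub>t ?l \<bullet>\<^sub>t ?T P" and ?q = "J \<bullet>\<^sub>t ?k \<bullet>\<^sub>t ?T Q"
  define w where "w = tadd C ?p ?q"
  have w [simp]: "tAr C w" "tdom w = t \<otimes> u" "tcod w = u"
    by (simp_all add: w_def)
  have T0: "?T (tzero C a b) = tzero C (t \<otimes> a) (t \<otimes> b)" if "a \<in> obj C" "b \<in> obj C" for a b
    using T_sub[of "tzero C a b" "tzero C a b"] that by simp
  have Pw: "P \<bullet>\<^sub>t w = ?l \<bullet>\<^sub>t ?T P"
  proof -
    have "P \<bullet>\<^sub>t w = tadd C (P \<bullet>\<^sub>t ?p) (P \<bullet>\<^sub>t ?q)"
      unfolding w_def by (rule cmp_tadd) simp_all
    moreover have "P \<bullet>\<^sub>t ?p = ?l \<bullet>\<^sub>t ?T P"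
      using cmp_cancel[OF d(13), of "?l \<bullet>\<^sub>t ?T P"] by simp
    moreover have "P \<bullet>\<^sub>t ?q = tzero C (t \<otimes> u) (fst X)"
      using cmp_cancel[OF d(15), of "?k \<bullet>\<^sub>t ?T Q"] by simp
    ultimately show ?thesis
      by simp
  qed
  have Qw: "Q \<bullet>\<^sub>t w = ?k \<bullet>\<^sub>t ?T Q"
  proof -
    have "Q \<bullet>\<^sub>t w = tadd C (Q \<bullet>\<^sub>t ?p) (Q \<bullet>\<^sub>t ?q)"
      unfolding w_def by (rule cmp_tadd) simp_all
    moreover have "Q \<bullet>\<^sub>t ?q = ?k \<bullet>\<^sub>t ?T Q"
      using cmp_cancel[OF d(14), of "?k \<bullet>\<^sub>t ?T Q"] by simp
    moreover have "Q \<bullet>\<^sub>t ?p = tzero C (t \<otimes> u) (fst Y)"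
      using cmp_cancel[OF d(16), of "?l \<bullet>\<^sub>t ?T P"] by simp
    ultimately show ?thesis
      by simp
  qed
  have joint: "F = G" if "P \<bullet>\<^sub>t F = P \<bullet>\<^sub>t G" "Q \<bullet>\<^sub>t F = Q \<bullet>\<^sub>t G" "tAr C F" "tAr C G" "tcod F = u" "tcod G = u" "tdom F = tdom G" for F G
  proof -
    have "F = tadd C (I \<bullet>\<^sub>t P) (J \<bullet>\<^sub>t Q) \<bullet>\<^sub>t F" "G = tadd C (I \<bullet>\<^sub>t P) (J \<bullet>\<^sub>t Q) \<bullet>\<^sub>t G"
      unfolding d(17) using that by simp_all
    moreover have "tadd C (I \<bullet>\<^sub>t P) (J \<bullet>\<^sub>t Q) \<bullet>\<^sub>t F = tadd C (I \<bullet>\<^sub>t P) (J \<bullet>\<^sub>t Q) \<bullet>\<^sub>t G"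
      using that by (simp add: tadd_cmp cmp_assoc)
    ultimately show ?thesis
      by metis
  qed
  have wm: "w \<bullet>\<^sub>t ?mu u = w \<bullet>\<^sub>t ?T w"
  proof (rule joint)
    have "P \<bullet>\<^sub>t w \<bullet>\<^sub>t ?mu u = ?l \<bullet>\<^sub>t ?T P \<bullet>\<^sub>t ?mu u"
      by (rule trans[OF cmp_cancel[OF Pw] cmp_assoc])
    also have "?T P \<bullet>\<^sub>t ?mu u = ?mu (fst X) \<bullet>\<^sub>t ?T (?T P)"
      using mu_natural[of P] by simp
    also have "?l \<bullet>\<^sub>t ?mu (fst X) \<bullet>\<^sub>t ?T (?T P) = ?l \<bullet>\<^sub>t ?T ?l \<bullet>\<^sub>t ?T (?T P)"
      by (rule trans[OF cmp_cancel[OF l(1)] cmp_assoc])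
    also have "\<dots> = ?l \<bullet>\<^sub>t ?T (P \<bullet>\<^sub>t w)"
      unfolding Pw by (subst T_cmp) simp_all
    also have "\<dots> = P \<bullet>\<^sub>t w \<bullet>\<^sub>t ?T w"
      using cmp_cancel[OF Pw, of "?T w"] by (simp add: T_cmp cmp_assoc)
    finally show "P \<bullet>\<^sub>t w \<bullet>\<^sub>t ?mu u = P \<bullet>\<^sub>t w \<bullet>\<^sub>t ?T w" .
    have "Q \<bullet>\<^sub>t w \<bullet>\<^sub>t ?mu u = ?k \<bullet>\<^sub>t ?T Q \<bullet>\<^sub>t ?mu u"
      by (rule trans[OF cmp_cancel[OF Qw] cmp_assoc])
    also have "?T Q \<bullet>\<^sub>t ?mu u = ?mu (fst Y) \<bullet>\<^sub>t ?T (?T Q)"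
      using mu_natural[of Q] by simp
    also have "?k \<bullet>\<^sub>t ?mu (fst Y) \<bullet>\<^sub>t ?T (?T Q) = ?k \<bullet>\<^sub>t ?T ?k \<bullet>\<^sub>t ?T (?T Q)"
      by (rule trans[OF cmp_cancel[OF k(1)] cmp_assoc])
    also have "\<dots> = ?k \<bullet>\<^sub>t ?T (Q \<bullet>\<^sub>t w)"
      unfolding Qw by (subst T_cmp) simp_all
    also have "\<dots> = Q \<bullet>\<^sub>t w \<bullet>\<^sub>t ?T w"
      using cmp_cancel[OF Qw, of "?T w"] by (simp add: T_cmp cmp_assoc)
    finally show "Q \<bullet>\<^sub>t w \<bullet>\<^sub>t ?mu u = Q \<bullet>\<^sub>t w \<bullet>\<^sub>t ?T w" .
  qed simp_all
  have we: "w \<bullet>\<^sub>t ?et u = tid C u"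
  proof (rule joint)
    have "P \<bullet>\<^sub>t w \<bullet>\<^sub>t ?et u = ?l \<bullet>\<^sub>t ?T P \<bullet>\<^sub>t ?et u"
      by (rule trans[OF cmp_cancel[OF Pw] cmp_assoc])
    also have "?T P \<bullet>\<^sub>t ?et u = ?et (fst X) \<bullet>\<^sub>t P"
      using et_natural[of P] by simp
    finally show "P \<bullet>\<^sub>t w \<bullet>\<^sub>t ?et u = P \<bullet>\<^sub>t tid C u"
      using cmp_cancel[OF l(2), of P] by simp
    have "Q \<bullet>\<^sub>t w \<bullet>\<^sub>t ?et u = ?k \<bullet>\<^sub>t ?T Q \<bullet>\<^sub>t ?et u"
      by (rule trans[OF cmp_cancel[OF Qw] cmp_assoc])
    also have "?T Q \<bullet>\<^sub>t ?et u = ?et (fst Y) \<bullet>\<^sub>t Q"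
      using et_natural[of Q] by simp
    finally show "Q \<bullet>\<^sub>t w \<bullet>\<^sub>t ?et u = Q \<bullet>\<^sub>t tid C u"
      using cmp_cancel[OF k(2), of Q] by simp
  qed simp_all
  have "action u w"
    unfolding action_def using wm we by simp
  let ?U = "(u, mor w)"
  have U: "?U \<in> obj LM" "ac ?U = w"
    by (rule action_LM[OF \<open>action u w\<close>])+
  have wI: "I \<bullet>\<^sub>t ?l = w \<bullet>\<^sub>t ?T I"
  proof -
    have "w \<bullet>\<^sub>t ?T I = tadd C (?p \<bullet>\<^sub>t ?T I) (?q \<bullet>\<^sub>t ?T I)"
      unfolding w_def by (rule tadd_cmp) simp_all
    moreover have "?T P \<bullet>\<^sub>t ?T I = tid C (t \<otimes> fst X)" "?T Q \<bullet>\<^sub>t ?T I = tzero C (t \<otimes> fst X) (t \<otimes> fst Y)"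
      using T_cmp[of I P] T_cmp[of I Q] by (simp_all add: T0)
    ultimately show ?thesis
      by (simp add: cmp_assoc)
  qed
  have wJ: "J \<bullet>\<^sub>t ?k = w \<bullet>\<^sub>t ?T J"
  proof -
    have "w \<bullet>\<^sub>t ?T J = tadd C (?p \<bullet>\<^sub>t ?T J) (?q \<bullet>\<^sub>t ?T J)"
      unfolding w_def by (rule tadd_cmp) simp_all
    moreover have "?T Q \<bullet>\<^sub>t ?T J = tid C (t \<otimes> fst Y)" "?T P \<bullet>\<^sub>t ?T J = tzero C (t \<otimes> fst Y) (t \<otimes> fst X)"
      using T_cmp[of J P] T_cmp[of J Q] by (simp_all add: T0)
    ultimately show ?thesis
      by (simp add: cmp_assoc)
  qed
  let ?I = "mk LM X (mor I) ?U" and ?J = "mk LM Y (mor J) ?U" and ?P = "mk LM ?U (mor P) X" and ?Q = "mk LM ?U (mor Q) Y"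
  have uI: "tAr LM ?I" "underlying ?I = I"
    by (rule underlying_mk[OF X U(1) d(1)]; use wI U(2) in simp)+
  have uJ: "tAr LM ?J" "underlying ?J = J"
    by (rule underlying_mk[OF Y U(1) d(2)]; use wJ U(2) in simp)+
  have uP: "tAr LM ?P" "underlying ?P = P"
    by (rule underlying_mk[OF U(1) X d(3)]; use Pw U(2) in simp)+
  have uQ: "tAr LM ?Q" "underlying ?Q = Q"
    by (rule underlying_mk[OF U(1) Y d(4)]; use Qw U(2) in simp)+
  have "L.dsum ?U [X, Y] (\<lambda>j. if j = 0 then ?I else ?J) (\<lambda>j. if j = 0 then ?P else ?Q)"
  proof (rule L.dsum_pairI)
    show "tcmp LM ?P ?I = tid LM X" "tcmp LM ?Q ?J = tid LM Y" "tcmp LM ?P ?J = tzero LM Y X" "tcmp LM ?Q ?I = tzero LM X Y"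
      by (rule underlying_eqI; use uI uJ uP uQ X Y U in \<open>simp add: underlying_cmp underlying_id underlying_zero\<close>)+
    show "tadd LM (tcmp LM ?I ?P) (tcmp LM ?J ?Q) = tid LM ?U"
      by (rule underlying_eqI; use uI uJ uP uQ X Y U d(17) in \<open>simp add: underlying_cmp underlying_id underlying_add\<close>)
  qed (rule uI(1) uJ(1) uP(1) uQ(1) mk_sel)+
  then show ?thesis
    by blast
qed

text \<open>Any two arrows with the same source and with target \<open>z\<close> agree, so the zero
  arrow satisfies the axioms of an action.\<close>

lemma LM_zero:
  assumes "z \<in> obj C" "tid C z = tzero C z z"
  shows "\<exists>Z\<in>obj LM. idm LM Z = zerom LM Z Z"
proof -
  note [simp] = assms(1)
  have z: "F = tzero C (tdom F) z" if "tAr C F" "tcod F = z" for F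
    using that assms(2) tzero_cmp[of F z z] by (metis Id_cmp assms(1))
  have eq: "F = G" if "tAr C F" "tcod F = z" "tAr C G" "tcod G = z" "tdom F = tdom G" for F G
    using z[of F] z[of G] that by metis
  have "action z (tzero C (t \<otimes> z) z)"
    unfolding action_def by (intro conjI; (intro eq)?; simp)
  then have Z: "(z, mor (tzero C (t \<otimes> z) z)) \<in> obj LM"
    by (rule action_LM)
  have "mor (tid C z) = mor (tzero C z z)"
    using assms(2) by simp
  then show ?thesis
    by (intro bexI[OF _ Z]) (simp add: mor_tzero)
qed

text \<open>\<open>C\<close> supplies a zero object, sums and split idempotents, and the Kleisli
  assumption supplies regularity of all module maps; these are the conditions of
  \<open>semisimple_categoryI\<close>.\<close>

theorem semisimple_left_modules:
  assumes "semisimple_category C"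
    and kleisli: "\<And>x y F. \<lbrakk>x \<in> obj C; y \<in> obj C; tAr C F; tdom F = x; tcod F = t \<otimes> y\<rbrakk>
      \<Longrightarrow> \<exists>G. tAr C G \<and> tdom G = y \<and> tcod G = t \<otimes> x
        \<and> (((mt \<boxtimes>\<^sub>t tid C y) \<bullet>\<^sub>t Ai t t y) \<bullet>\<^sub>t (tid C t \<boxtimes>\<^sub>t F))
          \<bullet>\<^sub>t (((mt \<boxtimes>\<^sub>t tid C x) \<bullet>\<^sub>t Ai t t x) \<bullet>\<^sub>t (tid C t \<boxtimes>\<^sub>t G)) \<bullet>\<^sub>t F = F"
  shows "semisimple_category LM"
proof -
  interpret S: semisimple_category C
    by (rule assms(1))
  have sums: "\<exists>u I P. dsum u ss I P" if "set ss \<subseteq> obj C" for ss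
    using S.direct_sums[OF that] is_direct_sum_iff that by metis
  obtain z I P where "dsum z [] I P"
    using sums[of "[]"] by auto
  then have z: "z \<in> obj C" "tid C z = tzero C z z"
    by (simp_all add: dsum_def)
  obtain Z where Z: "Z \<in> obj LM" "idm LM Z = zerom LM Z Z"
    using LM_zero[OF z] by blast
  show ?thesis
  proof (rule L.semisimple_categoryI[OF Z])
    show "\<exists>U I P. L.dsum U [X, Y] I P" if "X \<in> obj LM" "Y \<in> obj LM" for X Y
      using that sums by (intro LM_biproduct) simp_all
    show L.idempotents_split
      by (rule LM_idempotents_split[OF S.abelian_idempotents_split])
    fix F assume F: "tAr LM F"
    let ?X = "tdom F" and ?Y = "tcod F"
    have o: "?X \<in> obj LM" "?Y \<in> obj LM"
      using F tAr_sel by metis+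
    have a: "action (fst ?X) (ac ?X)" "action (fst ?Y) (ac ?Y)"
      using o by (simp_all add: LM_obj_action)
    obtain G where G: "tAr C G" "tdom G = fst ?Y" "tcod G = fst ?X" "G \<bullet>\<^sub>t ac ?Y = ac ?X \<bullet>\<^sub>t (tid C t \<boxtimes>\<^sub>t G)"
      "underlying F \<bullet>\<^sub>t G \<bullet>\<^sub>t underlying F = underlying F"
      using module_map_regular[OF kleisli a underlying(1)[OF F] underlying_sel underlying(3)[OF F]] by blast
    let ?G = "mk LM ?Y (mor G) ?X"
    have uG: "tAr LM ?G" "underlying ?G = G"
      by (rule underlying_mk[OF o(2,1) G(1-4)])+
    have "tcmp LM F (tcmp LM ?G F) = F"
      by (rule underlying_eqI) (use F uG G(5) in \<open>simp_all add: underlying_cmp\<close>)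
    then show "L.regular_arrow F"
      unfolding L.regular_arrow_def using uG(1) by (intro exI[of _ ?G] conjI mk_sel)
  qed
qed

end

section \<open>Semisimplicity of the trace algebra\<close>

context trace_of_algebras
begin

text \<open>Semisimple bimodules and separable algebras enter through the same condition
  \<open>reg\<close>: bilinear quasi-inverses for the maps generated between free bimodules.\<close>

theorem semisimple_tr_algebra:
  assumes ss: "semisimple_category C"
    and reg: "\<And>x y h. \<lbrakk>x \<in> obj M; y \<in> obj M; Ar h; Dom h = [fo x]; Cod h = [\<alpha>, fo y, \<beta>]\<rbrakk>
      \<Longrightarrow> \<exists>G. bilinear y x G \<and> ext y h \<bullet> G \<bullet> ext y h = ext y h"
  shows "semisimple_algebra C (tr_algebra C M \<Phi>Z Tr \<eta> \<epsilon> A B)"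
proof -
  let ?T = "tr_algebra C M \<Phi>Z Tr \<eta> \<epsilon> A B"
  interpret T: algebra_object C ?T
    by unfold_locales (rule is_algebra_tr)
  have T: "alg_obj ?T = t" "T.mt = mT"
    unfolding T.mt_def by (simp_all add: tr_algebra_eq)
  have star: "\<exists>k. Ar k \<and> Dom k = [fo y] \<and> Cod k = [\<alpha>, fo x, \<beta>] \<and> star y h (star x k h) = h"
    if "x \<in> obj M" "y \<in> obj M" "Ar h" "Dom h = [fo x]" "Cod h = [\<alpha>, fo y, \<beta>]" for x y h
    using reg[OF that] star_regular[OF that] by blast
  have "semisimple_category (left_modules C ?T)"
  proof (rule T.semisimple_left_modules[OF ss], unfold T)
    fix x y F assume F: "x \<in> obj C" "y \<in> obj C" "tAr C F" "tdom F = x" "tcod F = t \<otimes> y"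
    obtain g where "tAr C g" "tdom g = y" "tcod g = t \<otimes> x" "kl y F (kl x g F) = F"
      using kleisli_regular[OF star F(3,2,1,4,5)] by blast
    then show "\<exists>G. tAr C G \<and> tdom G = y \<and> tcod G = t \<otimes> x
        \<and> (((mT \<boxtimes>\<^sub>t tid C y) \<bullet>\<^sub>t C.Ai t t y) \<bullet>\<^sub>t (tid C t \<boxtimes>\<^sub>t F))
          \<bullet>\<^sub>t (((mT \<boxtimes>\<^sub>t tid C x) \<bullet>\<^sub>t C.Ai t t x) \<bullet>\<^sub>t (tid C t \<boxtimes>\<^sub>t G)) \<bullet>\<^sub>t F = F"
      unfolding kl_def by (intro exI[of _ g]) (simp only: C.cmp_assoc)
  qed
  then show ?thesis
    unfolding semisimple_algebra_def using is_algebra_tr by blast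
qed

lemma bimodules_semisimple:
  assumes "semisimple_category C" "semisimple_category (bimodules M A B)"
  shows "semisimple_algebra C (tr_algebra C M \<Phi>Z Tr \<eta> \<epsilon> A B)"
proof -
  let ?B = "bimodules M A B"
  have lin: "linear_category ?B"
    using assms(2) by (simp add: semisimple_category_def abelian_category_def)
  then interpret Bc: category ?B
    by (rule linear_category.axioms)
  have "\<exists>g\<in>hom ?B Y X. f \<cdot>\<^bsub>M\<^esub> g \<cdot>\<^bsub>M\<^esub> f = f" if XY: "X \<in> obj ?B" "Y \<in> obj ?B" "f \<in> hom ?B X Y" for X Y f
  proof -
    let ?F = "mk ?B X f Y"
    have F: "tAr ?B ?F"
      using XY by simp
    obtain G where G: "tAr ?B G" "tdom G = Y" "tcod G = X" "tcmp ?B ?F (tcmp ?B G ?F) = ?F"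
      using semisimple_category.semisimple_regular[OF assms(2) F, unfolded linear_category.regular_arrow_def[OF lin] mk_sel(1,2)]
      by blast
    have GF: "tAr ?B (tcmp ?B G ?F)"
      using F G(1,2) by (simp add: Bc.Ar_cmp del: tAr_mk)
    have "mor (tcmp ?B ?F (tcmp ?B G ?F)) = mor ?F"
      unfolding G(4) ..
    then have "f \<cdot>\<^bsub>?B\<^esub> mor G \<cdot>\<^bsub>?B\<^esub> f = f"
      using Bc.mor_cmp[OF F GF] Bc.mor_cmp[OF G(1) F] G(2,3) XY by simp
    moreover have "comp ?B = comp M"
      by (simp add: bimodules_def)
    moreover have "mor G \<in> hom ?B Y X"
      using G(1-3) by simp
    ultimately show ?thesis
      by (intro bexI[of _ "mor G"]) simp_all
  qed
  note reg = bimodules_regular[OF this]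
  show ?thesis
    by (rule semisimple_tr_algebra[OF assms(1)]) (rule reg)
qed

text \<open>Quasi-inverses in \<open>M\<close> come from its own semisimplicity; separability
  upgrades them to bilinear ones.\<close>

lemma separable_semisimple:
  assumes "semisimple_category C" "semisimple_category M" "separable_algebra M A" "separable_algebra M B"
  shows "semisimple_algebra C (tr_algebra C M \<Phi>Z Tr \<eta> \<epsilon> A B)"
proof -
  have "\<exists>G. tAr M G \<and> tdom G = tcod F \<and> tcod G = tdom F \<and> tcmp M F (tcmp M G F) = F" if "tAr M F" for F
    using semisimple_category.semisimple_regular[OF assms(2) that] unfolding D.regular_arrow_def .
  note reg = separable_regular[OF assms(3,4) this]
  show ?thesis
    by (rule semisimple_tr_algebra[OF assms(1)]) (rule reg)
qed

end

text \<open>The abstract strict category is instantiated by the strictification of the category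
  called \<open>C\<close> in this context, which is the target of the functor; \<open>D\<close> is
  its source.\<close>

lemma (in pivotal_category) trace_of_algebras_Str:
  assumes "pivotal_category D" and Z: "tensor_functor D (center C) \<Phi>Z" and "adjunction D C (phi C \<Phi>Z) Tr \<eta> \<epsilon>"
    "is_algebra C A" "is_algebra C B"
  shows "trace_of_algebras D C \<Phi>Z Tr \<eta> \<epsilon> (obj C) (tAr (lcat C)) tdom tcod (tcmp (lcat C)) (tid (lcat C)) ltns
    (\<lambda>a. a) str (\<lambda>a b. lift C [a, b] (Ai a b \<one>) [a \<otimes> b]) (\<lambda>a b. lift C [a \<otimes> b] (As a b \<one>) [a, b])
    (lift C [] (Li \<one>) [\<one>]) (lift C [\<one>] (Lu \<one>) []) A B"
proof -
  have D: "tensor_category D"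
    using assms(1) by (rule pivotal_category.axioms)
  show ?thesis
    by (intro trace_of_algebras.intro trace_setting.intro strong_functor_after.intro tensor_functor_between.intro
        trace_setting_axioms.intro trace_of_algebras_axioms.intro assms D tensor_category_axioms pivotal_category_axioms
        tensor_functor_phi[OF tensor_category_axioms Z D] Str.strong_functor_axioms Str.strong_functor_pivotal_axioms)
      (fact str_inj str_full)+
qed

theorem theorem5p6:
  fixes C :: "('k::field, 'o, 'm) PivCat"
    and M :: "('k, 'p, 'n) PivCat"
    and \<Phi>Z :: "('o, 'm, 'p \<times> ('p \<Rightarrow> 'n), 'n) TFunctor"
    and Tr :: "('p, 'n, 'o, 'm) Functor"
    and \<eta> :: "'o \<Rightarrow> 'm"
    and \<epsilon> :: "'p \<Rightarrow> 'n"
    and A B :: "('p, 'n) Alg"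
  assumes "pivotal_category C" and "semisimple_category C"
    and "pivotal_category M" and "semisimple_category M"
    and "pivotal_functor C (center M) \<Phi>Z"
    and "adjunction C M (tfunctor_comp M (forgetful M) \<Phi>Z) Tr \<eta> \<epsilon>"
    and "is_algebra M A" and "is_algebra M B"
  shows "(semisimple_category (bimodules M A B)
            \<longrightarrow> semisimple_algebra C (tr_algebra C M \<Phi>Z Tr \<eta> \<epsilon> A B)) \<and>
         (separable_algebra M A \<and> separable_algebra M B
            \<longrightarrow> semisimple_algebra C (tr_algebra C M \<Phi>Z Tr \<eta> \<epsilon> A B))"
proof -
  have "tensor_functor C (center M) \<Phi>Z"
    using assms(5) by (rule pivotal_functor.axioms)
  note tr = pivotal_category.trace_of_algebras_Str[OF assms(3,1) this assms(6)[folded phi_def] assms(7,8)]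
  show ?thesis
    using trace_of_algebras.bimodules_semisimple[OF tr assms(2)]
      trace_of_algebras.separable_semisimple[OF tr assms(2,4)] by blast
qed

end
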